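(* Let $T>0$, $\mathsf R>0$, $0\le\widehat\beta<2\pi$, $\theta_0\in\widehat L^2(\Omega_0)$, and let $(\theta^N,\Pi^N,\Phi^N)$, with $\mathbf u^N=(-\Phi^N_z,\Phi^N_x)$, be the Galerkin approximations (defined in the context) of the full nonlinear system $$\Delta \Pi-\widehat\beta\,\Pi_z=\mathsf R\, e^{\widehat\beta z}\theta_z,\qquad \mathbf u=-e^{-\widehat\beta z}\nabla\Pi+\mathsf R\,\theta\,\mathbf k,\qquad \theta_t+\mathbf u\cdot\nabla\theta=w+\Delta\theta \qquad (\mathbf u=(u,w))$$ with $w=\theta=\Pi_z=0$ on $z=0,1$, $1$-periodicity in $x$, and $\theta(0)=\theta_0$. Let $(\theta,\mathbf u,\Pi)$ be a limit of these approximations along a subsequence $N_j\to\infty$, i.e. $\theta^{N_j}\rightharpoonup\theta$ weakly in $L^2(0,T;\widehat W^{1,2}(\Omega_0))$, $\dot\theta^{N_j}\rightharpoonup\dot\theta$ weakly in $L^2(0,T;(\widehat W^{1,2}(\Omega_0))^* )$, $\mathbf u^{N_j}\rightharpoonup\mathbf u$ weakly in $L^2(0,T;\widehat L^2(\Omega_0))$ and $\Pi^{N_j}\rightharpoonup\Pi$ weakly in $L^2(0,T;\widetilde W^{1,2}(\Omega_0))$. Then $(\theta,\mathbf u,\Pi)$ is a weak solution of the full nonlinear system.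
   Context: Notation. $\Omega_0=[0,1]\times[0,1]$ with points $(x,z)$; functions are $1$-periodic in $x$; $\mathbf k=(0,1)$; $(\cdot,\cdot)$ is the $L^2(\Omega_0)$ inner product; subscripts $x,z,t$ are partial derivatives; a dot is the time derivative. $\mathsf R$ is the Darcy-Rayleigh number and $\widehat\beta$ the dimensionless compressibility factor. Spaces. For $i=\pm1$ and integers $m,n\ge0$ let $\phi^{1}_{m,n}=\cos(2\pi mx)\cos(\pi nz)$, $\phi^{-1}_{m,n}=\sin(2\pi mx)\cos(\pi nz)$ (the constant function being excluded, so that these have mean value zero), and $\xi^{1}_{m,n}=\cos(2\pi mx)\sin(\pi nz)$, $\xi^{-1}_{m,n}=\sin(2\pi mx)\sin(\pi nz)$. $\widetilde L^2,\widetilde W^{k,2}$ (resp. $\widehat L^2,\widehat W^{k,2}$) are the closures in $L^2(\Omega_0)$, $W^{k,2}(\Omega_0)$ of finite linear combinations of the $\phi^i_{m,n}$ (resp. $\xi^i_{m,n}$). For vector fields, $\widehat L^2(\Omega_0)$ is the $L^2$-closure of the span of the divergence-free fields $(-\partial_z\xi^i_{m,n},\partial_x\xi^i_{m,n})$. $(\widehat W^{1,2})^*$ is the dual space, with $L^2$ as pivot space and duality pairing $\langle\cdot,\cdot\rangle$. Galerkin approximations. $\theta^N,\Phi^N$ are linear combinations of $\xi^i_{m,n}$, and $\Pi^N$ of $\phi^i_{m,n}$, with $i=\pm1$, $0\le m,n\le N$ and time-dependent coefficients, $\mathbf u^N=(-\Phi^N_z,\Phi^N_x)$, $w^N=\Phi^N_x$,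 such that for all $\phi=\phi^i_{m,n}$ and $\xi=\xi^i_{m,n}$ with these indices: $-(\nabla\Pi^N,\nabla\phi)-\widehat\beta(\Pi^N_z,\phi)=\mathsf R(e^{\widehat\beta z}\theta^N_z,\phi)$; $-(\nabla\Phi^N,\nabla\xi)=-\widehat\beta(e^{-\widehat\beta z}\Pi^N_x,\xi)+\mathsf R(\theta^N_x,\xi)$; $(\dot\theta^N,\xi)+(\mathbf u^N\cdot\nabla\theta^N,\xi)=(w^N,\xi)-(\nabla\theta^N,\nabla\xi)$; and $\theta^N(0)$ is the $L^2$-orthogonal projection of $\theta_0$ onto the span of these $\xi^i_{m,n}$. (This is the truncation of the stream-function form $\Delta\Pi-\widehat\beta\Pi_z=\mathsf R e^{\widehat\beta z}\theta_z$, $\Delta\Phi=-\widehat\beta e^{-\widehat\beta z}\Pi_x+\mathsf R\theta_x$, $\theta_t+\mathbf u\cdot\nabla\theta=\Phi_x+\Delta\theta$, $\mathbf u=(-\Phi_z,\Phi_x)$.) Weak solution. $(\theta,\mathbf u,\Pi)$ with $\theta\in L^2(0,T;\widehat W^{1,2})$, $\dot\theta\in L^2(0,T;(\widehat W^{1,2})^* )$ (so $\theta\in C([0,T];\widehat L^2)$), $\mathbf u\in L^2(0,T;\widehat L^2)$, $\Pi\in L^2(0,T;\widetilde W^{1,2})$ is a weak solution if for a.e. $t\in(0,T)$: $\langle\dot\theta,g\rangle+(\mathbf u\cdot\nabla\theta,g)=(w,g)-(\nabla\theta,\nabla g)$ for all $g\in\widehat W^{1,2}(\Omega_0)$; $-(\nabla\Pi,\nabla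 h)-\widehat\beta(\Pi_z,h)=\mathsf R(e^{\widehat\beta z}\theta_z,h)$ for all $h\in\widetilde W^{1,2}(\Omega_0)$; $\mathbf u=-e^{-\widehat\beta z}\nabla\Pi+\mathsf R\theta\mathbf k$ a.e. in $\Omega_0$; and $\theta(0)=\theta_0$. *)

theory Defs
  imports "HOL-Analysis.Analysis" "HOL-Library.Function_Algebras"
begin

(* The pointwise vector space structure on functions; iterating the instance also covers
   time-dependent fields (real => real * real => 'v) and functionals (('p => 'v) => real). *)

instantiation "fun" :: (type, scaleR) scaleR
begin
definition scaleR_fun_def: "c *\<^sub>R f = (\<lambda>x. c *\<^sub>R f x)"
instance ..
end

instance "fun" :: (type, real_vector) real_vector
  by standard
    (simp_all add: scaleR_fun_def plus_fun_def fun_eq_iff scaleR_add_right scaleR_add_left)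


(* Function spaces are given by a carrier X and a seminorm nrm on representatives: elements are
   honest functions, and functions that agree almost everywhere are at distance 0. *)

section \<open>Seminormed spaces, duals, Bochner spaces\<close>

definition closure_span :: "'a::real_vector set \<Rightarrow> ('a \<Rightarrow> real) \<Rightarrow> 'a set \<Rightarrow> 'a set" where
  "closure_span X nrm B = {f \<in> X. \<forall>\<epsilon>>0. \<exists>p \<in> span B. nrm (f - p) < \<epsilon>}"

definition dual :: "'a::real_vector set \<Rightarrow> ('a \<Rightarrow> real) \<Rightarrow> ('a \<Rightarrow> real) set" where
  "dual X nrm = {F.
     (\<forall>f\<in>X. \<forall>g\<in>X. F (f + g) = F f + F g) \<and>
     (\<forall>c. \<forall>f\<in>X. F (c *\<^sub>R f) = c * F f) \<and>
     (\<exists>C. \<forall>f\<in>X. \<bar>F f\<bar> \<le> C * nrm f)}"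

definition dual_norm :: "'a::real_vector set \<Rightarrow> ('a \<Rightarrow> real) \<Rightarrow> ('a \<Rightarrow> real) \<Rightarrow> real" where
  "dual_norm X nrm F = (SUP f \<in> {f \<in> X. nrm f \<le> 1}. \<bar>F f\<bar>)"

definition weakly_converges ::
  "'a::real_vector set \<Rightarrow> ('a \<Rightarrow> real) \<Rightarrow> (nat \<Rightarrow> 'a) \<Rightarrow> 'a \<Rightarrow> bool" where
  "weakly_converges X nrm fs f \<longleftrightarrow>
     (\<forall>j. fs j \<in> X) \<and> f \<in> X \<and> (\<forall>F \<in> dual X nrm. (\<lambda>j. F (fs j)) \<longlonglongrightarrow> F f)"

definition strongly_measurable ::
  "real \<Rightarrow> 'a::real_vector set \<Rightarrow> ('a \<Rightarrow> real) \<Rightarrow> (real \<Rightarrow> 'a) \<Rightarrow> bool" where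
  "strongly_measurable T X nrm f \<longleftrightarrow>
     (\<exists>s. (\<forall>n. simple_function (lebesgue_on {0<..<T}) (s n) \<and> s n ` {0<..<T} \<subseteq> X) \<and>
          (AE t in lebesgue_on {0<..<T}. (\<lambda>n::nat. nrm (f t - s n t)) \<longlonglongrightarrow> 0))"

definition L2_time :: "real \<Rightarrow> 'a::real_vector set \<Rightarrow> ('a \<Rightarrow> real) \<Rightarrow> (real \<Rightarrow> 'a) set" where
  "L2_time T X nrm = {f. (AE t in lebesgue_on {0<..<T}. f t \<in> X) \<and>
     strongly_measurable T X nrm f \<and>
     integrable (lebesgue_on {0<..<T}) (\<lambda>t. (nrm (f t))\<^sup>2)}"

definition L2_time_norm :: "real \<Rightarrow> ('a \<Rightarrow> real) \<Rightarrow> (real \<Rightarrow> 'a) \<Rightarrow> real" where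
  "L2_time_norm T nrm f = sqrt (LINT t|lebesgue_on {0<..<T}. (nrm (f t))\<^sup>2)"

definition weakly_converges_L2_time ::
  "real \<Rightarrow> 'a::real_vector set \<Rightarrow> ('a \<Rightarrow> real) \<Rightarrow> (nat \<Rightarrow> real \<Rightarrow> 'a) \<Rightarrow> (real \<Rightarrow> 'a) \<Rightarrow> bool" where
  "weakly_converges_L2_time T X nrm = weakly_converges (L2_time T X nrm) (L2_time_norm T nrm)"


section \<open>Lebesgue and Sobolev spaces on the unit square\<close>

(* Infinitely differentiable: all iterated directional derivatives are Frechet differentiable. *)
coinductive smooth :: "('a::euclidean_space \<Rightarrow> real) \<Rightarrow> bool" where
  "\<lbrakk>\<forall>x. f differentiable (at x); \<forall>v. smooth (\<lambda>x. frechet_derivative f (at x) v)\<rbrakk> \<Longrightarrow> smooth f"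

definition test_functions :: "'a::euclidean_space set \<Rightarrow> ('a \<Rightarrow> real) set" where
  "test_functions S =
     {\<phi>. smooth \<phi> \<and> (\<exists>K. compact K \<and> K \<subseteq> S \<and> (\<forall>x. x \<notin> K \<longrightarrow> \<phi> x = 0))}"

definition \<Omega>0 :: "(real \<times> real) set" where
  "\<Omega>0 = {0..1} \<times> {0..1}"

definition L2 :: "(real \<times> real \<Rightarrow> 'v::real_inner) set" where
  "L2 = {f \<in> borel_measurable (lebesgue_on \<Omega>0).
           integrable (lebesgue_on \<Omega>0) (\<lambda>p. (norm (f p))\<^sup>2)}"

definition ip :: "(real \<times> real \<Rightarrow> 'v::real_inner) \<Rightarrow> (real \<times> real \<Rightarrow> 'v) \<Rightarrow> real" where
  "ip f g = (LINT p|lebesgue_on \<Omega>0. f p \<bullet> g p)"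

definition L2_norm :: "(real \<times> real \<Rightarrow> 'v::real_inner) \<Rightarrow> real" where
  "L2_norm f = sqrt (LINT p|lebesgue_on \<Omega>0. (norm (f p))\<^sup>2)"

(* classical partial derivatives *)

definition dx :: "(real \<times> real \<Rightarrow> real) \<Rightarrow> real \<times> real \<Rightarrow> real" where
  "dx f = (\<lambda>(x, z). deriv (\<lambda>s. f (s, z)) x)"

definition dz :: "(real \<times> real \<Rightarrow> real) \<Rightarrow> real \<times> real \<Rightarrow> real" where
  "dz f = (\<lambda>(x, z). deriv (\<lambda>s. f (x, s)) z)"

definition grad :: "(real \<times> real \<Rightarrow> real) \<Rightarrow> real \<times> real \<Rightarrow> real \<times> real" where
  "grad f = (\<lambda>p. (dx f p, dz f p))"

definition perp_grad :: "(real \<times> real \<Rightarrow> real) \<Rightarrow> real \<times> real \<Rightarrow> real \<times> real" where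
  "perp_grad f = (\<lambda>p. (- dz f p, dx f p))"

definition has_weak_grad ::
  "(real \<times> real \<Rightarrow> real) \<Rightarrow> (real \<times> real \<Rightarrow> real \<times> real) \<Rightarrow> bool" where
  "has_weak_grad f g \<longleftrightarrow> f \<in> L2 \<and> g \<in> L2 \<and>
     (\<forall>\<phi> \<in> test_functions (interior \<Omega>0).
        ip f (dx \<phi>) = - ip (\<lambda>p. fst (g p)) \<phi> \<and>
        ip f (dz \<phi>) = - ip (\<lambda>p. snd (g p)) \<phi>)"

(* determined up to a null set *)
definition wgrad :: "(real \<times> real \<Rightarrow> real) \<Rightarrow> real \<times> real \<Rightarrow> real \<times> real" where
  "wgrad f = (SOME g. has_weak_grad f g)"

definition W12 :: "(real \<times> real \<Rightarrow> real) set" where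
  "W12 = {f. \<exists>g. has_weak_grad f g}"

definition W12_norm :: "(real \<times> real \<Rightarrow> real) \<Rightarrow> real" where
  "W12_norm f = sqrt ((L2_norm f)\<^sup>2 + (L2_norm (wgrad f))\<^sup>2)"


section \<open>The trigonometric systems and their closures\<close>

definition trig :: "int \<Rightarrow> nat \<Rightarrow> real \<Rightarrow> real" where
  "trig i m x = (if i = 1 then cos (2 * pi * real m * x) else sin (2 * pi * real m * x))"

definition phi :: "int \<Rightarrow> nat \<Rightarrow> nat \<Rightarrow> real \<times> real \<Rightarrow> real" where
  "phi i m n = (\<lambda>(x, z). trig i m x * cos (pi * real n * z))"

definition xi :: "int \<Rightarrow> nat \<Rightarrow> nat \<Rightarrow> real \<times> real \<Rightarrow> real" where
  "xi i m n = (\<lambda>(x, z). trig i m x * sin (pi * real n * z))"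

definition xi_index :: "(int \<times> nat \<times> nat) set" where
  "xi_index = {1, -1} \<times> UNIV \<times> UNIV"

(* (1,0,0) gives the excluded constant function, (-1,0,0) the zero function *)
definition phi_index :: "(int \<times> nat \<times> nat) set" where
  "phi_index = {(i, m, n). i \<in> {1, -1} \<and> (m, n) \<noteq> (0, 0)}"

definition truncated :: "(int \<times> nat \<times> nat) set \<Rightarrow> nat \<Rightarrow> (int \<times> nat \<times> nat) set" where
  "truncated I N = {(i, m, n) \<in> I. m \<le> N \<and> n \<le> N}"

definition hat_L2 :: "(real \<times> real \<Rightarrow> real) set" where
  "hat_L2 = closure_span L2 L2_norm {xi i m n |i m n. (i, m, n) \<in> xi_index}"

definition hat_W12 :: "(real \<times> real \<Rightarrow> real) set" where
  "hat_W12 = closure_span W12 W12_norm {xi i m n |i m n. (i, m, n) \<in> xi_index}"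

definition tilde_W12 :: "(real \<times> real \<Rightarrow> real) set" where
  "tilde_W12 = closure_span W12 W12_norm {phi i m n |i m n. (i, m, n) \<in> phi_index}"

definition hat_L2_vec :: "(real \<times> real \<Rightarrow> real \<times> real) set" where
  "hat_L2_vec = closure_span L2 L2_norm {perp_grad (xi i m n) |i m n. (i, m, n) \<in> xi_index}"

definition hat_W12_dual :: "((real \<times> real \<Rightarrow> real) \<Rightarrow> real) set" where
  "hat_W12_dual = dual hat_W12 W12_norm"

definition hat_W12_dual_norm :: "((real \<times> real \<Rightarrow> real) \<Rightarrow> real) \<Rightarrow> real" where
  "hat_W12_dual_norm = dual_norm hat_W12 W12_norm"


section \<open>Galerkin approximations and weak solutions\<close>

(* P stands for the pressure variable Pi, and \<theta>' is the time derivative of \<theta>.  For basis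
   functions that vanish identically (such as xi i m 0) the coefficients are irrelevant. *)
definition galerkin ::
  "real \<Rightarrow> real \<Rightarrow> real \<Rightarrow> (real \<times> real \<Rightarrow> real) \<Rightarrow> nat \<Rightarrow>
   (real \<Rightarrow> real \<times> real \<Rightarrow> real) \<Rightarrow> (real \<Rightarrow> real \<times> real \<Rightarrow> real) \<Rightarrow>
   (real \<Rightarrow> real \<times> real \<Rightarrow> real) \<Rightarrow> (real \<Rightarrow> real \<times> real \<Rightarrow> real) \<Rightarrow> bool" where
  "galerkin T R \<beta> \<theta>0 N \<theta> \<theta>' P \<Phi> \<longleftrightarrow>
    (\<exists>a a' b c. \<forall>t\<in>{0..T}.
       \<theta> t = (\<Sum>(i, m, n) \<in> truncated xi_index N. a i m n t *\<^sub>R xi i m n) \<and>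
       \<theta>' t = (\<Sum>(i, m, n) \<in> truncated xi_index N. a' i m n t *\<^sub>R xi i m n) \<and>
       P t = (\<Sum>(i, m, n) \<in> truncated phi_index N. b i m n t *\<^sub>R phi i m n) \<and>
       \<Phi> t = (\<Sum>(i, m, n) \<in> truncated xi_index N. c i m n t *\<^sub>R xi i m n) \<and>
       (\<forall>(i, m, n) \<in> truncated xi_index N.
          (a i m n has_real_derivative a' i m n t) (at t within {0..T}))) \<and>
    (\<forall>t\<in>{0..T}. \<forall>(i, m, n) \<in> truncated phi_index N.
       - ip (grad (P t)) (grad (phi i m n)) - \<beta> * ip (dz (P t)) (phi i m n)
         = R * ip (\<lambda>p. exp (\<beta> * snd p) * dz (\<theta> t) p) (phi i m n)) \<and>
    (\<forall>t\<in>{0..T}. \<forall>(i, m, n) \<in> truncated xi_index N.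
       - ip (grad (\<Phi> t)) (grad (xi i m n))
         = - \<beta> * ip (\<lambda>p. exp (- \<beta> * snd p) * dx (P t) p) (xi i m n)
           + R * ip (dx (\<theta> t)) (xi i m n)) \<and>
    (\<forall>t\<in>{0..T}. \<forall>(i, m, n) \<in> truncated xi_index N.
       ip (\<theta>' t) (xi i m n) + ip (\<lambda>p. perp_grad (\<Phi> t) p \<bullet> grad (\<theta> t) p) (xi i m n)
         = ip (dx (\<Phi> t)) (xi i m n) - ip (grad (\<theta> t)) (grad (xi i m n))) \<and>
    (\<forall>(i, m, n) \<in> truncated xi_index N. ip (\<theta>0 - \<theta> 0) (xi i m n) = 0)"

(* the embedding of L^2 into the dual of hat_W12, with L^2 as pivot space *)
definition pivot :: "(real \<times> real \<Rightarrow> real) \<Rightarrow> (real \<times> real \<Rightarrow> real) \<Rightarrow> real" where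
  "pivot f = (\<lambda>g. ip f g)"

(* \<theta>' is the distributional time derivative of \<theta> on (0,T), as a dual-valued function *)
definition has_time_derivative ::
  "real \<Rightarrow> (real \<Rightarrow> real \<times> real \<Rightarrow> real) \<Rightarrow> (real \<Rightarrow> (real \<times> real \<Rightarrow> real) \<Rightarrow> real) \<Rightarrow> bool" where
  "has_time_derivative T \<theta> \<theta>' \<longleftrightarrow>
     (\<forall>\<phi> \<in> test_functions {0<..<T}. \<forall>g \<in> hat_W12.
        (LINT t|lebesgue_on {0<..<T}. deriv \<phi> t * pivot (\<theta> t) g)
          = - (LINT t|lebesgue_on {0<..<T}. \<phi> t * \<theta>' t g))"

(* The value at time 0 is that of the representative in C([0,T]; hat_L2). *)
definition has_initial_value ::
  "real \<Rightarrow> (real \<Rightarrow> real \<times> real \<Rightarrow> real) \<Rightarrow> (real \<times> real \<Rightarrow> real) \<Rightarrow> bool" where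
  "has_initial_value T \<theta> \<theta>0 \<longleftrightarrow>
     (\<exists>\<eta>. (\<forall>t\<in>{0..T}. \<eta> t \<in> hat_L2) \<and>
          (\<forall>t\<in>{0..T}. ((\<lambda>s. L2_norm (\<eta> s - \<eta> t)) \<longlongrightarrow> 0) (at t within {0..T})) \<and>
          (AE t in lebesgue_on {0<..<T}. AE p in lebesgue_on \<Omega>0. \<eta> t p = \<theta> t p) \<and>
          (AE p in lebesgue_on \<Omega>0. \<eta> 0 p = \<theta>0 p))"

(* Integrability of (u . grad \<theta>) g is required explicitly, since the Lebesgue integral of a
   non-integrable function is 0 by convention. *)
definition weak_solution ::
  "real \<Rightarrow> real \<Rightarrow> real \<Rightarrow> (real \<times> real \<Rightarrow> real) \<Rightarrow> (real \<Rightarrow> real \<times> real \<Rightarrow> real) \<Rightarrow>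
   (real \<Rightarrow> real \<times> real \<Rightarrow> real \<times> real) \<Rightarrow> (real \<Rightarrow> real \<times> real \<Rightarrow> real) \<Rightarrow> bool" where
  "weak_solution T R \<beta> \<theta>0 \<theta> u P \<longleftrightarrow>
    (\<exists>\<theta>'.
      \<theta> \<in> L2_time T hat_W12 W12_norm \<and>
      \<theta>' \<in> L2_time T hat_W12_dual hat_W12_dual_norm \<and>
      has_time_derivative T \<theta> \<theta>' \<and>
      u \<in> L2_time T hat_L2_vec L2_norm \<and>
      P \<in> L2_time T tilde_W12 W12_norm \<and>
      (AE t in lebesgue_on {0<..<T}.
        (\<forall>g \<in> hat_W12.
           integrable (lebesgue_on \<Omega>0) (\<lambda>p. (u t p \<bullet> wgrad (\<theta> t) p) * g p) \<and>
           \<theta>' t g + ip (\<lambda>p. u t p \<bullet> wgrad (\<theta> t) p) g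
             = ip (\<lambda>p. snd (u t p)) g - ip (wgrad (\<theta> t)) (wgrad g)) \<and>
        (\<forall>h \<in> tilde_W12.
           - ip (wgrad (P t)) (wgrad h) - \<beta> * ip (\<lambda>p. snd (wgrad (P t) p)) h
             = R * ip (\<lambda>p. exp (\<beta> * snd p) * snd (wgrad (\<theta> t) p)) h) \<and>
        (AE p in lebesgue_on \<Omega>0.
           u t p = - (exp (- \<beta> * snd p) *\<^sub>R wgrad (P t) p) + (R * \<theta> t p) *\<^sub>R (0, 1))) \<and>
      has_initial_value T \<theta> \<theta>0)"

end

theory Submission imports Defs
begin

text \<open>
  The pressure and stream function equations are linear. Tested with one fixed basis function they
  hold for all large \<open>N\<close>, every term is a bounded functional of the unknowns, and so they survive
  weak convergence (\<open>limit_equation\<close>). The real content lies in four other points.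

  \<^item> \<^emph>\<open>The convective term.\<close> Since \<open>u\<close> is divergence free and tangential, the term
  tested with a basis function \<open>\<xi>\<close> equals \<open>- (\<theta> u, \<nabla>\<xi>)\<close>, a bounded bilinear form
  in the \<open>L2\<close> norms of \<open>\<theta>\<close> and \<open>u\<close>. Weak convergence of one factor suffices if the other
  converges strongly. Strong convergence of the temperatures (\<open>strong_convergence\<close>) is a
  compactness argument in Fourier space. Weakly convergent sequences are bounded
  (\<open>weak_time_bounded\<close>); a single Fourier coefficient at time \<open>t\<close> is the initial coefficient plus the
  integral over \<open>(0,t)\<close> of its derivative, which is a bounded functional of the time derivative and
  hence converges for every \<open>t\<close> (\<open>coef_limit\<close>); the coefficients of high
  frequency are uniformly small because the \<open>W12\<close> norms are bounded (\<open>poincare_tail\<close>).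

  \<^item> \<^emph>\<open>All test functions.\<close> The limiting heat equation is known for basis functions. To extend it
  to \<open>hat_W12\<close> by density, \<open>g \<mapsto> (u \<cdot> \<nabla>\<theta>, g)\<close> must be bounded there, which may fail for a
  general \<open>u\<close> in \<open>L2\<close>, as functions in \<open>W12\<close> of a planar domain need not be bounded. But the stream
  function equation says that the vorticity of \<open>u\<close> is in \<open>L2\<close>. Together with the vanishing
  divergence this controls \<open>\<partial>\<^sub>z u\<close>, while \<open>\<partial>\<^sub>x g\<close> is in \<open>L2\<close>, and a product of a function with a
  \<open>z\<close>-derivative and a function with an \<open>x\<close>-derivative is in \<open>L2\<close> (\<open>C1_product_bound\<close>,
  \<open>velocity_multiplier\<close>).

  \<^item> \<^emph>\<open>Darcy's law.\<close> The approximations satisfy it only in the form of the two second-order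
  equations. The field \<open>v = - exp (- \<beta> z) \<nabla>\<Pi> + R \<theta> k\<close> has the same vorticity as \<open>u\<close> (stream
  function equation, \<open>darcy_perp\<close>) and is divergence free and tangential (pressure equation tested with
  \<open>exp (- \<beta> z) \<phi>\<close>, \<open>darcy_gradient_orthogonal\<close>). A field orthogonal to all gradients, to all
  rotated gradients, and to \<open>(1,0)\<close> vanishes (\<open>grad_perp_complete\<close>), hence \<open>u = v\<close>.

  \<^item> \<^emph>\<open>The initial value.\<close> The limits \<open>c\<^sub>k(t)\<close> of the Fourier coefficients are continuous in \<open>t\<close>
  and start at the coefficients of \<open>\<theta>0\<close>. The usual interpolation between \<open>L\<^sup>2(W12)\<close> and its dual becomes a
  bound of \<open>sup\<^sub>t c\<^sub>k(t)\<^sup>2\<close> by a summable sequence (\<open>majorant_bound\<close>, \<open>majorant_summable\<close>), so the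
  Fourier series converges in \<open>L2\<close> uniformly in \<open>t\<close>, and its sum is the continuous representative.

  All this rests on the completeness of the trigonometric systems, which follows from the
  Stone-Weierstrass theorem (\<open>cosine_system_complete\<close>, \<open>sine_system_complete\<close>).
\<close>

lemmas fsimps = plus_fun_def fun_diff_def zero_fun_def scaleR_fun_def fun_Compl_def

lemma sum_fun_apply: "(\<Sum>i\<in>I. f i) x = (\<Sum>i\<in>I. f i x)"
  for f :: "'i \<Rightarrow> 'b \<Rightarrow> 'c::comm_monoid_add"
  by (induction I rule: infinite_finite_induct) (auto simp: fsimps)

section \<open>Seminormed and pre-Hilbert spaces of representatives\<close>

text \<open>
  The function spaces consist of honest functions, so that functions equal almost everywhere are
  distinct elements at distance zero. No quotient is formed; the carrier is a subspace and the
  norm is only a seminorm.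
\<close>

locale seminormed =
  fixes X :: "'a::real_vector set" and nrm :: "'a \<Rightarrow> real"
  assumes subspace: "subspace X"
    and triangle: "\<And>f g. f \<in> X \<Longrightarrow> g \<in> X \<Longrightarrow> nrm (f + g) \<le> nrm f + nrm g"
    and homogeneous: "\<And>c f. f \<in> X \<Longrightarrow> nrm (c *\<^sub>R f) = \<bar>c\<bar> * nrm f"
begin

lemma closed: "0 \<in> X" "f \<in> X \<Longrightarrow> g \<in> X \<Longrightarrow> f + g \<in> X" "f \<in> X \<Longrightarrow> g \<in> X \<Longrightarrow> f - g \<in> X"
  "f \<in> X \<Longrightarrow> c *\<^sub>R f \<in> X" "f \<in> X \<Longrightarrow> - f \<in> X"
  using subspace by (auto simp: subspace_0 subspace_add subspace_diff subspace_scale subspace_neg)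

lemma nrm_zero [simp]: "nrm 0 = 0"
  using homogeneous[OF closed(1), of 0] by simp

lemma nrm_minus: "f \<in> X \<Longrightarrow> nrm (- f) = nrm f"
  using homogeneous[of f "-1"] by simp

lemma nrm_nonneg: "f \<in> X \<Longrightarrow> 0 \<le> nrm f"
  using triangle[of f "- f"] nrm_minus[of f] closed(5)[of f] by simp

lemma nrm_sym: "f \<in> X \<Longrightarrow> g \<in> X \<Longrightarrow> nrm (f - g) = nrm (g - f)"
  using nrm_minus[of "f - g"] closed(3) by simp

lemma triangle3: "f \<in> X \<Longrightarrow> g \<in> X \<Longrightarrow> h \<in> X \<Longrightarrow> nrm (f - h) \<le> nrm (f - g) + nrm (g - h)"
  using triangle[of "f - g" "g - h"] closed(3) by simp

lemma triangle_diff: "f \<in> X \<Longrightarrow> g \<in> X \<Longrightarrow> nrm (f - g) \<le> nrm f + nrm g"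
  using triangle[of f "-g"] nrm_minus closed(5) by simp

lemma reverse_triangle: "f \<in> X \<Longrightarrow> g \<in> X \<Longrightarrow> \<bar>nrm f - nrm g\<bar> \<le> nrm (f - g)"
  using triangle[of "f - g" g] triangle[of "g - f" f] nrm_sym[of f g] closed(3) by fastforce

lemma subspace_closure_span:
  assumes "B \<subseteq> X" shows "subspace (closure_span X nrm B)"
proof -
  have sB: "span B \<subseteq> X" using assms subspace by (simp add: span_minimal)
  show ?thesis
  proof (rule subspaceI)
    show "0 \<in> closure_span X nrm B"
      unfolding closure_span_def using closed(1) by (auto intro!: bexI[of _ 0] simp: span_zero)
  next
    fix f g assume f: "f \<in> closure_span X nrm B" and g: "g \<in> closure_span X nrm B"
    have X: "f \<in> X" "g \<in> X" using f g by (auto simp: closure_span_def)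
    have "\<exists>p\<in>span B. nrm (f + g - p) < e" if "e > 0" for e
    proof -
      obtain p q where p: "p \<in> span B" "nrm (f - p) < e/2" "q \<in> span B" "nrm (g - q) < e/2"
        using f g half_gt_zero[OF \<open>e > 0\<close>] unfolding closure_span_def by blast
      have "nrm (f + g - (p + q)) \<le> nrm (f - p) + nrm (g - q)"
        using triangle[of "f - p" "g - q"] X p sB closed(3) by (metis add_diff_add subsetD)
      then show ?thesis using p by (intro bexI[of _ "p+q"]) (auto simp: span_add)
    qed
    then show "f + g \<in> closure_span X nrm B" using X closed(2) by (auto simp: closure_span_def)
  next
    fix c f assume f: "f \<in> closure_span X nrm B"
    have X: "f \<in> X" using f by (auto simp: closure_span_def)
    have "\<exists>p\<in>span B. nrm (c *\<^sub>R f - p) < e" if "e > 0" for e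
    proof -
      obtain p where p: "p \<in> span B" "nrm (f - p) < e/(\<bar>c\<bar> + 1)"
        using f divide_pos_pos[OF \<open>e > 0\<close>, of "\<bar>c\<bar> + 1"] unfolding closure_span_def by fastforce
      have "nrm (c *\<^sub>R f - c *\<^sub>R p) = \<bar>c\<bar> * nrm (f - p)"
        using homogeneous[of "f - p" c] closed(3) X p(1) sB by (metis scaleR_right_diff_distrib subsetD)
      also have "\<dots> \<le> (\<bar>c\<bar> + 1) * nrm (f - p)"
        using nrm_nonneg[of "f-p"] closed(3) X p(1) sB by (simp add: algebra_simps subset_iff)
      also have "\<dots> < e" using p(2) by (simp add: field_simps)
      finally show ?thesis using p(1) by (intro bexI[of _ "c *\<^sub>R p"]) (auto simp: span_scale)
    qed
    then show "c *\<^sub>R f \<in> closure_span X nrm B" using X closed(4) by (auto simp: closure_span_def)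
  qed
qed

lemma span_subset_closure_span:
  assumes "B \<subseteq> X" shows "span B \<subseteq> closure_span X nrm B"
proof
  fix p assume p: "p \<in> span B"
  have "p \<in> X" using p assms subspace span_minimal by blast
  then show "p \<in> closure_span X nrm B" using p unfolding closure_span_def
    by (auto intro!: bexI[of _ p])
qed

lemma closure_span_sequence:
  assumes "B \<subseteq> X" "f \<in> closure_span X nrm B"
  obtains p where "\<And>n::nat. p n \<in> span B" "(\<lambda>n. nrm (f - p n)) \<longlonglongrightarrow> 0"
proof -
  have "\<forall>n. \<exists>p\<in>span B. nrm (f - p) < 1 / Suc n"
    using assms unfolding closure_span_def by simp
  then obtain p where p: "\<And>n. p n \<in> span B" "\<And>n. nrm (f - p n) < 1 / Suc n" by metis
  have "span B \<subseteq> X" using assms(1) subspace by (simp add: span_minimal)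
  then have "f - p n \<in> X" for n
    using assms closed(3)[of f "p n"] p(1)[of n] by (auto simp: closure_span_def)
  then have "(\<lambda>n. nrm (f - p n)) \<longlonglongrightarrow> 0"
    by (intro tendsto_sandwich[OF _ _ tendsto_const LIMSEQ_inverse_real_of_nat])
       (use p(2) nrm_nonneg in \<open>auto intro!: always_eventually simp: inverse_eq_divide less_imp_le\<close>)
  with p(1) that show ?thesis by blast
qed

text \<open>
  Every density argument below is an instance of this: a bounded linear functional is determined
  on the closure by its values on the spanning set.
\<close>

lemma closure_span_vanish:
  assumes B: "B \<subseteq> X" and f: "f \<in> closure_span X nrm B"
    and add: "\<And>g h. g \<in> X \<Longrightarrow> h \<in> X \<Longrightarrow> l (g + h) = l g + l h"
    and scale: "\<And>c g. g \<in> X \<Longrightarrow> l (c *\<^sub>R g) = c * l g"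
    and bound: "\<And>g. g \<in> X \<Longrightarrow> \<bar>l g\<bar> \<le> C * nrm g"
    and zero: "\<And>b. b \<in> B \<Longrightarrow> l b = 0"
  shows "l f = (0::real)"
proof -
  obtain p where p: "\<And>n::nat. p n \<in> span B" "(\<lambda>n. nrm (f - p n)) \<longlonglongrightarrow> 0"
    using closure_span_sequence[OF B f] by blast
  have fX: "f \<in> X" using f by (auto simp: closure_span_def)
  have sB: "span B \<subseteq> X" using assms(1) subspace by (simp add: span_minimal)
  have "l q = 0 \<and> q \<in> X" if "q \<in> span B" for q using that
  proof (induction rule: span_induct_alt)
    case base
    then show ?case using scale[of 0 0] closed(1) by simp
  next
    case (step c x y)
    then show ?case using B add[of "c *\<^sub>R x" y] scale[of x c] zero[of x] closed(2,4) by (simp add: subset_iff)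
  qed
  then have "l f = l (f - p n)" for n
    using add[of "f - p n" "p n"] p(1)[of n] fX closed(3) by auto
  then have "\<bar>l f\<bar> \<le> C * nrm (f - p n)" for n
    using bound[of "f - p n"] fX sB p(1)[of n] closed(3) by (metis subsetD)
  moreover have "(\<lambda>n. C * nrm (f - p n)) \<longlonglongrightarrow> C * 0" by (intro tendsto_intros p)
  ultimately have "\<bar>l f\<bar> \<le> C * 0" by (intro LIMSEQ_le_const) auto
  then show ?thesis by simp
qed

end

lemma seminormed_subspace:
  assumes "seminormed X nrm" "subspace Y" "Y \<subseteq> X" shows "seminormed Y nrm"
  using assms unfolding seminormed_def by blast

text \<open>
  The form may be degenerate, as functions supported on null sets have norm zero.
\<close>

locale pre_hilbert =
  fixes X :: "'a::real_vector set" and B :: "'a \<Rightarrow> 'a \<Rightarrow> real" and nrm :: "'a \<Rightarrow> real"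
  assumes subsp: "subspace X"
    and add_left: "\<And>f g h. f \<in> X \<Longrightarrow> g \<in> X \<Longrightarrow> h \<in> X \<Longrightarrow> B (f + g) h = B f h + B g h"
    and scale_left: "\<And>c f h. f \<in> X \<Longrightarrow> h \<in> X \<Longrightarrow> B (c *\<^sub>R f) h = c * B f h"
    and sym: "\<And>f g. f \<in> X \<Longrightarrow> g \<in> X \<Longrightarrow> B f g = B g f"
    and nonneg: "\<And>f. f \<in> X \<Longrightarrow> 0 \<le> B f f"
    and nrm_eq: "\<And>f. f \<in> X \<Longrightarrow> nrm f = sqrt (B f f)"
begin

lemma clos: "0 \<in> X" "f \<in> X \<Longrightarrow> g \<in> X \<Longrightarrow> f + g \<in> X" "f \<in> X \<Longrightarrow> g \<in> X \<Longrightarrow> f - g \<in> X"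
  "f \<in> X \<Longrightarrow> c *\<^sub>R f \<in> X"
  using subsp by (auto simp: subspace_0 subspace_add subspace_diff subspace_scale)

lemma add_right: "f \<in> X \<Longrightarrow> g \<in> X \<Longrightarrow> h \<in> X \<Longrightarrow> B h (f + g) = B h f + B h g"
  using add_left sym clos(2) by metis

lemma scale_right: "f \<in> X \<Longrightarrow> h \<in> X \<Longrightarrow> B h (c *\<^sub>R f) = c * B h f"
  using scale_left sym clos(4) by metis

lemma diff_left: "f \<in> X \<Longrightarrow> g \<in> X \<Longrightarrow> h \<in> X \<Longrightarrow> B (f - g) h = B f h - B g h"
  using add_left[of "f - g" g h] clos(3) by simp

lemma diff_right: "f \<in> X \<Longrightarrow> g \<in> X \<Longrightarrow> h \<in> X \<Longrightarrow> B h (f - g) = B h f - B h g"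
  using diff_left sym clos(3) by metis

lemma nrm_square: "f \<in> X \<Longrightarrow> (nrm f)\<^sup>2 = B f f"
  using nonneg nrm_eq by simp

lemma cauchy_schwarz: assumes "f \<in> X" "g \<in> X" shows "\<bar>B f g\<bar> \<le> nrm f * nrm g"
proof -
  have *: "0 \<le> B f f - 2 * c * B f g + c\<^sup>2 * B g g" for c
  proof -
    have "0 \<le> B (f - c *\<^sub>R g) (f - c *\<^sub>R g)" using assms by (intro nonneg clos)
    also have "\<dots> = B f f - 2 * c * B f g + c\<^sup>2 * B g g"
      using assms by (simp add: diff_left diff_right scale_left scale_right clos sym[of g f] algebra_simps power2_eq_square)
    finally show ?thesis .
  qed
  have "(B f g)\<^sup>2 \<le> B f f * B g g"
  proof (cases "B g g = 0")
    case True
    have "B f g = 0"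
    proof (rule ccontr)
      assume "B f g \<noteq> 0"
      then show False using *[of "(B f f + 1) / (2 * B f g)"] True by (simp add: field_simps)
    qed
    then show ?thesis using True by simp
  next
    case False
    then have "B g g > 0" using nonneg[OF assms(2)] by simp
    then show ?thesis using *[of "B f g / B g g"]
      by (simp add: field_simps power2_eq_square split: if_splits)
  qed
  then have "sqrt ((B f g)\<^sup>2) \<le> sqrt (B f f * B g g)" by (rule real_sqrt_le_mono)
  then show ?thesis using assms by (simp add: nrm_eq real_sqrt_mult)
qed

sublocale seminormed X nrm
proof
  show "subspace X" by (fact subsp)
  fix f g assume fg: "f \<in> X" "g \<in> X"
  have n: "0 \<le> nrm f" "0 \<le> nrm g" using fg by (auto simp: nrm_eq nonneg)
  have "(nrm (f + g))\<^sup>2 = B f f + 2 * B f g + B g g"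
    using fg by (simp add: nrm_square clos add_left add_right sym[of g f])
  also have "\<dots> \<le> (nrm f)\<^sup>2 + 2 * (nrm f * nrm g) + (nrm g)\<^sup>2"
    using cauchy_schwarz[OF fg] fg by (simp add: nrm_square)
  also have "\<dots> = (nrm f + nrm g)\<^sup>2" by (simp add: power2_sum)
  finally show "nrm (f + g) \<le> nrm f + nrm g" using n power2_le_imp_le add_nonneg_nonneg by blast
next
  fix c f assume "f \<in> X"
  then have "nrm (c *\<^sub>R f) = sqrt (c\<^sup>2 * B f f)"
    by (simp add: nrm_eq clos scale_left scale_right power2_eq_square mult.assoc)
  then show "nrm (c *\<^sub>R f) = \<bar>c\<bar> * nrm f"
    using \<open>f \<in> X\<close> by (simp add: nrm_eq real_sqrt_mult)
qed

lemma sum_closed: "(\<And>i. i \<in> I \<Longrightarrow> e i \<in> X) \<Longrightarrow> (\<Sum>i\<in>I. c i *\<^sub>R e i) \<in> X"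
  by (intro subspace_sum subsp clos) 

lemma sum_left: "(\<And>i. i \<in> I \<Longrightarrow> e i \<in> X) \<Longrightarrow> h \<in> X \<Longrightarrow> B (\<Sum>i\<in>I. c i *\<^sub>R e i) h = (\<Sum>i\<in>I. c i * B (e i) h)"
proof (induction I rule: infinite_finite_induct)
  case (insert x F)
  then show ?case using sum_closed[of F e c] by (simp add: add_left clos scale_left)
qed (use scale_left[of 0 h 0] clos in auto)

lemma sum_right: "(\<And>i. i \<in> I \<Longrightarrow> e i \<in> X) \<Longrightarrow> h \<in> X \<Longrightarrow> B h (\<Sum>i\<in>I. c i *\<^sub>R e i) = (\<Sum>i\<in>I. c i * B h (e i))"
  using sum_left[of I e h c] sum_closed[of I e c] by (simp add: sym)

text \<open>
  By the Cauchy-Schwarz inequality. This makes the basis functions that vanish identically, such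
  as \<open>xi i m 0\<close>, harmless in orthogonal expansions.
\<close>

lemma null_orthogonal: "f \<in> X \<Longrightarrow> e \<in> X \<Longrightarrow> B e e = 0 \<Longrightarrow> B f e = 0"
  using cauchy_schwarz[of f e] by (simp add: nrm_eq)

text \<open>
  For a null vector \<open>e i\<close> both the coefficient (because \<open>x / 0 = 0\<close>) and
  the vector contribute nothing, so the system need not consist of nonzero vectors.
\<close>

definition proj :: "('i \<Rightarrow> 'a) \<Rightarrow> 'i set \<Rightarrow> 'a \<Rightarrow> 'a" where
  "proj e I f = (\<Sum>i\<in>I. (B f (e i) / B (e i) (e i)) *\<^sub>R e i)"

lemma orthogonal_sum_square:
  assumes "finite I" "\<And>i. i \<in> I \<Longrightarrow> e i \<in> X" 
    and "\<And>i j. i \<in> I \<Longrightarrow> j \<in> I \<Longrightarrow> i \<noteq> j \<Longrightarrow> B (e i) (e j) = 0"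
  shows "(nrm (\<Sum>i\<in>I. c i *\<^sub>R e i))\<^sup>2 = (\<Sum>i\<in>I. (c i)\<^sup>2 * B (e i) (e i))"
proof -
  let ?s = "\<Sum>i\<in>I. c i *\<^sub>R e i"
  have "(nrm ?s)\<^sup>2 = (\<Sum>i\<in>I. c i * B (e i) ?s)"
    using assms sum_closed[of I e c] by (simp add: nrm_square sum_left)
  also have "\<dots> = (\<Sum>i\<in>I. c i * (\<Sum>j\<in>I. c j * B (e i) (e j)))"
    using assms by (intro sum.cong) (auto simp: sum_right)
  also have "\<dots> = (\<Sum>i\<in>I. c i * (\<Sum>j\<in>I. if i = j then c i * B (e i) (e i) else 0))"
    using assms by (intro sum.cong refl arg_cong2[where f="(*)"]) auto
  also have "\<dots> = (\<Sum>i\<in>I. (c i)\<^sup>2 * B (e i) (e i))"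
    using assms(1) by (intro sum.cong) (auto simp: power2_eq_square)
  finally show ?thesis .
qed

lemma proj_coefficient:
  assumes "finite I" "\<And>i. i \<in> I \<Longrightarrow> e i \<in> X" "f \<in> X" "j \<in> I"
    and "\<And>i j. i \<in> I \<Longrightarrow> j \<in> I \<Longrightarrow> i \<noteq> j \<Longrightarrow> B (e i) (e j) = 0"
  shows "B (proj e I f) (e j) = B f (e j)"
proof -
  have "B (proj e I f) (e j) = (\<Sum>i\<in>I. (B f (e i) / B (e i) (e i)) * B (e i) (e j))"
    using assms unfolding proj_def by (subst sum_left) auto
  also have "\<dots> = (\<Sum>i\<in>I. if i = j then B f (e j) else 0)"
    using assms null_orthogonal by (intro sum.cong) auto
  finally show ?thesis using assms by simp
qed

lemma bessel_identity:
  assumes "finite I" "\<And>i. i \<in> I \<Longrightarrow> e i \<in> X" "f \<in> X"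
    and "\<And>i j. i \<in> I \<Longrightarrow> j \<in> I \<Longrightarrow> i \<noteq> j \<Longrightarrow> B (e i) (e j) = 0"
  shows "(nrm (f - proj e I f))\<^sup>2 = (nrm f)\<^sup>2 - (\<Sum>i\<in>I. (B f (e i))\<^sup>2 / B (e i) (e i))"
    and "(nrm (proj e I f))\<^sup>2 = (\<Sum>i\<in>I. (B f (e i))\<^sup>2 / B (e i) (e i))"
proof -
  let ?p = "proj e I f"
  have pX: "?p \<in> X" unfolding proj_def using assms by (intro sum_closed) auto
  have 1: "B f ?p = (\<Sum>i\<in>I. (B f (e i))\<^sup>2 / B (e i) (e i))"
    unfolding proj_def using assms by (subst sum_right) (auto simp: power2_eq_square)
  have "(nrm ?p)\<^sup>2 = (\<Sum>i\<in>I. (B f (e i) / B (e i) (e i))\<^sup>2 * B (e i) (e i))"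
    unfolding proj_def using assms by (intro orthogonal_sum_square) auto
  also have "\<dots> = (\<Sum>i\<in>I. (B f (e i))\<^sup>2 / B (e i) (e i))"
    by (intro sum.cong) (auto simp: power2_eq_square)
  finally show 2: "(nrm ?p)\<^sup>2 = (\<Sum>i\<in>I. (B f (e i))\<^sup>2 / B (e i) (e i))" .
  show "(nrm (f - ?p))\<^sup>2 = (nrm f)\<^sup>2 - (\<Sum>i\<in>I. (B f (e i))\<^sup>2 / B (e i) (e i))"
    using pX assms(3) 1 2 by (simp add: nrm_square clos diff_left diff_right sym[of ?p f])
qed

lemma bessel:
  assumes "finite I" "\<And>i. i \<in> I \<Longrightarrow> e i \<in> X" "f \<in> X"
    and "\<And>i j. i \<in> I \<Longrightarrow> j \<in> I \<Longrightarrow> i \<noteq> j \<Longrightarrow> B (e i) (e j) = 0"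
  shows "(\<Sum>i\<in>I. (B f (e i))\<^sup>2 / B (e i) (e i)) \<le> (nrm f)\<^sup>2"
proof -
  have "0 \<le> (nrm (f - proj e I f))\<^sup>2" by simp
  then show ?thesis using bessel_identity(1)[OF assms] by simp
qed

end

lemma pre_hilbert_subspace:
  assumes "pre_hilbert X B nrm" "subspace Y" "Y \<subseteq> X" shows "pre_hilbert Y B nrm"
  using assms unfolding pre_hilbert_def by (simp add: subset_iff)

section \<open>The space L2\<close>

abbreviation "\<mu> \<equiv> lebesgue_on \<Omega>0"

lemma Omega0_cbox: "\<Omega>0 = cbox (0,0) (1,1)"
  by (auto simp: \<Omega>0_def)

lemma Omega0_sets [simp, intro]: "\<Omega>0 \<in> sets lebesgue" "\<Omega>0 \<in> lmeasurable"
  by (simp_all add: Omega0_cbox)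

interpretation \<mu>: finite_measure \<mu>
  by (rule finite_measureI) (simp add: emeasure_restrict_space Omega0_cbox emeasure_lborel_cbox_eq)

lemma L2D: assumes "f \<in> L2" shows "f \<in> borel_measurable \<mu>" "integrable \<mu> (\<lambda>p. (norm (f p))\<^sup>2)"
  using assms by (auto simp: L2_def)

lemma L2_measurable [measurable_dest]: "f \<in> L2 \<Longrightarrow> f \<in> borel_measurable \<mu>"
  by (rule L2D)

lemma L2_integrable_inner:
  fixes f g :: "real \<times> real \<Rightarrow> 'v::euclidean_space"
  assumes "f \<in> L2" "g \<in> L2" shows "integrable \<mu> (\<lambda>p. f p \<bullet> g p)"
proof (rule Bochner_Integration.integrable_bound)
  show "integrable \<mu> (\<lambda>p. (norm (f p))\<^sup>2 + (norm (g p))\<^sup>2)" using L2D[OF assms(1)] L2D[OF assms(2)] by simp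
  show "(\<lambda>p. f p \<bullet> g p) \<in> borel_measurable \<mu>" using L2D[OF assms(1)] L2D[OF assms(2)] by simp
  have "\<bar>x \<bullet> y\<bar> \<le> (norm x)\<^sup>2 + (norm y)\<^sup>2" for x y :: 'v
    using Cauchy_Schwarz_ineq2[of x y] sum_squares_bound[of "norm x" "norm y"]
     mult_nonneg_nonneg[OF norm_ge_zero norm_ge_zero, of x y] by linarith
  then show "AE p in \<mu>. norm (f p \<bullet> g p) \<le> norm ((norm (f p))\<^sup>2 + (norm (g p))\<^sup>2)" by simp
qed

lemma subspace_L2: "subspace (L2 :: (real \<times> real \<Rightarrow> 'v::euclidean_space) set)"
proof (rule subspaceI)
  show "0 \<in> (L2 :: (real \<times> real \<Rightarrow> 'v) set)" by (simp add: L2_def fsimps)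
next
  fix f g :: "real \<times> real \<Rightarrow> 'v" assume fg: "f \<in> L2" "g \<in> L2"
  have "integrable \<mu> (\<lambda>p. (norm (f p))\<^sup>2 + 2 * (f p \<bullet> g p) + (norm (g p))\<^sup>2)"
    using fg L2_integrable_inner[OF fg] L2D by (intro Bochner_Integration.integrable_add integrable_mult_right) auto
  then have "integrable \<mu> (\<lambda>p. (norm (f p + g p))\<^sup>2)"
    by (simp add: power2_norm_eq_inner inner_simps inner_commute algebra_simps)
  then show "f + g \<in> L2" using fg by (auto simp: L2_def fsimps)
next
  fix c and f :: "real \<times> real \<Rightarrow> 'v" assume "f \<in> L2"
  then show "c *\<^sub>R f \<in> L2" by (auto simp: L2_def fsimps power_mult_distrib)
qed

interpretation L2: pre_hilbert "L2 :: (real \<times> real \<Rightarrow> 'v::euclidean_space) set" ip L2_norm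
proof
  show "subspace (L2 :: (real \<times> real \<Rightarrow> 'v) set)" by (rule subspace_L2)
qed (auto simp: ip_def L2_norm_def power2_norm_eq_inner L2_integrable_inner inner_commute fsimps
    intro!: Bochner_Integration.integral_cong
    simp flip: Bochner_Integration.integral_add inner_add_left inner_add_right)

lemma ip_cong_AE:
  fixes f f' g g' :: "real \<times> real \<Rightarrow> 'v::euclidean_space"
  assumes "AE p in \<mu>. f p = f' p" "AE p in \<mu>. g p = g' p"
    "f \<in> L2" "f' \<in> L2" "g \<in> L2" "g' \<in> L2"
  shows "ip f g = ip f' g'"
  unfolding ip_def using assms by (intro integral_cong_AE) (measurable, auto)

lemma L2_norm_cong_AE:
  fixes f f' :: "real \<times> real \<Rightarrow> 'v::euclidean_space"
  assumes "AE p in \<mu>. f p = f' p" "f \<in> L2" "f' \<in> L2"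
  shows "L2_norm f = L2_norm f'"
  using ip_cong_AE[of f f' f f'] assms L2.nrm_eq by metis

lemma L2_dominated:
  fixes f :: "real \<times> real \<Rightarrow> 'v::euclidean_space" and g :: "real \<times> real \<Rightarrow> 'w::euclidean_space"
  assumes "f \<in> borel_measurable \<mu>" "g \<in> L2" "AE p in \<mu>. norm (f p) \<le> C * norm (g p)"
  shows "f \<in> L2" "L2_norm f \<le> \<bar>C\<bar> * L2_norm g"
proof -
  have C: "norm (f p) \<le> C * norm (g p) \<Longrightarrow> (norm (f p))\<^sup>2 \<le> C\<^sup>2 * (norm (g p))\<^sup>2" for p
    by (metis norm_ge_zero power_mono power_mult_distrib)
  have AE: "AE p in \<mu>. (norm (f p))\<^sup>2 \<le> C\<^sup>2 * (norm (g p))\<^sup>2" using assms(3) C by auto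
  have I: "integrable \<mu> (\<lambda>p. C\<^sup>2 * (norm (g p))\<^sup>2)" using L2D[OF assms(2)] by simp
  have "integrable \<mu> (\<lambda>p. (norm (f p))\<^sup>2)"
    by (rule Bochner_Integration.integrable_bound[OF I]) (use assms AE in auto)
  then show f: "f \<in> L2" using assms by (simp add: L2_def)
  have "(LINT p|\<mu>. (norm (f p))\<^sup>2) \<le> (LINT p|\<mu>. C\<^sup>2 * (norm (g p))\<^sup>2)"
    using L2D[OF f] I AE by (intro integral_mono_AE) auto
  also have "\<dots> = C\<^sup>2 * (LINT p|\<mu>. (norm (g p))\<^sup>2)" by simp
  finally have "L2_norm f \<le> sqrt (C\<^sup>2 * (LINT p|\<mu>. (norm (g p))\<^sup>2))"
    by (simp add: L2_norm_def)
  then show "L2_norm f \<le> \<bar>C\<bar> * L2_norm g" by (simp add: L2_norm_def real_sqrt_mult)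
qed

lemma L2_bounded:
  fixes f :: "real \<times> real \<Rightarrow> 'v::euclidean_space"
  assumes "f \<in> borel_measurable \<mu>" "\<And>p. p \<in> \<Omega>0 \<Longrightarrow> norm (f p) \<le> C" shows "f \<in> L2"
proof (rule L2_dominated(1)[where g = "\<lambda>_. 1::real" and C = C])
  show "(\<lambda>_. 1::real) \<in> L2" by (simp add: L2_def)
qed (use assms in auto)

lemma L2_continuous:
  fixes f :: "real \<times> real \<Rightarrow> 'v::euclidean_space"
  assumes "continuous_on \<Omega>0 f" shows "f \<in> L2"
proof -
  have "compact (f ` \<Omega>0)" using assms by (intro compact_continuous_image) (simp_all add: Omega0_cbox)
  then obtain C where "\<And>p. p \<in> \<Omega>0 \<Longrightarrow> norm (f p) \<le> C" by (metis bounded_iff compact_imp_bounded imageI)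
  then show ?thesis using continuous_imp_measurable_on_sets_lebesgue[OF assms] by (intro L2_bounded) auto
qed

lemma L2_AE_subsequence:
  fixes f :: "real \<times> real \<Rightarrow> 'v::euclidean_space"
  assumes "\<And>n. p n \<in> L2" "f \<in> L2" "(\<lambda>n. L2_norm (f - p n)) \<longlonglongrightarrow> 0"
  obtains s where "strict_mono s" "AE x in \<mu>. (\<lambda>n. p (s n) x) \<longlonglongrightarrow> f x"
proof -
  have d: "f - p n \<in> L2" for n using assms by (intro L2.clos)
  have *: "(\<lambda>n. \<integral>x. norm ((norm (f x - p n x))\<^sup>2) \<partial>\<mu>) \<longlonglongrightarrow> 0"
    using tendsto_power[OF assms(3), of 2] by (simp add: L2_norm_def fsimps)
  obtain s where s: "strict_mono s" "AE x in \<mu>. (\<lambda>n. (norm (f x - p (s n) x))\<^sup>2) \<longlonglongrightarrow> 0"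
    using tendsto_L1_AE_subseq[OF _ *] L2D(2)[OF d] by (auto simp: fsimps)
  have "(\<lambda>n. p (s n) x) \<longlonglongrightarrow> f x" if "(\<lambda>n. (norm (f x - p (s n) x))\<^sup>2) \<longlonglongrightarrow> 0" for x
  proof -
    have "(\<lambda>n. sqrt ((norm (f x - p (s n) x))\<^sup>2)) \<longlonglongrightarrow> sqrt 0" by (intro tendsto_intros that)
    then have "(\<lambda>n. norm (p (s n) x - f x)) \<longlonglongrightarrow> 0" by (simp add: norm_minus_commute)
    then show ?thesis by (simp add: LIM_zero_iff tendsto_norm_zero_iff)
  qed
  then show ?thesis using s that by (metis (mono_tags, lifting) eventually_mono)
qed

lemma Fatou_bound:
  fixes g :: "'a \<Rightarrow> real"
  assumes int: "\<And>n. integrable M (h n)" and nn: "\<And>n. AE x in M. 0 \<le> h n x"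
    and lim: "AE x in M. (\<lambda>n. h n x) \<longlonglongrightarrow> g x" and meas: "g \<in> borel_measurable M"
    and bound: "\<And>n. integral\<^sup>L M (h n) \<le> C"
  shows "integrable M g" "integral\<^sup>L M g \<le> C"
proof -
  have nnA: "AE x in M. \<forall>n. 0 \<le> h n x" using nn by (simp add: AE_all_countable)
  have g0: "AE x in M. 0 \<le> g x" using nnA lim by eventually_elim (auto intro: LIMSEQ_le_const)
  have C: "0 \<le> C" using integral_nonneg_AE[OF nn[of 0]] bound[of 0] by linarith
  have "(\<integral>\<^sup>+x. ennreal (g x) \<partial>M) = (\<integral>\<^sup>+x. liminf (\<lambda>n. ennreal (h n x)) \<partial>M)"
    using lim by (intro nn_integral_cong_AE) (auto simp: lim_imp_Liminf[OF _ tendsto_ennrealI])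
  also have "\<dots> \<le> liminf (\<lambda>n. \<integral>\<^sup>+x. ennreal (h n x) \<partial>M)"
    using int by (intro nn_integral_liminf) auto
  also have "\<dots> \<le> liminf (\<lambda>n. ennreal C)"
  proof (intro Liminf_mono always_eventually allI)
    fix n
    have "(\<integral>\<^sup>+x. ennreal (h n x) \<partial>M) = ennreal (integral\<^sup>L M (h n))"
      using int nn by (intro nn_integral_eq_integral) auto
    then show "(\<integral>\<^sup>+x. ennreal (h n x) \<partial>M) \<le> ennreal C" using bound by (simp add: ennreal_leI)
  qed
  also have "\<dots> = ennreal C" by (simp add: Liminf_const)
  finally have *: "(\<integral>\<^sup>+x. ennreal (g x) \<partial>M) \<le> ennreal C" .
  show gi: "integrable M g"
    by (rule integrableI_nonneg[OF meas g0]) (use * in \<open>simp add: le_less_trans\<close>)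
  have "ennreal (integral\<^sup>L M g) \<le> ennreal C" using * nn_integral_eq_integral[OF gi g0] by simp
  then show "integral\<^sup>L M g \<le> C" using C by simp
qed

text \<open>
  Riesz-Fischer: a subsequence with summable increments converges almost everywhere, and Fatou's
  lemma makes the pointwise limit a limit in norm.
\<close>

lemma L2_complete:
  fixes f :: "nat \<Rightarrow> real \<times> real \<Rightarrow> real"
  assumes f: "\<And>n. f n \<in> L2"
    and cauchy: "\<And>e. e > 0 \<Longrightarrow> \<exists>N. \<forall>m\<ge>N. \<forall>n\<ge>N. L2_norm (f m - f n) < e"
  obtains g where "g \<in> L2" "(\<lambda>n. L2_norm (f n - g)) \<longlonglongrightarrow> 0"
proof -
  have "\<exists>N. \<forall>m\<ge>N. \<forall>n\<ge>N. L2_norm (f m - f n) < (1/2)^k" for k :: nat by (rule cauchy) simp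
  then obtain N where N: "\<And>k m n. m \<ge> N k \<Longrightarrow> n \<ge> N k \<Longrightarrow> L2_norm (f m - f n) < (1/2)^k" by metis
  define s where "s k = (\<Sum>i\<le>k. N i)" for k
  have sN: "s k \<ge> N k" for k unfolding s_def by (simp add: member_le_sum)
  have sS: "s (Suc k) \<ge> N k" for k using sN[of k] by (simp add: s_def)
  define d where "d k p = \<bar>f (s (Suc k)) p - f (s k) p\<bar>" for k p
  have dL: "f (s (Suc k)) - f (s k) \<in> L2" for k using f by (intro L2.clos)
  have dm [measurable]: "d k \<in> borel_measurable \<mu>" for k unfolding d_def using f[THEN L2_measurable] by measurable
  have one: "(\<lambda>_. 1::real) \<in> L2" by (simp add: L2_def)
  have dL2: "d k \<in> L2" "L2_norm (d k) \<le> L2_norm (f (s (Suc k)) - f (s k))" for k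
    using L2_dominated[OF dm dL[of k], of k 1] by (auto simp: d_def fsimps)
  have d1: "(\<integral>\<^sup>+p. ennreal (d k p) \<partial>\<mu>) \<le> ennreal ((1/2)^k * L2_norm (\<lambda>_. 1::real))" for k
  proof -
    have i: "integrable \<mu> (d k)" using L2_integrable_inner[OF dL2(1) one] by simp
    have "(\<integral>\<^sup>+p. ennreal (d k p) \<partial>\<mu>) = ennreal (LINT p|\<mu>. d k p)"
    proof (rule nn_integral_eq_integral[OF i])
      show "AE p in \<mu>. 0 \<le> d k p" by (simp add: d_def)
    qed
    also have "(LINT p|\<mu>. d k p) = ip (d k) (\<lambda>_. 1)" by (simp add: ip_def)
    also have "\<dots> \<le> L2_norm (d k) * L2_norm (\<lambda>_. 1::real)"
      using L2.cauchy_schwarz[OF dL2(1) one, of k] by linarith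
    also have "\<dots> \<le> (1/2)^k * L2_norm (\<lambda>_. 1::real)"
      using dL2(2)[of k] N[OF sS sN, of k] L2.nrm_nonneg[OF one] by (intro mult_right_mono) auto
    finally show ?thesis by (simp add: ennreal_leI)
  qed
  have "(\<integral>\<^sup>+p. (\<Sum>k. ennreal (d k p)) \<partial>\<mu>) = (\<Sum>k. \<integral>\<^sup>+p. ennreal (d k p) \<partial>\<mu>)"
    by (intro nn_integral_suminf) measurable
  also have "\<dots> \<le> (\<Sum>k. ennreal ((1/2)^k * L2_norm (\<lambda>_. 1::real)))"
    using d1 by (intro suminf_le) auto
  also have "\<dots> = ennreal (\<Sum>k. (1/2)^k * L2_norm (\<lambda>_. 1::real))"
    using L2.nrm_nonneg[OF one] by (intro suminf_ennreal2) (auto intro!: summable_mult2 summable_geometric)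
  finally have "(\<integral>\<^sup>+p. (\<Sum>k. ennreal (d k p)) \<partial>\<mu>) \<noteq> \<infinity>" by (auto simp: top_unique)
  then have "AE p in \<mu>. (\<Sum>k. ennreal (d k p)) \<noteq> \<infinity>" by (intro nn_integral_noteq_infinite) auto
  then have conv: "AE p in \<mu>. convergent (\<lambda>k. f (s k) p)"
  proof eventually_elim
    case (elim p)
    then have "summable (\<lambda>k. d k p)" by (intro summable_suminf_not_top) (auto simp: d_def)
    then have "summable (\<lambda>k. f (s (Suc k)) p - f (s k) p)"
      unfolding d_def by (rule summable_rabs_cancel)
    then have "convergent (\<lambda>n. \<Sum>k<n. f (s (Suc k)) p - f (s k) p)" by (simp add: summable_iff_convergent)
    then have "convergent (\<lambda>n. f (s n) p - f (s 0) p)" using sum_lessThan_telescope[of "\<lambda>k. f (s k) p"] by simp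
    then show ?case
      using convergent_add[OF _ convergent_const[of "f (s 0) p"]] by fastforce
  qed
  define g where "g p = lim (\<lambda>k. f (s k) p)" for p
  have fm [measurable]: "f n \<in> borel_measurable \<mu>" for n using f by (rule L2_measurable)
  have gm [measurable]: "g \<in> borel_measurable \<mu>" unfolding g_def by measurable
  have lim: "AE p in \<mu>. (\<lambda>k. f (s k) p) \<longlonglongrightarrow> g p"
    using conv by eventually_elim (simp add: g_def convergent_LIMSEQ_iff)
  have near: "f n - g \<in> L2 \<and> L2_norm (f n - g) \<le> (1/2)^K" if "n \<ge> N K" for n K
  proof -
    have nL: "f n - f (s (k + K)) \<in> L2" for k using f by (intro L2.clos)
    have ge: "s (k + K) \<ge> N K" for k unfolding s_def by (simp add: member_le_sum)
    have bd: "(LINT p|\<mu>. (f n p - f (s (k + K)) p)\<^sup>2) \<le> ((1/2)^K)\<^sup>2" for k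
    proof -
      have "(LINT p|\<mu>. (f n p - f (s (k + K)) p)\<^sup>2) = (L2_norm (f n - f (s (k + K))))\<^sup>2"
        by (simp add: L2_norm_def fsimps integral_nonneg_AE)
      also have "\<dots> \<le> ((1/2)^K)\<^sup>2"
        using N[OF that ge, of k] L2.nrm_nonneg[OF nL, of k] by (intro power_mono) auto
      finally show ?thesis .
    qed
    have l: "AE p in \<mu>. (\<lambda>k. (f n p - f (s (k + K)) p)\<^sup>2) \<longlonglongrightarrow> (f n p - g p)\<^sup>2"
      using lim by eventually_elim (intro tendsto_intros LIMSEQ_ignore_initial_segment)
    have i: "integrable \<mu> (\<lambda>p. (f n p - f (s (k + K)) p)\<^sup>2)" for k using L2D(2)[OF nL, of k] by (simp add: fsimps)
    note F = Fatou_bound[OF i _ l _ bd]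
    have "integrable \<mu> (\<lambda>p. (f n p - g p)\<^sup>2)" "(LINT p|\<mu>. (f n p - g p)\<^sup>2) \<le> ((1/2)^K)\<^sup>2"
      by (rule F; simp; measurable)+
    then show ?thesis by (auto simp: L2_def L2_norm_def fsimps intro!: real_le_lsqrt)
  qed
  have "g = f (N 0) - (f (N 0) - g)" by simp
  then have gL: "g \<in> L2" using near[of 0 "N 0"] f by (metis L2.clos(3) order_refl)
  have "(\<lambda>n. L2_norm (f n - g)) \<longlonglongrightarrow> 0"
  proof (rule LIMSEQ_I)
    fix e :: real assume "e > 0"
    then obtain K where K: "(1/2)^K < e" using real_arch_pow_inv[of e "1/2"] by auto
    have "norm (L2_norm (f n - g) - 0) < e" if "n \<ge> N K" for n
      using near[OF that] L2.nrm_nonneg[of "f n - g"] K by auto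
    then show "\<exists>no. \<forall>n\<ge>no. norm (L2_norm (f n - g) - 0) < e" by blast
  qed
  with gL that show ?thesis by blast
qed

section \<open>Completeness of the trigonometric system\<close>

lemma integrable_mult_continuous:
  fixes f q :: "real \<times> real \<Rightarrow> real"
  assumes "integrable \<mu> f" "continuous_on \<Omega>0 q" shows "integrable \<mu> (\<lambda>p. f p * q p)"
proof -
  have "compact (q ` \<Omega>0)" using assms by (intro compact_continuous_image) (simp_all add: Omega0_cbox)
  then obtain C where C: "\<And>p. p \<in> \<Omega>0 \<Longrightarrow> norm (q p) \<le> C" by (metis bounded_iff compact_imp_bounded imageI)
  have [measurable]: "q \<in> borel_measurable \<mu>"
    using continuous_imp_measurable_on_sets_lebesgue[OF assms(2)] by simp
  have [measurable]: "f \<in> borel_measurable \<mu>" using assms(1) by simp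
  show ?thesis
  proof (rule Bochner_Integration.integrable_bound)
    show "integrable \<mu> (\<lambda>p. C * f p)" using assms(1) by simp
    show "(\<lambda>p. f p * q p) \<in> borel_measurable \<mu>" by measurable
    have "norm (f p * q p) \<le> norm (C * f p)" if "p \<in> \<Omega>0" for p
      using mult_left_mono[OF C[OF that], of "\<bar>f p\<bar>"] by (simp add: abs_mult mult.commute) 
         (smt (verit, best) mult_right_mono)
    then show "AE p in \<mu>. norm (f p * q p) \<le> norm (C * f p)" by (intro AE_I2) simp
  qed
qed

definition trig_polys :: "(real \<times> real \<Rightarrow> real) set" where
  "trig_polys = span {phi i m n |i m n. (i, m, n) \<in> xi_index}"

lemma phi_trig_polys: "i = 1 \<or> i = -1 \<Longrightarrow> phi i m n \<in> trig_polys"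
  unfolding trig_polys_def xi_index_def by (rule span_base) auto

lemma trig_polys_closed:
  "0 \<in> trig_polys" "f \<in> trig_polys \<Longrightarrow> g \<in> trig_polys \<Longrightarrow> f + g \<in> trig_polys"
  "f \<in> trig_polys \<Longrightarrow> g \<in> trig_polys \<Longrightarrow> f - g \<in> trig_polys"
  "f \<in> trig_polys \<Longrightarrow> c *\<^sub>R f \<in> trig_polys"
  unfolding trig_polys_def by (auto simp: span_zero span_add span_diff span_scale)

text \<open>
  Multiplication by a fixed function preserves trigonometric polynomials as soon as it maps basis
  functions to trigonometric polynomials. The product formulas give this for the three coordinates
  of the map below.
\<close>

lemma trig_polys_mult:
  assumes "\<And>i m n. i = 1 \<or> i = -1 \<Longrightarrow> (\<lambda>p. c p * phi i m n p) \<in> trig_polys" "q \<in> trig_polys"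
  shows "(\<lambda>p. c p * q p) \<in> trig_polys"
  using assms(2)[unfolded trig_polys_def]
proof (induction rule: span_induct_alt)
  case base
  then show ?case using trig_polys_closed(1) by (simp add: fsimps)
next
  case (step a x y)
  then obtain i m n where "x = phi i m n" "i = 1 \<or> i = -1" by (auto simp: xi_index_def)
  then have "a *\<^sub>R (\<lambda>p. c p * x p) + (\<lambda>p. c p * y p) \<in> trig_polys"
    using step assms(1)[of i m n] by (intro trig_polys_closed) auto
  then show ?case by (simp add: fsimps algebra_simps)
qed

lemma cos_mult_cos: "cos a * cos (b::real) = (cos (b + a) + cos (b - a)) / 2"
  and cos_mult_sin: "cos a * sin b = (sin (b + a) + sin (b - a)) / 2"
  and sin_mult_cos: "sin a * cos b = (sin (b + a) - sin (b - a)) / 2"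
  and sin_mult_sin: "sin a * sin b = (cos (b - a) - cos (b + a)) / 2"
  by (simp_all add: cos_add cos_diff sin_add sin_diff)

lemma trig_polys_mult_cos_x: "q \<in> trig_polys \<Longrightarrow> (\<lambda>p. cos (2 * pi * fst p) * q p) \<in> trig_polys"
proof (rule trig_polys_mult)
  fix i :: int and m n :: nat assume i: "i = 1 \<or> i = -1"
  show "(\<lambda>p. cos (2 * pi * fst p) * phi i m n p) \<in> trig_polys"
  proof (cases m)
    case 0
    then have "(\<lambda>p. cos (2 * pi * fst p) * phi i m n p) = (if i = 1 then phi 1 1 n else 0)"
      by (auto simp: phi_def trig_def fun_eq_iff fsimps)
    then show ?thesis using phi_trig_polys trig_polys_closed by simp
  next
    case (Suc k)
    have "2 * pi * real m * x + 2 * pi * x = 2 * pi * real (Suc m) * x"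
      "2 * pi * real m * x - 2 * pi * x = 2 * pi * real k * x" for x
      by (simp_all add: algebra_simps Suc)
    then have "cos (2 * pi * x) * trig i m x = (trig i (Suc m) x + trig i k x) / 2" for x
      unfolding trig_def by (auto simp: cos_mult_cos cos_mult_sin)
    then have T: "cos (2 * pi * x) * (trig i m x * c) = (trig i (Suc m) x + trig i k x) / 2 * c" for x c
      by (metis mult.assoc)
    then have "(\<lambda>p. cos (2 * pi * fst p) * phi i m n p) = (1/2) *\<^sub>R (phi i (Suc m) n + phi i k n)"
      by (simp add: phi_def fun_eq_iff fsimps T add_divide_distrib distrib_right)
    then show ?thesis using phi_trig_polys[OF i] trig_polys_closed by simp
  qed
qed

lemma trig_polys_mult_sin_x: "q \<in> trig_polys \<Longrightarrow> (\<lambda>p. sin (2 * pi * fst p) * q p) \<in> trig_polys"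
proof (rule trig_polys_mult)
  fix i :: int and m n :: nat assume i: "i = 1 \<or> i = -1"
  show "(\<lambda>p. sin (2 * pi * fst p) * phi i m n p) \<in> trig_polys"
  proof (cases m)
    case 0
    then have "(\<lambda>p. sin (2 * pi * fst p) * phi i m n p) = (if i = 1 then phi (-1) 1 n else 0)"
      by (auto simp: phi_def trig_def fun_eq_iff fsimps)
    then show ?thesis using phi_trig_polys trig_polys_closed by simp
  next
    case (Suc k)
    have "2 * pi * real m * x + 2 * pi * x = 2 * pi * real (Suc m) * x"
      "2 * pi * real m * x - 2 * pi * x = 2 * pi * real k * x" for x
      by (simp_all add: algebra_simps Suc)
    then have "sin (2 * pi * x) * trig i m x = of_int i * (trig (-i) (Suc m) x - trig (-i) k x) / 2" for x
      unfolding trig_def using i by (auto simp: sin_mult_cos sin_mult_sin)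
    then have T: "sin (2 * pi * x) * (trig i m x * c) = of_int i * (trig (-i) (Suc m) x - trig (-i) k x) / 2 * c" for x c
      by (metis mult.assoc)
    then have "(\<lambda>p. sin (2 * pi * fst p) * phi i m n p) = (of_int i/2) *\<^sub>R (phi (-i) (Suc m) n - phi (-i) k n)"
      by (simp add: phi_def fun_eq_iff fsimps T left_diff_distrib mult.assoc)
    moreover have "(of_int i/2) *\<^sub>R (phi (-i) (Suc m) n - phi (-i) k n) \<in> trig_polys"
      using i by (intro trig_polys_closed phi_trig_polys) auto
    ultimately show ?thesis by simp
  qed
qed

lemma trig_polys_mult_cos_z: "q \<in> trig_polys \<Longrightarrow> (\<lambda>p. cos (pi * snd p) * q p) \<in> trig_polys"
proof (rule trig_polys_mult)
  fix i :: int and m n :: nat assume i: "i = 1 \<or> i = -1"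
  show "(\<lambda>p. cos (pi * snd p) * phi i m n p) \<in> trig_polys"
  proof (cases n)
    case 0
    then have "(\<lambda>p. cos (pi * snd p) * phi i m n p) = phi i m 1"
      by (auto simp: phi_def fun_eq_iff)
    then show ?thesis using phi_trig_polys[OF i] by simp
  next
    case (Suc k)
    have "pi * real n * x + pi * x = pi * real (Suc n) * x"
      "pi * real n * x - pi * x = pi * real k * x" for x
      by (simp_all add: algebra_simps Suc)
    then have "cos (pi * x) * cos (pi * real n * x) = (cos (pi * real (Suc n) * x) + cos (pi * real k * x)) / 2" for x
      by (simp only: cos_mult_cos)
    then have T: "cos (pi * x) * (c * cos (pi * real n * x)) = c * ((cos (pi * real (Suc n) * x) + cos (pi * real k * x)) / 2)" for x c
      by (metis mult.left_commute)
    then have "(\<lambda>p. cos (pi * snd p) * phi i m n p) = (1/2) *\<^sub>R (phi i m (Suc n) + phi i m k)"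
      by (simp add: phi_def fun_eq_iff fsimps T add_divide_distrib distrib_left)
    then show ?thesis using phi_trig_polys[OF i] trig_polys_closed by simp
  qed
qed

text \<open>
  The square with its vertical sides glued together, embedded in three-dimensional space. The
  trigonometric polynomials in \<open>phi\<close> are the polynomials in these three coordinates,
  so the Stone-Weierstrass theorem applies to them on the image.
\<close>

definition cylinder_map :: "real \<times> real \<Rightarrow> real \<times> real \<times> real" where
  "cylinder_map p = (cos (2 * pi * fst p), sin (2 * pi * fst p), cos (pi * snd p))"

lemma polynomial_cylinder_map:
  assumes "real_polynomial_function P" shows "q \<in> trig_polys \<Longrightarrow> (\<lambda>p. P (cylinder_map p) * q p) \<in> trig_polys"
  using assms
proof (induction P arbitrary: q)
  case (linear f)
  have f: "f (a, b, c) = a * f (1,0,0) + b * f (0,1,0) + c * f (0,0,1)" for a b c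
  proof -
    have "(a, b, c) = a *\<^sub>R (1,0,0) + b *\<^sub>R (0,1,0) + c *\<^sub>R (0,0,1)" by simp
    then show ?thesis using bounded_linear.linear[OF linear(1)] by (simp only: linear_add linear_scale real_scaleR_def)
  qed
  have "f (1,0,0) *\<^sub>R (\<lambda>p. cos (2 * pi * fst p) * q p) + f (0,1,0) *\<^sub>R (\<lambda>p. sin (2 * pi * fst p) * q p)
      + f (0,0,1) *\<^sub>R (\<lambda>p. cos (pi * snd p) * q p) \<in> trig_polys"
    using linear by (intro trig_polys_closed trig_polys_mult_cos_x trig_polys_mult_sin_x trig_polys_mult_cos_z)
  moreover have "(\<lambda>p. f (cylinder_map p) * q p) = f (1,0,0) *\<^sub>R (\<lambda>p. cos (2 * pi * fst p) * q p)
      + f (0,1,0) *\<^sub>R (\<lambda>p. sin (2 * pi * fst p) * q p) + f (0,0,1) *\<^sub>R (\<lambda>p. cos (pi * snd p) * q p)"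
    unfolding cylinder_map_def by (rule ext, subst f) (simp add: fsimps algebra_simps)
  ultimately show ?case by simp
next
  case (const c)
  then show ?case using trig_polys_closed(4)[OF const, of c] by (simp add: fsimps)
next
  case (add f g)
  then show ?case using trig_polys_closed(2)[OF add.IH] by (simp add: fsimps algebra_simps)
next
  case (mult f g)
  then have "(\<lambda>p. f (cylinder_map p) * (g (cylinder_map p) * q p)) \<in> trig_polys" by blast
  then show ?case by (simp add: mult.assoc)
qed

lemma continuous_phi [continuous_intros]: "continuous_on S (phi i m n)"
  unfolding phi_def trig_def case_prod_beta by (cases "i = 1"; simp; intro continuous_intros)

lemma continuous_xi [continuous_intros]: "continuous_on S (xi i m n)"
  unfolding xi_def trig_def case_prod_beta by (cases "i = 1"; simp; intro continuous_intros)

lemma continuous_cylinder_map: "continuous_on S cylinder_map"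
  unfolding cylinder_map_def by (intro continuous_intros)

text \<open>
  Only points of the vertical sides are identified with each other, so nothing is identified with
  an interior point.
\<close>

lemma cylinder_map_inj:
  assumes "p \<in> \<Omega>0" "q \<in> box (0,0) (1,1)" "cylinder_map p = cylinder_map q" shows "p = q"
proof -
  obtain x z x' z' where pq: "p = (x, z)" "q = (x', z')" by fastforce
  have r: "0 \<le> x" "x \<le> 1" "0 \<le> z" "z \<le> 1" "0 < x'" "x' < 1" "0 < z'" "z' < 1"
    using assms(1,2) by (simp_all add: \<Omega>0_def pq box_prod)
  have "cos (pi * z) = cos (pi * z')" using assms(3) by (simp add: cylinder_map_def pq)
  moreover have "0 \<le> pi * y \<and> pi * y \<le> pi" if "0 \<le> y" "y \<le> 1" for y
    using that by (simp add: mult_left_le)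
  ultimately have zz: "pi * z = pi * z'" using r cos_inj_pi[of "pi * z" "pi * z'"] by (meson less_imp_le)
  have "sin (2 * pi * x) = sin (2 * pi * x') \<and> cos (2 * pi * x) = cos (2 * pi * x')"
    using assms(3) by (simp add: cylinder_map_def pq)
  then obtain n :: int where n: "2 * pi * x = 2 * pi * x' + 2 * pi * n" using sin_cos_eq_iff by blast
  then have "2 * pi * x = 2 * pi * (x' + n)" by (simp add: algebra_simps)
  then have "x = x' + n" by simp
  then have "n = 0" using r by linarith
  then show ?thesis using pq n zz by simp
qed

lemma AE_interior: "AE p in \<mu>. p \<in> box (0,0) (1,1)"
proof -
  have "negligible (cbox (0,0) (1,1) - box (0,0) (1::real,1::real))" by (rule negligible_frontier_interval)
  then have "AE p in lebesgue. p \<notin> cbox (0,0) (1,1) - box (0,0) (1::real,1::real)"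
    unfolding negligible_iff_null_sets by (rule AE_not_in)
  then have "AE p in lebesgue. p \<in> \<Omega>0 \<longrightarrow> p \<in> box (0,0) (1,1)"
    by (rule eventually_mono) (auto simp: Omega0_cbox)
  then show ?thesis by (subst AE_restrict_space_iff) auto
qed

text \<open>
  Orthogonality to the basis passes from trigonometric polynomials to continuous functions of
  \<open>cylinder_map\<close> by Stone-Weierstrass, and from these to the indicator of a compact
  set \<open>C\<close> of interior points: it is a bounded pointwise limit of such functions,
  because \<open>cylinder_map\<close> separates \<open>C\<close> from its complement.
\<close>

lemma integral_compact_zero:
  fixes f :: "real \<times> real \<Rightarrow> real"
  assumes f: "integrable \<mu> f" and orth: "\<And>i m n. i = 1 \<or> i = -1 \<Longrightarrow> (LINT p|\<mu>. f p * phi i m n p) = 0"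
    and C: "compact C" "C \<subseteq> box (0,0) (1,1)"
  shows "(LINT p|\<mu>. f p * indicator C p) = 0"
proof (cases "C = {}")
  case False
  have V: "continuous_on \<Omega>0 q \<and> (LINT p|\<mu>. f p * q p) = 0" if "q \<in> trig_polys" for q
    using that unfolding trig_polys_def
  proof (induction rule: span_induct_alt)
    case base
    then show ?case by (simp add: fsimps)
  next
    case (step c x y)
    then obtain i m n where x: "x = phi i m n" "i = 1 \<or> i = -1" by (auto simp: xi_index_def)
    have i: "integrable \<mu> (\<lambda>p. f p * phi i m n p)" "integrable \<mu> (\<lambda>p. f p * y p)"
      using f step by (auto intro!: integrable_mult_continuous continuous_intros)
    have "(\<lambda>p. f p * (c * phi i m n p + y p)) = (\<lambda>p. c * (f p * phi i m n p) + f p * y p)"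
      by (simp add: algebra_simps fun_eq_iff)
    then show ?case using step i orth[OF x(2)] unfolding x
      by (auto simp: fsimps intro!: continuous_intros)
  qed
  have one: "(\<lambda>p. 1) \<in> trig_polys" using phi_trig_polys[of 1 0 0] by (simp add: phi_def trig_def case_prod_unfold)
  have P: "(LINT p|\<mu>. f p * P (cylinder_map p)) = 0" if "real_polynomial_function P" for P
    using V[OF polynomial_cylinder_map[OF that one]] by simp
  have cont: "continuous_on \<Omega>0 (\<lambda>p. h (cylinder_map p))" if "continuous_on UNIV h" for h :: "_ \<Rightarrow> real"
    using that continuous_on_compose2[OF that continuous_cylinder_map] by auto
  have H: "(LINT p|\<mu>. f p * h (cylinder_map p)) = 0" if h: "continuous_on UNIV h" for h
  proof -
    let ?K = "cylinder_map ` \<Omega>0"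
    have K: "compact ?K" by (intro compact_continuous_image continuous_cylinder_map) (simp add: Omega0_cbox)
    have le: "\<bar>LINT p|\<mu>. f p * h (cylinder_map p)\<bar> \<le> e * (LINT p|\<mu>. \<bar>f p\<bar>)" if e: "e > 0" for e
    proof -
      obtain P where P': "real_polynomial_function P" "\<And>y. y \<in> ?K \<Longrightarrow> \<bar>h y - P y\<bar> < e"
        using Stone_Weierstrass_real_polynomial_function[OF K continuous_on_subset[OF h] e] by auto
      have contP: "continuous_on UNIV P" using P'(1) by (simp add: continuous_on_polymonial_function real_polynomial_function_eq)
      have i: "integrable \<mu> (\<lambda>p. f p * h (cylinder_map p))" "integrable \<mu> (\<lambda>p. f p * P (cylinder_map p))"
        using f cont h contP by (auto intro!: integrable_mult_continuous)
      then have "(LINT p|\<mu>. f p * h (cylinder_map p)) = (LINT p|\<mu>. f p * h (cylinder_map p) - f p * P (cylinder_map p))"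
        using P[OF P'(1)] by simp
      also have "\<bar>\<dots>\<bar> \<le> (LINT p|\<mu>. e * \<bar>f p\<bar>)"
      proof (rule integral_abs_bound[THEN order_trans], rule integral_mono)
        show "integrable \<mu> (\<lambda>p. \<bar>f p * h (cylinder_map p) - f p * P (cylinder_map p)\<bar>)" using i by simp
        show "integrable \<mu> (\<lambda>p. e * \<bar>f p\<bar>)" using f by simp
        fix p assume "p \<in> space \<mu>"
        then have "\<bar>h (cylinder_map p) - P (cylinder_map p)\<bar> \<le> e" using P'(2)[of "cylinder_map p"] by simp
        then have "\<bar>f p\<bar> * \<bar>h (cylinder_map p) - P (cylinder_map p)\<bar> \<le> \<bar>f p\<bar> * e" by (intro mult_left_mono) auto
        then show "\<bar>f p * h (cylinder_map p) - f p * P (cylinder_map p)\<bar> \<le> e * \<bar>f p\<bar>"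
          by (simp add: mult.commute flip: abs_mult right_diff_distrib)
      qed
      finally show ?thesis by simp
    qed
    show ?thesis
    proof (rule ccontr)
      let ?J = "\<bar>LINT p|\<mu>. f p * h (cylinder_map p)\<bar>" and ?F = "LINT p|\<mu>. \<bar>f p\<bar>"
      assume "(LINT p|\<mu>. f p * h (cylinder_map p)) \<noteq> 0"
      then have J: "?J > 0" by simp
      have F: "?F \<ge> 0" by simp
      have "?J \<le> ?J / (2 * (?F + 1)) * ?F" using F J by (intro le divide_pos_pos) (simp_all add: add_nonneg_pos)
      also have "a / (2 * (b + 1)) * b < a" if "a > 0" "b \<ge> 0" for a b :: real
        using that mult_strict_left_mono[of b "2 * (b + 1)" a] by (simp add: divide_less_eq)
      then have "?J / (2 * (?F + 1)) * ?F < ?J" using F J by blast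
      finally show False by simp
    qed
  qed
  let ?D = "cylinder_map ` C"
  have D: "closed ?D" "?D \<noteq> {}"
    using C False by (auto intro!: compact_imp_closed compact_continuous_image continuous_cylinder_map)
  \<comment> \<open>Continuous functions on the cylinder that decrease to the indicator of the image of
    \<open>C\<close>.\<close>
  define h where "h n y = max 0 (1 - real n * infdist y ?D)" for n y
  have hc: "continuous_on UNIV (h n)" for n unfolding h_def by (intro continuous_intros)
  have lim: "(\<lambda>n. h n (cylinder_map p)) \<longlonglongrightarrow> indicator C p" if "p \<in> \<Omega>0" for p
  proof (cases "p \<in> C")
    case True
    then show ?thesis by (simp add: h_def)
  next
    case False
    then have "cylinder_map p \<notin> ?D" using cylinder_map_inj[OF that] C(2) by blast
    then have pos: "infdist (cylinder_map p) ?D > 0"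
      using D infdist_pos_not_in_closed by blast
    obtain k :: nat where k: "real k * infdist (cylinder_map p) ?D > 1"
      using reals_Archimedean3[OF pos] by blast
    have "h n (cylinder_map p) = 0" if "n \<ge> k" for n
    proof -
      have "real n * infdist (cylinder_map p) ?D \<ge> real k * infdist (cylinder_map p) ?D"
        using that pos by (intro mult_right_mono) auto
      then show ?thesis using k by (simp add: h_def)
    qed
    then have "\<forall>\<^sub>F n in sequentially. h n (cylinder_map p) = 0" by (auto simp: eventually_sequentially)
    then show ?thesis using False by (simp add: tendsto_eventually)
  qed
  have Cm [measurable]: "C \<inter> \<Omega>0 \<in> sets \<mu>" using C(1)
    by (auto simp: sets_restrict_space_iff compact_imp_closed)
  have fm [measurable]: "f \<in> borel_measurable \<mu>" using f by simp
  have "(\<lambda>n. LINT p|\<mu>. f p * h n (cylinder_map p)) \<longlonglongrightarrow> (LINT p|\<mu>. f p * indicator C p)"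
  proof (rule integral_dominated_convergence[where w = "\<lambda>p. \<bar>f p\<bar>"])
    have "(\<lambda>p. f p * indicator (C \<inter> \<Omega>0) p) \<in> borel_measurable \<mu>" by measurable
    then show "(\<lambda>p. f p * indicator C p) \<in> borel_measurable \<mu>"
      by (rule measurable_cong[THEN iffD1, rotated]) (auto simp: indicator_def)
    show "(\<lambda>p. f p * h n (cylinder_map p)) \<in> borel_measurable \<mu>" for n
      using integrable_mult_continuous[OF f cont[OF hc]] by auto
    show "integrable \<mu> (\<lambda>p. \<bar>f p\<bar>)" using f by simp
    show "AE p in \<mu>. (\<lambda>n. f p * h n (cylinder_map p)) \<longlonglongrightarrow> f p * indicator C p"
      using lim by (intro AE_I2 tendsto_intros) simp
    show "AE p in \<mu>. norm (f p * h n (cylinder_map p)) \<le> \<bar>f p\<bar>" for n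
    proof (intro AE_I2)
      fix p
      have "0 \<le> h n (cylinder_map p)" "h n (cylinder_map p) \<le> 1" by (auto simp: h_def infdist_nonneg)
      then show "norm (f p * h n (cylinder_map p)) \<le> \<bar>f p\<bar>"
        using mult_left_mono[of "h n (cylinder_map p)" 1 "\<bar>f p\<bar>"] by (simp add: abs_mult)
    qed
  qed
  then show ?thesis using H[OF hc] by (simp add: LIMSEQ_const_iff)
qed simp

text \<open>
  If \<open>f\<close> were positive on a set of positive measure, it would be so on a compact
  subset of the open square, against \<open>integral_compact_zero\<close>.
\<close>

theorem cosine_system_complete:
  fixes f :: "real \<times> real \<Rightarrow> real"
  assumes f: "integrable \<mu> f" and orth: "\<And>i m n. i = 1 \<or> i = -1 \<Longrightarrow> (LINT p|\<mu>. f p * phi i m n p) = 0"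
  shows "AE p in \<mu>. f p = 0"
proof -
  have pos: "AE p in \<mu>. \<not> g p > 0" if g: "integrable \<mu> g"
    and o: "\<And>i m n. i = 1 \<or> i = -1 \<Longrightarrow> (LINT p|\<mu>. g p * phi i m n p) = 0" for g :: "real \<times> real \<Rightarrow> real"
  proof -
    define S where "S = {p \<in> \<Omega>0. g p > 0} \<inter> box (0,0) (1,1)"
    have "{p \<in> space \<mu>. g p > 0} \<in> sets \<mu>" using g by measurable
    then have S: "S \<in> sets lebesgue" by (auto simp: S_def sets_restrict_space_iff)
    have "S \<in> null_sets lebesgue"
    proof (rule ccontr)
      assume n: "S \<notin> null_sets lebesgue"
      have "bounded S"
        by (rule bounded_subset[OF bounded_cbox[of "(0,0)" "(1,1)"]]) (auto simp: S_def Omega0_cbox)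
      then have Slm: "S \<in> lmeasurable" using S by (intro bounded_set_imp_lmeasurable)
      then have mS: "measure lebesgue S > 0"
        using n negligible_iff_measure0[OF Slm] by (simp add: negligible_iff_null_sets less_le)
      obtain C where C: "closed C" "C \<subseteq> S" "S - C \<in> lmeasurable" "emeasure lebesgue (S - C) < ennreal (measure lebesgue S)"
        using sets_lebesgue_inner_closed[OF S mS] by blast
      have cC: "compact C" using C(1,2) bounded_subset[OF bounded_box[of "(0,0)" "(1::real,1::real)"]]
        by (auto simp: compact_eq_bounded_closed S_def)
      have CO: "C \<subseteq> \<Omega>0" using C(2) by (auto simp: S_def)
      have Cm [measurable]: "C \<in> sets \<mu>" using C(1) CO by (auto simp: sets_restrict_space_iff)
      have "(LINT p|\<mu>. g p * indicator C p) = 0"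
        using C(2) cC by (intro integral_compact_zero g o) (auto simp: S_def)
      moreover have "integrable \<mu> (\<lambda>p. g p * indicator C p)"
        using integrable_mult_indicator[OF Cm g] by (simp add: mult.commute)
      moreover have "AE p in \<mu>. 0 \<le> g p * indicator C p"
        using C(2) by (intro AE_I2) (auto simp: S_def indicator_def)
      ultimately have "AE p in \<mu>. g p * indicator C p = 0"
        using integral_nonneg_eq_0_iff_AE by blast
      then have "AE p in \<mu>. p \<notin> C" by (rule eventually_mono) (use C(2) in \<open>auto simp: S_def indicator_def\<close>)
      then have "AE p in lebesgue. p \<in> \<Omega>0 \<longrightarrow> p \<notin> C" by (subst (asm) AE_restrict_space_iff) auto
      then have "AE p in lebesgue. p \<notin> C" by (rule eventually_mono) (use CO in auto)
      then have "C \<in> null_sets lebesgue" using C(1) by (simp add: AE_iff_null_sets)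
      then have "emeasure lebesgue (S - C) = emeasure lebesgue S" using S by (simp add: emeasure_Diff_null_set)
      also have "\<dots> = ennreal (measure lebesgue S)"
        using fmeasurableD2[OF Slm] by (intro emeasure_eq_ennreal_measure) simp
      finally show False using C(4) by simp
    qed
    then have "AE p in lebesgue. p \<notin> S" by (rule AE_not_in)
    then have "AE p in \<mu>. p \<notin> S" by (subst AE_restrict_space_iff) auto
    then show ?thesis using AE_interior AE_space
      by eventually_elim (auto simp: S_def)
  qed
  have "AE p in \<mu>. \<not> f p > 0" by (rule pos[OF f orth])
  moreover have "AE p in \<mu>. \<not> - f p > 0" by (rule pos) (use f orth in auto)
  ultimately show ?thesis by eventually_elim auto
qed

text \<open>
  If \<open>f\<close> is orthogonal to the sines in \<open>z\<close>, then \<open>f sin (\<pi>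
  z)\<close> is orthogonal to the cosines, since \<open>sin (\<pi> z) cos (\<pi> n z)\<close> is a
  difference of sines; and \<open>sin (\<pi> z)\<close> is positive inside.
\<close>

theorem sine_system_complete:
  fixes f :: "real \<times> real \<Rightarrow> real"
  assumes f: "integrable \<mu> f" and orth: "\<And>i m n. i = 1 \<or> i = -1 \<Longrightarrow> (LINT p|\<mu>. f p * xi i m n p) = 0"
  shows "AE p in \<mu>. f p = 0"
proof -
  have s: "integrable \<mu> (\<lambda>p. f p * sin (pi * snd p))"
    by (intro integrable_mult_continuous f continuous_intros)
  have "AE p in \<mu>. f p * sin (pi * snd p) = 0"
  proof (rule cosine_system_complete[OF s])
    fix i :: int and m n :: nat assume i: "i = 1 \<or> i = -1"
    have xi_int: "integrable \<mu> (\<lambda>p. f p * xi i m k p)" for k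
      by (intro integrable_mult_continuous f continuous_intros)
    show "(LINT p|\<mu>. f p * sin (pi * snd p) * phi i m n p) = 0"
    proof (cases n)
      case 0
      then have "f p * sin (pi * snd p) * phi i m n p = f p * xi i m 1 p" for p
        by (cases p) (simp add: phi_def xi_def)
      then have "(\<lambda>p. f p * sin (pi * snd p) * phi i m n p) = (\<lambda>p. f p * xi i m 1 p)" by (rule ext)
      then show ?thesis using orth[OF i, of m 1] by simp
    next
      case (Suc k)
      have "pi * real n * x + pi * x = pi * real (Suc n) * x"
        "pi * real n * x - pi * x = pi * real k * x" for x
        by (simp_all add: algebra_simps Suc)
      then have "sin (pi * x) * cos (pi * real n * x) = (sin (pi * real (Suc n) * x) - sin (pi * real k * x)) / 2" for x
        by (simp only: sin_mult_cos)
      then have T: "b * sin (pi * x) * (c * cos (pi * real n * x)) = b * (c * ((sin (pi * real (Suc n) * x) - sin (pi * real k * x)) / 2))" for x b c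
        by (metis mult.left_commute mult.assoc)
      have "f p * sin (pi * snd p) * phi i m n p = (f p * xi i m (Suc n) p - f p * xi i m k p) / 2" for p
        by (cases p) (simp add: phi_def xi_def T right_diff_distrib diff_divide_distrib)
      then have "(\<lambda>p. f p * sin (pi * snd p) * phi i m n p)
          = (\<lambda>p. (f p * xi i m (Suc n) p - f p * xi i m k p) / 2)" by (rule ext)
      then show ?thesis using orth[OF i] xi_int by simp
    qed
  qed
  with AE_interior show ?thesis
  proof eventually_elim
    case (elim p)
    then have "0 < snd p" "snd p < 1" by (cases p; auto simp: box_prod)+
    then have "sin (pi * snd p) > 0" by (intro sin_gt_zero) auto
    then show ?case using elim by simp
  qed
qed

section \<open>Integration over the square\<close>

lemma integrable_continuous_square:
  fixes f :: "real \<times> real \<Rightarrow> real"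
  assumes "continuous_on \<Omega>0 f" shows "integrable \<mu> f"
  using continuous_imp_integrable[of "(0,0)" "(1,1)" f] assms by (simp add: Omega0_cbox)

lemma LINT_square:
  fixes f :: "real \<times> real \<Rightarrow> real"
  assumes "continuous_on \<Omega>0 f"
  shows "(LINT p|\<mu>. f p) = integral {0..1} (\<lambda>x. integral {0..1} (\<lambda>z. f (x, z)))"
    and "(LINT p|\<mu>. f p) = integral {0..1} (\<lambda>z. integral {0..1} (\<lambda>x. f (x, z)))"
proof -
  have c: "continuous_on (cbox (0,0) (1,1)) (\<lambda>(x,z). f (x, z))" using assms by (simp add: Omega0_cbox)
  have "(LINT p|\<mu>. f p) = integral \<Omega>0 f"
    using integrable_continuous_square[OF assms] by (intro lebesgue_integral_eq_integral) auto
  then show 1: "(LINT p|\<mu>. f p) = integral {0..1} (\<lambda>x. integral {0..1} (\<lambda>z. f (x, z)))"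
    using integral_prod_continuous[of 0 0 1 1 f] assms by (simp add: Omega0_cbox)
  show "(LINT p|\<mu>. f p) = integral {0..1} (\<lambda>z. integral {0..1} (\<lambda>x. f (x, z)))"
    using integral_swap_continuous[OF c] 1 by simp
qed

lemma LINT_product:
  fixes a b :: "real \<Rightarrow> real"
  assumes "continuous_on {0..1} a" "continuous_on {0..1} b"
  shows "(LINT p|\<mu>. a (fst p) * b (snd p)) = integral {0..1} a * integral {0..1} b"
proof -
  have "continuous_on \<Omega>0 (\<lambda>p. a (fst p) * b (snd p))"
    by (intro continuous_intros continuous_on_compose2[OF assms(1)] continuous_on_compose2[OF assms(2)])
       (auto simp: \<Omega>0_def)
  then show ?thesis by (subst LINT_square) simp_all
qed

lemma LINT_x_derivative:
  assumes d: "\<And>x z. x \<in> {0..1} \<Longrightarrow> z \<in> {0..1} \<Longrightarrow> ((\<lambda>s. h (s, z)) has_real_derivative h' (x, z)) (at x)"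
    and c: "continuous_on \<Omega>0 h'" and b: "\<And>z. z \<in> {0..1} \<Longrightarrow> h (0, z) = h (1, z)"
  shows "(LINT p|\<mu>. h' p) = 0"
proof -
  have "integral {0..1} (\<lambda>x. h' (x, z)) = 0" if "z \<in> {0..1}" for z
  proof -
    have "((\<lambda>x. h' (x, z)) has_integral (h (1, z) - h (0, z))) {0..1}"
      using d that by (intro fundamental_theorem_of_calculus)
        (auto simp flip: has_real_derivative_iff_has_vector_derivative intro: has_field_derivative_at_within)
    then show ?thesis using b that by (simp add: integral_unique)
  qed
  then have "integral {0..1} (\<lambda>z. integral {0..1} (\<lambda>x. h' (x, z))) = integral {0..1} (\<lambda>z::real. 0::real)"
    by (intro Henstock_Kurzweil_Integration.integral_cong)
  then show ?thesis using LINT_square(2)[OF c] by simp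
qed

lemma LINT_z_derivative:
  assumes d: "\<And>x z. x \<in> {0..1} \<Longrightarrow> z \<in> {0..1} \<Longrightarrow> ((\<lambda>s. h (x, s)) has_real_derivative h' (x, z)) (at z)"
    and c: "continuous_on \<Omega>0 h'" and b: "\<And>x. x \<in> {0..1} \<Longrightarrow> h (x, 0) = h (x, 1)"
  shows "(LINT p|\<mu>. h' p) = 0"
proof -
  have "integral {0..1} (\<lambda>z. h' (x, z)) = 0" if "x \<in> {0..1}" for x
  proof -
    have "((\<lambda>z. h' (x, z)) has_integral (h (x, 1) - h (x, 0))) {0..1}"
      using d that by (intro fundamental_theorem_of_calculus)
        (auto simp flip: has_real_derivative_iff_has_vector_derivative intro: has_field_derivative_at_within)
    then show ?thesis using b that by (simp add: integral_unique)
  qed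
  then have "integral {0..1} (\<lambda>x. integral {0..1} (\<lambda>z. h' (x, z))) = integral {0..1} (\<lambda>x::real. 0::real)"
    by (intro Henstock_Kurzweil_Integration.integral_cong)
  then show ?thesis using LINT_square(1)[OF c] by simp
qed

section \<open>Calculus of the trigonometric systems\<close>

lemma trig_derivative:
  assumes "i = 1 \<or> i = -1"
  shows "(trig i m has_real_derivative - of_int i * (2 * pi * real m) * trig (-i) m x) (at x)"
  using assms unfolding trig_def by (auto intro!: derivative_eq_intros)

lemma dx_eqI: "(\<And>x z. ((\<lambda>s. f (s, z)) has_real_derivative g (x, z)) (at x)) \<Longrightarrow> dx f = g"
  unfolding dx_def by (auto intro!: DERIV_imp_deriv)

lemma dz_eqI: "(\<And>x z. ((\<lambda>s. f (x, s)) has_real_derivative g (x, z)) (at z)) \<Longrightarrow> dz f = g"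
  unfolding dz_def by (auto intro!: DERIV_imp_deriv)

text \<open>
  Partial derivatives on the whole plane are required, which all basis functions have and which
  avoids one-sided derivatives on the boundary of the square.
\<close>

definition C1 :: "(real \<times> real \<Rightarrow> real) \<Rightarrow> bool" where
  "C1 f \<longleftrightarrow> continuous_on UNIV f \<and> continuous_on UNIV (dx f) \<and> continuous_on UNIV (dz f) \<and>
     (\<forall>x z. ((\<lambda>s. f (s, z)) has_real_derivative dx f (x, z)) (at x)) \<and>
     (\<forall>x z. ((\<lambda>s. f (x, s)) has_real_derivative dz f (x, z)) (at z))"

lemma C1I:
  assumes "\<And>x z. ((\<lambda>s. f (s, z)) has_real_derivative fx (x, z)) (at x)"
    and "\<And>x z. ((\<lambda>s. f (x, s)) has_real_derivative fz (x, z)) (at z)"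
    and "continuous_on UNIV f" "continuous_on UNIV fx" "continuous_on UNIV fz"
  shows "C1 f" "dx f = fx" "dz f = fz"
proof -
  show e: "dx f = fx" "dz f = fz" using assms by (auto intro: dx_eqI dz_eqI)
  show "C1 f" unfolding C1_def e using assms by blast
qed

lemma C1D:
  assumes "C1 f"
  shows "continuous_on S f" "continuous_on S (dx f)" "continuous_on S (dz f)"
    "((\<lambda>s. f (s, z)) has_real_derivative dx f (x, z)) (at x)"
    "((\<lambda>s. f (x, s)) has_real_derivative dz f (x, z)) (at z)"
  using assms unfolding C1_def by (auto intro: continuous_on_subset)

lemma C1_add: assumes "C1 f" "C1 g"
  shows "C1 (f + g)" "dx (f + g) = dx f + dx g" "dz (f + g) = dz f + dz g"
  by (rule C1I[of "f + g" "dx f + dx g" "dz f + dz g"];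
      unfold plus_fun_def; intro derivative_intros continuous_intros C1D assms)+

lemma C1_scale: assumes "C1 f"
  shows "C1 (c *\<^sub>R f)" "dx (c *\<^sub>R f) = c *\<^sub>R dx f" "dz (c *\<^sub>R f) = c *\<^sub>R dz f"
proof -
  have 1: "((\<lambda>s. (c *\<^sub>R f) (s, z)) has_real_derivative (c *\<^sub>R dx f) (x, z)) (at x)"
    "((\<lambda>s. (c *\<^sub>R f) (x, s)) has_real_derivative (c *\<^sub>R dz f) (x, z)) (at z)" for x z
    using C1D(4,5)[OF assms, THEN DERIV_cmult, of c] by (auto simp: fsimps)
  have 2: "continuous_on UNIV (c *\<^sub>R f)" "continuous_on UNIV (c *\<^sub>R dx f)" "continuous_on UNIV (c *\<^sub>R dz f)"
    using C1D[OF assms] by (auto simp: fsimps intro!: continuous_intros)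
  show "C1 (c *\<^sub>R f)" "dx (c *\<^sub>R f) = c *\<^sub>R dx f" "dz (c *\<^sub>R f) = c *\<^sub>R dz f"
    using C1I[OF 1 2] by auto
qed

lemma C1_zero: "C1 0" "dx 0 = 0" "dz 0 = 0"
  by (rule C1I[of 0 0 0]; simp add: fsimps)+

lemma C1_mult: assumes "C1 f" "C1 g"
  shows "C1 (\<lambda>p. f p * g p)" "dx (\<lambda>p. f p * g p) = (\<lambda>p. f p * dx g p + dx f p * g p)"
    "dz (\<lambda>p. f p * g p) = (\<lambda>p. f p * dz g p + dz f p * g p)"
proof -
  have 1: "((\<lambda>s. f (s, z) * g (s, z)) has_real_derivative f (x, z) * dx g (x, z) + dx f (x, z) * g (x, z)) (at x)"
    "((\<lambda>s. f (x, s) * g (x, s)) has_real_derivative f (x, z) * dz g (x, z) + dz f (x, z) * g (x, z)) (at z)" for x z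
    using DERIV_mult[OF C1D(4)[OF assms(1)] C1D(4)[OF assms(2)]]
      DERIV_mult[OF C1D(5)[OF assms(1)] C1D(5)[OF assms(2)]] by (simp_all add: algebra_simps)
  have 2: "continuous_on UNIV (\<lambda>p. f p * g p)" "continuous_on UNIV (\<lambda>p. f p * dx g p + dx f p * g p)"
     "continuous_on UNIV (\<lambda>p. f p * dz g p + dz f p * g p)"
    by (intro continuous_intros C1D assms)+
  show "C1 (\<lambda>p. f p * g p)" "dx (\<lambda>p. f p * g p) = (\<lambda>p. f p * dx g p + dx f p * g p)"
    "dz (\<lambda>p. f p * g p) = (\<lambda>p. f p * dz g p + dz f p * g p)"
    using C1I[OF 1 2] by auto
qed

lemma C1_L2: assumes "C1 f" shows "f \<in> L2" "dx f \<in> L2" "dz f \<in> L2" "grad f \<in> L2" "perp_grad f \<in> L2"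
  unfolding grad_def perp_grad_def by (intro L2_continuous continuous_intros C1D assms)+

text \<open>
  Only the values of the product on the boundary matter, so one lemma covers periodic functions
  and functions vanishing on the sides.
\<close>

lemma C1_ip_by_parts_x:
  assumes "C1 f" "C1 g" "\<And>z. z \<in> {0..1} \<Longrightarrow> f (0, z) * g (0, z) = f (1, z) * g (1, z)"
  shows "ip f (dx g) = - ip (dx f) g"
proof -
  have cont: "continuous_on \<Omega>0 (\<lambda>p. f p * dx g p + dx f p * g p)"
    by (intro continuous_intros C1D assms)
  have "(LINT p|\<mu>. f p * dx g p + dx f p * g p) = 0"
    by (rule LINT_x_derivative[where h = "\<lambda>p. f p * g p"])
      (use C1D(4)[OF C1_mult(1)[OF assms(1,2)]] assms(3) C1_mult(2)[OF assms(1,2)] cont in auto)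
  moreover have "(LINT p|\<mu>. f p * dx g p + dx f p * g p) = ip f (dx g) + ip (dx f) g"
    unfolding ip_def using L2_integrable_inner[of f "dx g"] L2_integrable_inner[of "dx f" g]
      C1_L2[OF assms(1)] C1_L2[OF assms(2)] by (simp add: inner_real_def)
  ultimately show ?thesis by simp
qed

lemma C1_ip_by_parts_z:
  assumes "C1 f" "C1 g" "\<And>x. x \<in> {0..1} \<Longrightarrow> f (x, 0) * g (x, 0) = f (x, 1) * g (x, 1)"
  shows "ip f (dz g) = - ip (dz f) g"
proof -
  have cont: "continuous_on \<Omega>0 (\<lambda>p. f p * dz g p + dz f p * g p)"
    by (intro continuous_intros C1D assms)
  have "(LINT p|\<mu>. f p * dz g p + dz f p * g p) = 0"
    by (rule LINT_z_derivative[where h = "\<lambda>p. f p * g p"])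
      (use C1D(5)[OF C1_mult(1)[OF assms(1,2)]] assms(3) C1_mult(3)[OF assms(1,2)] cont in auto)
  moreover have "(LINT p|\<mu>. f p * dz g p + dz f p * g p) = ip f (dz g) + ip (dz f) g"
    unfolding ip_def using L2_integrable_inner[of f "dz g"] L2_integrable_inner[of "dz f" g]
      C1_L2[OF assms(1)] C1_L2[OF assms(2)] by (simp add: inner_real_def)
  ultimately show ?thesis by simp
qed

lemma phi_C1:
  assumes i: "i = 1 \<or> i = -1"
  shows "C1 (phi i m n)" "dx (phi i m n) = (- of_int i * (2 * pi * real m)) *\<^sub>R phi (-i) m n"
    "dz (phi i m n) = (- (pi * real n)) *\<^sub>R xi i m n"
proof -
  let ?fx = "(- of_int i * (2 * pi * real m)) *\<^sub>R phi (-i) m n" and ?fz = "(- (pi * real n)) *\<^sub>R xi i m n"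
  have 1: "((\<lambda>s. phi i m n (s, z)) has_real_derivative ?fx (x, z)) (at x)" for x z
    using DERIV_cmult_right[OF trig_derivative[OF i, of m x], of "cos (pi * real n * z)"] 
    by (simp add: phi_def fsimps mult.assoc)
  have 2: "((\<lambda>s. phi i m n (x, s)) has_real_derivative ?fz (x, z)) (at z)" for x z
    unfolding phi_def xi_def by (auto simp: fsimps intro!: derivative_eq_intros)
  have 3: "continuous_on UNIV (phi i m n)" "continuous_on UNIV ?fx" "continuous_on UNIV ?fz"
    unfolding scaleR_fun_def by (intro continuous_intros)+
  show "C1 (phi i m n)" "dx (phi i m n) = ?fx" "dz (phi i m n) = ?fz"
    using C1I[OF 1 2 3] by auto
qed

lemma xi_C1:
  assumes i: "i = 1 \<or> i = -1"
  shows "C1 (xi i m n)" "dx (xi i m n) = (- of_int i * (2 * pi * real m)) *\<^sub>R xi (-i) m n"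
    "dz (xi i m n) = (pi * real n) *\<^sub>R phi i m n"
proof -
  let ?fx = "(- of_int i * (2 * pi * real m)) *\<^sub>R xi (-i) m n" and ?fz = "(pi * real n) *\<^sub>R phi i m n"
  have 1: "((\<lambda>s. xi i m n (s, z)) has_real_derivative ?fx (x, z)) (at x)" for x z
    using DERIV_cmult_right[OF trig_derivative[OF i, of m x], of "sin (pi * real n * z)"] 
    by (simp add: xi_def fsimps mult.assoc)
  have 2: "((\<lambda>s. xi i m n (x, s)) has_real_derivative ?fz (x, z)) (at z)" for x z
    unfolding phi_def xi_def by (auto simp: fsimps intro!: derivative_eq_intros)
  have 3: "continuous_on UNIV (xi i m n)" "continuous_on UNIV ?fx" "continuous_on UNIV ?fz"
    unfolding scaleR_fun_def by (intro continuous_intros)+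
  show "C1 (xi i m n)" "dx (xi i m n) = ?fx" "dz (xi i m n) = ?fz"
    using C1I[OF 1 2 3] by auto
qed

lemma sin_2pi_nat: "sin (2 * pi * real k) = 0" "cos (2 * pi * real k) = 1"
  using sin_2npi[of k] cos_2npi[of k] by (simp_all add: mult.commute mult.left_commute)

lemma phi_periodic: "phi i m n (0, z) = phi i m n (1, z)"
  by (simp add: phi_def trig_def sin_2pi_nat)

lemma xi_periodic: "xi i m n (0, z) = xi i m n (1, z)"
  by (simp add: xi_def trig_def sin_2pi_nat)

lemma xi_boundary: "xi i m n (x, 0) = 0" "xi i m n (x, 1) = 0"
  by (simp_all add: xi_def mult.commute)

lemma integral_cos: "c \<noteq> 0 \<Longrightarrow> integral {0..1} (\<lambda>x. cos (c * x)) = sin c / c" for c :: real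
proof -
  assume c: "c \<noteq> 0"
  have "((\<lambda>x. cos (c * x)) has_integral (sin (c * 1) / c - sin (c * 0) / c)) {0..1}"
    using c by (intro fundamental_theorem_of_calculus)
      (auto simp flip: has_real_derivative_iff_has_vector_derivative intro!: derivative_eq_intros)
  then show ?thesis by (simp add: integral_unique)
qed

lemma integral_sin: "c \<noteq> 0 \<Longrightarrow> integral {0..1} (\<lambda>x. sin (c * x)) = (1 - cos c) / c" for c :: real
proof -
  assume c: "c \<noteq> 0"
  have "((\<lambda>x. sin (c * x)) has_integral (- cos (c * 1) / c - - cos (c * 0) / c)) {0..1}"
    using c by (intro fundamental_theorem_of_calculus)
      (auto simp flip: has_real_derivative_iff_has_vector_derivative intro!: derivative_eq_intros)
  then show ?thesis using c by (simp add: integral_unique field_simps)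
qed

lemma integral_cos_pi: "integral {0..1} (\<lambda>x. cos (pi * of_int k * x)) = (if k = 0 then 1 else 0)"
  using integral_cos[of "pi * of_int k"] by (simp add: sin_npi_int)

lemma integral_sin_2pi: "integral {0..1} (\<lambda>x. sin (2 * pi * of_int k * x)) = 0"
  using integral_sin[of "2 * pi * of_int k"] by (cases "k = 0") simp_all

text \<open>
  The value 0 for \<open>m = 0\<close>, \<open>i = -1\<close> belongs to the function \<open>sin
  0\<close>.
\<close>

definition trig_sq :: "int \<Rightarrow> nat \<Rightarrow> real" where
  "trig_sq i m = (if m = 0 then if i = 1 then 1 else 0 else 1/2)"

definition cos_sq :: "nat \<Rightarrow> real" where "cos_sq n = (if n = 0 then 1 else 1/2)"
definition sin_sq :: "nat \<Rightarrow> real" where "sin_sq n = (if n = 0 then 0 else 1/2)"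

lemma integral_cos_cos: "integral {0..1} (\<lambda>x. cos (pi * real m * x) * cos (pi * real n * x)) = (if m = n then cos_sq n else 0)"
proof -
  have e: "cos (pi * real m * x) * cos (pi * real n * x) = (cos (pi * of_int (int n + int m) * x) + cos (pi * of_int (int n - int m) * x)) / 2" for x
    by (simp add: cos_mult_cos algebra_simps)
  have "integral {0..1} (\<lambda>x. cos (pi * real m * x) * cos (pi * real n * x)) =
     (integral {0..1} (\<lambda>x. cos (pi * of_int (int n + int m) * x)) + integral {0..1} (\<lambda>x. cos (pi * of_int (int n - int m) * x))) / 2"
    unfolding e by (subst integral_divide) (auto intro!: Henstock_Kurzweil_Integration.integral_add integrable_continuous_real continuous_intros)
  also have "\<dots> = (if m = n then cos_sq n else 0)" unfolding integral_cos_pi by (auto simp: cos_sq_def)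
  finally show ?thesis .
qed

lemma integral_sin_sin: "integral {0..1} (\<lambda>x. sin (pi * real m * x) * sin (pi * real n * x)) = (if m = n then sin_sq n else 0)"
proof -
  have e: "sin (pi * real m * x) * sin (pi * real n * x) = (cos (pi * of_int (int n - int m) * x) - cos (pi * of_int (int n + int m) * x)) / 2" for x
    by (simp add: sin_mult_sin algebra_simps)
  have "integral {0..1} (\<lambda>x. sin (pi * real m * x) * sin (pi * real n * x)) =
     (integral {0..1} (\<lambda>x. cos (pi * of_int (int n - int m) * x)) - integral {0..1} (\<lambda>x. cos (pi * of_int (int n + int m) * x))) / 2"
    unfolding e by (subst integral_divide) (auto intro!: Henstock_Kurzweil_Integration.integral_diff integrable_continuous_real continuous_intros)
  also have "\<dots> = (if m = n then sin_sq n else 0)" unfolding integral_cos_pi by (auto simp: sin_sq_def)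
  finally show ?thesis .
qed

lemma integral_cos_sin_2pi: "integral {0..1} (\<lambda>x. cos (2 * pi * real m * x) * sin (2 * pi * real n * x)) = 0"
proof -
  have e: "cos (2 * pi * real m * x) * sin (2 * pi * real n * x) = (sin (2 * pi * of_int (int n + int m) * x) + sin (2 * pi * of_int (int n - int m) * x)) / 2" for x
    by (simp add: cos_mult_sin algebra_simps)
  have "integral {0..1} (\<lambda>x. cos (2 * pi * real m * x) * sin (2 * pi * real n * x)) =
     (integral {0..1} (\<lambda>x. sin (2 * pi * of_int (int n + int m) * x)) + integral {0..1} (\<lambda>x. sin (2 * pi * of_int (int n - int m) * x))) / 2"
    unfolding e by (subst integral_divide) (auto intro!: Henstock_Kurzweil_Integration.integral_add integrable_continuous_real continuous_intros)
  then show ?thesis unfolding integral_sin_2pi by simp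
qed

lemma integral_trig_trig:
  assumes "i = 1 \<or> i = -1" "j = 1 \<or> j = -1"
  shows "integral {0..1} (\<lambda>x. trig i m x * trig j n x) = (if i = j \<and> m = n then trig_sq i m else 0)"
proof -
  have c: "integral {0..1} (\<lambda>x. cos (2 * pi * real m * x) * cos (2 * pi * real n * x)) = (if m = n then cos_sq n else 0)"
    using integral_cos_cos[of "2 * m" "2 * n"] by (simp add: mult_ac cos_sq_def)
  have s: "integral {0..1} (\<lambda>x. sin (2 * pi * real m * x) * sin (2 * pi * real n * x)) = (if m = n then sin_sq n else 0)"
    using integral_sin_sin[of "2 * m" "2 * n"] by (simp add: mult_ac sin_sq_def)
  have cs: "integral {0..1} (\<lambda>x. cos (2 * pi * real m * x) * sin (2 * pi * real n * x)) = 0"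
     "integral {0..1} (\<lambda>x. sin (2 * pi * real m * x) * cos (2 * pi * real n * x)) = 0"
    using integral_cos_sin_2pi[of m n] integral_cos_sin_2pi[of n m] by (simp_all add: mult.commute)
  have "integral {0..1} (\<lambda>x. trig i m x * trig j n x) = (if i = 1 then if j = 1 then if m = n then cos_sq n else 0 else 0
    else if j = 1 then 0 else if m = n then sin_sq n else 0)"
    unfolding trig_def by (cases "i = 1"; cases "j = 1"; simp only: simp_thms if_True if_False c s cs)
  then show ?thesis using assms by (auto simp: trig_sq_def cos_sq_def sin_sq_def)
qed

lemma continuous_trig [continuous_intros]: "continuous_on S (trig i m)"
  unfolding trig_def by (cases "i = 1"; simp; intro continuous_intros)

lemma ip_phi:
  assumes "i = 1 \<or> i = -1" "j = 1 \<or> j = -1"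
  shows "ip (phi i m n) (phi j m' n') = (if (i, m, n) = (j, m', n') then trig_sq i m * cos_sq n else 0)"
proof -
  have "ip (phi i m n) (phi j m' n') = (LINT p|\<mu>. (trig i m (fst p) * trig j m' (fst p)) * (cos (pi * real n * snd p) * cos (pi * real n' * snd p)))"
    unfolding ip_def phi_def by (simp add: case_prod_beta inner_real_def mult_ac)
  also have "\<dots> = integral {0..1} (\<lambda>x. trig i m x * trig j m' x) * integral {0..1} (\<lambda>z. cos (pi * real n * z) * cos (pi * real n' * z))"
    by (rule LINT_product) (intro continuous_intros)+
  finally show ?thesis unfolding integral_trig_trig[OF assms] integral_cos_cos by auto
qed

lemma ip_xi:
  assumes "i = 1 \<or> i = -1" "j = 1 \<or> j = -1"
  shows "ip (xi i m n) (xi j m' n') = (if (i, m, n) = (j, m', n') then trig_sq i m * sin_sq n else 0)"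
proof -
  have "ip (xi i m n) (xi j m' n') = (LINT p|\<mu>. (trig i m (fst p) * trig j m' (fst p)) * (sin (pi * real n * snd p) * sin (pi * real n' * snd p)))"
    unfolding ip_def xi_def by (simp add: case_prod_beta inner_real_def mult_ac)
  also have "\<dots> = integral {0..1} (\<lambda>x. trig i m x * trig j m' x) * integral {0..1} (\<lambda>z. sin (pi * real n * z) * sin (pi * real n' * z))"
    by (rule LINT_product) (intro continuous_intros)+
  finally show ?thesis unfolding integral_trig_trig[OF assms] integral_sin_sin by auto
qed

section \<open>Test functions and weak gradients\<close>

text \<open>
  The factor \<open>1 / s ^ k\<close> closes the family under differentiation: all derivatives of
  \<open>exp (- 1 / s)\<close> are linear combinations of its members.
\<close>

definition flat :: "nat \<Rightarrow> real \<Rightarrow> real" where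
  "flat k s = (if s > 0 then exp (- (1 / s)) / s ^ k else 0)"

lemma flat_right_limit: "(flat k \<longlongrightarrow> 0) (at_right 0)"
proof -
  have "((\<lambda>x::real. x ^ k / exp x) \<longlongrightarrow> 0) at_top" by (rule tendsto_power_div_exp_0)
  then have "((\<lambda>s::real. inverse s ^ k / exp (inverse s)) \<longlongrightarrow> 0) (at_right 0)"
    using filterlim_compose filterlim_inverse_at_top_right by blast
  moreover have "\<forall>\<^sub>F s in at_right 0. inverse s ^ k / exp (inverse s) = flat k s"
    unfolding eventually_at_right_field
    by (intro exI[of _ 1]) (auto simp: flat_def exp_minus field_simps)
  ultimately show ?thesis by (rule Lim_transform_eventually)
qed

lemma flat_limit: "(flat k \<longlongrightarrow> 0) (at 0)"
proof -
  have "\<forall>\<^sub>F s in at_left 0. 0 = flat k s"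
    unfolding eventually_at_left_field by (intro exI[of _ "-1"]) (auto simp: flat_def)
  then have "(flat k \<longlongrightarrow> 0) (at_left 0)" by (rule Lim_transform_eventually[OF tendsto_const])
  then show ?thesis using flat_right_limit filterlim_split_at by blast
qed

lemma flat_derivative:
  "(flat k has_real_derivative (flat (k + 2) s - real k * flat (k + 1) s)) (at s)"
proof (cases s "0 :: real" rule: linorder_cases)
  case less
  have "((\<lambda>_. 0) has_real_derivative 0) (at s)" by simp
  moreover have "\<forall>\<^sub>F x in nhds s. 0 = flat k x"
    using eventually_nhds_in_open[of "{..<0}" s] less by (auto elim!: eventually_mono simp: flat_def)
  ultimately show ?thesis using less DERIV_cong_ev[of s s "\<lambda>_. 0" "flat k" 0 0] by (simp add: flat_def)
next
  case greater
  have "((\<lambda>s. exp (- (1 / s)) / s ^ k) has_real_derivative (exp (- (1 / s)) / s ^ (k + 2) - real k * (exp (- (1 / s)) / s ^ (k+1)))) (at s)"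
  proof -
    have "((\<lambda>s. s ^ k) has_real_derivative real k * s ^ k / s) (at s)"
      using greater DERIV_pow[of k s] by (cases k) auto
    moreover have "((\<lambda>s. exp (- (1 / s))) has_real_derivative exp (- (1 / s)) / s\<^sup>2) (at s)"
      using greater by (auto intro!: derivative_eq_intros simp: field_simps power2_eq_square)
    ultimately have "((\<lambda>s. exp (- (1 / s)) / s ^ k) has_real_derivative
        (exp (- (1 / s)) / s\<^sup>2 * s ^ k - exp (- (1 / s)) * (real k * s ^ k / s)) / (s ^ k * s ^ k)) (at s)"
      using greater by (intro DERIV_divide) auto
    moreover have "(exp (- (1 / s)) / s\<^sup>2 * s ^ k - exp (- (1 / s)) * (real k * s ^ k / s)) / (s ^ k * s ^ k)
        = exp (- (1 / s)) / s ^ (k + 2) - real k * (exp (- (1 / s)) / s ^ (k+1))"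
      using greater by (simp add: field_simps power2_eq_square)
    ultimately show ?thesis by simp
  qed
  moreover have "\<forall>\<^sub>F x in nhds s. exp (- (1 / x)) / x ^ k = flat k x"
    using eventually_nhds_in_open[of "{0<..}" s] greater by (auto elim!: eventually_mono simp: flat_def)
  ultimately show ?thesis using greater
    DERIV_cong_ev[of s s "\<lambda>s. exp (- (1 / s)) / s ^ k" "flat k"] by (auto simp: flat_def)
next
  case equal
  have "((\<lambda>h. (flat k (0 + h) - flat k 0) / h) \<longlongrightarrow> 0) (at 0)"
  proof (rule Lim_transform_eventually[OF flat_limit[of "k + 1"]])
    show "\<forall>\<^sub>F h in at 0. flat (k + 1) h = (flat k (0 + h) - flat k 0) / h"
      by (intro always_eventually) (auto simp: flat_def)
  qed
  then show ?thesis using equal by (simp add: DERIV_def) (simp add: flat_def)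
qed

text \<open>
  A class of functions that is closed under directional derivatives and hence consists of smooth
  functions. It contains the basis functions and compactly supported bumps.
\<close>

inductive_set elementary :: "(real \<times> real \<Rightarrow> real) set" where
  const: "(\<lambda>_. c) \<in> elementary"
| cos: "(\<lambda>p. cos (p \<bullet> a)) \<in> elementary"
| sin: "(\<lambda>p. sin (p \<bullet> a)) \<in> elementary"
| flat: "(\<lambda>p. flat k (c + p \<bullet> a)) \<in> elementary"
| add: "f \<in> elementary \<Longrightarrow> g \<in> elementary \<Longrightarrow> (\<lambda>p. f p + g p) \<in> elementary"
| mult: "f \<in> elementary \<Longrightarrow> g \<in> elementary \<Longrightarrow> (\<lambda>p. f p * g p) \<in> elementary"

lemma elementary_derivative:
  assumes "f \<in> elementary"
  shows "\<exists>D. (\<forall>x. (f has_derivative D x) (at x)) \<and> (\<forall>v. (\<lambda>x. D x v) \<in> elementary)"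
  using assms
proof induction
  case (const c)
  show ?case by (intro exI[of _ "\<lambda>_ _. 0"]) (auto intro: elementary.const)
next
  case (cos a)
  have 1: "((\<lambda>p. cos (p \<bullet> a)) has_derivative (\<lambda>v. (- (v \<bullet> a)) * sin (x \<bullet> a))) (at x)" for x
    by (auto intro!: derivative_eq_intros)
  have 2: "(\<lambda>x. (- (v \<bullet> a)) * sin (x \<bullet> a)) \<in> elementary" for v
    by (intro elementary.mult elementary.const elementary.sin)
  show ?case by (rule exI[of _ "\<lambda>x v. (- (v \<bullet> a)) * sin (x \<bullet> a)"]) (use 1 2 in blast)
next
  case (sin a)
  have 1: "((\<lambda>p. sin (p \<bullet> a)) has_derivative (\<lambda>v. (v \<bullet> a) * cos (x \<bullet> a))) (at x)" for x
    by (auto intro!: derivative_eq_intros)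
  have 2: "(\<lambda>x. (v \<bullet> a) * cos (x \<bullet> a)) \<in> elementary" for v
    by (intro elementary.mult elementary.const elementary.cos)
  show ?case by (rule exI[of _ "\<lambda>x v. (v \<bullet> a) * cos (x \<bullet> a)"]) (use 1 2 in blast)
next
  case (flat k c a)
  let ?D = "\<lambda>x v. (v \<bullet> a) * (flat (k + 2) (c + x \<bullet> a) + (- real k) * flat (k + 1) (c + x \<bullet> a))"
  have "((\<lambda>p. flat k (c + p \<bullet> a)) has_derivative ?D x) (at x)" for x
  proof -
    have 1: "((\<lambda>p. c + p \<bullet> a) has_derivative (\<lambda>v. v \<bullet> a)) (at x)" by (auto intro!: derivative_eq_intros)
    have 2: "(flat k has_derivative (*) (flat (k + 2) (c + x \<bullet> a) - real k * flat (k + 1) (c + x \<bullet> a))) (at (c + x \<bullet> a))"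
      using flat_derivative[of k "c + x \<bullet> a"] by (simp add: has_field_derivative_def)
    show ?thesis using has_derivative_compose[OF 1 2] by (simp add: mult.commute)
  qed
  moreover have "(\<lambda>x. ?D x v) \<in> elementary" for v
    by (intro elementary.intros)
  ultimately show ?case by (intro exI[of _ ?D]) auto
next
  case (add f g)
  then obtain D E where D: "\<And>x. (f has_derivative D x) (at x)" "\<And>v. (\<lambda>x. D x v) \<in> elementary"
    and E: "\<And>x. (g has_derivative E x) (at x)" "\<And>v. (\<lambda>x. E x v) \<in> elementary" by metis
  have "((\<lambda>p. f p + g p) has_derivative (\<lambda>v. D x v + E x v)) (at x)" for x
    by (intro has_derivative_add D E)
  then show ?case using D(2) E(2) by (intro exI[of _ "\<lambda>x v. D x v + E x v"]) (auto intro: elementary.add)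
next
  case (mult f g)
  then obtain D E where D: "\<And>x. (f has_derivative D x) (at x)" "\<And>v. (\<lambda>x. D x v) \<in> elementary"
    and E: "\<And>x. (g has_derivative E x) (at x)" "\<And>v. (\<lambda>x. E x v) \<in> elementary" by metis
  have "((\<lambda>p. f p * g p) has_derivative (\<lambda>v. f x * E x v + D x v * g x)) (at x)" for x
    by (intro has_derivative_mult D E)
  then show ?case using D(2) E(2) mult.hyps
    by (intro exI[of _ "\<lambda>x v. f x * E x v + D x v * g x"]) (auto intro!: elementary.add elementary.mult)
qed

lemma elementary_smooth: "f \<in> elementary \<Longrightarrow> smooth f"
proof (coinduction arbitrary: f)
  case smooth
  obtain D where D: "\<And>x. (f has_derivative D x) (at x)" "\<And>v. (\<lambda>x. D x v) \<in> elementary"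
    using elementary_derivative[OF smooth] by blast
  have "frechet_derivative f (at x) = D x" for x using frechet_derivative_at[OF D(1)] by simp
  moreover have "f differentiable (at x)" for x using D(1) by (rule differentiableI)
  ultimately show ?case using D(2) by simp
qed

lemma interior_Omega0: "interior \<Omega>0 = box (0,0) (1,1)"
  unfolding Omega0_cbox by (rule interior_cbox)

text \<open>
  Positive exactly on the open square with a margin of \<open>1 / (n + 2)\<close> removed.
\<close>

definition bump :: "nat \<Rightarrow> real \<times> real \<Rightarrow> real" where
  "bump n p = (let d = 1 / real (n + 2) in flat 0 (- d + p \<bullet> (1, 0)) * flat 0 (1 - d + p \<bullet> (-1, 0))
     * (flat 0 (- d + p \<bullet> (0, 1)) * flat 0 (1 - d + p \<bullet> (0, -1))))"

lemma bump_elementary: "bump n \<in> elementary"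
  unfolding bump_def Let_def by (intro elementary.intros)

lemma phi_elementary: "phi i m n \<in> elementary"
proof -
  have "(\<lambda>p. cos (p \<bullet> (2 * pi * real m, 0)) * cos (p \<bullet> (0, pi * real n))) \<in> elementary"
    "(\<lambda>p. sin (p \<bullet> (2 * pi * real m, 0)) * cos (p \<bullet> (0, pi * real n))) \<in> elementary"
    by (intro elementary.intros)+
  moreover have "phi i m n = (if i = 1 then (\<lambda>p. cos (p \<bullet> (2 * pi * real m, 0)) * cos (p \<bullet> (0, pi * real n)))
    else (\<lambda>p. sin (p \<bullet> (2 * pi * real m, 0)) * cos (p \<bullet> (0, pi * real n))))"
    by (auto simp: phi_def trig_def fun_eq_iff mult_ac)
  ultimately show ?thesis by simp
qed

lemma bump_test_function: "(\<lambda>p. bump k p * phi i m n p) \<in> test_functions (interior \<Omega>0)"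
proof -
  define d where "d = 1 / real (k + 2)"
  have d: "0 < d" by (simp add: d_def)
  have "smooth (\<lambda>p. bump k p * phi i m n p)"
    by (intro elementary_smooth elementary.mult bump_elementary phi_elementary)
  moreover have "compact (cbox (d, d) (1 - d, 1 - d))" by simp
  moreover have "cbox (d, d) (1 - d, 1 - d) \<subseteq> interior \<Omega>0"
    unfolding interior_Omega0 using d by (auto simp: box_prod)
  moreover have "bump k p = 0" if "p \<notin> cbox (d, d) (1 - d, 1 - d)" for p
    using that unfolding bump_def Let_def d_def[symmetric] by (cases p) (auto simp: flat_def)
  ultimately show ?thesis unfolding test_functions_def by (auto intro!: exI[of _ "cbox (d, d) (1 - d, 1 - d)"])
qed

text \<open>
  The products of a bump with a basis function are test functions. Orthogonality to them says that
  \<open>g\<close> times the bump is orthogonal to the basis, so it vanishes by completeness; no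
  mollification is needed.
\<close>

lemma test_orthogonal_zero:
  assumes g: "g \<in> L2" and o: "\<And>\<phi>. \<phi> \<in> test_functions (interior \<Omega>0) \<Longrightarrow> ip g \<phi> = 0"
  shows "AE p in \<mu>. g p = (0::real)"
proof -
  have bc: "continuous_on S (bump k)" for S k
  proof -
    obtain D where "\<And>x. (bump k has_derivative D x) (at x)" using elementary_derivative[OF bump_elementary[of k]] by blast
    then show ?thesis using has_derivative_continuous has_derivative_at_withinI
      by (metis continuous_on_eq_continuous_within)
  qed
  have gi: "integrable \<mu> g" using L2_integrable_inner[OF g, of "\<lambda>_. 1"] by (simp add: L2_def)
  have "AE p in \<mu>. g p * bump k p = 0" for k
  proof (rule cosine_system_complete)
    show "integrable \<mu> (\<lambda>p. g p * bump k p)" by (intro integrable_mult_continuous gi bc)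
    show "(LINT p|\<mu>. g p * bump k p * phi i m n p) = 0" for i m n
      using o[OF bump_test_function[of k i m n]] by (simp add: ip_def mult.assoc)
  qed
  then have "AE p in \<mu>. \<forall>k. g p * bump k p = 0" unfolding AE_all_countable by blast
  with AE_interior show ?thesis
  proof eventually_elim
    case (elim p)
    obtain x z where p: "p = (x, z)" by fastforce
    have r: "0 < x" "x < 1" "0 < z" "z < 1" using elim(1) by (auto simp: p box_prod)
    define e where "e = min (min x (1 - x)) (min z (1 - z))"
    have "e > 0" using r by (simp add: e_def)
    then obtain k where k: "1 / real (Suc k) < e" using nat_approx_posE by blast
    have "1 / real (k + 2) < e" using k by (smt (verit) add_2_eq_Suc' frac_le of_nat_0_less_iff of_nat_Suc zero_less_Suc)
    then have "bump k p > 0" by (simp add: p bump_def Let_def flat_def e_def)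
    then show ?case using elim(2)[rule_format, of k] by simp
  qed
qed

lemma smooth_C1:
  assumes "smooth f" shows "C1 f"
proof -
  have d: "f differentiable (at x)" "smooth (\<lambda>x. frechet_derivative f (at x) v)" for x v
    using assms by (auto elim: smooth.cases)
  have cont: "continuous_on UNIV g" if "smooth g" for g :: "real \<times> real \<Rightarrow> real"
  proof -
    have "g differentiable (at x)" for x using that by (auto elim: smooth.cases)
    then show ?thesis by (simp add: continuous_on_eq_continuous_at differentiable_imp_continuous_within)
  qed
  have D: "(f has_derivative frechet_derivative f (at x)) (at x)" for x
    using d(1) frechet_derivative_works by blast
  have lin: "linear (frechet_derivative f (at x))" for x using D by (rule has_derivative_linear)
  have 1: "((\<lambda>s. f (s, z)) has_real_derivative frechet_derivative f (at (x, z)) (1, 0)) (at x)" for x z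
  proof -
    have "((\<lambda>s. (s, z)) has_derivative (\<lambda>h. (h, 0))) (at x)" by (intro derivative_intros)
    then have "((\<lambda>s. f (s, z)) has_derivative (\<lambda>h. frechet_derivative f (at (x, z)) (h, 0))) (at x)"
      by (rule has_derivative_compose[OF _ D])
    moreover have "(\<lambda>h. frechet_derivative f (at (x, z)) (h, 0)) = (*) (frechet_derivative f (at (x, z)) (1, 0))"
    proof
      fix h
      show "frechet_derivative f (at (x, z)) (h, 0) = frechet_derivative f (at (x, z)) (1, 0) * h"
        using linear_scale[OF lin, of "(x,z)" h "(1, 0)"] by (simp add: mult.commute)
    qed
    ultimately show ?thesis by (simp only: has_field_derivative_def)
  qed
  have 2: "((\<lambda>s. f (x, s)) has_real_derivative frechet_derivative f (at (x, z)) (0, 1)) (at z)" for x z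
  proof -
    have "((\<lambda>s. (x, s)) has_derivative (\<lambda>h. (0, h))) (at z)" by (intro derivative_intros)
    then have "((\<lambda>s. f (x, s)) has_derivative (\<lambda>h. frechet_derivative f (at (x, z)) (0, h))) (at z)"
      by (rule has_derivative_compose[OF _ D])
    moreover have "(\<lambda>h. frechet_derivative f (at (x, z)) (0, h)) = (*) (frechet_derivative f (at (x, z)) (0, 1))"
    proof
      fix h
      show "frechet_derivative f (at (x, z)) (0, h) = frechet_derivative f (at (x, z)) (0, 1) * h"
        using linear_scale[OF lin, of "(x,z)" h "(0, 1)"] by (simp add: mult.commute)
    qed
    ultimately show ?thesis by (simp only: has_field_derivative_def)
  qed
  show ?thesis by (rule C1I(1)[OF 1 2 cont[OF assms] cont[OF d(2)] cont[OF d(2)]])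
qed

lemma test_function_C1:
  assumes "\<phi> \<in> test_functions (interior \<Omega>0)"
  shows "C1 \<phi>" "x \<in> {0..1} \<Longrightarrow> \<phi> (x, 0) = 0 \<and> \<phi> (x, 1) = 0" "z \<in> {0..1} \<Longrightarrow> \<phi> (0, z) = 0 \<and> \<phi> (1, z) = 0"
proof -
  show "C1 \<phi>" using assms smooth_C1 by (auto simp: test_functions_def)
  have "\<phi> p = 0" if "p \<notin> box (0,0) (1,1)" for p
    using assms that unfolding interior_Omega0 test_functions_def by blast
  then show "x \<in> {0..1} \<Longrightarrow> \<phi> (x, 0) = 0 \<and> \<phi> (x, 1) = 0" "z \<in> {0..1} \<Longrightarrow> \<phi> (0, z) = 0 \<and> \<phi> (1, z) = 0"
    by (auto simp: box_prod)
qed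

lemma C1_has_weak_grad:
  assumes f: "C1 f" shows "has_weak_grad f (grad f)"
  unfolding has_weak_grad_def
proof (intro conjI ballI)
  fix \<phi> assume \<phi>: "\<phi> \<in> test_functions (interior \<Omega>0)"
  note t = test_function_C1[OF \<phi>]
  show "ip f (dx \<phi>) = - ip (\<lambda>p. fst (grad f p)) \<phi>"
    using C1_ip_by_parts_x[OF f t(1)] t(3) by (simp add: grad_def)
  show "ip f (dz \<phi>) = - ip (\<lambda>p. snd (grad f p)) \<phi>"
    using C1_ip_by_parts_z[OF f t(1)] t(2) by (simp add: grad_def)
qed (use C1_L2[OF f] in auto)

lemma L2_components:
  fixes g :: "real \<times> real \<Rightarrow> real \<times> real"
  assumes "g \<in> L2"
  shows "(\<lambda>p. fst (g p)) \<in> L2" "(\<lambda>p. snd (g p)) \<in> L2"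
    "L2_norm (\<lambda>p. fst (g p)) \<le> L2_norm g" "L2_norm (\<lambda>p. snd (g p)) \<le> L2_norm g"
proof -
  have "norm (fst x) \<le> 1 * norm x" "norm (snd x) \<le> 1 * norm x" for x :: "real \<times> real"
    using norm_fst_le[of "fst x" "snd x"] norm_snd_le[of "snd x" "fst x"] by simp_all
  then have ae: "AE p in \<mu>. norm (fst (g p)) \<le> 1 * norm (g p)" "AE p in \<mu>. norm (snd (g p)) \<le> 1 * norm (g p)"
    by blast+
  have "fst \<in> borel_measurable (borel :: (real \<times> real) measure)" "snd \<in> borel_measurable (borel :: (real \<times> real) measure)"
    by (intro borel_measurable_continuous_onI continuous_intros)+
  then have m: "(\<lambda>p. fst (g p)) \<in> borel_measurable \<mu>" "(\<lambda>p. snd (g p)) \<in> borel_measurable \<mu>"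
    using measurable_compose[OF L2_measurable[OF assms]] by blast+
  note a = L2_dominated[OF m(1) assms ae(1)] L2_dominated[OF m(2) assms ae(2)]
  show "(\<lambda>p. fst (g p)) \<in> L2" "(\<lambda>p. snd (g p)) \<in> L2" by (fact a)+
  show "L2_norm (\<lambda>p. fst (g p)) \<le> L2_norm g" "L2_norm (\<lambda>p. snd (g p)) \<le> L2_norm g"
    using a(2,4) by simp_all
qed

lemma L2_components_add:
  "(\<lambda>p. fst ((f + g) p)) = (\<lambda>p. fst (f p)) + (\<lambda>p. fst (g p))"
  "(\<lambda>p. snd ((f + g) p)) = (\<lambda>p. snd (f p)) + (\<lambda>p. snd (g p))"
  "(\<lambda>p. fst ((f - g) p)) = (\<lambda>p. fst (f p)) - (\<lambda>p. fst (g p))"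
  "(\<lambda>p. snd ((f - g) p)) = (\<lambda>p. snd (f p)) - (\<lambda>p. snd (g p))"
  "(\<lambda>p. fst ((c *\<^sub>R f) p)) = c *\<^sub>R (\<lambda>p. fst (f p))"
  "(\<lambda>p. snd ((c *\<^sub>R f) p)) = c *\<^sub>R (\<lambda>p. snd (f p))"
  for f g :: "real \<times> real \<Rightarrow> real \<times> real"
  by (auto simp: fsimps)

lemma test_function_L2:
  assumes "\<phi> \<in> test_functions (interior \<Omega>0)" shows "\<phi> \<in> L2" "dx \<phi> \<in> L2" "dz \<phi> \<in> L2"
  using C1_L2 test_function_C1[OF assms] by auto

lemma has_weak_grad_add:
  assumes "has_weak_grad f g" "has_weak_grad f' g'" shows "has_weak_grad (f + f') (g + g')"
  using assms unfolding has_weak_grad_def L2_components_add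
  by (auto simp: L2.add_left L2_components test_function_L2 L2.clos)

lemma has_weak_grad_scale:
  assumes "has_weak_grad f g" shows "has_weak_grad (c *\<^sub>R f) (c *\<^sub>R g)"
  using assms unfolding has_weak_grad_def L2_components_add
  by (auto simp: L2.scale_left L2_components test_function_L2 L2.clos)

text \<open>
  This is what makes the choice in \<open>wgrad\<close> immaterial.
\<close>

lemma has_weak_grad_unique:
  assumes "has_weak_grad f g" "has_weak_grad f g'" shows "AE p in \<mu>. g p = g' p"
proof -
  have L: "g \<in> L2" "g' \<in> L2" using assms by (auto simp: has_weak_grad_def)
  have "AE p in \<mu>. ((\<lambda>p. fst (g p)) - (\<lambda>p. fst (g' p))) p = 0"
  proof (rule test_orthogonal_zero)
    fix \<phi> assume \<phi>: "\<phi> \<in> test_functions (interior \<Omega>0)"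
    show "ip ((\<lambda>p. fst (g p)) - (\<lambda>p. fst (g' p))) \<phi> = 0"
      using assms \<phi> L by (auto simp: has_weak_grad_def L2.diff_left L2_components test_function_L2)
  qed (use L in \<open>intro L2.clos L2_components\<close>)
  moreover have "AE p in \<mu>. ((\<lambda>p. snd (g p)) - (\<lambda>p. snd (g' p))) p = 0"
  proof (rule test_orthogonal_zero)
    fix \<phi> assume \<phi>: "\<phi> \<in> test_functions (interior \<Omega>0)"
    show "ip ((\<lambda>p. snd (g p)) - (\<lambda>p. snd (g' p))) \<phi> = 0"
      using assms \<phi> L by (auto simp: has_weak_grad_def L2.diff_left L2_components test_function_L2)
  qed (use L in \<open>intro L2.clos L2_components\<close>)
  ultimately show ?thesis by eventually_elim (simp add: fsimps prod_eq_iff)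
qed

lemma W12_wgrad: assumes "f \<in> W12" shows "has_weak_grad f (wgrad f)" "f \<in> L2" "wgrad f \<in> L2"
proof -
  show "has_weak_grad f (wgrad f)" using assms someI_ex[of "has_weak_grad f"] unfolding W12_def wgrad_def by blast
  then show "f \<in> L2" "wgrad f \<in> L2" by (auto simp: has_weak_grad_def)
qed

lemma wgrad_eq: assumes "has_weak_grad f g" shows "f \<in> W12" "AE p in \<mu>. wgrad f p = g p"
proof -
  show W: "f \<in> W12" using assms by (auto simp: W12_def)
  show "AE p in \<mu>. wgrad f p = g p" using has_weak_grad_unique[OF W12_wgrad(1)[OF W] assms] .
qed

lemma wgrad_linear:
  assumes "f \<in> W12" "g \<in> W12"
  shows "f + g \<in> W12" "AE p in \<mu>. wgrad (f + g) p = (wgrad f + wgrad g) p"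
    "c *\<^sub>R f \<in> W12" "AE p in \<mu>. wgrad (c *\<^sub>R f) p = (c *\<^sub>R wgrad f) p"
  using wgrad_eq[OF has_weak_grad_add[OF W12_wgrad(1)[OF assms(1)] W12_wgrad(1)[OF assms(2)]]]
    wgrad_eq[OF has_weak_grad_scale[OF W12_wgrad(1)[OF assms(1)]]] by auto

lemma C1_wgrad: assumes "C1 f" shows "f \<in> W12" "AE p in \<mu>. wgrad f p = grad f p"
  using wgrad_eq[OF C1_has_weak_grad[OF assms]] by auto

lemma ip_wgrad_linear:
  assumes "f \<in> W12" "g \<in> W12" "h \<in> L2"
  shows "ip (wgrad (f + g)) h = ip (wgrad f) h + ip (wgrad g) h"
    "ip (wgrad (c *\<^sub>R f)) h = c * ip (wgrad f) h"
proof -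
  note W = W12_wgrad(3)[OF assms(1)] W12_wgrad(3)[OF assms(2)] wgrad_linear[OF assms(1,2)]
  have "ip (wgrad (f + g)) h = ip (wgrad f + wgrad g) h"
    using W W12_wgrad(3)[OF W(3)] assms(3) by (intro ip_cong_AE) (auto intro: L2.clos)
  then show "ip (wgrad (f + g)) h = ip (wgrad f) h + ip (wgrad g) h" using W assms(3) by (simp add: L2.add_left)
  have "ip (wgrad (c *\<^sub>R f)) h = ip (c *\<^sub>R wgrad f) h"
    using W(1) wgrad_linear(3,4)[OF assms(1,2), of c] W12_wgrad(3)[of "c *\<^sub>R f"] assms(3)
    by (intro ip_cong_AE) (auto intro: L2.clos)
  then show "ip (wgrad (c *\<^sub>R f)) h = c * ip (wgrad f) h" using W assms(3) by (simp add: L2.scale_left)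
qed

definition W12_ip :: "(real \<times> real \<Rightarrow> real) \<Rightarrow> (real \<times> real \<Rightarrow> real) \<Rightarrow> real" where
  "W12_ip f g = ip f g + ip (wgrad f) (wgrad g)"

lemma subspace_W12: "subspace W12"
proof (rule subspaceI)
  show "0 \<in> W12" using C1_wgrad(1)[OF C1_zero(1)] .
qed (use wgrad_linear in auto)

interpretation W12: pre_hilbert W12 W12_ip W12_norm
proof
  show "subspace W12" by (rule subspace_W12)
next
  fix f g h :: "real \<times> real \<Rightarrow> real" assume "f \<in> W12" "g \<in> W12" "h \<in> W12"
  then show "W12_ip (f + g) h = W12_ip f h + W12_ip g h"
    by (simp add: W12_ip_def L2.add_left W12_wgrad ip_wgrad_linear)
next
  fix c and f h :: "real \<times> real \<Rightarrow> real" assume "f \<in> W12" "h \<in> W12"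
  then show "W12_ip (c *\<^sub>R f) h = c * W12_ip f h"
    using ip_wgrad_linear(2)[of f f "wgrad h" c] by (simp add: W12_ip_def L2.scale_left W12_wgrad algebra_simps)
next
  fix f g assume "f \<in> W12" "g \<in> W12"
  then show "W12_ip f g = W12_ip g f" by (simp add: W12_ip_def L2.sym W12_wgrad)
next
  fix f assume f: "f \<in> W12"
  then show "0 \<le> W12_ip f f" by (simp add: W12_ip_def L2.nonneg W12_wgrad)
  show "W12_norm f = sqrt (W12_ip f f)"
    using W12_wgrad[OF f] by (simp add: W12_norm_def W12_ip_def L2.nrm_square)
qed

lemma W12_norm_ge:
  assumes "f \<in> W12" shows "L2_norm f \<le> W12_norm f" "L2_norm (wgrad f) \<le> W12_norm f"
  using L2.nrm_nonneg[OF W12_wgrad(2)[OF assms]] L2.nrm_nonneg[OF W12_wgrad(3)[OF assms]]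
  unfolding W12_norm_def by (auto intro!: real_le_rsqrt)

section \<open>Orthogonal expansions\<close>

lemma finite_truncated: "finite (truncated xi_index N)" "finite (truncated phi_index N)"
proof -
  have "truncated xi_index N \<subseteq> {1,-1} \<times> {..N} \<times> {..N}" "truncated phi_index N \<subseteq> {1,-1} \<times> {..N} \<times> {..N}"
    by (auto simp: truncated_def xi_index_def phi_index_def)
  then show "finite (truncated xi_index N)" "finite (truncated phi_index N)"
    by (auto intro: finite_subset)
qed

lemma truncated_mono: "M \<le> N \<Longrightarrow> truncated I M \<subseteq> truncated I N"
  by (auto simp: truncated_def)

lemma truncated_subset: "truncated I N \<subseteq> I"
  by (auto simp: truncated_def)

lemma mode_truncated: "(i, m, n) \<in> I \<Longrightarrow> m \<le> N \<Longrightarrow> n \<le> N \<Longrightarrow> (i, m, n) \<in> truncated I N"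
  by (auto simp: truncated_def)

text \<open>
  By Bessel's inequality the partial sums form a Cauchy sequence; their limit has the same
  coefficients as \<open>f\<close> and agrees with it by totality.
\<close>

lemma L2_expansion:
  fixes e :: "int \<times> nat \<times> nat \<Rightarrow> real \<times> real \<Rightarrow> real"
  assumes e: "\<And>k. k \<in> xi_index \<Longrightarrow> e k \<in> L2"
    and orth: "\<And>k l. k \<in> xi_index \<Longrightarrow> l \<in> xi_index \<Longrightarrow> k \<noteq> l \<Longrightarrow> ip (e k) (e l) = 0"
    and total: "\<And>g. g \<in> L2 \<Longrightarrow> (\<And>k. k \<in> xi_index \<Longrightarrow> ip g (e k) = 0) \<Longrightarrow> AE p in \<mu>. g p = 0"
    and f: "f \<in> L2"
  shows "(\<lambda>N. L2_norm (f - L2.proj e (truncated xi_index N) f)) \<longlonglongrightarrow> 0"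
proof -
  let ?J = "truncated xi_index" and ?P = "\<lambda>N. L2.proj e (truncated xi_index N) f"
  define S where "S N = (\<Sum>k\<in>?J N. (ip f (e k))\<^sup>2 / ip (e k) (e k))" for N
  have eJ: "k \<in> ?J N \<Longrightarrow> e k \<in> L2" for k N using e truncated_subset by blast
  have oJ: "k \<in> ?J N \<Longrightarrow> l \<in> ?J N \<Longrightarrow> k \<noteq> l \<Longrightarrow> ip (e k) (e l) = 0" for k l N
    using orth truncated_subset by (metis subsetD)
  have PL: "?P N \<in> L2" for N unfolding L2.proj_def using eJ by (intro L2.sum_closed)
  have bess: "S N \<le> (L2_norm f)\<^sup>2" for N
    unfolding S_def by (rule L2.bessel[OF finite_truncated(1) eJ f oJ])
  have mono: "incseq S" unfolding S_def
    using truncated_mono finite_truncated eJ by (intro monoI sum_mono2) (auto simp: L2.nonneg)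
  obtain L where L: "S \<longlonglongrightarrow> L"
    using incseq_convergent[OF mono, of "(L2_norm f)\<^sup>2"] bess by blast
  have diff: "(L2_norm (?P N - ?P M))\<^sup>2 = S N - S M" if "M \<le> N" for M N
  proof -
    have sub: "?J M \<subseteq> ?J N" using truncated_mono[OF that] .
    have "?P N - ?P M = (\<Sum>k\<in>?J N - ?J M. (ip f (e k) / ip (e k) (e k)) *\<^sub>R e k)"
      unfolding L2.proj_def using sum.subset_diff[OF sub finite_truncated(1), of "\<lambda>k. (ip f (e k) / ip (e k) (e k)) *\<^sub>R e k"]
      by (simp add: algebra_simps)
    then have "(L2_norm (?P N - ?P M))\<^sup>2 = (\<Sum>k\<in>?J N - ?J M. (ip f (e k) / ip (e k) (e k))\<^sup>2 * ip (e k) (e k))"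
      using L2.orthogonal_sum_square[of "?J N - ?J M" e] finite_truncated(1)[of N] eJ[of _ N] oJ[of _ N] by auto
    also have "\<dots> = (\<Sum>k\<in>?J N - ?J M. (ip f (e k))\<^sup>2 / ip (e k) (e k))"
      by (intro sum.cong) (auto simp: power2_eq_square)
    also have "\<dots> = S N - S M" unfolding S_def
      using sum.subset_diff[OF sub finite_truncated(1), of "\<lambda>k. (ip f (e k))\<^sup>2 / ip (e k) (e k)"] by simp
    finally show ?thesis .
  qed
  have cauchy: "\<exists>K. \<forall>m\<ge>K. \<forall>n\<ge>K. L2_norm (?P m - ?P n) < r" if r: "r > 0" for r
  proof -
    have "Cauchy S" using L by (rule LIMSEQ_imp_Cauchy)
    then obtain K where K: "\<And>m n. m \<ge> K \<Longrightarrow> n \<ge> K \<Longrightarrow> dist (S m) (S n) < r\<^sup>2"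
      using r unfolding Cauchy_def by (meson zero_less_power)
    have "L2_norm (?P m - ?P n) < r" if mn: "m \<ge> K" "n \<ge> K" for m n
    proof -
      have "(L2_norm (?P m - ?P n))\<^sup>2 \<le> \<bar>S m - S n\<bar>"
        using diff[of m n] diff[of n m] L2.nrm_sym[OF PL PL, of m n] by (cases "m \<le> n") auto
      also have "\<dots> < r\<^sup>2" using K[OF mn] by (simp add: dist_real_def)
      finally show ?thesis using r by (simp add: power2_less_imp_less)
    qed
    then show ?thesis by blast
  qed
  obtain g where g: "g \<in> L2" "(\<lambda>N. L2_norm (?P N - g)) \<longlonglongrightarrow> 0"
    using L2_complete[OF PL cauchy] by blast
  have coef: "ip (f - g) (e k) = 0" if k: "k \<in> xi_index" for k
  proof -
    obtain i m n where kk: "k = (i, m, n)" by (cases k) auto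
    have "\<bar>ip (f - g) (e k)\<bar> \<le> L2_norm (?P N - g) * L2_norm (e k)" if "N \<ge> max m n" for N
    proof -
      have "k \<in> ?J N" using k that unfolding kk by (intro mode_truncated) auto
      then have "ip (?P N) (e k) = ip f (e k)"
        using L2.proj_coefficient[of "?J N" e f k] finite_truncated(1) eJ f oJ by blast
      then have "ip (f - g) (e k) = ip (?P N - g) (e k)"
        using f g PL e[OF k] by (simp add: L2.diff_left)
      then show ?thesis using L2.cauchy_schwarz[OF L2.clos(3)[OF PL g(1)] e[OF k], of N] by simp
    qed
    then have "\<forall>\<^sub>F N in sequentially. \<bar>ip (f - g) (e k)\<bar> \<le> L2_norm (?P N - g) * L2_norm (e k)"
      unfolding eventually_sequentially by blast
    moreover have "(\<lambda>N. L2_norm (?P N - g) * L2_norm (e k)) \<longlonglongrightarrow> 0 * L2_norm (e k)"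
      by (intro tendsto_intros g)
    ultimately have "\<bar>ip (f - g) (e k)\<bar> \<le> 0 * L2_norm (e k)"
      using tendsto_le[OF sequentially_bot _ tendsto_const] by blast
    then show ?thesis by simp
  qed
  have ae: "AE p in \<mu>. (f - g) p = 0" by (rule total[OF L2.clos(3)[OF f g(1)] coef])
  have "L2_norm (f - ?P N) = L2_norm (?P N - g)" for N
  proof -
    have "L2_norm (f - ?P N) = L2_norm (g - ?P N)"
    proof (rule L2_norm_cong_AE)
      show "AE p in \<mu>. (f - ?P N) p = (g - ?P N) p" using ae by eventually_elim (simp add: fsimps)
    qed (intro L2.clos f g PL)+
    then show ?thesis using L2.nrm_sym[OF PL g(1)] by simp
  qed
  then show ?thesis using g(2) by simp
qed

definition sine_mode :: "int \<times> nat \<times> nat \<Rightarrow> real \<times> real \<Rightarrow> real" where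
  "sine_mode = (\<lambda>(i, m, n). xi i m n)"

definition cosine_mode :: "int \<times> nat \<times> nat \<Rightarrow> real \<times> real \<Rightarrow> real" where
  "cosine_mode = (\<lambda>(i, m, n). phi i m n)"

lemma xi_index_iff: "(i, m, n) \<in> xi_index \<longleftrightarrow> i = 1 \<or> i = -1"
  by (auto simp: xi_index_def)

lemma xi_L2: "xi i m n \<in> L2" by (intro L2_continuous continuous_intros)
lemma phi_L2: "phi i m n \<in> L2" by (intro L2_continuous continuous_intros)

lemma L2_integrable: "f \<in> L2 \<Longrightarrow> integrable \<mu> f" for f :: "real \<times> real \<Rightarrow> real"
  using L2_integrable_inner[of f "\<lambda>_. 1"] by (simp add: L2_def)

lemma sine_modes_total:
  assumes "g \<in> L2" "\<And>i m n. i = 1 \<or> i = -1 \<Longrightarrow> ip g (xi i m n) = 0" shows "AE p in \<mu>. g p = 0"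
  using sine_system_complete[OF L2_integrable[OF assms(1)]] assms(2) by (simp add: ip_def)

lemma cosine_modes_total:
  assumes "g \<in> L2" "\<And>i m n. i = 1 \<or> i = -1 \<Longrightarrow> ip g (phi i m n) = 0" shows "AE p in \<mu>. g p = 0"
  using cosine_system_complete[OF L2_integrable[OF assms(1)]] assms(2) by (simp add: ip_def)

lemma sine_mode_orthogonal:
  "k \<in> xi_index \<Longrightarrow> l \<in> xi_index \<Longrightarrow> k \<noteq> l \<Longrightarrow> ip (sine_mode k) (sine_mode l) = 0"
  unfolding sine_mode_def by (cases k; cases l) (auto simp: xi_index_iff ip_xi)

lemma cosine_mode_orthogonal:
  "k \<in> xi_index \<Longrightarrow> l \<in> xi_index \<Longrightarrow> k \<noteq> l \<Longrightarrow> ip (cosine_mode k) (cosine_mode l) = 0"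
  unfolding cosine_mode_def by (cases k; cases l) (auto simp: xi_index_iff ip_phi)

lemma mode_L2: "sine_mode k \<in> L2" "cosine_mode k \<in> L2"
  unfolding sine_mode_def cosine_mode_def by (cases k; simp add: xi_L2 phi_L2)+

abbreviation "sine_sum N f \<equiv> L2.proj sine_mode (truncated xi_index N) f"
abbreviation "cosine_sum N f \<equiv> L2.proj cosine_mode (truncated xi_index N) f"

lemma sine_expansion: "f \<in> L2 \<Longrightarrow> (\<lambda>N. L2_norm (f - sine_sum N f)) \<longlonglongrightarrow> 0"
  by (rule L2_expansion[OF mode_L2(1) sine_mode_orthogonal]; (rule sine_modes_total)?)
    (force simp: sine_mode_def xi_index_iff)+

lemma cosine_expansion: "f \<in> L2 \<Longrightarrow> (\<lambda>N. L2_norm (f - cosine_sum N f)) \<longlonglongrightarrow> 0"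
  by (rule L2_expansion[OF mode_L2(2) cosine_mode_orthogonal]; (rule cosine_modes_total)?)
    (force simp: cosine_mode_def xi_index_iff)+

section \<open>Bounded functionals\<close>

lemma dualI:
  assumes "\<And>f g. f \<in> X \<Longrightarrow> g \<in> X \<Longrightarrow> F (f + g) = F f + F g" "\<And>c f. f \<in> X \<Longrightarrow> F (c *\<^sub>R f) = c * F f"
    "\<And>f. f \<in> X \<Longrightarrow> \<bar>F f\<bar> \<le> C * nrm f"
  shows "F \<in> dual X nrm"
  using assms unfolding dual_def by blast

lemma dualD:
  assumes "F \<in> dual X nrm"
  shows "f \<in> X \<Longrightarrow> g \<in> X \<Longrightarrow> F (f + g) = F f + F g" "f \<in> X \<Longrightarrow> F (c *\<^sub>R f) = c * F f"
  using assms unfolding dual_def by blast+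

lemma dual_bound:
  assumes "seminormed X nrm" "F \<in> dual X nrm"
  obtains C where "C \<ge> 0" "\<And>f. f \<in> X \<Longrightarrow> \<bar>F f\<bar> \<le> C * nrm f"
proof -
  obtain C where C: "\<And>f. f \<in> X \<Longrightarrow> \<bar>F f\<bar> \<le> C * nrm f" using assms unfolding dual_def by blast
  have "\<bar>F f\<bar> \<le> \<bar>C\<bar> * nrm f" if "f \<in> X" for f
    using C[OF that] mult_right_mono[OF abs_ge_self seminormed.nrm_nonneg[OF assms(1) that], of C] by linarith
  then show ?thesis using that[of "\<bar>C\<bar>"] by simp
qed

lemma dual_add:
  assumes "F \<in> dual X nrm" "G \<in> dual X nrm" shows "(\<lambda>f. F f + G f) \<in> dual X nrm"
proof -
  obtain C D where C: "\<And>f. f \<in> X \<Longrightarrow> \<bar>F f\<bar> \<le> C * nrm f" and D: "\<And>f. f \<in> X \<Longrightarrow> \<bar>G f\<bar> \<le> D * nrm f"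
    using assms unfolding dual_def by blast
  show ?thesis
  proof (rule dualI[where C = "C + D"])
    fix f assume f: "f \<in> X"
    show "\<bar>F f + G f\<bar> \<le> (C + D) * nrm f" using C[OF f] D[OF f] by (simp add: distrib_right)
  qed (use dualD[OF assms(1)] dualD[OF assms(2)] in \<open>auto simp: algebra_simps\<close>)
qed

lemma dual_scale:
  assumes "F \<in> dual X nrm" shows "(\<lambda>f. c * F f) \<in> dual X nrm"
proof -
  obtain C where C: "\<And>f. f \<in> X \<Longrightarrow> \<bar>F f\<bar> \<le> C * nrm f" using assms unfolding dual_def by blast
  show ?thesis
  proof (rule dualI[where C = "\<bar>c\<bar> * C"])
    fix f assume f: "f \<in> X"
    show "\<bar>c * F f\<bar> \<le> (\<bar>c\<bar> * C) * nrm f"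
      using mult_left_mono[OF C[OF f], of "\<bar>c\<bar>"] by (simp add: abs_mult mult.assoc)
  qed (use dualD[OF assms] in \<open>auto simp: algebra_simps\<close>)
qed

lemma dual_minus: "F \<in> dual X nrm \<Longrightarrow> (\<lambda>f. - F f) \<in> dual X nrm"
  using dual_scale[of F X nrm "-1"] by simp

lemma dual_diff: "F \<in> dual X nrm \<Longrightarrow> G \<in> dual X nrm \<Longrightarrow> (\<lambda>f. F f - G f) \<in> dual X nrm"
  using dual_add[OF _ dual_minus] by fastforce

lemma dual_subset: "F \<in> dual X nrm \<Longrightarrow> Y \<subseteq> X \<Longrightarrow> F \<in> dual Y nrm"
  unfolding dual_def by blast

lemma closure_span_subset: "closure_span X nrm B \<subseteq> X"
  by (auto simp: closure_span_def)

lemma closure_span_dual_zero: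
  assumes X: "seminormed X nrm" and B: "B \<subseteq> X" and F: "F \<in> dual X nrm"
    and zero: "\<And>b. b \<in> B \<Longrightarrow> F b = 0" and f: "f \<in> closure_span X nrm B"
  shows "F f = 0"
proof -
  obtain C where C: "\<And>f. f \<in> X \<Longrightarrow> \<bar>F f\<bar> \<le> C * nrm f" using F unfolding dual_def by blast
  show ?thesis
    by (rule seminormed.closure_span_vanish[OF X B f, of F C]) (use dualD[OF F] C zero in auto)
qed

lemma ip_dual:
  fixes h :: "real \<times> real \<Rightarrow> 'v::euclidean_space"
  assumes "h \<in> L2" shows "(\<lambda>f. ip f h) \<in> dual L2 L2_norm"
  by (rule dualI[where C = "L2_norm h"])
    (use assms L2.cauchy_schwarz in \<open>auto simp: L2.add_left L2.scale_left mult.commute\<close>)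

lemma ip_W12_dual:
  assumes "h \<in> L2" shows "(\<lambda>f. ip f h) \<in> dual W12 W12_norm"
proof (rule dualI[where C = "L2_norm h"])
  fix f assume f: "f \<in> W12"
  have "\<bar>ip f h\<bar> \<le> L2_norm f * L2_norm h" using L2.cauchy_schwarz[OF W12_wgrad(2)[OF f] assms] .
  also have "\<dots> \<le> W12_norm f * L2_norm h"
    using W12_norm_ge(1)[OF f] L2.nrm_nonneg[OF assms] by (rule mult_right_mono)
  finally show "\<bar>ip f h\<bar> \<le> L2_norm h * W12_norm f" by (simp add: mult.commute)
qed (use assms W12_wgrad(2) in \<open>auto simp: L2.add_left L2.scale_left\<close>)

lemma wgrad_W12_dual:
  assumes "h \<in> L2" shows "(\<lambda>f. ip (wgrad f) h) \<in> dual W12 W12_norm"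
proof (rule dualI[where C = "L2_norm h"])
  fix f assume f: "f \<in> W12"
  have "\<bar>ip (wgrad f) h\<bar> \<le> L2_norm (wgrad f) * L2_norm h" using L2.cauchy_schwarz[OF W12_wgrad(3)[OF f] assms] .
  also have "\<dots> \<le> W12_norm f * L2_norm h"
    using W12_norm_ge(2)[OF f] L2.nrm_nonneg[OF assms] by (rule mult_right_mono)
  finally show "\<bar>ip (wgrad f) h\<bar> \<le> L2_norm h * W12_norm f" by (simp add: mult.commute)
qed (use assms in \<open>auto simp: ip_wgrad_linear\<close>)

lemma L2_Pair:
  fixes a b :: "real \<times> real \<Rightarrow> real"
  assumes "a \<in> L2" "b \<in> L2" shows "(\<lambda>p. (a p, b p)) \<in> L2"
proof -
  have [measurable]: "a \<in> borel_measurable \<mu>" "b \<in> borel_measurable \<mu>" using assms L2_measurable by auto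
  have "(\<lambda>p. (norm (a p, b p))\<^sup>2) = (\<lambda>p. (norm (a p))\<^sup>2 + (norm (b p))\<^sup>2)"
    by (simp add: norm_Pair)
  then have "integrable \<mu> (\<lambda>p. (norm (a p, b p))\<^sup>2)" using L2D[OF assms(1)] L2D[OF assms(2)] by simp
  moreover have "(\<lambda>p. (a p, b p)) \<in> borel_measurable \<mu>" by measurable
  ultimately show ?thesis by (simp add: L2_def)
qed

lemma ip_component:
  "ip (\<lambda>p. fst (g p)) h = ip g (\<lambda>p. (h p, 0::real))" "ip (\<lambda>p. snd (g p)) h = ip g (\<lambda>p. (0::real, h p))"
  for g :: "real \<times> real \<Rightarrow> real \<times> real"
  by (simp_all add: ip_def inner_prod_def)

lemma L2_zero: "(\<lambda>_. 0) \<in> (L2 :: (real \<times> real \<Rightarrow> 'v::euclidean_space) set)"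
  using L2.clos(1) by (simp add: fsimps)

lemma ip_Pair:
  fixes a b :: "real \<times> real \<Rightarrow> real" and g :: "real \<times> real \<Rightarrow> real \<times> real"
  assumes "g \<in> L2" "a \<in> L2" "b \<in> L2"
  shows "ip g (\<lambda>p. (a p, b p)) = ip (\<lambda>p. fst (g p)) a + ip (\<lambda>p. snd (g p)) b"
proof -
  have "(\<lambda>p. (a p, b p)) = (\<lambda>p. (a p, 0)) + (\<lambda>p. (0, b p))" by (auto simp: fsimps)
  then show ?thesis unfolding ip_component using assms by (simp add: L2.add_right L2_Pair L2_zero)
qed

lemma wgrad_component_dual:
  assumes "h \<in> L2"
  shows "(\<lambda>f. ip (\<lambda>p. fst (wgrad f p)) h) \<in> dual W12 W12_norm"
    "(\<lambda>f. ip (\<lambda>p. snd (wgrad f p)) h) \<in> dual W12 W12_norm"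
  unfolding ip_component by (intro wgrad_W12_dual L2_Pair assms L2_zero)+

text \<open>
  For smooth \<open>h\<close> both sides are bounded functionals of \<open>f\<close>, so it
  suffices to consider the spanning functions. In this way boundary conditions are encoded in the
  closures.
\<close>

lemma closure_by_parts_x:
  assumes B: "\<And>b. b \<in> B \<Longrightarrow> C1 b" and f: "f \<in> closure_span W12 W12_norm B" and h: "C1 h"
    and per: "\<And>b z. b \<in> B \<Longrightarrow> z \<in> {0..1} \<Longrightarrow> b (0, z) * h (0, z) = b (1, z) * h (1, z)"
  shows "ip (\<lambda>p. fst (wgrad f p)) h = - ip f (dx h)"
proof -
  have "ip (\<lambda>p. fst (wgrad f p)) h + ip f (dx h) = 0"
  proof (rule closure_span_dual_zero[OF W12.seminormed_axioms _ _ _ f])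
    show "B \<subseteq> W12" using B C1_wgrad by blast
    show "(\<lambda>f. ip (\<lambda>p. fst (wgrad f p)) h + ip f (dx h)) \<in> dual W12 W12_norm"
      by (intro dual_add wgrad_component_dual ip_W12_dual C1_L2 h)
    fix b assume b: "b \<in> B"
    have "ip (\<lambda>p. fst (wgrad b p)) h = ip (dx b) h"
      using C1_wgrad(2)[OF B[OF b]] W12_wgrad(3)[OF C1_wgrad(1)[OF B[OF b]]] C1_L2[OF B[OF b]] C1_L2[OF h]
      by (intro ip_cong_AE L2_components) (auto simp: grad_def elim!: eventually_mono)
    then show "ip (\<lambda>p. fst (wgrad b p)) h + ip b (dx h) = 0"
      using C1_ip_by_parts_x[OF B[OF b] h per[OF b]] by simp
  qed
  then show ?thesis by simp
qed

lemma closure_by_parts_z: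
  assumes B: "\<And>b. b \<in> B \<Longrightarrow> C1 b" and f: "f \<in> closure_span W12 W12_norm B" and h: "C1 h"
    and per: "\<And>b x. b \<in> B \<Longrightarrow> x \<in> {0..1} \<Longrightarrow> b (x, 0) * h (x, 0) = b (x, 1) * h (x, 1)"
  shows "ip (\<lambda>p. snd (wgrad f p)) h = - ip f (dz h)"
proof -
  have "ip (\<lambda>p. snd (wgrad f p)) h + ip f (dz h) = 0"
  proof (rule closure_span_dual_zero[OF W12.seminormed_axioms _ _ _ f])
    show "B \<subseteq> W12" using B C1_wgrad by blast
    show "(\<lambda>f. ip (\<lambda>p. snd (wgrad f p)) h + ip f (dz h)) \<in> dual W12 W12_norm"
      by (intro dual_add wgrad_component_dual ip_W12_dual C1_L2 h)
    fix b assume b: "b \<in> B"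
    have "ip (\<lambda>p. snd (wgrad b p)) h = ip (dz b) h"
      using C1_wgrad(2)[OF B[OF b]] W12_wgrad(3)[OF C1_wgrad(1)[OF B[OF b]]] C1_L2[OF B[OF b]] C1_L2[OF h]
      by (intro ip_cong_AE L2_components) (auto simp: grad_def elim!: eventually_mono)
    then show "ip (\<lambda>p. snd (wgrad b p)) h + ip b (dz h) = 0"
      using C1_ip_by_parts_z[OF B[OF b] h per[OF b]] by simp
  qed
  then show ?thesis by simp
qed

section \<open>The function spaces of the problem\<close>

abbreviation "xi_set \<equiv> {xi i m n |i m n. (i, m, n) \<in> xi_index}"
abbreviation "phi_set \<equiv> {phi i m n |i m n. (i, m, n) \<in> phi_index}"
abbreviation "perp_set \<equiv> {perp_grad (xi i m n) |i m n. (i, m, n) \<in> xi_index}"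

lemma basis_sets:
  "xi_set \<subseteq> W12" "phi_set \<subseteq> W12" "perp_set \<subseteq> L2" "xi_set \<subseteq> L2"
  "b \<in> xi_set \<Longrightarrow> C1 b" "b' \<in> phi_set \<Longrightarrow> C1 b'"
  using C1_wgrad(1) C1_L2 xi_C1(1) phi_C1(1) by (auto simp: xi_index_iff phi_index_def)

lemma hat_W12_subset: "hat_W12 \<subseteq> W12" "tilde_W12 \<subseteq> W12" "hat_L2_vec \<subseteq> L2" "hat_L2 \<subseteq> L2"
  unfolding hat_W12_def tilde_W12_def hat_L2_vec_def hat_L2_def by (rule closure_span_subset)+

lemma span_subsets:
  "span xi_set \<subseteq> hat_W12" "span phi_set \<subseteq> tilde_W12" "span perp_set \<subseteq> hat_L2_vec"
  unfolding hat_W12_def tilde_W12_def hat_L2_vec_def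
  by (rule W12.span_subset_closure_span L2.span_subset_closure_span basis_sets)+

interpretation hat_W12: pre_hilbert hat_W12 W12_ip W12_norm
  by (rule pre_hilbert_subspace[OF W12.pre_hilbert_axioms _ hat_W12_subset(1)])
     (unfold hat_W12_def, rule W12.subspace_closure_span[OF basis_sets(1)])

interpretation tilde_W12: pre_hilbert tilde_W12 W12_ip W12_norm
  by (rule pre_hilbert_subspace[OF W12.pre_hilbert_axioms _ hat_W12_subset(2)])
     (unfold tilde_W12_def, rule W12.subspace_closure_span[OF basis_sets(2)])

interpretation hat_vec: pre_hilbert hat_L2_vec ip L2_norm
  by (rule pre_hilbert_subspace[OF L2.pre_hilbert_axioms _ hat_W12_subset(3)])
     (unfold hat_L2_vec_def, rule L2.subspace_closure_span[OF basis_sets(3)])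

lemma xi_hat: "i = 1 \<or> i = -1 \<Longrightarrow> xi i m n \<in> hat_W12"
  using span_subsets(1) span_base[of "xi i m n" xi_set] by (auto simp: xi_index_iff)

lemma hat_by_parts_x:
  assumes "f \<in> hat_W12" "C1 h" "\<And>z. z \<in> {0..1} \<Longrightarrow> h (0, z) = h (1, z)"
  shows "ip (\<lambda>p. fst (wgrad f p)) h = - ip f (dx h)"
  using assms(1) unfolding hat_W12_def
  by (rule closure_by_parts_x[rotated]) (use assms basis_sets xi_periodic in auto)

lemma hat_by_parts_z:
  assumes "f \<in> hat_W12" "C1 h"
  shows "ip (\<lambda>p. snd (wgrad f p)) h = - ip f (dz h)"
  using assms(1) unfolding hat_W12_def
  by (rule closure_by_parts_z[rotated]) (use assms basis_sets xi_boundary in auto)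

lemma tilde_by_parts_x:
  assumes "f \<in> tilde_W12" "C1 h" "\<And>z. z \<in> {0..1} \<Longrightarrow> h (0, z) = h (1, z)"
  shows "ip (\<lambda>p. fst (wgrad f p)) h = - ip f (dx h)"
  using assms(1) unfolding tilde_W12_def
  by (rule closure_by_parts_x[rotated]) (use assms basis_sets phi_periodic in auto)

lemma tilde_by_parts_z:
  assumes "f \<in> tilde_W12" "C1 h" "\<And>x. x \<in> {0..1} \<Longrightarrow> h (x, 0) = 0 \<and> h (x, 1) = 0"
  shows "ip (\<lambda>p. snd (wgrad f p)) h = - ip f (dz h)"
  using assms(1) unfolding tilde_W12_def
  by (rule closure_by_parts_z[rotated]) (use assms basis_sets in auto)

text \<open>
  The eigenvalue of minus the Laplacian for the basis functions with indices \<open>m\<close>,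
  \<open>n\<close>.
\<close>

definition eigenvalue :: "nat \<Rightarrow> nat \<Rightarrow> real" where
  "eigenvalue m n = (2 * pi * real m)\<^sup>2 + (pi * real n)\<^sup>2"

lemma hat_grad_xi:
  assumes f: "f \<in> hat_W12" and i: "i = 1 \<or> i = -1"
  shows "ip (wgrad f) (grad (xi i m n)) = eigenvalue m n * ip f (xi i m n)"
proof -
  have i': "-i = 1 \<or> -i = -1" using i by auto
  have fW: "f \<in> W12" using f hat_W12_subset by auto
  note X = xi_C1[OF i, of m n] and X' = xi_C1[OF i', of m n] and Ph = phi_C1[OF i, of m n]
  have ii: "real_of_int i * real_of_int i = 1" using i by auto
  have L: "dx (xi i m n) \<in> L2" "dz (xi i m n) \<in> L2" by (intro C1_L2 X)+
  have "ip (wgrad f) (grad (xi i m n)) = ip (\<lambda>p. fst (wgrad f p)) (dx (xi i m n)) + ip (\<lambda>p. snd (wgrad f p)) (dz (xi i m n))"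
    unfolding grad_def by (rule ip_Pair[OF W12_wgrad(3)[OF fW] L])
  also have "ip (\<lambda>p. fst (wgrad f p)) (dx (xi i m n)) = - ip f (dx (dx (xi i m n)))"
    unfolding X(2) by (intro hat_by_parts_x f C1_scale X') (simp add: fsimps xi_periodic)
  also have "dx (dx (xi i m n)) = (- (2 * pi * real m)\<^sup>2) *\<^sub>R xi i m n"
    unfolding X(2) C1_scale(2)[OF X'(1)] X'(2) using ii by (simp add: power2_eq_square mult.assoc mult.left_commute)
  also have "ip (\<lambda>p. snd (wgrad f p)) (dz (xi i m n)) = - ip f (dz (dz (xi i m n)))"
    unfolding X(3) by (intro hat_by_parts_z f C1_scale Ph)
  also have "dz (dz (xi i m n)) = (- (pi * real n)\<^sup>2) *\<^sub>R xi i m n"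
    unfolding X(3) C1_scale(3)[OF Ph(1)] Ph(3) by (simp add: power2_eq_square)
  finally show ?thesis unfolding eigenvalue_def
    using W12_wgrad(2)[OF fW] by (simp only: L2.scale_right xi_L2) (simp add: algebra_simps)
qed

lemma grad_xi_ip:
  assumes i: "i = 1 \<or> i = -1" "j = 1 \<or> j = -1"
  shows "ip (grad (xi i m n)) (grad (xi j m' n')) = eigenvalue m' n' * ip (xi i m n) (xi j m' n')"
proof -
  note X = xi_C1(1)[OF i(1), of m n] and Y = xi_C1(1)[OF i(2), of m' n']
  have "ip (grad (xi i m n)) (grad (xi j m' n')) = ip (wgrad (xi i m n)) (grad (xi j m' n'))"
    using C1_wgrad[OF X] W12_wgrad(3)[OF C1_wgrad(1)[OF X]] C1_L2[OF X] C1_L2[OF Y]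
    by (intro ip_cong_AE) (auto elim!: eventually_mono)
  then show ?thesis using hat_grad_xi[OF xi_hat[OF i(1)] i(2)] by simp
qed

text \<open>
  Bessel's inequality for the orthogonal system of the gradients of the basis functions.
\<close>

lemma gradient_bessel:
  assumes f: "f \<in> hat_W12" and I: "finite I" "I \<subseteq> xi_index"
  shows "(\<Sum>(i, m, n)\<in>I. eigenvalue m n * ((ip f (xi i m n))\<^sup>2 / ip (xi i m n) (xi i m n))) \<le> (L2_norm (wgrad f))\<^sup>2"
proof -
  let ?e = "\<lambda>k. grad (sine_mode k)"
  have fW: "wgrad f \<in> L2" using f hat_W12_subset W12_wgrad by blast
  have "(\<Sum>k\<in>I. (ip (wgrad f) (?e k))\<^sup>2 / ip (?e k) (?e k)) \<le> (L2_norm (wgrad f))\<^sup>2"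
  proof (rule L2.bessel[OF I(1) _ fW])
    show "?e k \<in> L2" if "k \<in> I" for k
      using that I(2) by (cases k) (auto simp: sine_mode_def xi_index_iff intro!: C1_L2 xi_C1)
    show "ip (?e k) (?e l) = 0" if "k \<in> I" "l \<in> I" "k \<noteq> l" for k l
    proof -
      obtain i m n j m' n' where kl: "k = (i, m, n)" "l = (j, m', n')" by (cases k; cases l)
      have "i = 1 \<or> i = -1" "j = 1 \<or> j = -1" using that I(2) by (auto simp: kl xi_index_iff)
      then show ?thesis using that by (auto simp: kl sine_mode_def grad_xi_ip ip_xi)
    qed
  qed
  also have "(\<Sum>k\<in>I. (ip (wgrad f) (?e k))\<^sup>2 / ip (?e k) (?e k))
      = (\<Sum>(i, m, n)\<in>I. eigenvalue m n * ((ip f (xi i m n))\<^sup>2 / ip (xi i m n) (xi i m n)))"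
  proof (intro sum.cong refl)
    fix k assume k: "k \<in> I"
    obtain i m n where kk: "k = (i, m, n)" by (cases k)
    have i: "i = 1 \<or> i = -1" using k I(2) by (auto simp: kk xi_index_iff)
    show "(ip (wgrad f) (?e k))\<^sup>2 / ip (?e k) (?e k) = (case k of (i, m, n) \<Rightarrow> eigenvalue m n * ((ip f (xi i m n))\<^sup>2 / ip (xi i m n) (xi i m n)))"
      by (simp add: kk sine_mode_def hat_grad_xi[OF f i] grad_xi_ip[OF i i] power2_eq_square)
  qed
  finally show ?thesis .
qed

text \<open>
  A frequency above \<open>M\<close> has an eigenvalue of at least \<open>(\<pi> (M +
  1))\<^sup>2\<close>, so the gradient controls the tail of the expansion. With \<open>M\<close>
  fixed this reduces strong convergence to that of finitely many coefficients.
\<close>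

lemma poincare_tail:
  assumes f: "f \<in> hat_W12"
  shows "(L2_norm f)\<^sup>2 \<le> (\<Sum>(i, m, n)\<in>truncated xi_index M. (ip f (xi i m n))\<^sup>2 / ip (xi i m n) (xi i m n))
     + (L2_norm (wgrad f))\<^sup>2 / (pi * real (Suc M))\<^sup>2"
proof -
  have fL: "f \<in> L2" using f hat_W12_subset W12_wgrad by blast
  let ?J = "truncated xi_index" and ?L = "(pi * real (Suc M))\<^sup>2"
  let ?c = "\<lambda>(i, m, n). (ip f (xi i m n))\<^sup>2 / ip (xi i m n) (xi i m n)"
  let ?g = "\<lambda>k. eigenvalue (fst (snd k)) (snd (snd k)) * ?c k"
  have g: "(\<Sum>k\<in>?J N - ?J M. ?g k) \<le> (L2_norm (wgrad f))\<^sup>2" for N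
    using gradient_bessel[OF f, of "?J N - ?J M"] finite_truncated(1)[of N] truncated_subset[of xi_index N]
    by (simp add: case_prod_unfold subset_iff)
  have c0: "?c k \<ge> 0" for k by (cases k) (simp add: L2.nonneg xi_L2)
  have Lpos: "?L > 0" by simp
  have "(L2_norm (sine_sum N f))\<^sup>2 \<le> (\<Sum>k\<in>?J M. ?c k) + (L2_norm (wgrad f))\<^sup>2 / ?L" if "N \<ge> M" for N
  proof -
    have "(L2_norm (sine_sum N f))\<^sup>2 = (\<Sum>k\<in>?J N. (ip f (sine_mode k))\<^sup>2 / ip (sine_mode k) (sine_mode k))"
      using truncated_subset[of xi_index N]
      by (intro L2.bessel_identity(2) finite_truncated mode_L2 fL sine_mode_orthogonal) auto
    also have "\<dots> = (\<Sum>k\<in>?J N. ?c k)" by (intro sum.cong) (auto simp: sine_mode_def)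
    also have "\<dots> = (\<Sum>k\<in>?J N - ?J M. ?c k) + (\<Sum>k\<in>?J M. ?c k)"
      by (rule sum.subset_diff[OF truncated_mono[OF that] finite_truncated(1)])
    also have "(\<Sum>k\<in>?J N - ?J M. ?c k) \<le> (\<Sum>k\<in>?J N - ?J M. ?g k) / ?L"
      unfolding sum_divide_distrib
    proof (rule sum_mono)
      fix k assume k: "k \<in> ?J N - ?J M"
      obtain i m n where kk: "k = (i, m, n)" by (cases k)
      have "m \<ge> Suc M \<or> n \<ge> Suc M" using k by (auto simp: kk truncated_def)
      moreover have "(pi * real (Suc M))\<^sup>2 \<le> (2 * pi * real m)\<^sup>2" if "m \<ge> Suc M"
        using that by (intro power_mono mult_mono) auto
      moreover have "(pi * real (Suc M))\<^sup>2 \<le> (pi * real n)\<^sup>2" if "n \<ge> Suc M"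
        using that by (intro power_mono mult_mono) auto
      ultimately have "?L \<le> eigenvalue m n" unfolding eigenvalue_def
        by (smt (verit) zero_le_power2)
      then have "?L * ?c k \<le> eigenvalue m n * ?c k" using c0 by (intro mult_right_mono)
      then show "?c k \<le> (?g k) / ?L"
        by (subst pos_le_divide_eq[OF Lpos]) (simp add: kk mult.commute)
    qed
    also have "\<dots> \<le> (L2_norm (wgrad f))\<^sup>2 / ?L"
      by (rule divide_right_mono[OF g zero_le_power2])
    finally show ?thesis by simp
  qed
  moreover have "(\<lambda>N. (L2_norm (sine_sum N f))\<^sup>2) \<longlonglongrightarrow> (L2_norm f)\<^sup>2"
  proof (intro tendsto_power)
    have PL: "sine_sum N f \<in> L2" for N unfolding L2.proj_def by (intro L2.sum_closed mode_L2)
    have "(\<lambda>N. L2_norm (sine_sum N f) - L2_norm f) \<longlonglongrightarrow> 0"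
    proof (rule tendsto_rabs_zero_cancel, rule tendsto_sandwich[OF _ _ tendsto_const sine_expansion[OF fL]])
      show "\<forall>\<^sub>F N in sequentially. \<bar>L2_norm (sine_sum N f) - L2_norm f\<bar> \<le> L2_norm (f - sine_sum N f)"
        using L2.reverse_triangle[OF fL PL] by (simp add: abs_minus_commute)
    qed simp
    then show "(\<lambda>N. L2_norm (sine_sum N f)) \<longlonglongrightarrow> L2_norm f" by (simp add: LIM_zero_iff)
  qed
  ultimately show ?thesis by (intro tendsto_upperbound[where F = sequentially]) (auto simp: eventually_sequentially)
qed

text \<open>
  The sine functions vanish at top and bottom, so integration by parts moves all derivatives onto
  them without boundary terms, and their mixed second derivatives cancel. The first part says that
  the field is divergence free and tangential at top and bottom, the second that it has no mean
  horizontal flow.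
\<close>

lemma hat_vec_orthogonal:
  assumes u: "u \<in> hat_L2_vec"
  shows "C1 h \<Longrightarrow> (\<And>z. z \<in> {0..1} \<Longrightarrow> h (0, z) = h (1, z)) \<Longrightarrow> ip u (grad h) = 0" "ip u (\<lambda>_. (1, 0)) = 0"
proof -
  have v: "ip u h = 0" if h: "h \<in> L2" and z: "\<And>j m n. j = 1 \<or> j = -1 \<Longrightarrow> ip (perp_grad (xi j m n)) h = 0" for h
    by (rule closure_span_dual_zero[OF L2.seminormed_axioms basis_sets(3) ip_dual[OF h] _ u[unfolded hat_L2_vec_def]])
       (use z in \<open>auto simp: xi_index_iff\<close>)
  have p: "ip (perp_grad (xi j m n)) h = - ip (dz (xi j m n)) (\<lambda>p. fst (h p)) + ip (dx (xi j m n)) (\<lambda>p. snd (h p))"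
    if j: "j = 1 \<or> j = -1" and h: "h \<in> L2" for j m n and h :: "real \<times> real \<Rightarrow> real \<times> real"
  proof -
    note L = C1_L2[OF xi_C1(1)[OF j], of m n]
    have "ip (perp_grad (xi j m n)) h = ip h (\<lambda>p. (((- 1) *\<^sub>R dz (xi j m n)) p, dx (xi j m n) p))"
      using L2.sym[OF L(5) h] by (simp add: perp_grad_def fsimps)
    also have "\<dots> = ip (\<lambda>p. fst (h p)) ((- 1) *\<^sub>R dz (xi j m n)) + ip (\<lambda>p. snd (h p)) (dx (xi j m n))"
      using L by (intro ip_Pair h L2.clos)
    also have "\<dots> = - ip (dz (xi j m n)) (\<lambda>p. fst (h p)) + ip (dx (xi j m n)) (\<lambda>p. snd (h p))"
      using L L2_components[OF h] by (simp only: L2.scale_right) (simp add: L2.sym)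
    finally show ?thesis .
  qed
  show "ip u (grad h) = 0" if P: "C1 h" and per: "\<And>z. z \<in> {0..1} \<Longrightarrow> h (0, z) = h (1, z)"
  proof (rule v)
    show "grad h \<in> L2" using C1_L2 P by blast
    fix j m' n' assume j: "(j::int) = 1 \<or> j = -1"
    have j': "-j = 1 \<or> -j = -1" using j by auto
    note X = xi_C1[OF j, of m' n'] and X' = xi_C1[OF j', of m' n'] and Q = phi_C1[OF j, of m' n']
    have 1: "ip (dz (xi j m' n')) (dx h) = - ip (dx (dz (xi j m' n'))) h"
      unfolding X(3) by (intro C1_ip_by_parts_x C1_scale Q P) (simp add: fsimps xi_periodic phi_periodic per)
    have 2: "ip (dx (xi j m' n')) (dz h) = - ip (dz (dx (xi j m' n'))) h"
      unfolding X(2) by (intro C1_ip_by_parts_z C1_scale X' P) (simp add: fsimps xi_boundary)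
    have 3: "dx (dz (xi j m' n')) = dz (dx (xi j m' n'))"
      unfolding X(2,3) C1_scale[OF Q(1)] C1_scale[OF X'(1)] Q X'
      by (simp add: scaleR_scaleR mult.commute)
    show "ip (perp_grad (xi j m' n')) (grad h) = 0"
      using p[OF j C1_L2(4)[OF P]] 1 2 3 by (simp add: grad_def)
  qed
  show "ip u (\<lambda>_. (1, 0)) = 0"
  proof (rule v)
    have one: "(\<lambda>_. 1::real) \<in> L2" by (simp add: L2_def)
    show L: "(\<lambda>_. (1::real, 0::real)) \<in> L2" by (intro L2_Pair one L2_zero)
    fix j m' n' assume j: "(j::int) = 1 \<or> j = -1"
    have "C1 (phi 1 0 0)" by (rule phi_C1) simp
    moreover have "phi 1 0 0 = (\<lambda>_. 1)" by (auto simp: phi_def trig_def)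
    ultimately have c: "C1 (\<lambda>_. 1)" by simp
    have "ip (\<lambda>_. 1) (dz (xi j m' n')) = - ip (dz (\<lambda>_. 1)) (xi j m' n')"
      by (intro C1_ip_by_parts_z c xi_C1 j) (simp add: xi_boundary)
    also have "dz (\<lambda>_. 1) = (\<lambda>_. 0)" by (auto simp: dz_def)
    finally have "ip (dz (xi j m' n')) (\<lambda>_. 1) = 0"
      using L2.sym[OF one C1_L2(3)[OF xi_C1(1)[OF j]]] by (simp add: ip_def)
    then show "ip (perp_grad (xi j m' n')) (\<lambda>_. (1, 0)) = 0"
      using p[OF j L] by (simp add: ip_def)
  qed
qed

section \<open>Square integrable functions of time\<close>

abbreviation "time_measure (T::real) \<equiv> lebesgue_on {0<..<T}"

lemma finite_time: "finite_measure (time_measure T)"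
proof (rule finite_measureI)
  have "emeasure lborel {0<..<T} < \<infinity>" by (cases "0 \<le> T") auto
  then show "emeasure (time_measure T) (space (time_measure T)) \<noteq> \<infinity>"
    by (simp add: emeasure_restrict_space)
qed

lemma borel_measurable_cong_AE:
  fixes f g :: "'a::euclidean_space \<Rightarrow> real"
  assumes f: "f \<in> borel_measurable (lebesgue_on S)" and S: "S \<in> sets lebesgue"
    and ae: "AE x in lebesgue_on S. f x = g x"
  shows "g \<in> borel_measurable (lebesgue_on S)"
proof -
  have "AE x in lebesgue. (if x \<in> S then f x else 0) = (if x \<in> S then g x else 0)"
    using ae S by (subst (asm) AE_restrict_space_iff) (auto elim!: eventually_mono)
  moreover have "(\<lambda>x. if x \<in> S then f x else 0) \<in> borel_measurable lebesgue"
    using borel_measurable_if_I[OF f S] .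
  ultimately have "(\<lambda>x. if x \<in> S then g x else 0) \<in> borel_measurable lebesgue"
    by (rule borel_measurable_AE[rotated])
  then show ?thesis using borel_measurable_if_D by blast
qed

lemma borel_measurable_lim_AE:
  fixes h :: "nat \<Rightarrow> 'a::euclidean_space \<Rightarrow> real"
  assumes h: "\<And>n. h n \<in> borel_measurable (lebesgue_on S)" and S: "S \<in> sets lebesgue"
    and ae: "AE x in lebesgue_on S. (\<lambda>n. h n x) \<longlonglongrightarrow> g x"
  shows "g \<in> borel_measurable (lebesgue_on S)"
proof (rule borel_measurable_cong_AE[OF _ S])
  show "(\<lambda>x. lim (\<lambda>n. h n x)) \<in> borel_measurable (lebesgue_on S)" using h by measurable
  show "AE x in lebesgue_on S. lim (\<lambda>n. h n x) = g x" using ae by eventually_elim (rule limI)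
qed

lemma square_integrable_mult:
  fixes a b :: "'a \<Rightarrow> real"
  assumes "a \<in> borel_measurable M" "integrable M (\<lambda>t. (a t)\<^sup>2)"
    "b \<in> borel_measurable M" "integrable M (\<lambda>t. (b t)\<^sup>2)"
  shows "integrable M (\<lambda>t. a t * b t)"
proof (rule Bochner_Integration.integrable_bound)
  show "integrable M (\<lambda>t. (a t)\<^sup>2 + (b t)\<^sup>2)" using assms by simp
  have "\<bar>x * y\<bar> \<le> x\<^sup>2 + y\<^sup>2" for x y :: real
  proof -
    have "2 * (\<bar>x\<bar> * \<bar>y\<bar>) \<le> x\<^sup>2 + y\<^sup>2" using sum_squares_bound[of "\<bar>x\<bar>" "\<bar>y\<bar>"] by simp
    moreover have "0 \<le> \<bar>x\<bar> * \<bar>y\<bar>" by simp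
    ultimately show ?thesis unfolding abs_mult by linarith
  qed
  then show "AE t in M. norm (a t * b t) \<le> norm ((a t)\<^sup>2 + (b t)\<^sup>2)" by simp
qed (use assms in measurable)

lemma integral_cauchy_schwarz:
  fixes a b :: "'a \<Rightarrow> real"
  assumes a: "a \<in> borel_measurable M" "integrable M (\<lambda>t. (a t)\<^sup>2)"
    and b: "b \<in> borel_measurable M" "integrable M (\<lambda>t. (b t)\<^sup>2)"
  shows "(LINT t|M. \<bar>a t * b t\<bar>) \<le> sqrt (LINT t|M. (a t)\<^sup>2) * sqrt (LINT t|M. (b t)\<^sup>2)"
proof -
  let ?X = "{f :: 'a \<Rightarrow> real. f \<in> borel_measurable M \<and> integrable M (\<lambda>t. (f t)\<^sup>2)}"
  interpret P: pre_hilbert ?X "\<lambda>f g. LINT t|M. f t * g t" "\<lambda>f. sqrt (LINT t|M. f t * f t)"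
  proof
    show "subspace ?X"
    proof (rule subspaceI)
      show "0 \<in> ?X" by (simp add: fsimps)
      fix f g assume fg: "f \<in> ?X" "g \<in> ?X"
      then have "integrable M (\<lambda>t. (f t)\<^sup>2 + 2 * (f t * g t) + (g t)\<^sup>2)"
        by (intro Bochner_Integration.integrable_add integrable_mult_right square_integrable_mult) auto
      then show "f + g \<in> ?X" using fg by (auto simp: fsimps power2_sum algebra_simps)
    next
      fix c f assume "f \<in> ?X" then show "c *\<^sub>R f \<in> ?X" by (auto simp: fsimps power_mult_distrib)
    qed
  next
    fix f g h assume "f \<in> ?X" "g \<in> ?X" "h \<in> ?X"
    then have "integrable M (\<lambda>t. f t * h t)" "integrable M (\<lambda>t. g t * h t)"
      by (auto intro: square_integrable_mult)
    then show "(LINT t|M. (f + g) t * h t) = (LINT t|M. f t * h t) + (LINT t|M. g t * h t)"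
      by (simp add: fsimps distrib_right)
  qed (auto simp: fsimps mult.assoc, simp add: mult.commute)
  have "(\<lambda>t. \<bar>a t\<bar>) \<in> ?X" "(\<lambda>t. \<bar>b t\<bar>) \<in> ?X" using a b by auto
  from P.cauchy_schwarz[OF this] show ?thesis
    by (simp add: abs_mult power2_eq_square)
qed

text \<open>
  The absolute value as a seminorm, so that scalar functions of time are covered by the general
  theory.
\<close>

definition scalar_norm :: "real \<Rightarrow> real" where "scalar_norm x = \<bar>x\<bar>"

lemma seminormed_scalar: "seminormed UNIV scalar_norm"
  by standard (auto simp: scalar_norm_def abs_mult)

lemma bounded_scalar_L2_time:
  assumes m: "\<psi> \<in> borel_measurable (time_measure T)" and b: "\<And>t. \<bar>\<psi> t\<bar> \<le> C"
  shows "\<psi> \<in> L2_time T UNIV scalar_norm"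
proof -
  interpret finite_measure "time_measure T" by (rule finite_time)
  obtain F where F: "\<And>i. simple_function (time_measure T) (F i)"
    "\<And>x. x \<in> space (time_measure T) \<Longrightarrow> (\<lambda>i. F i x) \<longlonglongrightarrow> \<psi> x"
    using borel_measurable_implies_sequence_metric[OF m, of 0] by blast
  have "AE t in time_measure T. (\<lambda>n. scalar_norm (\<psi> t - F n t)) \<longlonglongrightarrow> 0"
  proof (intro AE_I2)
    fix t assume "t \<in> space (time_measure T)"
    from tendsto_diff[OF tendsto_const F(2)[OF this], of "\<psi> t"]
    show "(\<lambda>n. scalar_norm (\<psi> t - F n t)) \<longlonglongrightarrow> 0"
      unfolding scalar_norm_def using tendsto_rabs_zero by force
  qed
  then have "strongly_measurable T UNIV scalar_norm \<psi>" unfolding strongly_measurable_def using F(1) by blast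
  moreover have "integrable (time_measure T) (\<lambda>t. (scalar_norm (\<psi> t))\<^sup>2)"
  proof (rule integrable_const_bound)
    show "AE t in time_measure T. norm ((scalar_norm (\<psi> t))\<^sup>2) \<le> C\<^sup>2"
      using b by (auto simp: scalar_norm_def intro!: AE_I2) (metis abs_ge_zero power2_abs power_mono)
    show "(\<lambda>t. (scalar_norm (\<psi> t))\<^sup>2) \<in> borel_measurable (time_measure T)"
      unfolding scalar_norm_def using m by measurable
  qed
  ultimately show ?thesis by (simp add: L2_time_def)
qed

context seminormed
begin

lemma L2_timeD:
  assumes "f \<in> L2_time T X nrm"
  shows "AE t in time_measure T. f t \<in> X" "integrable (time_measure T) (\<lambda>t. (nrm (f t))\<^sup>2)"
    "strongly_measurable T X nrm f"
  using assms by (auto simp: L2_time_def)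

lemma nrm_continuous:
  assumes "f \<in> X" "\<And>n. s n \<in> X" "(\<lambda>n. nrm (f - s n)) \<longlonglongrightarrow> 0"
  shows "(\<lambda>n. nrm (s n)) \<longlonglongrightarrow> nrm f"
proof -
  have "(\<lambda>n. nrm (s n) - nrm f) \<longlonglongrightarrow> 0"
  proof (rule tendsto_rabs_zero_cancel, rule tendsto_sandwich[OF _ _ tendsto_const assms(3)])
    show "\<forall>\<^sub>F n in sequentially. \<bar>nrm (s n) - nrm f\<bar> \<le> nrm (f - s n)"
      using reverse_triangle[OF assms(1,2)] by (simp add: abs_minus_commute)
  qed simp
  then show ?thesis by (simp add: LIM_zero_iff)
qed

text \<open>
  The approximating simple functions take values in the carrier, where the norm is continuous; the
  limit is measurable because the Lebesgue measure is complete.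
\<close>

lemma measurable_nrm:
  assumes f: "strongly_measurable T X nrm f" "AE t in time_measure T. f t \<in> X"
  shows "(\<lambda>t. nrm (f t)) \<in> borel_measurable (time_measure T)"
proof -
  obtain s where s: "\<And>n. simple_function (time_measure T) (s n)" "\<And>n. s n ` {0<..<T} \<subseteq> X"
    "AE t in time_measure T. (\<lambda>n. nrm (f t - s n t)) \<longlonglongrightarrow> 0"
    using f unfolding strongly_measurable_def by blast
  show ?thesis
  proof (rule borel_measurable_lim_AE[where h = "\<lambda>n t. nrm (s n t)"])
    show "(\<lambda>t. nrm (s n t)) \<in> borel_measurable (time_measure T)" for n
      using simple_function_compose1[OF s(1)[of n], of nrm] by (rule borel_measurable_simple_function)
    show "AE t in time_measure T. (\<lambda>n. nrm (s n t)) \<longlonglongrightarrow> nrm (f t)"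
      using f(2) s(3) AE_space
    proof eventually_elim
      case (elim t)
      have "s n t \<in> X" for n using s(2)[of n] elim(3) by auto
      then show ?case using nrm_continuous[OF elim(1) _ elim(2)] by simp
    qed
  qed simp
qed

lemma L2_time_measurable: "f \<in> L2_time T X nrm \<Longrightarrow> (\<lambda>t. nrm (f t)) \<in> borel_measurable (time_measure T)"
  using measurable_nrm L2_timeD by blast

lemma L2_time_norm_nonneg: "0 \<le> L2_time_norm T nrm f"
  by (simp add: L2_time_norm_def)

lemma L2_time_norm_square: "(L2_time_norm T nrm f)\<^sup>2 = (LINT t|time_measure T. (nrm (f t))\<^sup>2)"
  by (simp add: L2_time_norm_def)

lemma L2_time_diff:
  assumes f: "f \<in> L2_time T X nrm" and g: "g \<in> L2_time T X nrm"
  shows "(\<lambda>t. f t - g t) \<in> L2_time T X nrm"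
    "(L2_time_norm T nrm (\<lambda>t. f t - g t))\<^sup>2 \<le> 2 * (L2_time_norm T nrm f)\<^sup>2 + 2 * (L2_time_norm T nrm g)\<^sup>2"
proof -
  obtain s where s: "\<And>n. simple_function (time_measure T) (s n)" "\<And>n. s n ` {0<..<T} \<subseteq> X"
    "AE t in time_measure T. (\<lambda>n. nrm (f t - s n t)) \<longlonglongrightarrow> 0"
    using L2_timeD(3)[OF f] unfolding strongly_measurable_def by blast
  obtain r where r: "\<And>n. simple_function (time_measure T) (r n)" "\<And>n. r n ` {0<..<T} \<subseteq> X"
    "AE t in time_measure T. (\<lambda>n. nrm (g t - r n t)) \<longlonglongrightarrow> 0"
    using L2_timeD(3)[OF g] unfolding strongly_measurable_def by blast
  have X: "AE t in time_measure T. f t - g t \<in> X"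
    using L2_timeD(1)[OF f] L2_timeD(1)[OF g] by eventually_elim (rule closed)
  have sm: "strongly_measurable T X nrm (\<lambda>t. f t - g t)"
    unfolding strongly_measurable_def
  proof (intro exI[of _ "\<lambda>n t. s n t - r n t"] conjI allI)
    show "simple_function (time_measure T) (\<lambda>t. s n t - r n t)" for n
      by (rule simple_function_compose2[OF s(1) r(1)])
    show "(\<lambda>t. s n t - r n t) ` {0<..<T} \<subseteq> X" for n
    proof (rule image_subsetI)
      fix t assume "t \<in> {0<..<T}"
      then show "s n t - r n t \<in> X" using s(2)[of n] r(2)[of n] by (intro closed(3)) auto
    qed
    show "AE t in time_measure T. (\<lambda>n. nrm (f t - g t - (s n t - r n t))) \<longlonglongrightarrow> 0"
      using s(3) r(3) L2_timeD(1)[OF f] L2_timeD(1)[OF g] AE_space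
    proof eventually_elim
      case (elim t)
      have X: "s n t \<in> X" "r n t \<in> X" for n using elim(5) s(2)[of n] r(2)[of n] by auto
      have "(\<lambda>n. nrm (f t - s n t) + nrm (g t - r n t)) \<longlonglongrightarrow> 0 + 0" by (intro tendsto_add elim)
      moreover have "nrm (f t - g t - (s n t - r n t)) \<le> nrm (f t - s n t) + nrm (g t - r n t)" for n
      proof -
        have "f t - g t - (s n t - r n t) = (f t - s n t) - (g t - r n t)" by simp
        then show ?thesis using triangle_diff[OF closed(3)[OF elim(3) X(1)[of n]] closed(3)[OF elim(4) X(2)[of n]]] by (simp only:)
      qed
      ultimately show ?case
        using tendsto_sandwich[of "\<lambda>_. 0" "\<lambda>n. nrm (f t - g t - (s n t - r n t))" sequentially
            "\<lambda>n. nrm (f t - s n t) + nrm (g t - r n t)" 0]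
          nrm_nonneg closed(3) elim X by (simp add: always_eventually)
    qed
  qed
  have le: "AE t in time_measure T. (nrm (f t - g t))\<^sup>2 \<le> 2 * (nrm (f t))\<^sup>2 + 2 * (nrm (g t))\<^sup>2"
    using L2_timeD(1)[OF f] L2_timeD(1)[OF g]
  proof eventually_elim
    case (elim t)
    have "(nrm (f t - g t))\<^sup>2 \<le> (nrm (f t) + nrm (g t))\<^sup>2"
      using elim by (intro power_mono triangle_diff nrm_nonneg closed)
    also have "\<dots> \<le> 2 * (nrm (f t))\<^sup>2 + 2 * (nrm (g t))\<^sup>2"
      using sum_squares_bound[of "nrm (f t)" "nrm (g t)"] by (simp add: power2_sum)
    finally show ?case .
  qed
  have i: "integrable (time_measure T) (\<lambda>t. 2 * (nrm (f t))\<^sup>2 + 2 * (nrm (g t))\<^sup>2)"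
    using L2_timeD(2)[OF f] L2_timeD(2)[OF g] by simp
  have m: "(\<lambda>t. nrm (f t - g t)) \<in> borel_measurable (time_measure T)" by (rule measurable_nrm[OF sm X])
  have int: "integrable (time_measure T) (\<lambda>t. (nrm (f t - g t))\<^sup>2)"
    by (rule Bochner_Integration.integrable_bound[OF i]) (use m le in auto)
  show "(\<lambda>t. f t - g t) \<in> L2_time T X nrm" using X sm int by (simp add: L2_time_def)
  have "(LINT t|time_measure T. (nrm (f t - g t))\<^sup>2) \<le> (LINT t|time_measure T. 2 * (nrm (f t))\<^sup>2 + 2 * (nrm (g t))\<^sup>2)"
    by (rule integral_mono_AE[OF int i le])
  then show "(L2_time_norm T nrm (\<lambda>t. f t - g t))\<^sup>2 \<le> 2 * (L2_time_norm T nrm f)\<^sup>2 + 2 * (L2_time_norm T nrm g)\<^sup>2"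
    using L2_timeD(2)[OF f] L2_timeD(2)[OF g] by (simp add: L2_time_norm_square)
qed

end

locale bounded_form = X: seminormed X nX + Y: seminormed Y nY
  for X :: "'a::real_vector set" and nX and Y :: "'b::real_vector set" and nY +
  fixes B :: "'a \<Rightarrow> 'b \<Rightarrow> real" and C :: real
  assumes form_add_left: "\<And>f f' g. f \<in> X \<Longrightarrow> f' \<in> X \<Longrightarrow> g \<in> Y \<Longrightarrow> B (f + f') g = B f g + B f' g"
    and form_scale_left: "\<And>c f g. f \<in> X \<Longrightarrow> g \<in> Y \<Longrightarrow> B (c *\<^sub>R f) g = c * B f g"
    and form_add_right: "\<And>f g g'. f \<in> X \<Longrightarrow> g \<in> Y \<Longrightarrow> g' \<in> Y \<Longrightarrow> B f (g + g') = B f g + B f g'"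
    and form_bound: "\<And>f g. f \<in> X \<Longrightarrow> g \<in> Y \<Longrightarrow> \<bar>B f g\<bar> \<le> C * (nX f * nY g)"
begin

lemma form_diff: assumes "f \<in> X" "f' \<in> X" "g \<in> Y" "g' \<in> Y"
  shows "B f g - B f' g' = B (f - f') g + B f' (g - g')"
  using form_add_left[of "f - f'" f' g] form_add_right[of f' "g - g'" g'] assms X.closed Y.closed by simp

lemma form_time:
  assumes f: "f \<in> L2_time T X nX" and g: "g \<in> L2_time T Y nY"
  shows "integrable (time_measure T) (\<lambda>t. B (f t) (g t))"
    "(LINT t|time_measure T. \<bar>B (f t) (g t)\<bar>) \<le> \<bar>C\<bar> * (L2_time_norm T nX f * L2_time_norm T nY g)"
proof -
  obtain s where s: "\<And>n. simple_function (time_measure T) (s n)" "\<And>n. s n ` {0<..<T} \<subseteq> X"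
    "AE t in time_measure T. (\<lambda>n. nX (f t - s n t)) \<longlonglongrightarrow> 0"
    using X.L2_timeD(3)[OF f] unfolding strongly_measurable_def by blast
  obtain r where r: "\<And>n. simple_function (time_measure T) (r n)" "\<And>n. r n ` {0<..<T} \<subseteq> Y"
    "AE t in time_measure T. (\<lambda>n. nY (g t - r n t)) \<longlonglongrightarrow> 0"
    using Y.L2_timeD(3)[OF g] unfolding strongly_measurable_def by blast
  have m: "(\<lambda>t. B (f t) (g t)) \<in> borel_measurable (time_measure T)"
  proof (rule borel_measurable_lim_AE[where h = "\<lambda>n t. B (s n t) (r n t)"])
    show "(\<lambda>t. B (s n t) (r n t)) \<in> borel_measurable (time_measure T)" for n
      using simple_function_compose2[OF s(1)[of n] r(1)[of n], of B] by (rule borel_measurable_simple_function)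
    show "AE t in time_measure T. (\<lambda>n. B (s n t) (r n t)) \<longlonglongrightarrow> B (f t) (g t)"
      using s(3) r(3) X.L2_timeD(1)[OF f] Y.L2_timeD(1)[OF g] AE_space
    proof eventually_elim
      case (elim t)
      have M: "s n t \<in> X" "r n t \<in> Y" for n using elim(5) s(2)[of n] r(2)[of n] by auto
      have le: "\<bar>B (f t) (g t) - B (s n t) (r n t)\<bar> \<le> C * (nX (f t - s n t) * nY (g t)) + C * (nX (s n t) * nY (g t - r n t))" for n
        unfolding form_diff[OF elim(3) M(1) elim(4) M(2)]
        by (rule order_trans[OF abs_triangle_ineq add_mono[OF form_bound form_bound]])
          (intro elim M X.closed(3) Y.closed(3))+
      have "(\<lambda>n. nX (s n t)) \<longlonglongrightarrow> nX (f t)" by (rule X.nrm_continuous[OF elim(3) M(1) elim(1)])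
      then have "(\<lambda>n. C * (nX (f t - s n t) * nY (g t)) + C * (nX (s n t) * nY (g t - r n t)))
          \<longlonglongrightarrow> C * (0 * nY (g t)) + C * (nX (f t) * 0)"
        by (intro tendsto_add tendsto_mult tendsto_const elim(1,2))
      then have z: "(\<lambda>n. C * (nX (f t - s n t) * nY (g t)) + C * (nX (s n t) * nY (g t - r n t))) \<longlonglongrightarrow> 0"
        by (simp only: mult_zero_left mult_zero_right add_0)
      have "(\<lambda>n. B (f t) (g t) - B (s n t) (r n t)) \<longlonglongrightarrow> 0"
      proof (rule Lim_null_comparison[OF always_eventually z], rule allI)
        show "norm (B (f t) (g t) - B (s n t) (r n t))
          \<le> C * (nX (f t - s n t) * nY (g t)) + C * (nX (s n t) * nY (g t - r n t))" for n
          using le[of n] by (simp only: real_norm_def)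
      qed
      from tendsto_diff[OF tendsto_const[of "B (f t) (g t)"] this] show ?case by simp
    qed
  qed simp
  note fm = X.L2_time_measurable[OF f] and gm = Y.L2_time_measurable[OF g]
  note fi = X.L2_timeD(2)[OF f] and gi = Y.L2_timeD(2)[OF g]
  have fg: "integrable (time_measure T) (\<lambda>t. nX (f t) * nY (g t))"
    by (rule square_integrable_mult[OF fm fi gm gi])
  have le: "AE t in time_measure T. \<bar>B (f t) (g t)\<bar> \<le> C * (nX (f t) * nY (g t))"
    using X.L2_timeD(1)[OF f] Y.L2_timeD(1)[OF g] by eventually_elim (rule form_bound)
  have le': "AE t in time_measure T. \<bar>B (f t) (g t)\<bar> \<le> \<bar>C\<bar> * \<bar>nX (f t) * nY (g t)\<bar>"
    using le
  proof eventually_elim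
    case (elim t)
    also have "C * (nX (f t) * nY (g t)) \<le> \<bar>C * (nX (f t) * nY (g t))\<bar>" by (rule abs_ge_self)
    finally show ?case by (simp only: abs_mult[of C])
  qed
  show i: "integrable (time_measure T) (\<lambda>t. B (f t) (g t))"
    by (rule Bochner_Integration.integrable_bound[OF integrable_mult_right[OF fg, of C] m])
       (use le in \<open>auto elim!: eventually_mono\<close>)
  have "(LINT t|time_measure T. \<bar>B (f t) (g t)\<bar>) \<le> (LINT t|time_measure T. \<bar>C\<bar> * \<bar>nX (f t) * nY (g t)\<bar>)"
    by (rule integral_mono_AE[OF _ _ le']) (use i fg in auto)
  also have "\<dots> = \<bar>C\<bar> * (LINT t|time_measure T. \<bar>nX (f t) * nY (g t)\<bar>)" by simp
  also have "\<dots> \<le> \<bar>C\<bar> * (L2_time_norm T nX f * L2_time_norm T nY g)"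
    unfolding L2_time_norm_def by (intro mult_left_mono integral_cauchy_schwarz fm fi gm gi) simp
  finally show "(LINT t|time_measure T. \<bar>B (f t) (g t)\<bar>) \<le> \<bar>C\<bar> * (L2_time_norm T nX f * L2_time_norm T nY g)" .
qed

lemma form_time_bound:
  assumes f: "f \<in> L2_time T X nX" and g: "g \<in> L2_time T Y nY"
  shows "\<bar>LINT t|time_measure T. B (f t) (g t)\<bar> \<le> \<bar>C\<bar> * (L2_time_norm T nX f * L2_time_norm T nY g)"
  using integral_abs_bound[of "time_measure T" "\<lambda>t. B (f t) (g t)"] form_time(2)[OF assms] by linarith

text \<open>
  In particular for a form and a fixed second argument: this supplies all functionals against
  which weak convergence in time is used.
\<close>

lemma form_time_dual:
  assumes g: "g \<in> L2_time T Y nY"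
  shows "(\<lambda>f. LINT t|time_measure T. B (f t) (g t)) \<in> dual (L2_time T X nX) (L2_time_norm T nX)"
proof (rule dualI[where C = "\<bar>C\<bar> * L2_time_norm T nY g"])
  fix f f' assume f: "f \<in> L2_time T X nX" and f': "f' \<in> L2_time T X nX"
  have i: "integrable (time_measure T) (\<lambda>t. B (f t) (g t) + B (f' t) (g t))"
    using form_time(1)[OF f g] form_time(1)[OF f' g] by simp
  have ae: "AE t in time_measure T. B (f t) (g t) + B (f' t) (g t) = B ((f + f') t) (g t)"
    using X.L2_timeD(1)[OF f] X.L2_timeD(1)[OF f'] Y.L2_timeD(1)[OF g]
    by eventually_elim (simp add: form_add_left)
  have m: "(\<lambda>t. B ((f + f') t) (g t)) \<in> borel_measurable (time_measure T)"
    by (rule borel_measurable_cong_AE[OF borel_measurable_integrable[OF i] _ ae]) simp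
  have "(LINT t|time_measure T. B ((f + f') t) (g t)) = (LINT t|time_measure T. B (f t) (g t) + B (f' t) (g t))"
    by (rule integral_cong_AE[OF m borel_measurable_integrable[OF i]]) (use ae in \<open>auto elim!: eventually_mono\<close>)
  then show "(LINT t|time_measure T. B ((f + f') t) (g t)) = (LINT t|time_measure T. B (f t) (g t)) + (LINT t|time_measure T. B (f' t) (g t))"
    using form_time(1)[OF f g] form_time(1)[OF f' g] by simp
next
  fix c f assume f: "f \<in> L2_time T X nX"
  have i: "integrable (time_measure T) (\<lambda>t. c * B (f t) (g t))" using form_time(1)[OF f g] by simp
  have ae: "AE t in time_measure T. c * B (f t) (g t) = B ((c *\<^sub>R f) t) (g t)"
    using X.L2_timeD(1)[OF f] Y.L2_timeD(1)[OF g]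
    by eventually_elim (simp add: form_scale_left scaleR_fun_def)
  have m: "(\<lambda>t. B ((c *\<^sub>R f) t) (g t)) \<in> borel_measurable (time_measure T)"
    by (rule borel_measurable_cong_AE[OF borel_measurable_integrable[OF i] _ ae]) simp
  have "(LINT t|time_measure T. B ((c *\<^sub>R f) t) (g t)) = (LINT t|time_measure T. c * B (f t) (g t))"
    by (rule integral_cong_AE[OF m borel_measurable_integrable[OF i]]) (use ae in \<open>auto elim!: eventually_mono\<close>)
  then show "(LINT t|time_measure T. B ((c *\<^sub>R f) t) (g t)) = c * (LINT t|time_measure T. B (f t) (g t))" by simp
next
  fix f assume "f \<in> L2_time T X nX"
  from form_time_bound[OF this g]
  show "\<bar>LINT t|time_measure T. B (f t) (g t)\<bar> \<le> \<bar>C\<bar> * L2_time_norm T nY g * L2_time_norm T nX f"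
    by (simp add: mult_ac)
qed

lemma form_weak_limit:
  assumes "weakly_converges_L2_time T X nX fs f" "g \<in> L2_time T Y nY"
  shows "(\<lambda>j. LINT t|time_measure T. B (fs j t) (g t)) \<longlonglongrightarrow> (LINT t|time_measure T. B (f t) (g t))"
proof -
  have "\<forall>F\<in>dual (L2_time T X nX) (L2_time_norm T nX). (\<lambda>j. F (fs j)) \<longlonglongrightarrow> F f"
    using assms(1) unfolding weakly_converges_L2_time_def weakly_converges_def by blast
  from bspec[OF this form_time_dual[OF assms(2)]] show ?thesis .
qed

end

lemma dual_form:
  assumes "seminormed X nX" "l \<in> dual X nX"
  obtains C where "C \<ge> 0" "bounded_form X nX UNIV scalar_norm (\<lambda>f c. c * l f) C"
    "\<And>f. f \<in> X \<Longrightarrow> \<bar>l f\<bar> \<le> C * nX f"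
proof -
  obtain C where C: "C \<ge> 0" "\<And>f. f \<in> X \<Longrightarrow> \<bar>l f\<bar> \<le> C * nX f" using dual_bound[OF assms] by blast
  have "bounded_form X nX UNIV scalar_norm (\<lambda>f c. c * l f) C"
  proof (intro bounded_form.intro assms seminormed_scalar bounded_form_axioms.intro)
    fix f c assume f: "f \<in> X"
    show "\<bar>c * l f\<bar> \<le> C * (nX f * scalar_norm c)"
      using mult_left_mono[OF C(2)[OF f], of "\<bar>c\<bar>"] by (simp add: abs_mult scalar_norm_def mult_ac)
  qed (use dualD[OF assms(2)] in \<open>auto simp: algebra_simps\<close>)
  with C that show ?thesis by blast
qed

text \<open>
  A functional in space times a bounded scalar function of time is a functional on functions of
  time.
\<close>

lemma dual_time:
  assumes "seminormed X nX" "l \<in> dual X nX" "\<psi> \<in> borel_measurable (time_measure T)" "\<And>t. \<bar>\<psi> t\<bar> \<le> 1"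
  shows "f \<in> L2_time T X nX \<Longrightarrow> integrable (time_measure T) (\<lambda>t. \<psi> t * l (f t))"
    "weakly_converges_L2_time T X nX fs f \<Longrightarrow>
      (\<lambda>j. LINT t|time_measure T. \<psi> t * l (fs j t)) \<longlonglongrightarrow> (LINT t|time_measure T. \<psi> t * l (f t))"
proof -
  obtain C where "bounded_form X nX UNIV scalar_norm (\<lambda>f c. c * l f) C" using dual_form[OF assms(1,2)] by blast
  then interpret bounded_form X nX UNIV scalar_norm "\<lambda>f c. c * l f" C .
  have p: "\<psi> \<in> L2_time T UNIV scalar_norm" using bounded_scalar_L2_time[OF assms(3,4)] .
  show "f \<in> L2_time T X nX \<Longrightarrow> integrable (time_measure T) (\<lambda>t. \<psi> t * l (f t))"
    using form_time(1)[OF _ p] .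
  show "weakly_converges_L2_time T X nX fs f \<Longrightarrow>
      (\<lambda>j. LINT t|time_measure T. \<psi> t * l (fs j t)) \<longlonglongrightarrow> (LINT t|time_measure T. \<psi> t * l (f t))"
    using form_weak_limit[OF _ p] .
qed

lemma dual_time_integrable:
  assumes "seminormed X nX" "l \<in> dual X nX" "f \<in> L2_time T X nX"
  shows "integrable (time_measure T) (\<lambda>t. l (f t))" "integrable (time_measure T) (\<lambda>t. (l (f t))\<^sup>2)"
proof -
  show i: "integrable (time_measure T) (\<lambda>t. l (f t))"
    using dual_time(1)[OF assms(1,2) _ _ assms(3), of "\<lambda>_. 1"] by simp
  obtain C where C: "C \<ge> 0" "\<And>f. f \<in> X \<Longrightarrow> \<bar>l f\<bar> \<le> C * nX f" using dual_bound[OF assms(1,2)] by blast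
  show "integrable (time_measure T) (\<lambda>t. (l (f t))\<^sup>2)"
  proof (rule Bochner_Integration.integrable_bound)
    show "integrable (time_measure T) (\<lambda>t. C\<^sup>2 * (nX (f t))\<^sup>2)"
      using seminormed.L2_timeD(2)[OF assms(1,3)] by simp
    show "AE t in time_measure T. norm ((l (f t))\<^sup>2) \<le> norm (C\<^sup>2 * (nX (f t))\<^sup>2)"
      using seminormed.L2_timeD(1)[OF assms(1,3)]
    proof eventually_elim
      case (elim t)
      have "\<bar>l (f t)\<bar>\<^sup>2 \<le> (C * nX (f t))\<^sup>2" by (intro power_mono C elim) simp
      then show ?case by (simp add: power_mult_distrib)
    qed
  qed (use i in measurable)
qed

text \<open>
  Testing with the sign of \<open>E\<close> gives the integral of its absolute value.
\<close>

lemma AE_zero_test: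
  assumes E: "integrable (time_measure T) E"
    and z: "\<And>\<psi>. \<psi> \<in> borel_measurable (time_measure T) \<Longrightarrow> (\<And>t. \<bar>\<psi> t\<bar> \<le> 1) \<Longrightarrow> (LINT t|time_measure T. \<psi> t * E t) = 0"
  shows "AE t in time_measure T. E t = (0::real)"
proof -
  have "(LINT t|time_measure T. sgn (E t) * E t) = 0" using E by (intro z) (auto simp: sgn_if)
  then have "(LINT t|time_measure T. \<bar>E t\<bar>) = 0" by (simp add: abs_sgn mult.commute)
  then have "AE t in time_measure T. \<bar>E t\<bar> = 0" using E by (subst (asm) integral_nonneg_eq_0_iff_AE) auto
  then show ?thesis by simp
qed

section \<open>Weakly convergent sequences are bounded\<close>

text \<open>
  A gliding hump argument, which needs no completeness of the space. If the norms were unbounded,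
  there would be terms of norm above \<open>4 ^ k\<close>. The functional built from their norming
  functionals with weights \<open>3 ^ (-k)\<close> and signs chosen so that no cancellation occurs
  is bounded, but of order \<open>(4/3) ^ k\<close> on these terms, whereas it should converge
  along the sequence.
\<close>

lemma uniform_boundedness:
  fixes fs :: "nat \<Rightarrow> 'a::real_vector"
  assumes w: "weakly_converges X nrm fs f" and F: "\<And>j. F j \<in> dual X nrm"
    and le: "\<And>j g. g \<in> X \<Longrightarrow> \<bar>F j g\<bar> \<le> nrm g" and eq: "\<And>j. F j (fs j) = nrm (fs j)"
  shows "\<exists>C\<ge>0. \<forall>j. nrm (fs j) \<le> C"
proof (rule ccontr)
  assume neg: "\<not> ?thesis"
  have "\<exists>j. nrm (fs j) > 4 ^ k" for k :: nat
    using neg by (meson not_le zero_le_numeral zero_le_power)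
  then obtain s where s: "\<And>k. nrm (fs (s k)) > 4 ^ k" by metis
  have fX: "fs j \<in> X" for j using w by (simp add: weakly_converges_def)
  \<comment> \<open>The partial sums of the functional. The sign of the new term depends on the value of the
    earlier ones at the point where that term is large.\<close>
  define G where "G = rec_nat (\<lambda>_. 0 :: real) (\<lambda>k G h. G h + (if G (fs (s k)) \<ge> 0 then 1 else -1) * (1/3)^k * F (s k) h)"
  define \<sigma> :: "nat \<Rightarrow> real" where "\<sigma> k = (if G k (fs (s k)) \<ge> 0 then 1 else -1)" for k
  have G0: "G 0 h = 0" and GS: "G (Suc k) h = G k h + \<sigma> k * (1/3)^k * F (s k) h" for k h
    by (simp_all add: G_def \<sigma>_def)
  define a where "a h k = \<sigma> k * (1/3)^k * F (s k) h" for h k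
  have Gsum: "G k h = (\<Sum>i<k. a h i)" for k h by (induction k) (simp_all add: G0 GS a_def)
  have abs_a: "\<bar>a h k\<bar> \<le> (1/3)^k * nrm h" if "h \<in> X" for h k
  proof -
    have "\<bar>a h k\<bar> = (1/3)^k * \<bar>F (s k) h\<bar>" by (simp add: a_def abs_mult \<sigma>_def)
    then show ?thesis using le[OF that, of "s k"] by (simp add: mult_left_mono)
  qed
  have gs: "summable (\<lambda>k. (1/3::real)^k * c)" for c by (intro summable_mult2 summable_geometric) simp
  have sa: "summable (\<lambda>k. \<bar>a h k\<bar>)" if "h \<in> X" for h
    by (rule summable_comparison_test[OF _ gs[of "nrm h"]]) (use abs_a[OF that] in auto)
  have gsum: "(\<Sum>k. (1/3::real)^k * c) = 3/2 * c" for c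
    using suminf_mult2[OF summable_geometric[of "1/3::real"], of c] suminf_geometric[of "1/3::real"] by simp
  have sa': "summable (a h)" if "h \<in> X" for h using sa[OF that] by (rule summable_rabs_cancel)
  define L where "L h = (\<Sum>k. a h k)" for h
  have L: "L \<in> dual X nrm"
  proof (rule dualI[where C = "3/2"])
    fix g h assume gh: "g \<in> X" "h \<in> X"
    have "a (g + h) = (\<lambda>k. a g k + a h k)" using dualD(1)[OF F gh] by (auto simp: a_def algebra_simps)
    then show "L (g + h) = L g + L h" unfolding L_def using suminf_add[OF sa'[OF gh(1)] sa'[OF gh(2)]] by simp
  next
    fix c h assume h: "h \<in> X"
    have "a (c *\<^sub>R h) = (\<lambda>k. c * a h k)" using dualD(2)[OF F h] by (auto simp: a_def)
    then show "L (c *\<^sub>R h) = c * L h" unfolding L_def using suminf_mult[OF sa'[OF h]] by simp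
  next
    fix h assume h: "h \<in> X"
    have "\<bar>L h\<bar> \<le> (\<Sum>k. \<bar>a h k\<bar>)" unfolding L_def by (rule summable_rabs[OF sa[OF h]])
    also have "\<dots> \<le> (\<Sum>k. (1/3)^k * nrm h)" by (rule suminf_le[OF abs_a[OF h] sa[OF h] gs])
    also have "\<dots> = 3/2 * nrm h" by (rule gsum)
    finally show "\<bar>L h\<bar> \<le> 3/2 * nrm h" .
  qed
  have big: "\<bar>L (fs (s k))\<bar> \<ge> 1/2 * (4/3)^k" for k
  proof -
    let ?h = "fs (s k)"
    have n0: "nrm ?h > 0" using s[of k] by (smt (verit) zero_le_power)
    define q where "q = (1/3)^k * nrm ?h"
    have "q > 0" using n0 by (simp add: q_def)
    then have "\<bar>G k ?h + \<sigma> k * q\<bar> = \<bar>G k ?h\<bar> + q" by (auto simp: \<sigma>_def)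
    then have "\<bar>G (Suc k) ?h\<bar> = \<bar>G k ?h\<bar> + (1/3)^k * nrm ?h"
      unfolding GS eq q_def by (simp add: mult.assoc)
    then have 1: "\<bar>G (Suc k) ?h\<bar> \<ge> (1/3)^k * nrm ?h" by simp
    have "L ?h = (\<Sum>i. a ?h (i + Suc k)) + G (Suc k) ?h"
      unfolding L_def Gsum by (rule suminf_split_initial_segment[OF sa'[OF fX]])
    \<comment> \<open>The later terms have total weight \<open>3 ^ (-k) / 2\<close>, which is half the weight
      of the \<open>k\<close>-th one.\<close>
    moreover have "\<bar>\<Sum>i. a ?h (i + Suc k)\<bar> \<le> 1/2 * ((1/3)^k * nrm ?h)"
    proof -
      have sum2: "summable (\<lambda>i. \<bar>a ?h (i + Suc k)\<bar>)" using sa[OF fX] by (subst summable_iff_shift)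
      have "\<bar>\<Sum>i. a ?h (i + Suc k)\<bar> \<le> (\<Sum>i. \<bar>a ?h (i + Suc k)\<bar>)" by (rule summable_rabs[OF sum2])
      also have "\<dots> \<le> (\<Sum>i. (1/3)^i * ((1/3)^Suc k * nrm ?h))"
      proof (intro suminf_le sum2 gs)
        show "\<bar>a ?h (i + Suc k)\<bar> \<le> (1/3)^i * ((1/3)^Suc k * nrm ?h)" for i
          using abs_a[OF fX, of "s k" "i + Suc k"] by (simp only: power_add mult.assoc)
      qed
      also have "\<dots> = 3/2 * ((1/3)^Suc k * nrm ?h)"
        by (rule gsum)
      finally show ?thesis by (simp add: mult.commute)
    qed
    ultimately have "\<bar>L ?h\<bar> \<ge> 1/2 * ((1/3)^k * nrm ?h)" using 1 by linarith
    also have "1/2 * ((1/3)^k * nrm ?h) \<ge> 1/2 * ((1/3)^k * 4^k)"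
      using s[of k] by (intro mult_left_mono) auto
    also have "1/2 * ((1/3::real)^k * 4^k) = 1/2 * (4/3)^k" by (simp add: power_divide)
    finally show ?thesis by simp
  qed
  have "(\<lambda>j. L (fs j)) \<longlonglongrightarrow> L f" using w L by (simp add: weakly_converges_def)
  then have "Bseq (\<lambda>j. L (fs j))" using convergentI convergent_imp_Bseq by blast
  then obtain K where K: "\<And>j. \<bar>L (fs j)\<bar> \<le> K" unfolding Bseq_def by auto
  obtain k where "(4/3)^k > 2 * K" using real_arch_pow[of "4/3" "2 * K"] by auto
  then show False using big[of k] K[of "s k"] by simp
qed

text \<open>
  The norming functional of an element is the inner product with it, divided by its norm.
\<close>

lemma weak_time_bounded:
  assumes H: "pre_hilbert X B nrm" and w: "weakly_converges_L2_time T X nrm fs f"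
  shows "\<exists>C\<ge>0. \<forall>j. L2_time_norm T nrm (fs j) \<le> C"
proof -
  interpret pre_hilbert X B nrm by (rule H)
  interpret F: bounded_form X nrm X nrm B 1
  proof (intro bounded_form.intro seminormed_axioms bounded_form_axioms.intro)
    show "\<bar>B f g\<bar> \<le> 1 * (nrm f * nrm g)" if "f \<in> X" "g \<in> X" for f g using cauchy_schwarz[OF that] by simp
  qed (auto simp: add_left scale_left add_right)
  let ?n = "L2_time_norm T nrm" and ?X = "L2_time T X nrm"
  have w': "weakly_converges ?X ?n fs f" using w by (simp add: weakly_converges_L2_time_def)
  have fX: "fs j \<in> ?X" for j using w' by (simp add: weakly_converges_def)
  show ?thesis
  proof (rule uniform_boundedness[OF w'])
    fix j
    let ?F = "\<lambda>g. LINT t|time_measure T. B (g t) (fs j t)"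
    show "(\<lambda>g. (1 / ?n (fs j)) * ?F g) \<in> dual ?X ?n" by (rule dual_scale[OF F.form_time_dual[OF fX]])
    show "\<bar>(1 / ?n (fs j)) * ?F g\<bar> \<le> ?n g" if g: "g \<in> ?X" for g
    proof (cases "?n (fs j) = 0")
      case True then show ?thesis by (simp add: L2_time_norm_nonneg)
    next
      case False
      then have "?n (fs j) > 0" using L2_time_norm_nonneg[of T "fs j"] by linarith
      then show ?thesis using F.form_time_bound[OF g fX, of j] by (simp add: abs_mult divide_le_eq)
    qed
    have "?F (fs j) = (LINT t|time_measure T. (nrm (fs j t))\<^sup>2)"
    proof (rule integral_cong_AE)
      show "AE t in time_measure T. B (fs j t) (fs j t) = (nrm (fs j t))\<^sup>2"
        using L2_timeD(1)[OF fX[of j]] by eventually_elim (simp add: nrm_square)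
      show "(\<lambda>t. B (fs j t) (fs j t)) \<in> borel_measurable (time_measure T)"
        using F.form_time(1)[OF fX fX] by measurable
      show "(\<lambda>t. (nrm (fs j t))\<^sup>2) \<in> borel_measurable (time_measure T)"
        using L2_timeD(2)[OF fX] by measurable
    qed
    also have "\<dots> = ?n (fs j) * ?n (fs j)" by (simp only: L2_time_norm_square[symmetric] power2_eq_square[of "?n (fs j)"])
    finally show "(1 / ?n (fs j)) * ?F (fs j) = ?n (fs j)" by simp
  qed
qed

section \<open>Derivatives of partial sums\<close>

lemma C1_sum:
  assumes "finite I" "\<And>k. k \<in> I \<Longrightarrow> C1 (e k)"
  shows "C1 (\<Sum>k\<in>I. c k *\<^sub>R e k)" "dx (\<Sum>k\<in>I. c k *\<^sub>R e k) = (\<Sum>k\<in>I. c k *\<^sub>R dx (e k))"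
    "dz (\<Sum>k\<in>I. c k *\<^sub>R e k) = (\<Sum>k\<in>I. c k *\<^sub>R dz (e k))"
proof -
  have "C1 (\<Sum>k\<in>I. c k *\<^sub>R e k) \<and> dx (\<Sum>k\<in>I. c k *\<^sub>R e k) = (\<Sum>k\<in>I. c k *\<^sub>R dx (e k)) \<and>
    dz (\<Sum>k\<in>I. c k *\<^sub>R e k) = (\<Sum>k\<in>I. c k *\<^sub>R dz (e k))"
    using assms
  proof (induction I rule: finite_induct)
    case empty
    then show ?case by (simp only: sum.empty C1_zero simp_thms)
  next
    case (insert k I)
    have k: "C1 (e k)" using insert by simp
    have I: "C1 (\<Sum>k\<in>I. c k *\<^sub>R e k)" using insert by simp
    have IH: "dx (\<Sum>k\<in>I. c k *\<^sub>R e k) = (\<Sum>k\<in>I. c k *\<^sub>R dx (e k))"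
      "dz (\<Sum>k\<in>I. c k *\<^sub>R e k) = (\<Sum>k\<in>I. c k *\<^sub>R dz (e k))" using insert by simp_all
    show ?case
      by (simp only: sum.insert[OF insert.hyps(1,2)] C1_add[OF C1_scale(1)[OF k] I] C1_scale[OF k] IH simp_thms)
  qed
  then show "C1 (\<Sum>k\<in>I. c k *\<^sub>R e k)" "dx (\<Sum>k\<in>I. c k *\<^sub>R e k) = (\<Sum>k\<in>I. c k *\<^sub>R dx (e k))"
    "dz (\<Sum>k\<in>I. c k *\<^sub>R e k) = (\<Sum>k\<in>I. c k *\<^sub>R dz (e k))" by blast+
qed

text \<open>
  Differentiation in \<open>x\<close> exchanges the sine and the cosine in \<open>x\<close>, and
  so flips the sign of the first index.
\<close>

definition flip_mode :: "int \<times> nat \<times> nat \<Rightarrow> int \<times> nat \<times> nat" where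
  "flip_mode = (\<lambda>(i, m, n). (- i, m, n))"

lemma sum_flip_mode: "(\<Sum>k\<in>truncated xi_index N. g (flip_mode k)) = (\<Sum>k\<in>truncated xi_index N. g k)"
  by (rule sum.reindex_bij_witness[of _ flip_mode flip_mode]) (auto simp: flip_mode_def truncated_def xi_index_def)

lemma mode_C1:
  assumes "k \<in> xi_index" shows "C1 (sine_mode k)" "C1 (cosine_mode k)"
  using assms by (cases k; auto simp: sine_mode_def cosine_mode_def xi_index_iff intro: xi_C1 phi_C1)+

lemma truncated_index: "k \<in> truncated xi_index N \<Longrightarrow> k \<in> xi_index"
  using truncated_subset by blast

lemma partial_sum_C1: "C1 (sine_sum N f)" "C1 (cosine_sum N f)"
  unfolding L2.proj_def using finite_truncated(1) mode_C1 truncated_index by (intro C1_sum; blast)+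

lemma partial_sum_dx:
  "dx (sine_sum N f) = (\<Sum>k\<in>truncated xi_index N. (ip f (sine_mode k) / ip (sine_mode k) (sine_mode k)) *\<^sub>R dx (sine_mode k))"
  "dx (cosine_sum N f) = (\<Sum>k\<in>truncated xi_index N. (ip f (cosine_mode k) / ip (cosine_mode k) (cosine_mode k)) *\<^sub>R dx (cosine_mode k))"
  unfolding L2.proj_def using finite_truncated(1) mode_C1 truncated_index by (intro C1_sum; blast)+

lemma partial_sum_dz:
  "dz (sine_sum N f) = (\<Sum>k\<in>truncated xi_index N. (ip f (sine_mode k) / ip (sine_mode k) (sine_mode k)) *\<^sub>R dz (sine_mode k))"
  "dz (cosine_sum N f) = (\<Sum>k\<in>truncated xi_index N. (ip f (cosine_mode k) / ip (cosine_mode k) (cosine_mode k)) *\<^sub>R dz (cosine_mode k))"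
  unfolding L2.proj_def using finite_truncated(1) mode_C1 truncated_index by (intro C1_sum; blast)+

text \<open>
  Differentiation commutes with the partial sums of the Fourier series when the boundary terms
  cancel. So the expansion of a smooth function converges together with its gradient.
\<close>

lemma cosine_sum_dx:
  assumes q: "C1 q" and per: "\<And>z. z \<in> {0..1} \<Longrightarrow> q (0, z) = q (1, z)"
  shows "dx (cosine_sum N q) = cosine_sum N (dx q)"
proof -
  have "dx (cosine_sum N q) = (\<Sum>k\<in>truncated xi_index N. (ip (dx q) (cosine_mode (flip_mode k)) / ip (cosine_mode (flip_mode k)) (cosine_mode (flip_mode k))) *\<^sub>R cosine_mode (flip_mode k))"
    unfolding partial_sum_dx
  proof (intro sum.cong refl)
    fix k assume "k \<in> truncated xi_index N"
    then obtain i m n where k: "k = (i, m, n)" and i: "i = 1 \<or> i = -1" and i': "-i = 1 \<or> -i = -1"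
      using truncated_index by (cases k) (force simp: xi_index_iff)
    have ii: "real_of_int i * real_of_int i = 1" using i by auto
    note P = phi_C1[OF i, of m n] and P' = phi_C1[OF i', of m n]
    have "ip q (dx (phi (-i) m n)) = - ip (dx q) (phi (-i) m n)"
      by (intro C1_ip_by_parts_x q P') (simp add: per phi_periodic)
    moreover have "ip q (dx (phi (-i) m n)) = of_int i * (2 * pi * real m) * ip q (phi i m n)"
      unfolding P'(2) by (subst L2.scale_right) (simp_all add: phi_L2 C1_L2[OF q])
    ultimately have e: "ip (dx q) (phi (-i) m n) = - of_int i * (2 * pi * real m) * ip q (phi i m n)" by simp
    \<comment> \<open>For \<open>m = 0\<close> one of the two functions vanishes and the norms differ, but
      then the derivative is zero.\<close>
    have "ip (phi (-i) m n) (phi (-i) m n) = ip (phi i m n) (phi i m n)" if "m \<noteq> 0"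
      using that by (simp add: ip_phi[OF i i] ip_phi[OF i' i'] trig_sq_def)
    then show "(ip q (cosine_mode k) / ip (cosine_mode k) (cosine_mode k)) *\<^sub>R dx (cosine_mode k) =
      (ip (dx q) (cosine_mode (flip_mode k)) / ip (cosine_mode (flip_mode k)) (cosine_mode (flip_mode k))) *\<^sub>R cosine_mode (flip_mode k)"
      unfolding k flip_mode_def cosine_mode_def prod.case P(2) e by (cases "m = 0") simp_all
  qed
  also have "\<dots> = cosine_sum N (dx q)"
    unfolding L2.proj_def by (rule sum_flip_mode[where g = "\<lambda>k. (ip (dx q) (cosine_mode k) / ip (cosine_mode k) (cosine_mode k)) *\<^sub>R cosine_mode k"])
  finally show ?thesis .
qed

lemma cosine_sum_dz:
  assumes q: "C1 q" shows "dz (cosine_sum N q) = sine_sum N (dz q)"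
  unfolding partial_sum_dz unfolding L2.proj_def
proof (intro sum.cong refl)
  fix k assume "k \<in> truncated xi_index N"
  then obtain i m n where k: "k = (i, m, n)" and i: "i = 1 \<or> i = -1"
    using truncated_index by (cases k) (force simp: xi_index_iff)
  note P = phi_C1[OF i, of m n] and X = xi_C1[OF i, of m n]
  have "ip q (dz (xi i m n)) = - ip (dz q) (xi i m n)"
    by (intro C1_ip_by_parts_z q X) (simp add: xi_boundary)
  moreover have "ip q (dz (xi i m n)) = (pi * real n) * ip q (phi i m n)"
    unfolding X(3) by (subst L2.scale_right) (simp_all add: phi_L2 C1_L2[OF q])
  ultimately have e: "ip (dz q) (xi i m n) = - (pi * real n) * ip q (phi i m n)" by simp
  have "ip (phi i m n) (phi i m n) = ip (xi i m n) (xi i m n)" if "n \<noteq> 0"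
    using that by (simp add: ip_phi[OF i i] ip_xi[OF i i] cos_sq_def sin_sq_def)
  then show "(ip q (cosine_mode k) / ip (cosine_mode k) (cosine_mode k)) *\<^sub>R dz (cosine_mode k) =
      (ip (dz q) (sine_mode k) / ip (sine_mode k) (sine_mode k)) *\<^sub>R sine_mode k"
    unfolding k sine_mode_def cosine_mode_def prod.case P(3) e by (cases "n = 0") simp_all
qed

section \<open>Recovering Darcy's law\<close>

definition weight :: "real \<Rightarrow> real \<times> real \<Rightarrow> real" where
  "weight c p = exp (c * snd p)"

lemma weight_C1: "C1 (weight c)" "dx (weight c) = (\<lambda>_. 0)" "dz (weight c) = (\<lambda>p. c * weight c p)"
proof -
  have 1: "((\<lambda>s. weight c (s, z)) has_real_derivative 0) (at x)" for x z by (simp add: weight_def)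
  have 2: "((\<lambda>s. weight c (x, s)) has_real_derivative c * weight c (x, z)) (at z)" for x z
    unfolding weight_def by (auto intro!: derivative_eq_intros)
  have 3: "continuous_on UNIV (weight c)" "continuous_on UNIV (\<lambda>p::real\<times>real. 0::real)" "continuous_on UNIV (\<lambda>p. c * weight c p)"
    unfolding weight_def by (intro continuous_intros)+
  show "C1 (weight c)" "dx (weight c) = (\<lambda>_. 0)" "dz (weight c) = (\<lambda>p. c * weight c p)"
    using C1I[of "weight c" "\<lambda>_. 0" "\<lambda>p. c * weight c p", OF 1 2 3] by auto
qed

lemma continuous_mult_L2:
  fixes f :: "real \<times> real \<Rightarrow> 'v::euclidean_space"
  assumes w: "continuous_on \<Omega>0 w" and f: "f \<in> L2"
  shows "(\<lambda>p. w p *\<^sub>R f p) \<in> L2"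
proof -
  have "compact (w ` \<Omega>0)" using w by (intro compact_continuous_image) (simp_all add: Omega0_cbox)
  then obtain C where C: "\<And>p. p \<in> \<Omega>0 \<Longrightarrow> norm (w p) \<le> C" by (metis bounded_iff compact_imp_bounded imageI)
  have [measurable]: "w \<in> borel_measurable \<mu>"
    using continuous_imp_measurable_on_sets_lebesgue[OF w] by simp
  have [measurable]: "f \<in> borel_measurable \<mu>" using f by (rule L2_measurable)
  show ?thesis
  proof (rule L2_dominated(1)[OF _ f])
    show "AE p in \<mu>. norm (w p *\<^sub>R f p) \<le> C * norm (f p)"
      using C by (intro AE_I2) (auto intro!: mult_right_mono)
  qed measurable
qed

lemma weight_mult_L2: "f \<in> L2 \<Longrightarrow> (\<lambda>p. weight c p * f p) \<in> L2"
  using continuous_mult_L2[of "weight c" f] C1D(1)[OF weight_C1(1)] by simp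

lemma ip_weight: "ip (\<lambda>p. weight c p * f p) g = ip f (\<lambda>p. weight c p * g p)"
  by (simp add: ip_def mult_ac)

definition darcy_velocity ::
  "real \<Rightarrow> real \<Rightarrow> (real \<times> real \<Rightarrow> real) \<Rightarrow> (real \<times> real \<Rightarrow> real) \<Rightarrow> real \<times> real \<Rightarrow> real \<times> real" where
  "darcy_velocity R \<beta> \<theta> P = (\<lambda>p. - (exp (- \<beta> * snd p) *\<^sub>R wgrad P p) + (R * \<theta> p) *\<^sub>R (0, 1))"

lemma darcy_velocity_ip:
  assumes P: "P \<in> tilde_W12" and \<theta>: "\<theta> \<in> hat_W12" and ab: "a \<in> L2" "b \<in> L2"
  shows "darcy_velocity R \<beta> \<theta> P \<in> L2"
    "ip (darcy_velocity R \<beta> \<theta> P) (\<lambda>p. (a p, b p)) =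
      - ip (\<lambda>p. fst (wgrad P p)) (\<lambda>p. weight (-\<beta>) p * a p) - ip (\<lambda>p. snd (wgrad P p)) (\<lambda>p. weight (-\<beta>) p * b p) + R * ip \<theta> b"
proof -
  have PL: "wgrad P \<in> L2" using P hat_W12_subset W12_wgrad by blast
  have TL: "\<theta> \<in> L2" using \<theta> hat_W12_subset W12_wgrad by blast
  let ?a = "\<lambda>p. fst (wgrad P p)" and ?b = "\<lambda>p. snd (wgrad P p)"
  have L: "?a \<in> L2" "?b \<in> L2" using L2_components[OF PL] by auto
  let ?u = "(-1) *\<^sub>R (\<lambda>p. weight (-\<beta>) p * ?a p)" and ?w = "(-1) *\<^sub>R (\<lambda>p. weight (-\<beta>) p * ?b p) + R *\<^sub>R \<theta>"
  have uL: "?u \<in> L2" "?w \<in> L2" using L TL by (intro L2.clos weight_mult_L2; simp)+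
  have eq: "darcy_velocity R \<beta> \<theta> P = (\<lambda>p. (?u p, ?w p))"
    unfolding darcy_velocity_def weight_def by (auto simp: fsimps prod_eq_iff)
  show D: "darcy_velocity R \<beta> \<theta> P \<in> L2" unfolding eq by (rule L2_Pair[OF uL])
  have "ip (darcy_velocity R \<beta> \<theta> P) (\<lambda>p. (a p, b p)) = ip ?u a + ip ?w b"
    using ip_Pair[OF D ab] unfolding eq by (simp only: fst_conv snd_conv)
  also have "ip ?u a = - ip ?a (\<lambda>p. weight (-\<beta>) p * a p)"
    using L ab by (subst L2.scale_left) (auto simp: weight_mult_L2 ip_weight)
  also have "ip ?w b = - ip ?b (\<lambda>p. weight (-\<beta>) p * b p) + R * ip \<theta> b"
    by (subst L2.add_left[OF L2.clos(4)[OF weight_mult_L2[OF L(2)]] L2.clos(4)[OF TL] ab(2)],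
        subst L2.scale_left[OF weight_mult_L2[OF L(2)] ab(2)], subst L2.scale_left[OF TL ab(2)])
       (simp add: ip_weight)
  finally show "ip (darcy_velocity R \<beta> \<theta> P) (\<lambda>p. (a p, b p)) =
      - ip ?a (\<lambda>p. weight (-\<beta>) p * a p) - ip ?b (\<lambda>p. weight (-\<beta>) p * b p) + R * ip \<theta> b" by simp
qed

lemma L2_ip_limit:
  fixes f :: "real \<times> real \<Rightarrow> 'v::euclidean_space"
  assumes "f \<in> L2" "g \<in> L2" "\<And>n. h n \<in> L2" "(\<lambda>n. L2_norm (g - h n)) \<longlonglongrightarrow> 0"
  shows "(\<lambda>n. ip f (h n)) \<longlonglongrightarrow> ip f g"
proof -
  have "(\<lambda>n. L2_norm f * L2_norm (g - h n)) \<longlonglongrightarrow> L2_norm f * 0" by (intro tendsto_intros assms)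
  then have "(\<lambda>n. L2_norm f * L2_norm (g - h n)) \<longlonglongrightarrow> 0" by simp
  then have "(\<lambda>n. ip f (g - h n)) \<longlonglongrightarrow> 0"
    by (rule Lim_null_comparison[OF always_eventually, rotated])
       (use L2.cauchy_schwarz[OF assms(1) L2.clos(3)[OF assms(2,3)]] in simp)
  then have "(\<lambda>n. ip f g - ip f (h n)) \<longlonglongrightarrow> 0" using assms by (simp add: L2.diff_right)
  from tendsto_diff[OF tendsto_const[of "ip f g"] this] show ?thesis by simp
qed

text \<open>
  The field tested with \<open>\<nabla>\<phi>\<close> is the residual \<open>E\<close> of the
  pressure equation tested with \<open>exp (- \<beta> z) \<phi>\<close>: the derivative of the
  weight reproduces the term with \<open>\<beta>\<close>, and integrating
  \<open>\<theta>\<^sub>z\<close> by parts gives the buoyancy. The weighted function is not in the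
  span of the basis, and its mean does not vanish. The residual is a functional that is continuous
  along cosine series with their gradients, and it is zero on all basis functions but the
  constant, so it is a multiple of the mean. The choice \<open>\<phi> = 1\<close> shows that the
  multiple is zero, since the gradient of 1 vanishes and the mean of the weight does not.
\<close>

lemma darcy_gradient_orthogonal:
  assumes P: "P \<in> tilde_W12" and \<theta>: "\<theta> \<in> hat_W12" and i: "i = 1 \<or> i = -1"
    and eq: "\<And>i m n. (i, m, n) \<in> phi_index \<Longrightarrow>
      - ip (wgrad P) (grad (phi i m n)) - \<beta> * ip (\<lambda>p. snd (wgrad P p)) (phi i m n)
        = R * ip (\<lambda>p. exp (\<beta> * snd p) * snd (wgrad \<theta> p)) (phi i m n)"
  shows "ip (darcy_velocity R \<beta> \<theta> P) (grad (phi i m n)) = 0"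
proof -
  have PL: "wgrad P \<in> L2" using P hat_W12_subset W12_wgrad by blast
  have TL: "\<theta> \<in> L2" "wgrad \<theta> \<in> L2" using \<theta> hat_W12_subset W12_wgrad by blast+
  define a where "a p = fst (wgrad P p)" for p
  define b where "b p = snd (wgrad P p)" for p
  define w where "w p = weight \<beta> p * snd (wgrad \<theta> p)" for p
  have L: "a \<in> L2" "b \<in> L2" "w \<in> L2"
    using L2_components[OF PL] L2_components[OF TL(2)] weight_mult_L2 unfolding a_def b_def w_def by blast+
  define E where "E h = - ip a (dx h) - ip b (dz h) - \<beta> * ip b h - R * ip w h" for h
  have E_phi: "E (phi j k l) = 0" if "j = 1 \<or> j = -1" "(j, k, l) \<noteq> (1, 0, 0)" for j k l
  proof (cases "(k, l) = (0, 0)")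
    \<comment> \<open>Here \<open>phi j k l\<close> is the zero function \<open>sin 0\<close>, which is not
      among the indices.\<close>
    case True
    then have z: "phi j k l = 0" using that by (auto simp: phi_def trig_def fsimps)
    show ?thesis unfolding E_def z C1_zero using L by (simp add: ip_def)
  next
    case False
    then have "(j, k, l) \<in> phi_index" using that by (auto simp: phi_index_def)
    from eq[OF this] show ?thesis unfolding E_def grad_def a_def b_def w_def
      using ip_Pair[OF PL C1_L2(2,3)[OF phi_C1(1)[OF that(1)]], of k l k l] by (simp add: weight_def[abs_def])
  qed
  have E_expand: "E q = ip q (phi 1 0 0) * E (phi 1 0 0)"
    if q: "C1 q" and per: "\<And>z. z \<in> {0..1} \<Longrightarrow> q (0, z) = q (1, z)" for q
  proof -
    have "(\<lambda>N. E (cosine_sum N q)) \<longlonglongrightarrow> E q" unfolding E_def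
    proof (intro tendsto_intros L2_ip_limit L C1_L2(1-3)[OF q] C1_L2(1-3)[OF partial_sum_C1(2)])
      show "(\<lambda>N. L2_norm (dx q - dx (cosine_sum N q))) \<longlonglongrightarrow> 0"
      proof -
        have e: "dx (cosine_sum N q) = cosine_sum N (dx q)" for N
          by (rule cosine_sum_dx[OF q]) (rule per)
        show ?thesis unfolding e by (rule cosine_expansion[OF C1_L2(2)[OF q]])
      qed
      show "(\<lambda>N. L2_norm (dz q - dz (cosine_sum N q))) \<longlonglongrightarrow> 0"
        unfolding cosine_sum_dz[OF q] by (rule sine_expansion[OF C1_L2(3)[OF q]])
    qed (rule cosine_expansion[OF C1_L2(1)[OF q]])+
    moreover have "E (cosine_sum N q) = ip q (phi 1 0 0) * E (phi 1 0 0)" for N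
    proof -
      let ?J = "truncated xi_index N" and ?c = "\<lambda>k. ip q (cosine_mode k) / ip (cosine_mode k) (cosine_mode k)"
      have dL: "dx (cosine_mode k) \<in> L2" "dz (cosine_mode k) \<in> L2" if "k \<in> ?J" for k
        using C1_L2 mode_C1(2)[OF truncated_index[OF that]] by blast+
      have "E (cosine_sum N q) = (\<Sum>k\<in>?J. ?c k * E (cosine_mode k))"
        unfolding E_def partial_sum_dx partial_sum_dz unfolding L2.proj_def
        using L dL mode_L2 by (simp add: L2.sum_right sum_subtractf sum.distrib sum_distrib_left algebra_simps flip: sum_negf)
      also have "\<dots> = (\<Sum>k\<in>?J. if k = (1, 0, 0) then ip q (phi 1 0 0) * E (phi 1 0 0) else 0)"
      proof (intro sum.cong refl)
        fix k assume "k \<in> ?J"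
        then obtain j m n where k: "k = (j, m, n)" and j: "j = 1 \<or> j = -1"
          using truncated_index by (cases k) (force simp: xi_index_iff)
        show "?c k * E (cosine_mode k) = (if k = (1, 0, 0) then ip q (phi 1 0 0) * E (phi 1 0 0) else 0)"
          using E_phi[OF j, of m n] by (auto simp: k cosine_mode_def ip_phi trig_sq_def cos_sq_def)
      qed
      also have "\<dots> = ip q (phi 1 0 0) * E (phi 1 0 0)"
        using finite_truncated(1) by (simp add: truncated_def xi_index_def)
      finally show ?thesis .
    qed
    ultimately show ?thesis by (simp add: LIMSEQ_const_iff)
  qed
  have E_weight: "E (\<lambda>p. weight (-\<beta>) p * phi j k l p) = ip (darcy_velocity R \<beta> \<theta> P) (grad (phi j k l))"
    if j: "j = 1 \<or> j = -1" for j k l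
  proof -
    note P1 = phi_C1(1)[OF j, of k l]
    note M = C1_mult[OF weight_C1(1)[of "-\<beta>"] P1]
    let ?W = "weight (-\<beta>)" and ?p = "phi j k l"
    have WL: "(\<lambda>p. ?W p * f p) \<in> L2" if "f \<in> L2" for f using weight_mult_L2[OF that] .
    have dxq: "dx (\<lambda>p. ?W p * ?p p) = (\<lambda>p. ?W p * dx ?p p)" unfolding M weight_C1 by simp
    have dzq: "dz (\<lambda>p. ?W p * ?p p) = (\<lambda>p. ?W p * dz ?p p) + (-\<beta>) *\<^sub>R (\<lambda>p. ?W p * ?p p)"
      unfolding M weight_C1 by (auto simp: fsimps)
    have "ip b (dz (\<lambda>p. ?W p * ?p p)) = ip b (\<lambda>p. ?W p * dz ?p p) - \<beta> * ip b (\<lambda>p. ?W p * ?p p)"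
      unfolding dzq using L WL C1_L2[OF P1] phi_L2 by (simp only: L2.add_right L2.scale_right L2.clos)
    moreover have "ip w (\<lambda>p. ?W p * ?p p) = ip (\<lambda>p. snd (wgrad \<theta> p)) ?p"
      unfolding w_def ip_def weight_def by (simp add: mult_ac flip: exp_add mult.assoc)
    moreover have "ip (\<lambda>p. snd (wgrad \<theta> p)) ?p = - ip \<theta> (dz ?p)" by (rule hat_by_parts_z[OF \<theta> P1])
    moreover have "ip (darcy_velocity R \<beta> \<theta> P) (grad ?p) = - ip a (\<lambda>p. ?W p * dx ?p p) - ip b (\<lambda>p. ?W p * dz ?p p) + R * ip \<theta> (dz ?p)"
      unfolding grad_def a_def b_def by (rule darcy_velocity_ip[OF P \<theta> C1_L2(2,3)[OF P1]])
    ultimately show ?thesis unfolding E_def dxq by simp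
  qed
  have C1q: "C1 (\<lambda>p. weight (-\<beta>) p * phi j k l p)" if "j = 1 \<or> j = -1" for j k l
    by (intro C1_mult weight_C1 phi_C1 that)
  have perq: "weight (-\<beta>) (0, z) * phi j k l (0, z) = weight (-\<beta>) (1, z) * phi j k l (1, z)" for j k l z
    by (simp add: weight_def phi_periodic)
  have one: "phi 1 0 0 = (\<lambda>_. 1)" by (auto simp: phi_def trig_def)
  have "ip (weight (-\<beta>)) (phi 1 0 0) > 0"
  proof -
    have i: "integrable \<mu> (weight (-\<beta>))" by (intro integrable_continuous_square C1D weight_C1)
    have "ip (weight (-\<beta>)) (phi 1 0 0) = (LINT p|\<mu>. weight (-\<beta>) p)" by (simp add: ip_def one)
    moreover have "(LINT p|\<mu>. weight (-\<beta>) p) \<noteq> 0"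
    proof
      assume "(LINT p|\<mu>. weight (-\<beta>) p) = 0"
      then have "AE p in \<mu>. weight (-\<beta>) p = 0"
        using i by (subst (asm) integral_nonneg_eq_0_iff_AE) (auto simp: weight_def)
      then have "AE p in \<mu>. False" by eventually_elim (simp add: weight_def)
      then have "ip (phi 1 0 0) (phi 1 0 0) = ip 0 (phi 1 0 0)"
        by (intro ip_cong_AE phi_L2 L2.clos) (auto elim: eventually_mono)
      then show False using ip_phi[of 1 1 0 0 0 0] by (simp add: trig_sq_def cos_sq_def) (simp add: ip_def)
    qed
    moreover have "(LINT p|\<mu>. weight (-\<beta>) p) \<ge> 0" by (intro integral_nonneg_AE) (simp add: weight_def)
    ultimately show ?thesis by simp
  qed
  moreover have "ip (weight (-\<beta>)) (phi 1 0 0) * E (phi 1 0 0) = 0"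
  proof -
    have "ip (weight (-\<beta>)) (phi 1 0 0) * E (phi 1 0 0) = E (\<lambda>p. weight (-\<beta>) p * phi 1 0 0 p)"
      using E_expand[OF C1q perq, of 1 0 0] by (simp add: one)
    also have "\<dots> = ip (darcy_velocity R \<beta> \<theta> P) (grad (phi 1 0 0))" by (rule E_weight) simp
    also have "grad (phi 1 0 0) = 0" unfolding grad_def phi_C1(2,3)[of 1, simplified] by (auto simp: fsimps zero_prod_def)
    finally show ?thesis by (simp add: ip_def)
  qed
  ultimately have "E (phi 1 0 0) = 0" by simp
  then show ?thesis using E_expand[OF C1q[OF i] perq, of m n] E_weight[OF i, of m n] by simp
qed

text \<open>
  Integration by parts: the curl of \<open>exp (- \<beta> z) \<nabla>\<Pi>\<close> is
  \<open>\<beta> exp (- \<beta> z) \<Pi>\<^sub>x\<close>, because second derivatives cancel.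
\<close>

lemma darcy_perp:
  assumes P: "P \<in> tilde_W12" and \<theta>: "\<theta> \<in> hat_W12" and i: "i = 1 \<or> i = -1"
  shows "ip (darcy_velocity R \<beta> \<theta> P) (perp_grad (xi i m n)) =
    \<beta> * ip (\<lambda>p. exp (- \<beta> * snd p) * fst (wgrad P p)) (xi i m n) - R * ip (\<lambda>p. fst (wgrad \<theta> p)) (xi i m n)"
proof -
  have i': "-i = 1 \<or> -i = -1" using i by auto
  have PL: "P \<in> L2" "wgrad P \<in> L2" using P hat_W12_subset W12_wgrad by blast+
  define a where "a p = fst (wgrad P p)" for p
  define b where "b p = snd (wgrad P p)" for p
  have L: "a \<in> L2" "b \<in> L2"
    using L2_components[OF PL(2)] unfolding a_def b_def by blast+
  let ?W = "weight (-\<beta>)" and ?x = "xi i m n"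
  note X = xi_C1[OF i, of m n] and X' = xi_C1[OF i', of m n] and Q = phi_C1[OF i, of m n]
  have dxC: "C1 (dx ?x)" "C1 (dz ?x)" unfolding X by (intro C1_scale X' Q)+
  have comm: "dx (dz ?x) = dz (dx ?x)"
    unfolding X(2,3) C1_scale[OF Q(1)] C1_scale[OF X'(1)] Q X'
    by (simp add: scaleR_scaleR mult.commute)
  have WL: "(\<lambda>p. ?W p * f p) \<in> L2" if "f \<in> L2" for f using weight_mult_L2[OF that] .
  note XL = C1_L2[OF X(1)]
  define g where "g = (\<lambda>p. ?W p * dz ?x p) + (-\<beta>) *\<^sub>R (\<lambda>p. ?W p * ?x p)"
  define h where "h = (\<lambda>p. ?W p * dx ?x p)"
  have gC: "C1 g" unfolding g_def by (intro C1_add C1_scale C1_mult weight_C1 dxC X)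
  have hC: "C1 h" unfolding h_def by (intro C1_mult weight_C1 dxC)
  have "ip a g = - ip P (dx g)" unfolding a_def
    by (rule tilde_by_parts_x[OF P gC]) (simp add: g_def fsimps X(3) weight_def xi_periodic phi_periodic)
  moreover have "ip b h = - ip P (dz h)" unfolding b_def
    by (rule tilde_by_parts_z[OF P hC]) (simp add: h_def X(2) fsimps xi_boundary)
  moreover have "dx g = dz h"
  proof -
    have "dx g = (\<lambda>p. ?W p * dx (dz ?x) p) + (-\<beta>) *\<^sub>R (\<lambda>p. ?W p * dx ?x p)"
      unfolding g_def C1_add(2)[OF C1_mult(1)[OF weight_C1(1) dxC(2)] C1_scale(1)[OF C1_mult(1)[OF weight_C1(1) X(1)]]]
        C1_scale(2)[OF C1_mult(1)[OF weight_C1(1) X(1)]] C1_mult(2)[OF weight_C1(1) X(1)] C1_mult(2)[OF weight_C1(1) dxC(2)] weight_C1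
      by (auto simp: fsimps)
    also have "\<dots> = dz h" unfolding h_def C1_mult(3)[OF weight_C1(1) dxC(1)] weight_C1 comm
      by (auto simp: fsimps)
    finally show ?thesis .
  qed
  moreover have "ip a g = ip a (\<lambda>p. ?W p * dz ?x p) - \<beta> * ip a (\<lambda>p. ?W p * ?x p)"
    unfolding g_def using L WL XL by (simp only: L2.add_right L2.scale_right L2.clos)
  moreover have "ip (\<lambda>p. fst (wgrad \<theta> p)) ?x = - ip \<theta> (dx ?x)"
    by (rule hat_by_parts_x[OF \<theta> X(1)]) (rule xi_periodic)
  moreover have "ip (darcy_velocity R \<beta> \<theta> P) (perp_grad ?x) = - ip a (\<lambda>p. ?W p * ((-1) *\<^sub>R dz ?x) p) - ip b (\<lambda>p. ?W p * dx ?x p) + R * ip \<theta> (dx ?x)"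
    using darcy_velocity_ip(2)[OF P \<theta> L2.clos(4)[OF XL(3), of "-1"] XL(2), of R \<beta>]
    unfolding perp_grad_def a_def b_def by (simp add: fsimps)
  moreover have "ip a (\<lambda>p. ?W p * ((-1) *\<^sub>R dz ?x) p) = - ip a (\<lambda>p. ?W p * dz ?x p)"
    by (simp add: ip_def fsimps)
  moreover have "ip (\<lambda>p. exp (- \<beta> * snd p) * a p) ?x = ip a (\<lambda>p. ?W p * ?x p)"
    using ip_weight[of "-\<beta>" a ?x] unfolding weight_def .
  ultimately show ?thesis unfolding h_def a_def by (simp add: algebra_simps)
qed

lemma darcy_mean:
  assumes P: "P \<in> tilde_W12" and \<theta>: "\<theta> \<in> hat_W12"
  shows "ip (darcy_velocity R \<beta> \<theta> P) (\<lambda>_. (1, 0)) = 0"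
proof -
  have one: "(\<lambda>_. 1::real) \<in> L2" by (simp add: L2_def)
  have "ip (\<lambda>p. fst (wgrad P p)) (weight (-\<beta>)) = - ip P (dx (weight (-\<beta>)))"
    by (rule tilde_by_parts_x[OF P weight_C1(1)]) (simp add: weight_def)
  then have "ip (\<lambda>p. fst (wgrad P p)) (weight (-\<beta>)) = 0" unfolding weight_C1 by (simp add: ip_def)
  then show ?thesis using darcy_velocity_ip(2)[OF P \<theta> one L2_zero, of R \<beta>] by (simp add: ip_def)
qed

text \<open>
  The divergence and the curl of a mode, as linear equations for the two Fourier coefficients of
  \<open>d\<close>.
\<close>

lemma mode_equations:
  assumes d: "d \<in> L2" and i: "i = 1 \<or> i = -1"
  shows "ip d (grad (phi i m n)) =
      - (real_of_int i * (2 * pi * real m)) * ip (\<lambda>p. fst (d p)) (phi (-i) m n) - (pi * real n) * ip (\<lambda>p. snd (d p)) (xi i m n)"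
    "ip d (perp_grad (xi (-i) m n)) =
      (real_of_int i * (2 * pi * real m)) * ip (\<lambda>p. snd (d p)) (xi i m n) - (pi * real n) * ip (\<lambda>p. fst (d p)) (phi (-i) m n)"
proof -
  let ?a = "\<lambda>p. fst (d p)" and ?b = "\<lambda>p. snd (d p)"
  have L: "?a \<in> L2" "?b \<in> L2" using L2_components[OF d] by auto
  have i': "-i = 1 \<or> -i = -1" using i by auto
  note P = phi_C1[OF i, of m n] and X = xi_C1[OF i', of m n]
  show "ip d (grad (phi i m n)) = - (real_of_int i * (2 * pi * real m)) * ip ?a (phi (-i) m n) - (pi * real n) * ip ?b (xi i m n)"
    using ip_Pair[OF d C1_L2(2,3)[OF P(1)]] L phi_L2 xi_L2
    unfolding grad_def P(2,3) by (simp only: L2.scale_right) simp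
  have e: "perp_grad (xi (-i) m n) = (\<lambda>p. (((-1) *\<^sub>R dz (xi (-i) m n)) p, dx (xi (-i) m n) p))"
    by (simp add: perp_grad_def fsimps)
  show "ip d (perp_grad (xi (-i) m n)) = (real_of_int i * (2 * pi * real m)) * ip ?b (xi i m n) - (pi * real n) * ip ?a (phi (-i) m n)"
    using ip_Pair[OF d L2.clos(4)[OF C1_L2(3)[OF X(1)], of "-1"] C1_L2(2)[OF X(1)]] L phi_L2 xi_L2
    unfolding e X(2,3) scaleR_scaleR by (simp only: L2.scale_right) simp
qed

text \<open>
  For each frequency the two conditions form a linear system with determinant \<open>s\<^sup>2 +
  t\<^sup>2\<close>, which is zero only for the frequency zero; the condition on the mean takes
  care of that one.
\<close>

lemma grad_perp_complete:
  assumes d: "d \<in> L2"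
    and g: "\<And>i m n. i = 1 \<or> i = -1 \<Longrightarrow> ip d (grad (phi i m n)) = 0"
    and p: "\<And>i m n. i = 1 \<or> i = -1 \<Longrightarrow> ip d (perp_grad (xi i m n)) = 0"
    and c: "ip d (\<lambda>_. (1, 0)) = 0"
  shows "AE p in \<mu>. d p = 0"
proof -
  let ?a = "\<lambda>p. fst (d p)" and ?b = "\<lambda>p. snd (d p)"
  have L: "?a \<in> L2" "?b \<in> L2" using L2_components[OF d] by auto
  have zero: "ip ?a (phi (-i) m n) = 0 \<and> ip ?b (xi i m n) = 0" if i: "i = 1 \<or> i = -1" for i m n
  proof -
    have i': "-i = 1 \<or> -i = -1" using i by auto
    have ii: "real_of_int i * real_of_int i = 1" using i by auto
    note 1 = g[OF i, of m n, unfolded mode_equations(1)[OF d i]]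
    note 2 = p[OF i', of m n, unfolded mode_equations(2)[OF d i]]
    show ?thesis
    proof (cases "m = 0 \<and> n = 0")
      case True
      then have "xi i m n = 0" by (auto simp: xi_def fsimps)
      moreover have "phi (-i) m n = (if i = -1 then (\<lambda>_. 1) else 0)" using True i by (auto simp: phi_def trig_def fsimps)
      moreover have "ip ?a (\<lambda>_. 1) = 0" using c by (simp add: ip_component)
      ultimately show ?thesis by (simp add: ip_def)
    next
      case False
      define A where "A = ip ?a (phi (-i) m n)"
      define B where "B = ip ?b (xi i m n)"
      define s where "s = real_of_int i * (2 * pi * real m)"
      define t where "t = pi * real n"
      have st: "s * s + t * t > 0"
      proof -
        have "s * s = (2 * pi * real m) * (2 * pi * real m)" using ii unfolding s_def by (simp add: algebra_simps)
        moreover have "2 * pi * real m \<noteq> 0 \<or> t \<noteq> 0" using False unfolding t_def by auto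
        then have "(2 * pi * real m) * (2 * pi * real m) + t * t > 0" by (simp only: sum_squares_gt_zero_iff)
        ultimately show ?thesis by simp
      qed
      have e: "s * A + t * B = 0" "s * B - t * A = 0" using 1 2 unfolding A_def B_def s_def t_def by (simp_all add: algebra_simps)
      have "(s * s + t * t) * A = s * (s * A + t * B) - t * (s * B - t * A)" by (simp add: algebra_simps)
      moreover have "(s * s + t * t) * B = t * (s * A + t * B) + s * (s * B - t * A)" by (simp add: algebra_simps)
      ultimately have "(s * s + t * t) * A = 0" "(s * s + t * t) * B = 0" by (simp_all only: e mult_zero_right diff_zero add_0_right)
      moreover have "s * s + t * t \<noteq> 0" using st by linarith
      ultimately have "A = 0" "B = 0" by (simp_all only: mult_eq_0_iff simp_thms)
      then show ?thesis by (simp add: A_def B_def)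
    qed
  qed
  have "AE p in \<mu>. ?a p = 0"
    using zero[of "-i" for i] by (intro cosine_modes_total L) (metis minus_minus)
  moreover have "AE p in \<mu>. ?b p = 0" using zero by (intro sine_modes_total L) blast
  ultimately show ?thesis by eventually_elim (simp add: prod_eq_iff)
qed

text \<open>
  Both sides have the same curl, zero divergence and no mean horizontal flow.
\<close>

theorem darcy_law:
  assumes P: "P \<in> tilde_W12" and \<theta>: "\<theta> \<in> hat_W12" and u: "u \<in> hat_L2_vec"
    and eq: "\<And>i m n. (i, m, n) \<in> phi_index \<Longrightarrow>
      - ip (wgrad P) (grad (phi i m n)) - \<beta> * ip (\<lambda>p. snd (wgrad P p)) (phi i m n)
        = R * ip (\<lambda>p. exp (\<beta> * snd p) * snd (wgrad \<theta> p)) (phi i m n)"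
    and stream: "\<And>i m n. i = 1 \<or> i = -1 \<Longrightarrow> ip u (perp_grad (xi i m n)) =
      \<beta> * ip (\<lambda>p. exp (- \<beta> * snd p) * fst (wgrad P p)) (xi i m n) - R * ip (\<lambda>p. fst (wgrad \<theta> p)) (xi i m n)"
  shows "AE p in \<mu>. u p = - (exp (- \<beta> * snd p) *\<^sub>R wgrad P p) + (R * \<theta> p) *\<^sub>R (0, 1)"
proof -
  let ?v = "darcy_velocity R \<beta> \<theta> P"
  have v: "?v \<in> L2" using darcy_velocity_ip(1)[OF P \<theta> L2_zero L2_zero] .
  have uL: "u \<in> L2" using u hat_W12_subset by auto
  have one: "(\<lambda>_. (1::real, 0::real)) \<in> L2" by (simp add: L2_def)
  have "AE p in \<mu>. (u - ?v) p = 0"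
  proof (rule grad_perp_complete)
    show "u - ?v \<in> L2" by (intro L2.clos uL v)
    show "ip (u - ?v) (\<lambda>_. (1, 0)) = 0"
      using hat_vec_orthogonal(2)[OF u] darcy_mean[OF P \<theta>] by (simp add: L2.diff_left uL v one)
    fix i :: int and m n :: nat assume i: "i = 1 \<or> i = -1"
    show "ip (u - ?v) (grad (phi i m n)) = 0"
      using hat_vec_orthogonal(1)[OF u phi_C1(1)[OF i] phi_periodic, of m n] darcy_gradient_orthogonal[OF P \<theta> i eq, where m = m and n = n]
      by (simp add: L2.diff_left uL v C1_L2 phi_C1 i)
    show "ip (u - ?v) (perp_grad (xi i m n)) = 0"
      using stream[OF i] darcy_perp[OF P \<theta> i] by (simp add: L2.diff_left uL v C1_L2 xi_C1 i)
  qed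
  then show ?thesis by eventually_elim (simp add: darcy_velocity_def fsimps)
qed

section \<open>Products under anisotropic regularity\<close>

text \<open>
  The derivative of \<open>h\<^sup>2\<close> is at most \<open>h\<^sup>2 + h'\<^sup>2\<close>, and
  \<open>h\<^sup>2\<close> is at most its mean at some point.
\<close>

lemma sup_bound_1D:
  fixes h h' :: "real \<Rightarrow> real"
  assumes d: "\<And>s. s \<in> {0..1} \<Longrightarrow> (h has_real_derivative h' s) (at s)" and c: "continuous_on {0..1} h'"
    and x: "x \<in> {0..1}"
  shows "(h x)\<^sup>2 \<le> integral {0..1} (\<lambda>s. 2 * (h s)\<^sup>2 + (h' s)\<^sup>2)"
proof -
  have hc: "continuous_on {0..1} h"
    using d by (intro continuous_at_imp_continuous_on ballI DERIV_isCont)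
  have c2: "continuous_on {0..1} (\<lambda>y. (h y)\<^sup>2)" by (intro continuous_intros hc)
  have ne: "{0..1::real} \<noteq> {}" by simp
  obtain s where s: "s \<in> {0..1}" "\<And>y. y \<in> {0..1} \<Longrightarrow> (h s)\<^sup>2 \<le> (h y)\<^sup>2"
    using continuous_attains_inf[OF compact_Icc ne c2] by blast
  have i1: "(\<lambda>s. (h s)\<^sup>2) integrable_on {0..1}" by (intro integrable_continuous_real continuous_intros hc)
  have i2: "(\<lambda>s. (h s)\<^sup>2 + (h' s)\<^sup>2) integrable_on {a..b}" if "{a..b} \<subseteq> {0..1}" for a b
    using that by (intro integrable_continuous_real continuous_intros continuous_on_subset[OF hc] continuous_on_subset[OF c])
  have "integral {0..1} (\<lambda>_::real. (h s)\<^sup>2) \<le> integral {0..1} (\<lambda>y. (h y)\<^sup>2)"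
    by (intro integral_le i1) (use s in auto)
  then have 1: "(h s)\<^sup>2 \<le> integral {0..1} (\<lambda>y. (h y)\<^sup>2)" by simp
  have ftc: "\<bar>(h b)\<^sup>2 - (h a)\<^sup>2\<bar> \<le> integral {0..1} (\<lambda>s. (h s)\<^sup>2 + (h' s)\<^sup>2)" if ab: "a \<le> b" "a \<in> {0..1}" "b \<in> {0..1}" for a b
  proof -
    have sub: "{a..b} \<subseteq> {0..1}" using ab by auto
    have I: "((\<lambda>y. 2 * h y * h' y) has_integral ((h b)\<^sup>2 - (h a)\<^sup>2)) {a..b}"
    proof (rule fundamental_theorem_of_calculus[OF ab(1)])
      fix y assume "y \<in> {a..b}"
      then have "(h has_real_derivative h' y) (at y within {a..b})" using d sub has_field_derivative_at_within by blast
      then show "((\<lambda>y. (h y)\<^sup>2) has_vector_derivative 2 * h y * h' y) (at y within {a..b})"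
        unfolding has_real_derivative_iff_has_vector_derivative[symmetric]
        by (auto intro!: derivative_eq_intros)
    qed
    have "norm (integral {a..b} (\<lambda>y. 2 * h y * h' y)) \<le> integral {a..b} (\<lambda>s. (h s)\<^sup>2 + (h' s)\<^sup>2)"
    proof (rule integral_norm_bound_integral)
      show "(\<lambda>y. 2 * h y * h' y) integrable_on {a..b}" using I by blast
      show "norm (2 * h y * h' y) \<le> (h y)\<^sup>2 + (h' y)\<^sup>2" for y
        using sum_squares_bound[of "\<bar>h y\<bar>" "\<bar>h' y\<bar>"] by (simp add: abs_mult)
    qed (rule i2[OF sub])
    also have "\<dots> \<le> integral {0..1} (\<lambda>s. (h s)\<^sup>2 + (h' s)\<^sup>2)"
      by (intro integral_subset_le sub i2) auto
    finally show ?thesis using integral_unique[OF I] by simp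
  qed
  have "(h x)\<^sup>2 \<le> (h s)\<^sup>2 + integral {0..1} (\<lambda>s. (h s)\<^sup>2 + (h' s)\<^sup>2)"
    using ftc[of s x] ftc[of x s] s(1) x by (cases "s \<le> x") auto
  also have "\<dots> \<le> integral {0..1} (\<lambda>y. (h y)\<^sup>2) + integral {0..1} (\<lambda>s. (h s)\<^sup>2 + (h' s)\<^sup>2)" using 1 by simp
  also have "\<dots> = integral {0..1} (\<lambda>s. 2 * (h s)\<^sup>2 + (h' s)\<^sup>2)"
    using Henstock_Kurzweil_Integration.integral_add[OF i1 i2[OF order_refl]] by (simp add: algebra_simps)
  finally show ?thesis .
qed

text \<open>
  On each vertical line \<open>f\<^sup>2\<close> is bounded by a function of \<open>x\<close>
  alone, on each horizontal line \<open>g\<^sup>2\<close> by a function of \<open>z\<close> alone;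
  the integral of the product of the two bounds is a product of integrals.
\<close>

lemma C1_product_bound:
  assumes f: "C1 f" and g: "C1 g"
  shows "(LINT p|\<mu>. (f p * g p)\<^sup>2) \<le> (2 * (L2_norm f)\<^sup>2 + (L2_norm (dz f))\<^sup>2) * (2 * (L2_norm g)\<^sup>2 + (L2_norm (dx g))\<^sup>2)"
proof -
  define A where "A x = integral {0..1} (\<lambda>z. 2 * (f (x, z))\<^sup>2 + (dz f (x, z))\<^sup>2)" for x
  define B where "B z = integral {0..1} (\<lambda>x. 2 * (g (x, z))\<^sup>2 + (dx g (x, z))\<^sup>2)" for z
  have cf: "continuous_on S (\<lambda>p. 2 * (f p)\<^sup>2 + (dz f p)\<^sup>2)" for S by (intro continuous_intros C1D f)
  have cg: "continuous_on S (\<lambda>p. 2 * (g p)\<^sup>2 + (dx g p)\<^sup>2)" for S by (intro continuous_intros C1D g)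
  have Ac: "continuous_on {0..1} A" unfolding A_def
    using integral_continuous_on_param[of "{0..1}" 0 1 "\<lambda>x z. 2 * (f (x, z))\<^sup>2 + (dz f (x, z))\<^sup>2"] cf
    by (simp add: case_prod_unfold)
  have Bc: "continuous_on {0..1} B" unfolding B_def
  proof -
    have "continuous_on UNIV (\<lambda>q. 2 * (g (snd q, fst q))\<^sup>2 + (dx g (snd q, fst q))\<^sup>2)"
      by (intro continuous_on_compose2[OF cg[of UNIV]] continuous_intros) auto
    then show "continuous_on {0..1} (\<lambda>z. integral {0..1} (\<lambda>x. 2 * (g (x, z))\<^sup>2 + (dx g (x, z))\<^sup>2))"
      using integral_continuous_on_param[of "{0..1}" 0 1 "\<lambda>z x. 2 * (g (x, z))\<^sup>2 + (dx g (x, z))\<^sup>2"] continuous_on_subset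
      by (simp add: case_prod_unfold) blast
  qed
  have cAB: "continuous_on \<Omega>0 (\<lambda>p. A (fst p) * B (snd p))"
    by (intro continuous_intros continuous_on_compose2[OF Ac] continuous_on_compose2[OF Bc]) (auto simp: \<Omega>0_def)
  have le: "(f p * g p)\<^sup>2 \<le> A (fst p) * B (snd p)" if "p \<in> \<Omega>0" for p
  proof -
    define x z where "x = fst p" and "z = snd p"
    have p: "p = (x, z)" "x \<in> {0..1}" "z \<in> {0..1}" using that by (auto simp: \<Omega>0_def x_def z_def)
    have c1: "continuous_on {0..1} (\<lambda>s. dz f (x, s))" "continuous_on {0..1} (\<lambda>s. dx g (s, z))"
      by (intro continuous_on_compose2[OF C1D(3)[OF f, of UNIV]] continuous_on_compose2[OF C1D(2)[OF g, of UNIV]] continuous_intros; simp)+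
    have "(f p)\<^sup>2 \<le> A x" unfolding A_def p(1) by (rule sup_bound_1D[OF C1D(5)[OF f] c1(1) p(3)])
    moreover have "(g p)\<^sup>2 \<le> B z" unfolding B_def p(1) by (rule sup_bound_1D[OF C1D(4)[OF g] c1(2) p(2)])
    ultimately have "(f p)\<^sup>2 * (g p)\<^sup>2 \<le> A x * B z"
      by (intro mult_mono) (auto intro: order_trans[OF zero_le_power2])
    then show ?thesis by (simp add: p(1) power_mult_distrib)
  qed
  have "(LINT p|\<mu>. (f p * g p)\<^sup>2) \<le> (LINT p|\<mu>. A (fst p) * B (snd p))"
  proof (rule integral_mono)
    show "integrable \<mu> (\<lambda>p. (f p * g p)\<^sup>2)" by (intro integrable_continuous_square continuous_intros C1D f g)
    show "integrable \<mu> (\<lambda>p. A (fst p) * B (snd p))" by (rule integrable_continuous_square[OF cAB])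
  qed (use le in simp)
  also have "\<dots> = integral {0..1} A * integral {0..1} B" by (rule LINT_product[OF Ac Bc])
  also have "integral {0..1} A = (LINT p|\<mu>. 2 * (f p)\<^sup>2 + (dz f p)\<^sup>2)"
    unfolding A_def by (rule LINT_square(1)[OF cf, symmetric])
  also have "\<dots> = 2 * (L2_norm f)\<^sup>2 + (L2_norm (dz f))\<^sup>2"
    using L2D(2)[OF C1_L2(1)[OF f]] L2D(2)[OF C1_L2(3)[OF f]] by (simp add: L2_norm_def)
  also have "integral {0..1} B = (LINT p|\<mu>. 2 * (g p)\<^sup>2 + (dx g p)\<^sup>2)"
    unfolding B_def by (rule LINT_square(2)[OF cg, symmetric])
  also have "\<dots> = 2 * (L2_norm g)\<^sup>2 + (L2_norm (dx g))\<^sup>2"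
    using L2D(2)[OF C1_L2(1)[OF g]] L2D(2)[OF C1_L2(2)[OF g]] by (simp add: L2_norm_def)
  finally show ?thesis .
qed

lemma product_bound_limit:
  fixes f g :: "real \<times> real \<Rightarrow> real"
  assumes f: "f \<in> L2" and g: "g \<in> L2" and F: "\<And>n. C1 (F n)" and G: "\<And>n. C1 (G n)"
    and limF: "(\<lambda>n. L2_norm (f - F n)) \<longlonglongrightarrow> 0" and limG: "(\<lambda>n. L2_norm (g - G n)) \<longlonglongrightarrow> 0"
    and bF: "\<And>n. 2 * (L2_norm (F n))\<^sup>2 + (L2_norm (dz (F n)))\<^sup>2 \<le> A"
    and bG: "\<And>n. 2 * (L2_norm (G n))\<^sup>2 + (L2_norm (dx (G n)))\<^sup>2 \<le> B"
  shows "(\<lambda>p. f p * g p) \<in> L2" "(L2_norm (\<lambda>p. f p * g p))\<^sup>2 \<le> A * B"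
proof -
  obtain s where s: "strict_mono s" "AE p in \<mu>. (\<lambda>n. F (s n) p) \<longlonglongrightarrow> f p"
    using L2_AE_subsequence[OF C1_L2(1)[OF F] f limF] by blast
  have "(\<lambda>n. L2_norm (g - G (s n))) \<longlonglongrightarrow> 0"
    using LIMSEQ_subseq_LIMSEQ[OF limG s(1)] by (simp add: o_def)
  then obtain r where r: "strict_mono r" "AE p in \<mu>. (\<lambda>n. G (s (r n)) p) \<longlonglongrightarrow> g p"
    using L2_AE_subsequence[of "\<lambda>n. G (s n)", OF C1_L2(1)[OF G] g] by blast
  let ?h = "\<lambda>n p. (F (s (r n)) p * G (s (r n)) p)\<^sup>2"
  have [measurable]: "f \<in> borel_measurable \<mu>" "g \<in> borel_measurable \<mu>" using f g L2_measurable by auto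
  have i: "integrable \<mu> (?h n)" for n by (intro integrable_continuous_square continuous_intros C1D F G)
  have lim: "AE p in \<mu>. (\<lambda>n. ?h n p) \<longlonglongrightarrow> (f p * g p)\<^sup>2" using s(2) r(2)
  proof eventually_elim
    case (elim p)
    have "(\<lambda>n. F (s (r n)) p) \<longlonglongrightarrow> f p" using LIMSEQ_subseq_LIMSEQ[OF elim(1) r(1)] by (simp add: o_def)
    then show ?case using elim(2) by (intro tendsto_intros)
  qed
  have b: "integral\<^sup>L \<mu> (?h n) \<le> A * B" for n
  proof -
    have "integral\<^sup>L \<mu> (?h n) \<le> (2 * (L2_norm (F (s (r n))))\<^sup>2 + (L2_norm (dz (F (s (r n)))))\<^sup>2) *
      (2 * (L2_norm (G (s (r n))))\<^sup>2 + (L2_norm (dx (G (s (r n)))))\<^sup>2)" by (rule C1_product_bound[OF F G])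
    also have "\<dots> \<le> A * B" using bF[of "s (r n)"] bG[of "s (r n)"]
      by (intro mult_mono) (auto intro: order_trans[rotated])
    finally show ?thesis .
  qed
  have m: "(\<lambda>p. (f p * g p)\<^sup>2) \<in> borel_measurable \<mu>" by measurable
  have nn: "AE p in \<mu>. 0 \<le> ?h n p" for n by simp
  note Fa = Fatou_bound[OF i nn lim m b]
  have mm: "(\<lambda>p. f p * g p) \<in> borel_measurable \<mu>" by measurable
  show "(\<lambda>p. f p * g p) \<in> L2" using Fa(1) mm by (simp add: L2_def)
  show "(L2_norm (\<lambda>p. f p * g p))\<^sup>2 \<le> A * B" using Fa(2) by (simp add: L2_norm_def)
qed

lemma mode_sum_square:
  "(L2_norm (\<Sum>k\<in>truncated xi_index N. c k *\<^sub>R sine_mode k))\<^sup>2 =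
    (\<Sum>k\<in>truncated xi_index N. (c k)\<^sup>2 * ip (sine_mode k) (sine_mode k))"
  "(L2_norm (\<Sum>k\<in>truncated xi_index N. c k *\<^sub>R cosine_mode k))\<^sup>2 =
    (\<Sum>k\<in>truncated xi_index N. (c k)\<^sup>2 * ip (cosine_mode k) (cosine_mode k))"
  by (intro L2.orthogonal_sum_square finite_truncated mode_L2;
      blast intro: sine_mode_orthogonal cosine_mode_orthogonal truncated_index)+

lemma partial_sum_norm:
  assumes "f \<in> L2" shows "L2_norm (sine_sum N f) \<le> L2_norm f" "L2_norm (cosine_sum N f) \<le> L2_norm f"
proof -
  have "(L2_norm (sine_sum N f))\<^sup>2 \<le> (L2_norm f)\<^sup>2"
    using L2.bessel_identity(2)[OF finite_truncated(1) mode_L2(1) assms sine_mode_orthogonal]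
      L2.bessel[OF finite_truncated(1) mode_L2(1) assms sine_mode_orthogonal] truncated_index by simp
  then show "L2_norm (sine_sum N f) \<le> L2_norm f" using L2.nrm_nonneg[OF assms] by (rule power2_le_imp_le)
  have "(L2_norm (cosine_sum N f))\<^sup>2 \<le> (L2_norm f)\<^sup>2"
    using L2.bessel_identity(2)[OF finite_truncated(1) mode_L2(2) assms cosine_mode_orthogonal]
      L2.bessel[OF finite_truncated(1) mode_L2(2) assms cosine_mode_orthogonal] truncated_index by simp
  then show "L2_norm (cosine_sum N f) \<le> L2_norm f" using L2.nrm_nonneg[OF assms] by (rule power2_le_imp_le)
qed

lemma sine_sum_gradient_norm:
  assumes g: "g \<in> hat_W12"
  shows "L2_norm (dx (sine_sum N g)) \<le> L2_norm (wgrad g)"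
proof -
  let ?J = "truncated xi_index N" and ?c = "\<lambda>k. ip g (sine_mode k) / ip (sine_mode k) (sine_mode k)"
  have gL: "wgrad g \<in> L2" using g hat_W12_subset W12_wgrad by blast
  have gr: "grad (sine_sum N g) = (\<Sum>k\<in>?J. ?c k *\<^sub>R grad (sine_mode k))"
  proof
    fix p
    show "grad (sine_sum N g) p = (\<Sum>k\<in>?J. ?c k *\<^sub>R grad (sine_mode k)) p"
      unfolding grad_def partial_sum_dx partial_sum_dz
      by (rule prod_eqI) (simp_all add: sum_fun_apply fst_sum snd_sum scaleR_fun_def)
  qed
  have GL: "grad (sine_mode k) \<in> L2" if "k \<in> ?J" for k
    using C1_L2(4)[OF mode_C1(1)[OF truncated_index[OF that]]] .
  have orth: "ip (grad (sine_mode k)) (grad (sine_mode l)) = 0" if kl: "k \<in> ?J" "l \<in> ?J" "k \<noteq> l" for k l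
  proof -
    obtain i m n j m' n' where e: "k = (i, m, n)" "l = (j, m', n')" by (cases k; cases l)
    have "i = 1 \<or> i = -1" "j = 1 \<or> j = -1" using truncated_index[OF kl(1)] truncated_index[OF kl(2)] by (auto simp: e xi_index_iff)
    then show ?thesis using kl(3) by (auto simp: e sine_mode_def grad_xi_ip ip_xi)
  qed
  have "(L2_norm (grad (sine_sum N g)))\<^sup>2 = (\<Sum>k\<in>?J. (?c k)\<^sup>2 * ip (grad (sine_mode k)) (grad (sine_mode k)))"
    unfolding gr by (rule L2.orthogonal_sum_square[OF finite_truncated(1) GL orth])
  also have "\<dots> = (\<Sum>(i, m, n)\<in>?J. eigenvalue m n * ((ip g (xi i m n))\<^sup>2 / ip (xi i m n) (xi i m n)))"
  proof (intro sum.cong refl)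
    fix k assume k: "k \<in> ?J"
    obtain i m n where e: "k = (i, m, n)" by (cases k)
    have i: "i = 1 \<or> i = -1" using truncated_index[OF k] by (auto simp: e xi_index_iff)
    show "(?c k)\<^sup>2 * ip (grad (sine_mode k)) (grad (sine_mode k)) = (case k of (i, m, n) \<Rightarrow> eigenvalue m n * ((ip g (xi i m n))\<^sup>2 / ip (xi i m n) (xi i m n)))"
      by (simp add: e sine_mode_def grad_xi_ip[OF i i] power2_eq_square)
  qed
  also have "\<dots> \<le> (L2_norm (wgrad g))\<^sup>2" by (rule gradient_bessel[OF g finite_truncated(1) truncated_subset])
  finally have "L2_norm (grad (sine_sum N g)) \<le> L2_norm (wgrad g)"
    using L2.nrm_nonneg[OF gL] by (rule power2_le_imp_le)
  moreover have "L2_norm (dx (sine_sum N g)) \<le> L2_norm (grad (sine_sum N g))"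
    using L2_components(3)[OF C1_L2(4)[OF partial_sum_C1(1)]] by (simp add: grad_def)
  ultimately show ?thesis by linarith
qed

text \<open>
  Vanishing divergence and the curl \<open>F\<close> determine each Fourier coefficient of
  \<open>u\<close> by a linear system, as for Cauchy-Riemann equations, so the derivative of
  \<open>u\<close> is controlled by \<open>F\<close> mode by mode.
\<close>

lemma velocity_partial_sums:
  assumes u: "u \<in> hat_L2_vec" and F: "F \<in> L2"
    and stream: "\<And>i m n. i = 1 \<or> i = -1 \<Longrightarrow> ip u (perp_grad (xi i m n)) = - ip F (xi i m n)"
  shows "L2_norm (dz (cosine_sum N (\<lambda>p. fst (u p)))) \<le> L2_norm F"
    "L2_norm (dz (sine_sum N (\<lambda>p. snd (u p)))) \<le> L2_norm F"
proof -
  let ?J = "truncated xi_index N" and ?a = "\<lambda>p. fst (u p)" and ?b = "\<lambda>p. snd (u p)"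
  have uL: "u \<in> L2" using u hat_W12_subset by auto
  \<comment> \<open>With \<open>s\<close>, \<open>t\<close> the horizontal and vertical wave numbers and
    \<open>A\<close>, \<open>B\<close> the coefficients, \<open>s A + t B = 0\<close> and \<open>s B - t A = -
    f\<close>, which gives \<open>A\<close> and \<open>B\<close> by Cramer's rule. The case \<open>m =
    0\<close> is listed separately because the norms of the modes with indices \<open>i\<close> and \<open>-
    i\<close> differ there.\<close>
  have key: "(pi * real n * ip ?a (phi (-i) m n))\<^sup>2 \<le> (ip F (xi (-i) m n))\<^sup>2 \<and>
      (pi * real n * ip ?b (xi i m n))\<^sup>2 \<le> (ip F (xi (-i) m n))\<^sup>2 \<and>
      (m = 0 \<longrightarrow> pi * real n * ip ?b (xi i m n) = 0)"
    if i: "i = 1 \<or> i = -1" for i m n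
  proof -
    have i': "-i = 1 \<or> -i = -1" using i by auto
    define A where "A = ip ?a (phi (-i) m n)"
    define B where "B = ip ?b (xi i m n)"
    define f where "f = ip F (xi (-i) m n)"
    define s where "s = real_of_int i * (2 * pi * real m)"
    define t where "t = pi * real n"
    have e1: "s * A + t * B = 0"
      using hat_vec_orthogonal(1)[OF u phi_C1(1)[OF i] phi_periodic, of m n]
      unfolding mode_equations(1)[OF uL i] A_def B_def s_def t_def by simp
    have e2: "s * B - t * A = - f"
      using stream[OF i', of m n] unfolding mode_equations(2)[OF uL i] A_def B_def s_def t_def f_def by simp
    have "(s * s + t * t) * A = s * (s * A + t * B) - t * (s * B - t * A)" by (simp add: algebra_simps)
    then have A: "(s\<^sup>2 + t\<^sup>2) * A = t * f" unfolding e1 e2 by (simp add: power2_eq_square)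
    have "(s * s + t * t) * B = t * (s * A + t * B) + s * (s * B - t * A)" by (simp add: algebra_simps)
    then have B: "(s\<^sup>2 + t\<^sup>2) * B = - s * f" unfolding e1 e2 by (simp add: power2_eq_square)
    have "(t * A)\<^sup>2 \<le> f\<^sup>2 \<and> (t * B)\<^sup>2 \<le> f\<^sup>2"
    proof (cases "t = 0")
      case False
      then have p: "s\<^sup>2 + t\<^sup>2 > 0" by (simp add: add_nonneg_pos)
      have "(s\<^sup>2 + t\<^sup>2) * \<bar>t * A\<bar> = t\<^sup>2 * \<bar>f\<bar>"
        using A p by (metis abs_mult abs_of_pos mult.left_commute abs_mult_self_eq power2_eq_square mult.assoc)
      also have "\<dots> \<le> (s\<^sup>2 + t\<^sup>2) * \<bar>f\<bar>" by (intro mult_right_mono) auto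
      finally have 1: "\<bar>t * A\<bar> \<le> \<bar>f\<bar>" using p by simp
      have "(s\<^sup>2 + t\<^sup>2) * \<bar>t * B\<bar> = \<bar>s * t\<bar> * \<bar>f\<bar>"
      proof -
        have "(s\<^sup>2 + t\<^sup>2) * \<bar>t * B\<bar> = \<bar>(s\<^sup>2 + t\<^sup>2) * (t * B)\<bar>" using p by (simp add: abs_mult)
        also have "(s\<^sup>2 + t\<^sup>2) * (t * B) = t * ((s\<^sup>2 + t\<^sup>2) * B)" by (simp add: algebra_simps)
        finally show ?thesis unfolding B by (simp add: abs_mult mult_ac)
      qed
      also have "\<dots> \<le> (s\<^sup>2 + t\<^sup>2) * \<bar>f\<bar>"
      proof (intro mult_right_mono)
        have "2 * (\<bar>s\<bar> * \<bar>t\<bar>) \<le> s\<^sup>2 + t\<^sup>2" using sum_squares_bound[of "\<bar>s\<bar>" "\<bar>t\<bar>"] by simp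
        moreover have "0 \<le> \<bar>s\<bar> * \<bar>t\<bar>" by simp
        ultimately show "\<bar>s * t\<bar> \<le> s\<^sup>2 + t\<^sup>2" unfolding abs_mult by linarith
      qed simp
      finally have 2: "\<bar>t * B\<bar> \<le> \<bar>f\<bar>" using p by simp
      from 1 2 show ?thesis by (simp add: abs_le_square_iff)
    qed simp
    moreover have "t * B = 0" if "m = 0" using e1 that by (simp add: s_def)
    ultimately show ?thesis unfolding A_def B_def f_def t_def by simp
  qed
  have bes: "(\<Sum>k\<in>?J. (ip F (sine_mode k))\<^sup>2 / ip (sine_mode k) (sine_mode k)) \<le> (L2_norm F)\<^sup>2"
    using L2.bessel[OF finite_truncated(1) mode_L2(1) F sine_mode_orthogonal] truncated_index by simp
  let ?ca = "\<lambda>k. ip ?a (cosine_mode k) / ip (cosine_mode k) (cosine_mode k)"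
  let ?cb = "\<lambda>k. ip ?b (sine_mode k) / ip (sine_mode k) (sine_mode k)"
  let ?t = "\<lambda>k. pi * real (snd (snd k))"
  have nn: "ip (sine_mode k) (sine_mode k) \<ge> 0" for k by (rule L2.nonneg[OF mode_L2(1)])
  have "dz (cosine_sum N ?a) = (\<Sum>k\<in>?J. (?ca k * - ?t k) *\<^sub>R sine_mode k)"
    unfolding partial_sum_dz
    by (intro sum.cong refl) (auto dest!: truncated_index simp: cosine_mode_def sine_mode_def xi_index_iff phi_C1(3))
  then have "(L2_norm (dz (cosine_sum N ?a)))\<^sup>2 = (\<Sum>k\<in>?J. (?ca k * - ?t k)\<^sup>2 * ip (sine_mode k) (sine_mode k))"
    by (simp only: mode_sum_square)
  also have "\<dots> \<le> (\<Sum>k\<in>?J. (ip F (sine_mode k))\<^sup>2 / ip (sine_mode k) (sine_mode k))"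
  proof (intro sum_mono)
    fix k assume k: "k \<in> ?J"
    obtain j m n where e: "k = (j, m, n)" by (cases k)
    have j: "j = 1 \<or> j = -1" using truncated_index[OF k] by (auto simp: e xi_index_iff)
    then have j': "-j = 1 \<or> -j = -1" by auto
    show "(?ca k * - ?t k)\<^sup>2 * ip (sine_mode k) (sine_mode k) \<le> (ip F (sine_mode k))\<^sup>2 / ip (sine_mode k) (sine_mode k)"
    proof (cases "n = 0")
      case True then show ?thesis using nn[of k] by (simp add: e)
    next
      case False
      have eq: "ip (cosine_mode k) (cosine_mode k) = ip (sine_mode k) (sine_mode k)"
        using False by (simp add: e cosine_mode_def sine_mode_def ip_phi[OF j j] ip_xi[OF j j] cos_sq_def sin_sq_def)
      have "(?ca k * - ?t k)\<^sup>2 * ip (sine_mode k) (sine_mode k) = (?t k * ip ?a (cosine_mode k))\<^sup>2 / ip (sine_mode k) (sine_mode k)"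
        unfolding eq by (simp add: power2_eq_square)
      also have "\<dots> \<le> (ip F (sine_mode k))\<^sup>2 / ip (sine_mode k) (sine_mode k)"
        using key[OF j', of n m] nn[of k] by (intro divide_right_mono) (simp_all add: e cosine_mode_def sine_mode_def)
      finally show ?thesis .
    qed
  qed
  also note bes
  finally show "L2_norm (dz (cosine_sum N ?a)) \<le> L2_norm F" using L2.nrm_nonneg[OF F] by (rule power2_le_imp_le)
  have "dz (sine_sum N ?b) = (\<Sum>k\<in>?J. (?cb k * ?t k) *\<^sub>R cosine_mode k)"
    unfolding partial_sum_dz
    by (intro sum.cong refl) (auto dest!: truncated_index simp: cosine_mode_def sine_mode_def xi_index_iff xi_C1(3))
  then have "(L2_norm (dz (sine_sum N ?b)))\<^sup>2 = (\<Sum>k\<in>?J. (?cb k * ?t k)\<^sup>2 * ip (cosine_mode k) (cosine_mode k))"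
    by (simp only: mode_sum_square)
  also have "\<dots> \<le> (\<Sum>k\<in>?J. (ip F (sine_mode (flip_mode k)))\<^sup>2 / ip (sine_mode (flip_mode k)) (sine_mode (flip_mode k)))"
  proof (intro sum_mono)
    fix k assume k: "k \<in> ?J"
    obtain j m n where e: "k = (j, m, n)" by (cases k)
    have j: "j = 1 \<or> j = -1" using truncated_index[OF k] by (auto simp: e xi_index_iff)
    then have j': "-j = 1 \<or> -j = -1" by auto
    show "(?cb k * ?t k)\<^sup>2 * ip (cosine_mode k) (cosine_mode k) \<le> (ip F (sine_mode (flip_mode k)))\<^sup>2 / ip (sine_mode (flip_mode k)) (sine_mode (flip_mode k))"
    proof (cases "n = 0 \<or> m = 0")
      case True
      then have z: "?cb k * ?t k = 0" using key[OF j, of n m] by (auto simp: e sine_mode_def)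
      show ?thesis unfolding z using nn[of "flip_mode k"] by simp
    next
      case False
      have eq: "ip (cosine_mode k) (cosine_mode k) = ip (sine_mode k) (sine_mode k)"
          "ip (sine_mode (flip_mode k)) (sine_mode (flip_mode k)) = ip (sine_mode k) (sine_mode k)"
        using False by (simp_all add: e flip_mode_def cosine_mode_def sine_mode_def ip_phi[OF j j] ip_xi[OF j j] ip_xi[OF j' j'] cos_sq_def sin_sq_def trig_sq_def)
      have "(?cb k * ?t k)\<^sup>2 * ip (cosine_mode k) (cosine_mode k) = (?t k * ip ?b (sine_mode k))\<^sup>2 / ip (sine_mode k) (sine_mode k)"
        unfolding eq by (simp add: power2_eq_square)
      also have "\<dots> \<le> (ip F (sine_mode (flip_mode k)))\<^sup>2 / ip (sine_mode k) (sine_mode k)"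
        using key[OF j, of n m] nn[of k] by (intro divide_right_mono) (simp_all add: e flip_mode_def sine_mode_def)
      finally show ?thesis unfolding eq .
    qed
  qed
  also have "\<dots> = (\<Sum>k\<in>?J. (ip F (sine_mode k))\<^sup>2 / ip (sine_mode k) (sine_mode k))"
    by (rule sum_flip_mode[where g = "\<lambda>k. (ip F (sine_mode k))\<^sup>2 / ip (sine_mode k) (sine_mode k)"])
  also note bes
  finally show "L2_norm (dz (sine_sum N ?b)) \<le> L2_norm F" using L2.nrm_nonneg[OF F] by (rule power2_le_imp_le)
qed

text \<open>
  The pairing of \<open>g\<close> with \<open>u\<close> needs one derivative of each, in different
  directions: the \<open>z\<close>-derivative of \<open>u\<close> is controlled through the curl,
  the \<open>x\<close>-derivative of \<open>g\<close> by its \<open>W12\<close> norm. Partial sums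
  of the Fourier series provide smooth approximations respecting both bounds.
\<close>

theorem velocity_multiplier:
  assumes u: "u \<in> hat_L2_vec" and F: "F \<in> L2"
    and stream: "\<And>i m n. i = 1 \<or> i = -1 \<Longrightarrow> ip u (perp_grad (xi i m n)) = - ip F (xi i m n)"
  obtains K where "K \<ge> 0" "\<And>g. g \<in> hat_W12 \<Longrightarrow> (\<lambda>p. g p *\<^sub>R u p) \<in> L2"
    "\<And>g. g \<in> hat_W12 \<Longrightarrow> L2_norm (\<lambda>p. g p *\<^sub>R u p) \<le> K * W12_norm g"
proof -
  let ?a = "\<lambda>p. fst (u p)" and ?b = "\<lambda>p. snd (u p)"
  have uL: "u \<in> L2" using u hat_W12_subset by auto
  have L: "?a \<in> L2" "?b \<in> L2" using L2_components[OF uL] by auto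
  let ?A = "2 * (L2_norm ?a)\<^sup>2 + (L2_norm F)\<^sup>2" and ?B = "2 * (L2_norm ?b)\<^sup>2 + (L2_norm F)\<^sup>2"
  have *: "(\<lambda>p. g p *\<^sub>R u p) \<in> L2 \<and> (L2_norm (\<lambda>p. g p *\<^sub>R u p))\<^sup>2 \<le> (?A + ?B) * (3 * (W12_norm g)\<^sup>2)"
    if g: "g \<in> hat_W12" for g
  proof -
    have gW: "g \<in> W12" using g hat_W12_subset by blast
    have gL: "g \<in> L2" using W12_wgrad[OF gW] by blast
    have G: "2 * (L2_norm (sine_sum n g))\<^sup>2 + (L2_norm (dx (sine_sum n g)))\<^sup>2 \<le> 3 * (W12_norm g)\<^sup>2" for n
    proof -
      have "(L2_norm (sine_sum n g))\<^sup>2 \<le> (W12_norm g)\<^sup>2"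
        using partial_sum_norm(1)[OF gL, of n] W12_norm_ge(1)[OF gW] L2.nrm_nonneg[OF C1_L2(1)[OF partial_sum_C1(1)]]
        by (intro power_mono) (auto intro: order_trans)
      moreover have "(L2_norm (dx (sine_sum n g)))\<^sup>2 \<le> (W12_norm g)\<^sup>2"
        using sine_sum_gradient_norm[OF g, of n] W12_norm_ge(2)[OF gW] L2.nrm_nonneg[OF C1_L2(2)[OF partial_sum_C1(1)]]
        by (intro power_mono) (auto intro: order_trans)
      ultimately show ?thesis by simp
    qed
    have sq: "x \<le> y \<Longrightarrow> 0 \<le> x \<Longrightarrow> x\<^sup>2 \<le> y\<^sup>2" for x y :: real by (rule power_mono)
    have A: "2 * (L2_norm (cosine_sum n ?a))\<^sup>2 + (L2_norm (dz (cosine_sum n ?a)))\<^sup>2 \<le> ?A" for n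
      using sq[OF partial_sum_norm(2)[OF L(1), of n] L2.nrm_nonneg[OF C1_L2(1)[OF partial_sum_C1(2)]]]
        sq[OF velocity_partial_sums(1)[OF assms, of n] L2.nrm_nonneg[OF C1_L2(3)[OF partial_sum_C1(2)]]] by simp
    have B: "2 * (L2_norm (sine_sum n ?b))\<^sup>2 + (L2_norm (dz (sine_sum n ?b)))\<^sup>2 \<le> ?B" for n
      using sq[OF partial_sum_norm(1)[OF L(2), of n] L2.nrm_nonneg[OF C1_L2(1)[OF partial_sum_C1(1)]]]
        sq[OF velocity_partial_sums(2)[OF assms, of n] L2.nrm_nonneg[OF C1_L2(3)[OF partial_sum_C1(1)]]] by simp
    note pa = product_bound_limit[OF L(1) gL partial_sum_C1(2) partial_sum_C1(1) cosine_expansion[OF L(1)] sine_expansion[OF gL] A G]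
    note pb = product_bound_limit[OF L(2) gL partial_sum_C1(1) partial_sum_C1(1) sine_expansion[OF L(2)] sine_expansion[OF gL] B G]
    have eq: "(\<lambda>p. g p *\<^sub>R u p) = (\<lambda>p. (?a p * g p, ?b p * g p))" by (auto simp: prod_eq_iff mult.commute)
    have PL: "(\<lambda>p. (?a p * g p, ?b p * g p)) \<in> L2" by (rule L2_Pair[OF pa(1) pb(1)])
    have "(L2_norm (\<lambda>p. (?a p * g p, ?b p * g p)))\<^sup>2 = ip (\<lambda>p. (?a p * g p, ?b p * g p)) (\<lambda>p. (?a p * g p, ?b p * g p))"
      by (rule L2.nrm_square[OF PL])
    also have "\<dots> = (L2_norm (\<lambda>p. ?a p * g p))\<^sup>2 + (L2_norm (\<lambda>p. ?b p * g p))\<^sup>2"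
      by (simp only: ip_Pair[OF PL pa(1) pb(1)] fst_conv snd_conv L2.nrm_square[OF pa(1)] L2.nrm_square[OF pb(1)])
    also have "\<dots> \<le> (?A + ?B) * (3 * (W12_norm g)\<^sup>2)" using pa(2) pb(2) by (simp only: distrib_right add_mono)
    finally show ?thesis unfolding eq using PL by blast
  qed
  show ?thesis
  proof (rule that[of "sqrt (3 * (?A + ?B))"])
    fix g assume g: "g \<in> hat_W12"
    then show "(\<lambda>p. g p *\<^sub>R u p) \<in> L2" using * by blast
    have "L2_norm (\<lambda>p. g p *\<^sub>R u p) \<le> sqrt ((?A + ?B) * (3 * (W12_norm g)\<^sup>2))" using *[OF g] by (intro real_le_rsqrt) blast
    also have "(?A + ?B) * (3 * (W12_norm g)\<^sup>2) = (3 * (?A + ?B)) * (W12_norm g)\<^sup>2" by (simp only: mult_ac)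
    also have "sqrt \<dots> = sqrt (3 * (?A + ?B)) * W12_norm g"
      by (simp only: real_sqrt_mult[of _ "(W12_norm g)\<^sup>2"] real_sqrt_abs abs_of_nonneg[OF hat_W12.nrm_nonneg[OF g]])
    finally show "L2_norm (\<lambda>p. g p *\<^sub>R u p) \<le> sqrt (3 * (?A + ?B)) * W12_norm g" .
  qed simp
qed

section \<open>The convective term\<close>

text \<open>
  For rotated gradients of basis functions and basis functions this says that \<open>u\<close> is
  orthogonal to \<open>\<nabla>(\<theta> \<xi>)\<close>. The closure is taken first in
  \<open>\<theta>\<close>, with a continuous \<open>u\<close>, and then in \<open>u\<close>, which
  is possible because \<open>\<xi>\<close> and its gradient are bounded.
\<close>

lemma convective_by_parts:
  assumes u: "u \<in> hat_L2_vec" and \<theta>: "\<theta> \<in> hat_W12" and i: "i = 1 \<or> i = -1"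
  shows "ip (\<lambda>p. u p \<bullet> wgrad \<theta> p) (xi i m n) = - ip u (\<lambda>p. \<theta> p *\<^sub>R grad (xi i m n) p)"
proof -
  let ?x = "xi i m n"
  note X = xi_C1(1)[OF i, of m n]
  have gc: "continuous_on \<Omega>0 (grad ?x)" unfolding grad_def by (intro continuous_intros C1D X)
  have m1: "(\<lambda>p. ?x p *\<^sub>R wgrad f p) \<in> L2" if "f \<in> W12" for f
    by (rule continuous_mult_L2[OF C1D(1)[OF X] W12_wgrad(3)[OF that]])
  have m2: "(\<lambda>p. f p *\<^sub>R grad ?x p) \<in> L2" if f: "f \<in> L2" for f
  proof -
    have "(\<lambda>p. (dx ?x p *\<^sub>R f p, dz ?x p *\<^sub>R f p)) \<in> L2"
      by (intro L2_Pair continuous_mult_L2 f C1D X)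
    moreover have "(\<lambda>p. f p *\<^sub>R grad ?x p) = (\<lambda>p. (dx ?x p *\<^sub>R f p, dz ?x p *\<^sub>R f p))"
      by (auto simp: grad_def mult.commute)
    ultimately show ?thesis by simp
  qed
  have TW: "\<theta> \<in> W12" using \<theta> hat_W12_subset by blast
  have TL: "\<theta> \<in> L2" using W12_wgrad[OF TW] by blast
  have uL: "u \<in> L2" using u hat_W12_subset by auto
  have basis: "ip v (\<lambda>p. ?x p *\<^sub>R wgrad f p) + ip v (\<lambda>p. f p *\<^sub>R grad ?x p) = 0"
    if v: "v \<in> hat_L2_vec" and vc: "continuous_on \<Omega>0 v" and f: "f \<in> hat_W12" for v f
  proof -
    have vL: "v \<in> L2" by (rule L2_continuous[OF vc])
    have "(\<lambda>f. ip (wgrad f) (\<lambda>p. ?x p *\<^sub>R v p) + ip f (\<lambda>p. v p \<bullet> grad ?x p)) \<in> dual W12 W12_norm"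
      by (intro dual_add wgrad_W12_dual ip_W12_dual L2_continuous continuous_intros vc gc C1D X)
    then have "ip (wgrad f) (\<lambda>p. ?x p *\<^sub>R v p) + ip f (\<lambda>p. v p \<bullet> grad ?x p) = 0"
    proof (rule closure_span_dual_zero[OF W12.seminormed_axioms basis_sets(1) _ _ f[unfolded hat_W12_def]])
      fix b assume "b \<in> xi_set"
      then obtain j m' n' where b: "b = xi j m' n'" and j: "j = 1 \<or> j = -1" by (auto simp: xi_index_iff)
      have B: "C1 b" unfolding b by (rule xi_C1(1)[OF j])
      have 1: "ip (wgrad b) (\<lambda>p. ?x p *\<^sub>R v p) = ip (grad b) (\<lambda>p. ?x p *\<^sub>R v p)"
        by (intro ip_cong_AE C1_wgrad(2) W12_wgrad C1_wgrad(1) C1_L2 B AE_I2 refl L2_continuous continuous_intros vc C1D X)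
      have 2: "integrable \<mu> (\<lambda>p. grad b p \<bullet> (?x p *\<^sub>R v p))" "integrable \<mu> (\<lambda>p. b p \<bullet> (v p \<bullet> grad ?x p))"
        by (intro L2_integrable_inner C1_L2 B L2_continuous continuous_intros vc gc C1D X)+
      have "ip (grad b) (\<lambda>p. ?x p *\<^sub>R v p) + ip b (\<lambda>p. v p \<bullet> grad ?x p) = ip v (grad (\<lambda>p. b p * ?x p))"
        unfolding ip_def Bochner_Integration.integral_add[OF 2, symmetric]
        by (intro Bochner_Integration.integral_cong refl)
           (simp add: grad_def C1_mult(2,3)[OF B X] inner_prod_def algebra_simps)
      also have "\<dots> = 0"
        by (rule hat_vec_orthogonal(1)[OF v C1_mult(1)[OF B X]]) (simp add: b xi_periodic)
      finally show "ip (wgrad b) (\<lambda>p. ?x p *\<^sub>R v p) + ip b (\<lambda>p. v p \<bullet> grad ?x p) = 0" unfolding 1 .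
    qed
    then show ?thesis by (simp add: ip_def inner_commute mult_ac)
  qed
  have "ip u (\<lambda>p. ?x p *\<^sub>R wgrad \<theta> p) + ip u (\<lambda>p. \<theta> p *\<^sub>R grad ?x p) = 0"
  proof (rule closure_span_dual_zero[OF L2.seminormed_axioms basis_sets(3) _ _ u[unfolded hat_L2_vec_def]])
    show "(\<lambda>u. ip u (\<lambda>p. ?x p *\<^sub>R wgrad \<theta> p) + ip u (\<lambda>p. \<theta> p *\<^sub>R grad ?x p)) \<in> dual L2 L2_norm"
      by (intro dual_add ip_dual m1 m2 TW TL)
    fix v assume v: "v \<in> perp_set"
    then obtain j m' n' where b: "v = perp_grad (xi j m' n')" and j: "j = 1 \<or> j = -1" by (auto simp: xi_index_iff)
    have "continuous_on \<Omega>0 v" unfolding b perp_grad_def by (intro continuous_intros C1D xi_C1 j)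
    moreover have "v \<in> hat_L2_vec" using span_subsets(3) span_base[OF v] by (rule subsetD)
    ultimately show "ip v (\<lambda>p. ?x p *\<^sub>R wgrad \<theta> p) + ip v (\<lambda>p. \<theta> p *\<^sub>R grad ?x p) = 0" using \<theta> by (intro basis)
  qed
  moreover have "ip (\<lambda>p. u p \<bullet> wgrad \<theta> p) ?x = ip u (\<lambda>p. ?x p *\<^sub>R wgrad \<theta> p)"
    by (simp add: ip_def mult_ac)
  ultimately show ?thesis by simp
qed

section \<open>Weak limits of linear equations\<close>

lemma L2_time_mono:
  assumes X: "seminormed X n1" "seminormed X n2" and le: "\<And>f. f \<in> X \<Longrightarrow> n2 f \<le> n1 f"
    and f: "f \<in> L2_time T X n1"
  shows "f \<in> L2_time T X n2"
proof -
  interpret A: seminormed X n1 by (rule X)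
  interpret B: seminormed X n2 by (rule X)
  obtain s where s: "\<And>n. simple_function (time_measure T) (s n)" "\<And>n. s n ` {0<..<T} \<subseteq> X"
    "AE t in time_measure T. (\<lambda>n. n1 (f t - s n t)) \<longlonglongrightarrow> 0"
    using A.L2_timeD(3)[OF f] unfolding strongly_measurable_def by blast
  have sm: "strongly_measurable T X n2 f" unfolding strongly_measurable_def
  proof (intro exI[of _ s] conjI allI s(1,2))
    show "AE t in time_measure T. (\<lambda>n. n2 (f t - s n t)) \<longlonglongrightarrow> 0"
      using s(3) A.L2_timeD(1)[OF f] AE_space
    proof eventually_elim
      case (elim t)
      have M: "f t - s n t \<in> X" for n using elim(2,3) s(2)[of n] by (intro A.closed(3)) auto
      show ?case
        by (rule Lim_null_comparison[OF always_eventually elim(1)])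
          (use le[OF M] B.nrm_nonneg[OF M] in simp)
    qed
  qed
  have m: "(\<lambda>t. n2 (f t)) \<in> borel_measurable (time_measure T)" by (rule B.measurable_nrm[OF sm A.L2_timeD(1)[OF f]])
  have "integrable (time_measure T) (\<lambda>t. (n2 (f t))\<^sup>2)"
  proof (rule Bochner_Integration.integrable_bound[OF A.L2_timeD(2)[OF f]])
    show "AE t in time_measure T. norm ((n2 (f t))\<^sup>2) \<le> norm ((n1 (f t))\<^sup>2)"
      using A.L2_timeD(1)[OF f]
    proof eventually_elim
      case (elim t)
      then show ?case using le[OF elim] B.nrm_nonneg[OF elim] by (simp add: power_mono)
    qed
  qed (use m in measurable)
  then show ?thesis using sm A.L2_timeD(1)[OF f] by (simp add: L2_time_def)
qed

lemma L2_time_scale: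
  assumes X: "seminormed X nrm" and p: "\<psi> \<in> borel_measurable (time_measure T)" "\<And>t. \<bar>\<psi> t\<bar> \<le> 1"
    and f: "f \<in> L2_time T X nrm"
  shows "(\<lambda>t. \<psi> t *\<^sub>R f t) \<in> L2_time T X nrm"
proof -
  interpret seminormed X nrm by (rule X)
  obtain s where s: "\<And>n. simple_function (time_measure T) (s n)" "\<And>n. s n ` {0<..<T} \<subseteq> X"
    "AE t in time_measure T. (\<lambda>n. nrm (f t - s n t)) \<longlonglongrightarrow> 0"
    using L2_timeD(3)[OF f] unfolding strongly_measurable_def by blast
  obtain F where F: "\<And>i. simple_function (time_measure T) (F i)"
    "\<And>x. x \<in> space (time_measure T) \<Longrightarrow> (\<lambda>i. F i x) \<longlonglongrightarrow> \<psi> x"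
    using borel_measurable_implies_sequence_metric[OF p(1), of 0] by blast
  have X: "AE t in time_measure T. \<psi> t *\<^sub>R f t \<in> X"
    using L2_timeD(1)[OF f] by eventually_elim (rule closed(4))
  have sm: "strongly_measurable T X nrm (\<lambda>t. \<psi> t *\<^sub>R f t)" unfolding strongly_measurable_def
  proof (intro exI[of _ "\<lambda>n t. F n t *\<^sub>R s n t"] conjI allI)
    show "simple_function (time_measure T) (\<lambda>t. F n t *\<^sub>R s n t)" for n
      by (rule simple_function_compose2[OF F(1) s(1)])
    show "(\<lambda>t. F n t *\<^sub>R s n t) ` {0<..<T} \<subseteq> X" for n using s(2)[of n] closed(4) by blast
    show "AE t in time_measure T. (\<lambda>n. nrm (\<psi> t *\<^sub>R f t - F n t *\<^sub>R s n t)) \<longlonglongrightarrow> 0"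
      using s(3) L2_timeD(1)[OF f] AE_space
    proof eventually_elim
      case (elim t)
      have M: "s n t \<in> X" for n using elim(3) s(2)[of n] by auto
      have Ft: "(\<lambda>n. F n t) \<longlonglongrightarrow> \<psi> t" by (rule F(2)[OF elim(3)])
      have "(\<lambda>n. \<bar>\<psi> t - F n t\<bar> * nrm (f t) + \<bar>F n t\<bar> * nrm (f t - s n t)) \<longlonglongrightarrow> \<bar>\<psi> t - \<psi> t\<bar> * nrm (f t) + \<bar>\<psi> t\<bar> * 0"
        by (intro tendsto_intros Ft elim(1))
      then have z: "(\<lambda>n. \<bar>\<psi> t - F n t\<bar> * nrm (f t) + \<bar>F n t\<bar> * nrm (f t - s n t)) \<longlonglongrightarrow> 0" by simp
      show ?case
      proof (rule Lim_null_comparison[OF always_eventually z], rule allI)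
        fix n
        have d: "f t - s n t \<in> X" by (intro closed(3) elim(2) M)
        have e: "\<psi> t *\<^sub>R f t - F n t *\<^sub>R s n t = (\<psi> t - F n t) *\<^sub>R f t + F n t *\<^sub>R (f t - s n t)"
          by (simp add: algebra_simps)
        have "nrm (\<psi> t *\<^sub>R f t - F n t *\<^sub>R s n t) \<le> nrm ((\<psi> t - F n t) *\<^sub>R f t) + nrm (F n t *\<^sub>R (f t - s n t))"
          unfolding e by (intro triangle closed(4) elim(2) d)
        then show "norm (nrm (\<psi> t *\<^sub>R f t - F n t *\<^sub>R s n t)) \<le> \<bar>\<psi> t - F n t\<bar> * nrm (f t) + \<bar>F n t\<bar> * nrm (f t - s n t)"
          using nrm_nonneg[OF closed(3)[OF closed(4)[OF elim(2)] closed(4)[OF M]]]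
          by (simp only: homogeneous[OF elim(2)] homogeneous[OF d] real_norm_def abs_of_nonneg)
      qed
    qed
  qed
  have m: "(\<lambda>t. nrm (\<psi> t *\<^sub>R f t)) \<in> borel_measurable (time_measure T)" by (rule measurable_nrm[OF sm X])
  have "integrable (time_measure T) (\<lambda>t. (nrm (\<psi> t *\<^sub>R f t))\<^sup>2)"
  proof (rule Bochner_Integration.integrable_bound[OF L2_timeD(2)[OF f]])
    show "AE t in time_measure T. norm ((nrm (\<psi> t *\<^sub>R f t))\<^sup>2) \<le> norm ((nrm (f t))\<^sup>2)"
      using L2_timeD(1)[OF f]
    proof eventually_elim
      case (elim t)
      have "nrm (\<psi> t *\<^sub>R f t) \<le> 1 * nrm (f t)"
        unfolding homogeneous[OF elim] by (intro mult_right_mono p(2) nrm_nonneg elim)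
      then show ?case using nrm_nonneg[OF closed(4)[OF elim]] by (simp add: power_mono)
    qed
  qed (use m in measurable)
  then show ?thesis using sm X by (simp add: L2_time_def)
qed

lemma zero_dual: "seminormed X nrm \<Longrightarrow> (\<lambda>_. 0) \<in> dual X nrm"
  by (rule dualI[where C = 0]) auto

text \<open>
  Tested with any bounded function of time the equation passes to the limit. It need only hold
  eventually, as a basis function is admissible only for large \<open>N\<close>.
\<close>

lemma limit_equation:
  assumes X: "seminormed X nX" and Y: "seminormed Y nY" and Z: "seminormed Z nZ"
    and l: "lx \<in> dual X nX" "ly \<in> dual Y nY" "lz \<in> dual Z nZ"
    and w: "weakly_converges_L2_time T X nX fs f" "weakly_converges_L2_time T Y nY gs g" "weakly_converges_L2_time T Z nZ hs h"
    and eq: "\<forall>\<^sub>F j in sequentially. \<forall>t\<in>{0<..<T}. lx (fs j t) + ly (gs j t) + lz (hs j t) = 0"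
  shows "AE t in time_measure T. lx (f t) + ly (g t) + lz (h t) = 0"
proof (rule AE_zero_test)
  have m: "f \<in> L2_time T X nX" "g \<in> L2_time T Y nY" "h \<in> L2_time T Z nZ"
    using w by (auto simp: weakly_converges_L2_time_def weakly_converges_def)
  show "integrable (time_measure T) (\<lambda>t. lx (f t) + ly (g t) + lz (h t))"
    using dual_time_integrable(1)[OF X l(1) m(1)] dual_time_integrable(1)[OF Y l(2) m(2)]
      dual_time_integrable(1)[OF Z l(3) m(3)] by simp
  fix \<psi> :: "real \<Rightarrow> real" assume p: "\<psi> \<in> borel_measurable (time_measure T)" "\<And>t. \<bar>\<psi> t\<bar> \<le> 1"
  note a = dual_time[OF X l(1) p] and b = dual_time[OF Y l(2) p] and c = dual_time[OF Z l(3) p]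
  have mj: "fs j \<in> L2_time T X nX" "gs j \<in> L2_time T Y nY" "hs j \<in> L2_time T Z nZ" for j
    using w by (auto simp: weakly_converges_L2_time_def weakly_converges_def)
  have "(\<lambda>j. (LINT t|time_measure T. \<psi> t * lx (fs j t)) + (LINT t|time_measure T. \<psi> t * ly (gs j t)) + (LINT t|time_measure T. \<psi> t * lz (hs j t)))
    \<longlonglongrightarrow> (LINT t|time_measure T. \<psi> t * lx (f t)) + (LINT t|time_measure T. \<psi> t * ly (g t)) + (LINT t|time_measure T. \<psi> t * lz (h t))"
    by (intro tendsto_add a(2) b(2) c(2) w)
  moreover have "\<forall>\<^sub>F j in sequentially. (LINT t|time_measure T. \<psi> t * lx (fs j t)) + (LINT t|time_measure T. \<psi> t * ly (gs j t)) + (LINT t|time_measure T. \<psi> t * lz (hs j t)) = 0"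
    using eq
  proof eventually_elim
    case (elim j)
    have "(LINT t|time_measure T. \<psi> t * lx (fs j t)) + (LINT t|time_measure T. \<psi> t * ly (gs j t)) + (LINT t|time_measure T. \<psi> t * lz (hs j t))
      = (LINT t|time_measure T. \<psi> t * lx (fs j t) + \<psi> t * ly (gs j t) + \<psi> t * lz (hs j t))"
      using a(1)[OF mj(1)] b(1)[OF mj(2)] c(1)[OF mj(3)] by simp
    also have "\<dots> = (LINT t|time_measure T. 0)"
      using elim by (intro Bochner_Integration.integral_cong refl) (simp flip: distrib_left)
    finally show ?case by simp
  qed
  ultimately have "(LINT t|time_measure T. \<psi> t * lx (f t)) + (LINT t|time_measure T. \<psi> t * ly (g t)) + (LINT t|time_measure T. \<psi> t * lz (h t)) = 0"
    by (intro LIMSEQ_unique[OF _ tendsto_eventually])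
  then show "(LINT t|time_measure T. \<psi> t * (lx (f t) + ly (g t) + lz (h t))) = 0"
    using a(1)[OF m(1)] b(1)[OF m(2)] c(1)[OF m(3)] by (simp add: distrib_left)
qed

section \<open>The dual of the temperature space\<close>

lemma dual_norm_bound:
  assumes X: "seminormed X nrm" and F: "F \<in> dual X nrm" and f: "f \<in> X"
  shows "\<bar>F f\<bar> \<le> dual_norm X nrm F * nrm f" "0 \<le> dual_norm X nrm F"
proof -
  interpret seminormed X nrm by (rule X)
  obtain C where C: "C \<ge> 0" "\<And>f. f \<in> X \<Longrightarrow> \<bar>F f\<bar> \<le> C * nrm f" using dual_bound[OF X F] by blast
  have bdd: "bdd_above ((\<lambda>f. \<bar>F f\<bar>) ` {f \<in> X. nrm f \<le> 1})"
  proof (rule bdd_aboveI2)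
    fix g assume g: "g \<in> {f \<in> X. nrm f \<le> 1}"
    have "\<bar>F g\<bar> \<le> C * nrm g" using C g by blast
    also have "\<dots> \<le> C * 1" using C g by (intro mult_left_mono) auto
    finally show "\<bar>F g\<bar> \<le> C" by simp
  qed
  have unit: "\<bar>F g\<bar> \<le> dual_norm X nrm F" if "g \<in> X" "nrm g \<le> 1" for g
    unfolding dual_norm_def by (rule cSUP_upper[OF _ bdd]) (use that in simp)
  show "0 \<le> dual_norm X nrm F" using unit[OF closed(1)] nrm_zero by simp
  show "\<bar>F f\<bar> \<le> dual_norm X nrm F * nrm f"
  proof (cases "nrm f = 0")
    case True
    then show ?thesis using C(2)[OF f] by simp
  next
    case False
    then have p: "nrm f > 0" using nrm_nonneg[OF f] by simp
    have "nrm ((1 / nrm f) *\<^sub>R f) \<le> 1" unfolding homogeneous[OF f] using p by simp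
    then have "\<bar>F ((1 / nrm f) *\<^sub>R f)\<bar> \<le> dual_norm X nrm F" by (intro unit closed(4) f)
    then show ?thesis unfolding dualD(2)[OF F f] using p by (simp add: abs_mult field_simps)
  qed
qed

lemma dual_norm_least:
  assumes X: "seminormed X nrm" and "\<And>f. f \<in> X \<Longrightarrow> nrm f \<le> 1 \<Longrightarrow> \<bar>F f\<bar> \<le> K"
  shows "dual_norm X nrm F \<le> K"
proof -
  interpret seminormed X nrm by (rule X)
  show ?thesis unfolding dual_norm_def
    by (rule cSUP_least) (use assms closed(1) nrm_zero in \<open>auto intro!: exI[of _ 0]\<close>)
qed

lemma seminormed_dual:
  assumes X: "seminormed X nrm" shows "seminormed (dual X nrm) (dual_norm X nrm)"
proof
  show "subspace (dual X nrm)"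
  proof (rule subspaceI)
    show "0 \<in> dual X nrm" using zero_dual[OF X] by (simp add: zero_fun_def)
    show "F + G \<in> dual X nrm" if "F \<in> dual X nrm" "G \<in> dual X nrm" for F G
      using dual_add[OF that] by (simp add: plus_fun_def)
    show "c *\<^sub>R F \<in> dual X nrm" if "F \<in> dual X nrm" for c F
      using dual_scale[OF that] by (simp add: scaleR_fun_def)
  qed
next
  fix F G assume FG: "F \<in> dual X nrm" "G \<in> dual X nrm"
  show "dual_norm X nrm (F + G) \<le> dual_norm X nrm F + dual_norm X nrm G"
  proof (rule dual_norm_least[OF X])
    fix f assume f: "f \<in> X" "nrm f \<le> 1"
    have "\<bar>F f\<bar> \<le> dual_norm X nrm F * 1" "\<bar>G f\<bar> \<le> dual_norm X nrm G * 1"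
      using dual_norm_bound[OF X FG(1) f(1)] dual_norm_bound[OF X FG(2) f(1)] f(2)
      by (meson mult_left_mono order_trans)+
    then show "\<bar>(F + G) f\<bar> \<le> dual_norm X nrm F + dual_norm X nrm G" by (simp add: plus_fun_def)
  qed
next
  fix c F assume F: "F \<in> dual X nrm"
  have le: "dual_norm X nrm (c *\<^sub>R F) \<le> \<bar>c\<bar> * dual_norm X nrm F" if F: "F \<in> dual X nrm" for c F
  proof (rule dual_norm_least[OF X])
    fix f assume f: "f \<in> X" "nrm f \<le> 1"
    have "\<bar>F f\<bar> \<le> dual_norm X nrm F * 1"
      using dual_norm_bound[OF X F f(1)] f(2) by (meson mult_left_mono order_trans)
    then show "\<bar>(c *\<^sub>R F) f\<bar> \<le> \<bar>c\<bar> * dual_norm X nrm F"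
      by (simp add: scaleR_fun_def abs_mult mult_left_mono)
  qed
  show "dual_norm X nrm (c *\<^sub>R F) = \<bar>c\<bar> * dual_norm X nrm F"
  proof (cases "c = 0")
    case True
    interpret seminormed X nrm by (rule X)
    have "0 \<le> dual_norm X nrm (c *\<^sub>R F)"
      using dual_norm_bound(2)[OF X _ closed(1), of "c *\<^sub>R F"] dual_scale[OF F, of c] by (simp add: scaleR_fun_def)
    then show ?thesis using le[OF F, of c] True by simp
  next
    case False
    have "c *\<^sub>R F \<in> dual X nrm" using dual_scale[OF F, of c] by (simp add: scaleR_fun_def)
    from le[OF this, of "inverse c"] have "dual_norm X nrm F \<le> \<bar>inverse c\<bar> * dual_norm X nrm (c *\<^sub>R F)"
      using False by simp
    then have "\<bar>c\<bar> * dual_norm X nrm F \<le> \<bar>c\<bar> * (\<bar>inverse c\<bar> * dual_norm X nrm (c *\<^sub>R F))" by (rule mult_left_mono) simp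
    also have "\<dots> = dual_norm X nrm (c *\<^sub>R F)" using False by (simp add: abs_inverse)
    finally show ?thesis using le[OF F, of c] by simp
  qed
qed

text \<open>
  The time derivatives live in the dual, to which the theory of functions of time applies as well.
\<close>

lemma seminormed_hat_dual: "seminormed hat_W12_dual hat_W12_dual_norm"
  using seminormed_dual[OF hat_W12.seminormed_axioms] unfolding hat_W12_dual_def hat_W12_dual_norm_def .

lemma evaluation_dual:
  assumes g: "g \<in> hat_W12" shows "(\<lambda>F. F g) \<in> dual hat_W12_dual hat_W12_dual_norm"
proof (rule dualI[where C = "W12_norm g"])
  fix F assume "F \<in> hat_W12_dual"
  from dual_norm_bound(1)[OF hat_W12.seminormed_axioms this[unfolded hat_W12_dual_def] g]
  show "\<bar>F g\<bar> \<le> W12_norm g * hat_W12_dual_norm F" by (simp add: hat_W12_dual_norm_def mult.commute)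
qed (auto simp: plus_fun_def scaleR_fun_def)

section \<open>The Galerkin system tested with a basis function\<close>

lemma span_C1:
  assumes "\<And>b. b \<in> B \<Longrightarrow> C1 b" "p \<in> span B" shows "C1 p"
  using assms(2)
proof (induction rule: span_induct_alt)
  case base then show ?case by (rule C1_zero)
next
  case (step c x y) then show ?case using assms(1) by (intro C1_add C1_scale)
qed

lemma C1_ip_wgrad:
  assumes f: "C1 f" and h: "h \<in> L2" shows "ip (wgrad f) h = ip (grad f) h"
  by (intro ip_cong_AE C1_wgrad(2) W12_wgrad(3) C1_wgrad(1) C1_L2(4) f h AE_I2 refl)

lemma span_perp_grad:
  assumes "p \<in> span xi_set" shows "perp_grad p \<in> hat_L2_vec"
proof -
  have "C1 p \<and> perp_grad p \<in> span perp_set" using assms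
  proof (induction rule: span_induct_alt)
    case base
    have e0: "perp_grad 0 = 0" unfolding perp_grad_def C1_zero by (auto simp: fsimps zero_prod_def)
    show ?case unfolding e0 by (intro conjI C1_zero(1) span_zero)
  next
    case (step c x y)
    have x: "C1 x" using step(1) by (rule basis_sets(5))
    have y: "C1 y" using step by blast
    have e: "perp_grad (c *\<^sub>R x + y) = c *\<^sub>R perp_grad x + perp_grad y"
      unfolding perp_grad_def C1_add(2,3)[OF C1_scale(1)[OF x] y] C1_scale(2,3)[OF x]
      by (auto simp: fsimps)
    have "perp_grad x \<in> span perp_set" using step(1) by (intro span_base) blast
    then have "perp_grad (c *\<^sub>R x + y) \<in> span perp_set"
      unfolding e using step by (intro span_add span_scale) blast+
    then show ?case using C1_add(1)[OF C1_scale(1)[OF x] y] by blast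
  qed
  then show ?thesis using span_subsets(3) by blast
qed

locale galerkin_limit =
  fixes T R \<beta> :: real
    and \<theta>0 :: "real \<times> real \<Rightarrow> real"
    and \<theta>N d\<theta>N PN \<Phi>N :: "nat \<Rightarrow> real \<Rightarrow> real \<times> real \<Rightarrow> real"
    and r :: "nat \<Rightarrow> nat"
    and \<theta> P :: "real \<Rightarrow> real \<times> real \<Rightarrow> real"
    and u :: "real \<Rightarrow> real \<times> real \<Rightarrow> real \<times> real"
    and d\<theta> :: "real \<Rightarrow> (real \<times> real \<Rightarrow> real) \<Rightarrow> real"
  assumes T: "T > 0"
    and initial: "\<theta>0 \<in> hat_L2"
    and gal: "\<And>N. galerkin T R \<beta> \<theta>0 N (\<theta>N N) (d\<theta>N N) (PN N) (\<Phi>N N)"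
    and r: "strict_mono r"
    and conv_\<theta>: "weakly_converges_L2_time T hat_W12 W12_norm (\<lambda>j. \<theta>N (r j)) \<theta>"
    and conv_d\<theta>: "weakly_converges_L2_time T hat_W12_dual hat_W12_dual_norm
           (\<lambda>j t. pivot (d\<theta>N (r j) t)) d\<theta>"
    and conv_u: "weakly_converges_L2_time T hat_L2_vec L2_norm (\<lambda>j t. perp_grad (\<Phi>N (r j) t)) u"
    and conv_P: "weakly_converges_L2_time T tilde_W12 W12_norm (\<lambda>j. PN (r j)) P"
begin

lemma limits:
  "\<theta> \<in> L2_time T hat_W12 W12_norm" "d\<theta> \<in> L2_time T hat_W12_dual hat_W12_dual_norm"
  "u \<in> L2_time T hat_L2_vec L2_norm" "P \<in> L2_time T tilde_W12 W12_norm"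
  "\<theta>N (r j) \<in> L2_time T hat_W12 W12_norm" "(\<lambda>t. pivot (d\<theta>N (r j) t)) \<in> L2_time T hat_W12_dual hat_W12_dual_norm"
  "(\<lambda>t. perp_grad (\<Phi>N (r j) t)) \<in> L2_time T hat_L2_vec L2_norm"
  using conv_\<theta> conv_d\<theta> conv_u conv_P unfolding weakly_converges_L2_time_def weakly_converges_def by blast+

lemma spans:
  assumes t: "t \<in> {0..T}"
  shows "\<theta>N N t \<in> span xi_set" "d\<theta>N N t \<in> span xi_set" "\<Phi>N N t \<in> span xi_set" "PN N t \<in> span phi_set"
proof -
  have x: "(\<Sum>(i, m, n)\<in>truncated xi_index N. a i m n *\<^sub>R xi i m n) \<in> span xi_set" for a
  proof (rule span_sum)
    fix k assume "k \<in> truncated xi_index N"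
    then obtain i m n where k: "k = (i, m, n)" "(i, m, n) \<in> xi_index"
      using truncated_subset by (cases k) blast
    then have "xi i m n \<in> xi_set" by blast
    then show "(case k of (i, m, n) \<Rightarrow> a i m n *\<^sub>R xi i m n) \<in> span xi_set"
      unfolding k prod.case by (intro span_scale span_base)
  qed
  have p: "(\<Sum>(i, m, n)\<in>truncated phi_index N. a i m n *\<^sub>R phi i m n) \<in> span phi_set" for a
  proof (rule span_sum)
    fix k assume "k \<in> truncated phi_index N"
    then obtain i m n where k: "k = (i, m, n)" "(i, m, n) \<in> phi_index"
      using truncated_subset by (cases k) blast
    then have "phi i m n \<in> phi_set" by blast
    then show "(case k of (i, m, n) \<Rightarrow> a i m n *\<^sub>R phi i m n) \<in> span phi_set"
      unfolding k prod.case by (intro span_scale span_base)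
  qed
  obtain a a' b c where "\<theta>N N t = (\<Sum>(i, m, n) \<in> truncated xi_index N. a i m n t *\<^sub>R xi i m n)"
       "d\<theta>N N t = (\<Sum>(i, m, n) \<in> truncated xi_index N. a' i m n t *\<^sub>R xi i m n)"
       "PN N t = (\<Sum>(i, m, n) \<in> truncated phi_index N. b i m n t *\<^sub>R phi i m n)"
       "\<Phi>N N t = (\<Sum>(i, m, n) \<in> truncated xi_index N. c i m n t *\<^sub>R xi i m n)"
    using gal[of N] t unfolding galerkin_def by blast
  then show "\<theta>N N t \<in> span xi_set" "d\<theta>N N t \<in> span xi_set" "\<Phi>N N t \<in> span xi_set" "PN N t \<in> span phi_set"
    using x p by simp_all
qed

lemma C1_approx:
  assumes t: "t \<in> {0..T}"
  shows "C1 (\<theta>N N t)" "C1 (d\<theta>N N t)" "C1 (\<Phi>N N t)" "C1 (PN N t)"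
  using spans[OF t, of N] span_C1 basis_sets(5,6) by blast+

lemma approx_spaces:
  assumes t: "t \<in> {0..T}" shows "\<theta>N N t \<in> hat_W12" "PN N t \<in> tilde_W12"
  using spans[OF t, of N] span_subsets by blast+

lemma wgrad_approx:
  assumes t: "t \<in> {0..T}" and h: "h \<in> L2"
  shows "ip (wgrad (\<theta>N N t)) h = ip (grad (\<theta>N N t)) h" "ip (wgrad (PN N t)) h = ip (grad (PN N t)) h"
  by (rule C1_ip_wgrad[OF C1_approx(1)[OF t] h], rule C1_ip_wgrad[OF C1_approx(4)[OF t] h])

lemma galerkin_pressure:
  assumes k: "(i, m, n) \<in> truncated phi_index N" and t: "t \<in> {0..T}"
  shows "- ip (wgrad (PN N t)) (grad (phi i m n)) - \<beta> * ip (\<lambda>p. snd (wgrad (PN N t) p)) (phi i m n)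
      = R * ip (\<lambda>p. snd (wgrad (\<theta>N N t) p)) (\<lambda>p. weight \<beta> p * phi i m n p)"
proof -
  have i: "i = 1 \<or> i = -1" using k by (auto simp: truncated_def phi_index_def)
  have wL: "(\<lambda>p. weight \<beta> p * phi i m n p) \<in> L2" by (intro weight_mult_L2 phi_L2)
  have "- ip (grad (PN N t)) (grad (phi i m n)) - \<beta> * ip (dz (PN N t)) (phi i m n)
         = R * ip (\<lambda>p. exp (\<beta> * snd p) * dz (\<theta>N N t) p) (phi i m n)"
    using gal[of N] k t unfolding galerkin_def by blast
  moreover have "ip (\<lambda>p. exp (\<beta> * snd p) * dz (\<theta>N N t) p) (phi i m n) = ip (dz (\<theta>N N t)) (\<lambda>p. weight \<beta> p * phi i m n p)"
    using ip_weight[of \<beta> "dz (\<theta>N N t)"] unfolding weight_def .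
  moreover have "ip (\<lambda>p. snd (wgrad (\<theta>N N t) p)) (\<lambda>p. weight \<beta> p * phi i m n p) = ip (dz (\<theta>N N t)) (\<lambda>p. weight \<beta> p * phi i m n p)"
    unfolding ip_component wgrad_approx[OF t L2_Pair[OF L2_zero wL]] by (simp add: ip_component[symmetric] grad_def)
  moreover have "ip (\<lambda>p. snd (wgrad (PN N t) p)) (phi i m n) = ip (dz (PN N t)) (phi i m n)"
    unfolding ip_component wgrad_approx[OF t L2_Pair[OF L2_zero phi_L2]] by (simp add: ip_component[symmetric] grad_def)
  ultimately show ?thesis using wgrad_approx(2)[OF t C1_L2(4)[OF phi_C1(1)[OF i]]] by simp
qed

lemma galerkin_stream:
  assumes k: "(i, m, n) \<in> truncated xi_index N" and t: "t \<in> {0..T}"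
  shows "ip (perp_grad (\<Phi>N N t)) (perp_grad (xi i m n)) =
    \<beta> * ip (\<lambda>p. fst (wgrad (PN N t) p)) (\<lambda>p. weight (-\<beta>) p * xi i m n p) - R * ip (\<lambda>p. fst (wgrad (\<theta>N N t) p)) (xi i m n)"
proof -
  have wL: "(\<lambda>p. weight (-\<beta>) p * xi i m n p) \<in> L2" by (intro weight_mult_L2 xi_L2)
  have "- ip (grad (\<Phi>N N t)) (grad (xi i m n))
         = - \<beta> * ip (\<lambda>p. exp (- \<beta> * snd p) * dx (PN N t) p) (xi i m n) + R * ip (dx (\<theta>N N t)) (xi i m n)"
    using gal[of N] k t unfolding galerkin_def by blast
  moreover have "ip (\<lambda>p. exp (- \<beta> * snd p) * dx (PN N t) p) (xi i m n) = ip (dx (PN N t)) (\<lambda>p. weight (-\<beta>) p * xi i m n p)"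
    using ip_weight[of "-\<beta>" "dx (PN N t)"] unfolding weight_def .
  moreover have "ip (\<lambda>p. fst (wgrad (PN N t) p)) (\<lambda>p. weight (-\<beta>) p * xi i m n p) = ip (dx (PN N t)) (\<lambda>p. weight (-\<beta>) p * xi i m n p)"
    unfolding ip_component wgrad_approx[OF t L2_Pair[OF wL L2_zero]] by (simp add: ip_component[symmetric] grad_def)
  moreover have "ip (\<lambda>p. fst (wgrad (\<theta>N N t) p)) (xi i m n) = ip (dx (\<theta>N N t)) (xi i m n)"
    unfolding ip_component wgrad_approx[OF t L2_Pair[OF xi_L2 L2_zero]] by (simp add: ip_component[symmetric] grad_def)
  moreover have "ip (perp_grad (\<Phi>N N t)) (perp_grad (xi i m n)) = ip (grad (\<Phi>N N t)) (grad (xi i m n))"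
    by (simp add: ip_def perp_grad_def grad_def add.commute)
  ultimately show ?thesis by simp
qed

text \<open>
  The convective term is integrated by parts, so that no derivative of the temperature is left in
  it.
\<close>

lemma galerkin_heat:
  assumes k: "(i, m, n) \<in> truncated xi_index N" and t: "t \<in> {0..T}"
  shows "ip (d\<theta>N N t) (xi i m n) = ip (perp_grad (\<Phi>N N t)) (\<lambda>p. \<theta>N N t p *\<^sub>R grad (xi i m n) p)
    + ip (\<lambda>p. snd (perp_grad (\<Phi>N N t) p)) (xi i m n) - ip (wgrad (\<theta>N N t)) (grad (xi i m n))"
proof -
  have i: "i = 1 \<or> i = -1" using k by (auto simp: truncated_def xi_index_def)
  have "ip (d\<theta>N N t) (xi i m n) + ip (\<lambda>p. perp_grad (\<Phi>N N t) p \<bullet> grad (\<theta>N N t) p) (xi i m n)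
         = ip (dx (\<Phi>N N t)) (xi i m n) - ip (grad (\<theta>N N t)) (grad (xi i m n))"
    using gal[of N] k t unfolding galerkin_def by blast
  moreover have "ip (\<lambda>p. perp_grad (\<Phi>N N t) p \<bullet> grad (\<theta>N N t) p) (xi i m n) = - ip (perp_grad (\<Phi>N N t)) (\<lambda>p. \<theta>N N t p *\<^sub>R grad (xi i m n) p)"
  proof -
    let ?u = "perp_grad (\<Phi>N N t)" and ?x = "xi i m n"
    note X = xi_C1(1)[OF i, of m n]
    have h: "(\<lambda>p. ?x p *\<^sub>R ?u p) \<in> L2" by (intro continuous_mult_L2 C1D X C1_L2 C1_approx t)
    have "ip (\<lambda>p. ?u p \<bullet> wgrad (\<theta>N N t) p) ?x = - ip ?u (\<lambda>p. \<theta>N N t p *\<^sub>R grad ?x p)"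
      by (intro convective_by_parts span_perp_grad spans approx_spaces t i)
    moreover have "ip (\<lambda>p. ?u p \<bullet> wgrad (\<theta>N N t) p) ?x = ip (wgrad (\<theta>N N t)) (\<lambda>p. ?x p *\<^sub>R ?u p)"
      "ip (\<lambda>p. ?u p \<bullet> grad (\<theta>N N t) p) ?x = ip (grad (\<theta>N N t)) (\<lambda>p. ?x p *\<^sub>R ?u p)"
      by (simp_all add: ip_def inner_commute mult_ac)
    ultimately show ?thesis using wgrad_approx(1)[OF t h] by simp
  qed
  ultimately show ?thesis using wgrad_approx(1)[OF t C1_L2(4)[OF xi_C1(1)[OF i]]] by (simp add: perp_grad_def)
qed

end

section \<open>Limits of the pressure and stream function equations\<close>

lemma hat_L2_seminormed: "seminormed hat_W12 L2_norm"
  by (rule seminormed_subspace[OF L2.seminormed_axioms hat_W12.subsp]) (use hat_W12_subset W12_wgrad in blast)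

lemma hat_L2: "f \<in> hat_W12 \<Longrightarrow> f \<in> L2" "f \<in> hat_W12 \<Longrightarrow> wgrad f \<in> L2"
  using hat_W12_subset W12_wgrad by blast+

lemma dual_time_L1:
  assumes X: "seminormed X nX" and l: "l \<in> dual X nX"
  obtains C where "C \<ge> 0" "\<And>f. f \<in> L2_time T X nX \<Longrightarrow> (LINT t|time_measure T. \<bar>l (f t)\<bar>) \<le> C * L2_time_norm T nX f"
proof -
  obtain C where C: "C \<ge> 0" "bounded_form X nX UNIV scalar_norm (\<lambda>f c. c * l f) C"
    "\<And>f. f \<in> X \<Longrightarrow> \<bar>l f\<bar> \<le> C * nX f" by (rule dual_form[OF X l]) (rule that)
  interpret bounded_form X nX UNIV scalar_norm "\<lambda>f c. c * l f" C by (rule C(2))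
  have one: "(\<lambda>_. 1) \<in> L2_time T UNIV scalar_norm" by (rule bounded_scalar_L2_time[where C = 1]) auto
  show ?thesis
  proof (rule that[of "C * L2_time_norm T scalar_norm (\<lambda>_. 1)"])
    show "0 \<le> C * L2_time_norm T scalar_norm (\<lambda>_. 1)" using C(1) by (simp add: L2_time_norm_def)
    fix f assume "f \<in> L2_time T X nX"
    from form_time(2)[OF this one] show "(LINT t|time_measure T. \<bar>l (f t)\<bar>) \<le> C * L2_time_norm T scalar_norm (\<lambda>_. 1) * L2_time_norm T nX f"
      using C(1) by (simp add: mult_ac)
  qed
qed

text \<open>
  The convective term tested with a basis function, up to sign, after integration by parts.
\<close>

definition convection :: "(int \<times> nat \<times> nat) \<Rightarrow> (real \<times> real \<Rightarrow> real) \<Rightarrow> (real \<times> real \<Rightarrow> real \<times> real) \<Rightarrow> real" where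
  "convection k f v = ip v (\<lambda>p. f p *\<^sub>R grad (sine_mode k) p)"

lemma convection_form:
  assumes k: "k \<in> xi_index"
  obtains K where "K \<ge> 0" "bounded_form hat_W12 L2_norm hat_L2_vec L2_norm (convection k) K"
proof -
  let ?g = "grad (sine_mode k)"
  note X = mode_C1(1)[OF k]
  have "continuous_on \<Omega>0 ?g" unfolding grad_def by (intro continuous_intros C1D X)
  then have "compact (?g ` \<Omega>0)" by (intro compact_continuous_image) (simp_all add: Omega0_cbox)
  then obtain K where K: "\<And>p. p \<in> \<Omega>0 \<Longrightarrow> norm (?g p) \<le> K" by (metis bounded_iff compact_imp_bounded imageI)
  have gm: "?g \<in> borel_measurable \<mu>" using C1_L2(4)[OF X] by (rule L2_measurable)
  have M: "(\<lambda>p. f p *\<^sub>R ?g p) \<in> L2" "L2_norm (\<lambda>p. f p *\<^sub>R ?g p) \<le> \<bar>K\<bar> * L2_norm f" if f: "f \<in> L2" for f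
  proof -
    have m: "(\<lambda>p. f p *\<^sub>R ?g p) \<in> borel_measurable \<mu>" using gm L2_measurable[OF f] by measurable
    have "norm (f p *\<^sub>R ?g p) \<le> K * norm (f p)" if "p \<in> \<Omega>0" for p
      using mult_right_mono[OF K[OF that] abs_ge_zero[of "f p"]] by (simp add: mult.commute)
    then have ae: "AE p in \<mu>. norm (f p *\<^sub>R ?g p) \<le> K * norm (f p)" by (intro AE_I2) simp
    show "(\<lambda>p. f p *\<^sub>R ?g p) \<in> L2" "L2_norm (\<lambda>p. f p *\<^sub>R ?g p) \<le> \<bar>K\<bar> * L2_norm f"
      using L2_dominated[OF m f ae] by auto
  qed
  have vL: "v \<in> L2" if "v \<in> hat_L2_vec" for v using that hat_W12_subset by blast
  have "bounded_form hat_W12 L2_norm hat_L2_vec L2_norm (convection k) \<bar>K\<bar>"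
  proof (intro bounded_form.intro hat_L2_seminormed hat_vec.seminormed_axioms bounded_form_axioms.intro)
    fix f f' v assume f: "f \<in> hat_W12" "f' \<in> hat_W12" and v: "v \<in> hat_L2_vec"
    have "(\<lambda>p. (f + f') p *\<^sub>R ?g p) = (\<lambda>p. f p *\<^sub>R ?g p) + (\<lambda>p. f' p *\<^sub>R ?g p)" by (auto simp: fsimps scaleR_add_left)
    then show "convection k (f + f') v = convection k f v + convection k f' v"
      unfolding convection_def using M(1) hat_L2(1) f vL[OF v] by (simp only: L2.add_right)
  next
    fix c f v assume f: "f \<in> hat_W12" and v: "v \<in> hat_L2_vec"
    have "(\<lambda>p. (c *\<^sub>R f) p *\<^sub>R ?g p) = c *\<^sub>R (\<lambda>p. f p *\<^sub>R ?g p)" by (auto simp: fsimps)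
    then show "convection k (c *\<^sub>R f) v = c * convection k f v"
      unfolding convection_def using M(1) hat_L2(1) f vL[OF v] by (simp only: L2.scale_right)
  next
    fix f v v' assume "f \<in> hat_W12" "v \<in> hat_L2_vec" "v' \<in> hat_L2_vec"
    then show "convection k f (v + v') = convection k f v + convection k f v'"
      unfolding convection_def using M(1) hat_L2(1) vL by (simp only: L2.add_left)
  next
    fix f v assume f: "f \<in> hat_W12" and v: "v \<in> hat_L2_vec"
    have "\<bar>convection k f v\<bar> \<le> L2_norm v * L2_norm (\<lambda>p. f p *\<^sub>R ?g p)"
      unfolding convection_def by (intro L2.cauchy_schwarz vL v M(1) hat_L2(1) f)
    also have "\<dots> \<le> L2_norm v * (\<bar>K\<bar> * L2_norm f)"
      by (intro mult_left_mono M(2) hat_L2(1) f L2.nrm_nonneg vL v)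
    finally show "\<bar>convection k f v\<bar> \<le> \<bar>K\<bar> * (L2_norm f * L2_norm v)" by (simp add: mult_ac)
  qed
  then show ?thesis using that[of "\<bar>K\<bar>"] by simp
qed

lemma hat_time_L2:
  assumes "f \<in> L2_time T hat_W12 W12_norm" shows "f \<in> L2_time T hat_W12 L2_norm"
  by (rule L2_time_mono[OF hat_W12.seminormed_axioms hat_L2_seminormed _ assms])
     (use W12_norm_ge(1) hat_W12_subset in blast)

lemma L2_time_norm_le:
  assumes f: "f \<in> L2_time T hat_W12 W12_norm" shows "L2_time_norm T L2_norm f \<le> L2_time_norm T W12_norm f"
  unfolding L2_time_norm_def
proof (intro real_sqrt_le_mono integral_mono_AE)
  show "integrable (time_measure T) (\<lambda>t. (L2_norm (f t))\<^sup>2)"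
    by (rule seminormed.L2_timeD(2)[OF hat_L2_seminormed hat_time_L2[OF f]])
  show "integrable (time_measure T) (\<lambda>t. (W12_norm (f t))\<^sup>2)" by (rule hat_W12.L2_timeD(2)[OF f])
  show "AE t in time_measure T. (L2_norm (f t))\<^sup>2 \<le> (W12_norm (f t))\<^sup>2"
    using hat_W12.L2_timeD(1)[OF f]
  proof eventually_elim
    case (elim t)
    then have W: "f t \<in> W12" using hat_W12_subset by blast
    show ?case by (intro power_mono W12_norm_ge(1) W L2.nrm_nonneg W12_wgrad(2))
  qed
qed

lemma sine_mode_hat: "k \<in> xi_index \<Longrightarrow> sine_mode k \<in> hat_W12"
  by (cases k) (auto simp: sine_mode_def xi_index_iff intro: xi_hat)

context galerkin_limit
begin

lemma r_ge: "j \<le> r j"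
  by (rule seq_suble[OF r])

lemma eventually_mode: "\<forall>\<^sub>F j in sequentially. (i, m, n) \<in> I \<longrightarrow> (i, m, n) \<in> truncated I (r j)"
proof -
  have "\<forall>\<^sub>F j in sequentially. max m n \<le> j" by (rule eventually_ge_at_top)
  then show ?thesis
  proof eventually_elim
    case (elim j)
    then show ?case using r_ge[of j] by (auto intro!: mode_truncated)
  qed
qed

lemma dual_W12: "l \<in> dual W12 W12_norm \<Longrightarrow> l \<in> dual hat_W12 W12_norm" "l \<in> dual W12 W12_norm \<Longrightarrow> l \<in> dual tilde_W12 W12_norm"
  using dual_subset hat_W12_subset by blast+

lemma limit_pressure_mode:
  assumes k: "(i, m, n) \<in> phi_index"
  shows "AE t in time_measure T. - ip (wgrad (P t)) (grad (phi i m n)) - \<beta> * ip (\<lambda>p. snd (wgrad (P t) p)) (phi i m n)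
      = R * ip (\<lambda>p. exp (\<beta> * snd p) * snd (wgrad (\<theta> t) p)) (phi i m n)"
proof -
  have i: "i = 1 \<or> i = -1" using k by (auto simp: phi_index_def)
  have gL: "grad (phi i m n) \<in> L2" using C1_L2(4)[OF phi_C1(1)[OF i]] .
  have wL: "(\<lambda>p. weight \<beta> p * phi i m n p) \<in> L2" by (intro weight_mult_L2 phi_L2)
  let ?lx = "\<lambda>f. - ip (wgrad f) (grad (phi i m n)) - \<beta> * ip (\<lambda>p. snd (wgrad f p)) (phi i m n)"
  let ?ly = "\<lambda>f. - (R * ip (\<lambda>p. snd (wgrad f p)) (\<lambda>p. weight \<beta> p * phi i m n p))"
  have "AE t in time_measure T. ?lx (P t) + ?ly (\<theta> t) + (\<lambda>_. 0) (\<theta> t) = 0"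
  proof (rule limit_equation[OF tilde_W12.seminormed_axioms hat_W12.seminormed_axioms hat_W12.seminormed_axioms _ _ _ conv_P conv_\<theta> conv_\<theta>])
    show "?lx \<in> dual tilde_W12 W12_norm"
      by (intro dual_W12 dual_diff dual_minus dual_scale wgrad_W12_dual wgrad_component_dual gL phi_L2)
    show "?ly \<in> dual hat_W12 W12_norm"
      by (intro dual_W12 dual_minus dual_scale wgrad_component_dual wL)
    show "(\<lambda>_. 0) \<in> dual hat_W12 W12_norm" by (rule zero_dual[OF hat_W12.seminormed_axioms])
    show "\<forall>\<^sub>F j in sequentially. \<forall>t\<in>{0<..<T}. ?lx (PN (r j) t) + ?ly (\<theta>N (r j) t) + 0 = 0"
      using eventually_mode[of i m n phi_index]
    proof eventually_elim
      case (elim j)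
      then show ?case using galerkin_pressure[of i m n "r j"] k by auto
    qed
  qed
  then show ?thesis
  proof eventually_elim
    case (elim t)
    then show ?case using ip_weight[of \<beta> "\<lambda>p. snd (wgrad (\<theta> t) p)" "phi i m n"] unfolding weight_def by simp
  qed
qed

lemma limit_pressure:
  "AE t in time_measure T. \<forall>k. k \<in> phi_index \<longrightarrow> (case k of (i, m, n) \<Rightarrow>
     - ip (wgrad (P t)) (grad (phi i m n)) - \<beta> * ip (\<lambda>p. snd (wgrad (P t) p)) (phi i m n)
      = R * ip (\<lambda>p. exp (\<beta> * snd p) * snd (wgrad (\<theta> t) p)) (phi i m n))"
  unfolding AE_all_countable
proof
  fix k :: "int \<times> nat \<times> nat"
  obtain i m n where k: "k = (i, m, n)" by (cases k)
  show "AE t in time_measure T. k \<in> phi_index \<longrightarrow> (case k of (i, m, n) \<Rightarrow>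
     - ip (wgrad (P t)) (grad (phi i m n)) - \<beta> * ip (\<lambda>p. snd (wgrad (P t) p)) (phi i m n)
      = R * ip (\<lambda>p. exp (\<beta> * snd p) * snd (wgrad (\<theta> t) p)) (phi i m n))"
    using limit_pressure_mode[of i m n] unfolding k prod.case by (cases "(i, m, n) \<in> phi_index") auto
qed

lemma limit_stream_mode:
  assumes i: "i = 1 \<or> i = -1"
  shows "AE t in time_measure T. ip (u t) (perp_grad (xi i m n)) =
      \<beta> * ip (\<lambda>p. exp (- \<beta> * snd p) * fst (wgrad (P t) p)) (xi i m n) - R * ip (\<lambda>p. fst (wgrad (\<theta> t) p)) (xi i m n)"
proof -
  have k: "(i, m, n) \<in> xi_index" using i by (simp add: xi_index_iff)
  have gL: "perp_grad (xi i m n) \<in> L2" using C1_L2(5)[OF xi_C1(1)[OF i]] .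
  have wL: "(\<lambda>p. weight (-\<beta>) p * xi i m n p) \<in> L2" by (intro weight_mult_L2 xi_L2)
  let ?lx = "\<lambda>v. ip v (perp_grad (xi i m n))"
  let ?ly = "\<lambda>f. - (\<beta> * ip (\<lambda>p. fst (wgrad f p)) (\<lambda>p. weight (-\<beta>) p * xi i m n p))"
  let ?lz = "\<lambda>f. R * ip (\<lambda>p. fst (wgrad f p)) (xi i m n)"
  have "AE t in time_measure T. ?lx (u t) + ?ly (P t) + ?lz (\<theta> t) = 0"
  proof (rule limit_equation[OF hat_vec.seminormed_axioms tilde_W12.seminormed_axioms hat_W12.seminormed_axioms _ _ _ conv_u conv_P conv_\<theta>])
    show "?lx \<in> dual hat_L2_vec L2_norm" using dual_subset[OF ip_dual[OF gL] hat_W12_subset(3)] .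
    show "?ly \<in> dual tilde_W12 W12_norm"
      by (intro dual_W12 dual_minus dual_scale wgrad_component_dual wL)
    show "?lz \<in> dual hat_W12 W12_norm"
      by (intro dual_W12 dual_scale wgrad_component_dual xi_L2)
    show "\<forall>\<^sub>F j in sequentially. \<forall>t\<in>{0<..<T}. ?lx (perp_grad (\<Phi>N (r j) t)) + ?ly (PN (r j) t) + ?lz (\<theta>N (r j) t) = 0"
      using eventually_mode[of i m n xi_index]
    proof eventually_elim
      case (elim j)
      then show ?case using galerkin_stream[of i m n "r j"] k by auto
    qed
  qed
  then show ?thesis
  proof eventually_elim
    case (elim t)
    then show ?case using ip_weight[of "-\<beta>" "\<lambda>p. fst (wgrad (P t) p)" "xi i m n"] unfolding weight_def by simp
  qed
qed

lemma limit_stream: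
  "AE t in time_measure T. \<forall>k. k \<in> xi_index \<longrightarrow> (case k of (i, m, n) \<Rightarrow> ip (u t) (perp_grad (xi i m n)) =
      \<beta> * ip (\<lambda>p. exp (- \<beta> * snd p) * fst (wgrad (P t) p)) (xi i m n) - R * ip (\<lambda>p. fst (wgrad (\<theta> t) p)) (xi i m n))"
  unfolding AE_all_countable
proof
  fix k :: "int \<times> nat \<times> nat"
  obtain i m n where k: "k = (i, m, n)" by (cases k)
  show "AE t in time_measure T. k \<in> xi_index \<longrightarrow> (case k of (i, m, n) \<Rightarrow> ip (u t) (perp_grad (xi i m n)) =
      \<beta> * ip (\<lambda>p. exp (- \<beta> * snd p) * fst (wgrad (P t) p)) (xi i m n) - R * ip (\<lambda>p. fst (wgrad (\<theta> t) p)) (xi i m n))"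
    using limit_stream_mode[of i m n] unfolding k prod.case by (cases "i = 1 \<or> i = -1") (auto simp: xi_index_iff)
qed

section \<open>Strong convergence of the temperature\<close>

definition coef :: "nat \<Rightarrow> int \<times> nat \<times> nat \<Rightarrow> real \<Rightarrow> real" where
  "coef j k t = ip (\<theta>N (r j) t) (sine_mode k)"

definition rate :: "nat \<Rightarrow> int \<times> nat \<times> nat \<Rightarrow> real \<Rightarrow> real" where
  "rate j k t = ip (d\<theta>N (r j) t) (sine_mode k)"

text \<open>
  Defined for every \<open>t\<close>, while \<open>\<theta> t\<close> is determined only up to
  null sets of times.
\<close>

definition lim_coef :: "int \<times> nat \<times> nat \<Rightarrow> real \<Rightarrow> real" where
  "lim_coef k t = ip \<theta>0 (sine_mode k) + (LINT s|time_measure T. indicator {..<t} s * d\<theta> s (sine_mode k))"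

lemma indicator_lessThan: "(indicator {..<t} :: real \<Rightarrow> real) \<in> borel_measurable (time_measure T)"
  "\<And>s. \<bar>indicator {..<t} s :: real\<bar> \<le> 1"
proof -
  have "(indicator {..<t} :: real \<Rightarrow> real) \<in> borel_measurable lebesgue"
    by (rule borel_measurable_indicator) simp
  then show "(indicator {..<t} :: real \<Rightarrow> real) \<in> borel_measurable (time_measure T)" by (rule measurable_restrict_space1)
qed (simp add: indicator_def)

lemma rate_integrable:
  assumes k: "k \<in> xi_index"
  shows "integrable (time_measure T) (rate j k)" "integrable (time_measure T) (\<lambda>s. indicator {..<t} s * rate j k s)"
  using dual_time_integrable(1)[OF seminormed_hat_dual evaluation_dual[OF sine_mode_hat[OF k]] limits(6)[of j]]
    dual_time(1)[OF seminormed_hat_dual evaluation_dual[OF sine_mode_hat[OF k]] indicator_lessThan limits(6)[of j], of t]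
  by (simp_all add: pivot_def rate_def[abs_def])

lemma coef_integrable:
  assumes k: "k \<in> xi_index"
  shows "integrable (time_measure T) (coef j k)"
  using dual_time_integrable(1)[OF hat_W12.seminormed_axioms dual_W12(1)[OF ip_W12_dual[OF mode_L2(1)]] limits(5)[of j]]
  by (simp add: coef_def[abs_def])

lemma coef_derivative:
  assumes t: "t \<in> {0..T}"
  shows "(coef j k has_real_derivative rate j k t) (at t within {0..T})"
proof -
  obtain a a' b c where A: "\<forall>t\<in>{0..T}.
       \<theta>N (r j) t = (\<Sum>(i, m, n) \<in> truncated xi_index (r j). a i m n t *\<^sub>R xi i m n) \<and>
       d\<theta>N (r j) t = (\<Sum>(i, m, n) \<in> truncated xi_index (r j). a' i m n t *\<^sub>R xi i m n) \<and>
       PN (r j) t = (\<Sum>(i, m, n) \<in> truncated phi_index (r j). b i m n t *\<^sub>R phi i m n) \<and>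
       \<Phi>N (r j) t = (\<Sum>(i, m, n) \<in> truncated xi_index (r j). c i m n t *\<^sub>R xi i m n) \<and>
       (\<forall>(i, m, n) \<in> truncated xi_index (r j).
          (a i m n has_real_derivative a' i m n t) (at t within {0..T}))"
    using conjunct1[OF gal[of "r j", unfolded galerkin_def]] by (elim exE)
  have e: "\<theta>N (r j) t = (\<Sum>(i, m, n) \<in> truncated xi_index (r j). a i m n t *\<^sub>R xi i m n)"
       "d\<theta>N (r j) t = (\<Sum>(i, m, n) \<in> truncated xi_index (r j). a' i m n t *\<^sub>R xi i m n)"
       "(i, m, n) \<in> truncated xi_index (r j) \<Longrightarrow> (a i m n has_real_derivative a' i m n t) (at t within {0..T})"
    if "t \<in> {0..T}" for t i m n
    using bspec[OF A that] by blast+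
  define c where "c = (\<lambda>(i, m, n). ip (xi i m n) (sine_mode k))"
  have s: "ip (\<Sum>(i, m, n) \<in> truncated xi_index (r j). b i m n *\<^sub>R xi i m n) (sine_mode k) =
    (\<Sum>(i, m, n) \<in> truncated xi_index (r j). b i m n * c (i, m, n))" for b
    using L2.sum_left[of "truncated xi_index (r j)" "\<lambda>(i, m, n). xi i m n" "sine_mode k" "\<lambda>(i, m, n). b i m n"] mode_L2(1)[of k]
    by (simp add: case_prod_unfold xi_L2 c_def)
  have D: "((\<lambda>t. \<Sum>(i, m, n) \<in> truncated xi_index (r j). a i m n t * c (i, m, n)) has_real_derivative
      (\<Sum>(i, m, n) \<in> truncated xi_index (r j). a' i m n t * c (i, m, n))) (at t within {0..T})"
    unfolding case_prod_unfold by (rule DERIV_sum) (use e(3)[OF t] in \<open>auto intro!: DERIV_cmult_right\<close>)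
  have "(\<Sum>(i, m, n) \<in> truncated xi_index (r j). a i m n t * c (i, m, n)) = coef j k t" if "t \<in> {0..T}" for t
    unfolding coef_def e(1)[OF that] s ..
  moreover have "rate j k t = (\<Sum>(i, m, n) \<in> truncated xi_index (r j). a' i m n t * c (i, m, n))"
    unfolding rate_def e(2)[OF t] s ..
  ultimately show ?thesis
    by (simp only:) (rule has_field_derivative_transform_within[OF D zero_less_one t])
qed

lemma coef_FTC:
  assumes k: "k \<in> xi_index" and t: "t \<in> {0..T}"
  shows "coef j k t = coef j k 0 + (LINT s|time_measure T. indicator {..<t} s * rate j k s)"
proof -
  have 1: "(rate j k has_integral (coef j k t - coef j k 0)) {0..t}"
  proof (rule fundamental_theorem_of_calculus)
    show "(coef j k has_vector_derivative rate j k s) (at s within {0..t})" if "s \<in> {0..t}" for s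
    proof -
      have "(coef j k has_real_derivative rate j k s) (at s within {0..T})" using that t by (intro coef_derivative) auto
      then have "(coef j k has_real_derivative rate j k s) (at s within {0..t})"
        using t by (rule_tac DERIV_subset) auto
      then show ?thesis by (simp only: has_real_derivative_iff_has_vector_derivative)
    qed
  qed (use t in simp)
  then have 2: "((\<lambda>s. if s \<in> {0..t} then rate j k s else 0) has_integral (coef j k t - coef j k 0)) UNIV"
    by (simp only: has_integral_restrict_UNIV)
  have "((\<lambda>s. if s \<in> {0<..<T} then indicator {..<t} s * rate j k s else 0) has_integral (coef j k t - coef j k 0)) UNIV"
    by (rule has_integral_spike_finite[OF _ _ 2, of "{0, t}"]) (use t in \<open>auto simp: indicator_def\<close>)
  then have "((\<lambda>s. indicator {..<t} s * rate j k s) has_integral (coef j k t - coef j k 0)) {0<..<T}"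
    by (simp only: has_integral_restrict_UNIV)
  moreover have "((\<lambda>s. indicator {..<t} s * rate j k s) has_integral (LINT s|time_measure T. indicator {..<t} s * rate j k s)) {0<..<T}"
    by (rule has_integral_integral_lebesgue_on[OF rate_integrable(2)[OF k]]) simp
  ultimately have "coef j k t - coef j k 0 = (LINT s|time_measure T. indicator {..<t} s * rate j k s)"
    by (rule has_integral_unique)
  then show ?thesis by simp
qed

lemma theta0_L2: "\<theta>0 \<in> L2"
  using initial hat_W12_subset by blast

lemma coef_initial: "\<forall>\<^sub>F j in sequentially. k \<in> xi_index \<longrightarrow> coef j k 0 = ip \<theta>0 (sine_mode k)"
proof -
  obtain i m n where k: "k = (i, m, n)" by (cases k)
  show ?thesis using eventually_mode[of i m n xi_index]
  proof eventually_elim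
    case (elim j)
    have "ip (\<theta>0 - \<theta>N (r j) 0) (xi i m n) = 0" if "(i, m, n) \<in> truncated xi_index (r j)"
      using gal[of "r j"] that unfolding galerkin_def by blast
    moreover have "\<theta>N (r j) 0 \<in> L2" using approx_spaces(1)[of 0] T hat_L2 by auto
    ultimately show ?case using elim theta0_L2 by (auto simp: k coef_def sine_mode_def L2.diff_left xi_L2)
  qed
qed

text \<open>
  The coefficient is its initial value plus the integral of its derivative up to time
  \<open>t\<close>, and the latter is a functional of the time derivative.
\<close>

lemma coef_limit:
  assumes k: "k \<in> xi_index" and t: "t \<in> {0..T}"
  shows "(\<lambda>j. coef j k t) \<longlonglongrightarrow> lim_coef k t"
proof -
  have "(\<lambda>j. LINT s|time_measure T. indicator {..<t} s * rate j k s) \<longlonglongrightarrow> (LINT s|time_measure T. indicator {..<t} s * d\<theta> s (sine_mode k))"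
    using dual_time(2)[OF seminormed_hat_dual evaluation_dual[OF sine_mode_hat[OF k]] indicator_lessThan conv_d\<theta>, of t]
    by (simp add: pivot_def rate_def)
  then have "(\<lambda>j. ip \<theta>0 (sine_mode k) + (LINT s|time_measure T. indicator {..<t} s * rate j k s)) \<longlonglongrightarrow> lim_coef k t"
    unfolding lim_coef_def by (intro tendsto_intros)
  moreover have "\<forall>\<^sub>F j in sequentially. ip \<theta>0 (sine_mode k) + (LINT s|time_measure T. indicator {..<t} s * rate j k s) = coef j k t"
    using coef_initial[of k] by eventually_elim (use k coef_FTC[OF k t] in simp)
  ultimately show ?thesis by (rule Lim_transform_eventually)
qed

lemma temperature_bound: "\<exists>C\<ge>0. \<forall>j. L2_time_norm T W12_norm (\<theta>N (r j)) \<le> C"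
  by (rule weak_time_bounded[OF hat_W12.pre_hilbert_axioms conv_\<theta>])

lemma velocity_bound: "\<exists>C\<ge>0. \<forall>j. L2_time_norm T L2_norm (\<lambda>t. perp_grad (\<Phi>N (r j) t)) \<le> C"
  by (rule weak_time_bounded[OF hat_vec.pre_hilbert_axioms conv_u])

lemma heat_mode:
  assumes k: "k \<in> truncated xi_index N" and t: "t \<in> {0..T}"
  shows "ip (d\<theta>N N t) (sine_mode k) = convection k (\<theta>N N t) (perp_grad (\<Phi>N N t))
    + ip (\<lambda>p. snd (perp_grad (\<Phi>N N t) p)) (sine_mode k) - ip (wgrad (\<theta>N N t)) (grad (sine_mode k))"
proof -
  obtain i m n where e: "k = (i, m, n)" by (cases k)
  show ?thesis using galerkin_heat[OF k[unfolded e] t] by (simp add: e sine_mode_def convection_def)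
qed

lemma snd_dual: assumes "h \<in> L2" shows "(\<lambda>v. ip (\<lambda>p. snd (v p)) h) \<in> dual hat_L2_vec L2_norm"
  unfolding ip_component by (rule dual_subset[OF ip_dual hat_W12_subset(3)]) (intro L2_Pair assms L2_zero)

text \<open>
  Estimating the right-hand side of the heat equation term by term, with the bounds for weakly
  convergent sequences. The time derivatives themselves are not covered by
  \<open>weak_time_bounded\<close>, as their space is a dual with no inner product at hand.
\<close>

lemma rate_bounded:
  assumes k: "k \<in> xi_index"
  obtains K where "\<forall>\<^sub>F j in sequentially. (LINT s|time_measure T. \<bar>rate j k s\<bar>) \<le> K"
proof -
  obtain A where A: "A \<ge> 0" "\<And>j. L2_time_norm T W12_norm (\<theta>N (r j)) \<le> A" using temperature_bound by blast
  obtain B where B: "B \<ge> 0" "\<And>j. L2_time_norm T L2_norm (\<lambda>t. perp_grad (\<Phi>N (r j) t)) \<le> B" using velocity_bound by blast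
  define C where "C = max A B"
  have C: "C \<ge> 0" "L2_time_norm T W12_norm (\<theta>N (r j)) \<le> C"
    "L2_time_norm T L2_norm (\<lambda>t. perp_grad (\<Phi>N (r j) t)) \<le> C" for j
    using A(1) A(2)[of j] B(2)[of j] by (auto simp: C_def)
  obtain K1 where K1: "K1 \<ge> 0" "bounded_form hat_W12 L2_norm hat_L2_vec L2_norm (convection k) K1"
    using convection_form[OF k] by blast
  interpret B: bounded_form hat_W12 L2_norm hat_L2_vec L2_norm "convection k" K1 by (rule K1(2))
  obtain K2 where K2: "K2 \<ge> 0" "\<And>v. v \<in> L2_time T hat_L2_vec L2_norm \<Longrightarrow>
      (LINT t|time_measure T. \<bar>ip (\<lambda>p. snd (v t p)) (sine_mode k)\<bar>) \<le> K2 * L2_time_norm T L2_norm v"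
    using dual_time_L1[OF hat_vec.seminormed_axioms snd_dual[OF mode_L2(1)[of k]]] by blast
  have gL: "grad (sine_mode k) \<in> L2" using C1_L2(4)[OF mode_C1(1)[OF k]] .
  note gd = dual_W12(1)[OF wgrad_W12_dual[OF gL]]
  obtain K3 where K3: "K3 \<ge> 0" "\<And>v. v \<in> L2_time T hat_W12 W12_norm \<Longrightarrow>
      (LINT t|time_measure T. \<bar>ip (wgrad (v t)) (grad (sine_mode k))\<bar>) \<le> K3 * L2_time_norm T W12_norm v"
    using dual_time_L1[OF hat_W12.seminormed_axioms gd] by blast
  obtain i m n where e: "k = (i, m, n)" by (cases k)
  have "\<forall>\<^sub>F j in sequentially. (LINT s|time_measure T. \<bar>rate j k s\<bar>) \<le> K1 * (C * C) + K2 * C + K3 * C"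
    using eventually_mode[of i m n xi_index]
  proof eventually_elim
    case (elim j)
    then have kj: "k \<in> truncated xi_index (r j)" using k e by blast
    let ?v = "\<lambda>t. perp_grad (\<Phi>N (r j) t)" and ?f = "\<theta>N (r j)"
    have i1: "integrable (time_measure T) (\<lambda>t. \<bar>convection k (?f t) (?v t)\<bar>)"
      using B.form_time(1)[OF hat_time_L2[OF limits(5)] limits(7)] by simp
    have i2: "integrable (time_measure T) (\<lambda>t. \<bar>ip (\<lambda>p. snd (?v t p)) (sine_mode k)\<bar>)"
      using dual_time_integrable(1)[OF hat_vec.seminormed_axioms snd_dual[OF mode_L2(1)[of k]] limits(7)] by simp
    have i3: "integrable (time_measure T) (\<lambda>t. \<bar>ip (wgrad (?f t)) (grad (sine_mode k))\<bar>)"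
      using dual_time_integrable(1)[OF hat_W12.seminormed_axioms gd limits(5)] by simp
    have "(LINT s|time_measure T. \<bar>rate j k s\<bar>) \<le> (LINT s|time_measure T. \<bar>convection k (?f s) (?v s)\<bar>
       + \<bar>ip (\<lambda>p. snd (?v s p)) (sine_mode k)\<bar> + \<bar>ip (wgrad (?f s)) (grad (sine_mode k))\<bar>)"
    proof (rule integral_mono)
      show "integrable (time_measure T) (\<lambda>s. \<bar>rate j k s\<bar>)" using rate_integrable(1)[OF k] by simp
      fix s assume "s \<in> space (time_measure T)"
      then have "s \<in> {0..T}" by simp
      then have e: "rate j k s = convection k (?f s) (?v s) + ip (\<lambda>p. snd (?v s p)) (sine_mode k) - ip (wgrad (?f s)) (grad (sine_mode k))"
        unfolding rate_def by (rule heat_mode[OF kj])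
      show "\<bar>rate j k s\<bar> \<le> \<bar>convection k (?f s) (?v s)\<bar>
       + \<bar>ip (\<lambda>p. snd (?v s p)) (sine_mode k)\<bar> + \<bar>ip (wgrad (?f s)) (grad (sine_mode k))\<bar>"
        unfolding e by linarith
    qed (intro Bochner_Integration.integrable_add i1 i2 i3)
    also have "\<dots> = (LINT s|time_measure T. \<bar>convection k (?f s) (?v s)\<bar>)
       + (LINT s|time_measure T. \<bar>ip (\<lambda>p. snd (?v s p)) (sine_mode k)\<bar>) + (LINT s|time_measure T. \<bar>ip (wgrad (?f s)) (grad (sine_mode k))\<bar>)"
      using i1 i2 i3 by simp
    also have "\<dots> \<le> K1 * (C * C) + K2 * C + K3 * C"
    proof (intro add_mono)
      have "(LINT s|time_measure T. \<bar>convection k (?f s) (?v s)\<bar>) \<le> \<bar>K1\<bar> * (L2_time_norm T L2_norm ?f * L2_time_norm T L2_norm ?v)"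
        by (rule B.form_time(2)[OF hat_time_L2[OF limits(5)] limits(7)])
      also have "\<dots> \<le> \<bar>K1\<bar> * (C * C)"
      proof (intro mult_left_mono mult_mono C)
        show "L2_time_norm T L2_norm ?f \<le> C" using L2_time_norm_le[OF limits(5), of j] C(2)[of j] by linarith
      qed (auto simp: L2_time_norm_def)
      finally show "(LINT s|time_measure T. \<bar>convection k (?f s) (?v s)\<bar>) \<le> K1 * (C * C)" using K1(1) by simp
      show "(LINT s|time_measure T. \<bar>ip (\<lambda>p. snd (?v s p)) (sine_mode k)\<bar>) \<le> K2 * C"
        using K2(2)[OF limits(7), of j] mult_left_mono[OF C(3) K2(1), of j] by linarith
      show "(LINT s|time_measure T. \<bar>ip (wgrad (?f s)) (grad (sine_mode k))\<bar>) \<le> K3 * C"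
        using K3(2)[OF limits(5), of j] mult_left_mono[OF C(2) K3(1), of j] by linarith
    qed
    finally show ?case .
  qed
  then show ?thesis by (rule that)
qed

lemma coef_bounded:
  assumes k: "k \<in> xi_index"
  obtains K where "\<forall>\<^sub>F j in sequentially. \<forall>t\<in>{0..T}. \<bar>coef j k t\<bar> \<le> K"
proof -
  obtain K where K: "\<forall>\<^sub>F j in sequentially. (LINT s|time_measure T. \<bar>rate j k s\<bar>) \<le> K" using rate_bounded[OF k] by blast
  have "\<forall>\<^sub>F j in sequentially. \<forall>t\<in>{0..T}. \<bar>coef j k t\<bar> \<le> \<bar>ip \<theta>0 (sine_mode k)\<bar> + K"
    using K coef_initial[of k]
  proof eventually_elim
    case (elim j)
    show ?case
    proof
      fix t assume t: "t \<in> {0..T}"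
      have "\<bar>LINT s|time_measure T. indicator {..<t} s * rate j k s\<bar> \<le> (LINT s|time_measure T. \<bar>indicator {..<t} s * rate j k s\<bar>)"
        by (rule integral_abs_bound)
      also have "\<dots> \<le> (LINT s|time_measure T. \<bar>rate j k s\<bar>)"
        using rate_integrable(1)[OF k, of j] integrable_abs[OF rate_integrable(2)[OF k, of t j]]
        by (intro integral_mono) (auto simp: indicator_def)
      finally show "\<bar>coef j k t\<bar> \<le> \<bar>ip \<theta>0 (sine_mode k)\<bar> + K" using elim k coef_FTC[OF k t, of j] by simp
    qed
  qed
  then show ?thesis by (rule that)
qed

lemma lim_coef_measurable: assumes k: "k \<in> xi_index" shows "lim_coef k \<in> borel_measurable (time_measure T)"
proof (rule borel_measurable_LIMSEQ_metric)
  show "coef j k \<in> borel_measurable (time_measure T)" for j using coef_integrable[OF k] by simp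
  show "(\<lambda>j. coef j k t) \<longlonglongrightarrow> lim_coef k t" if "t \<in> space (time_measure T)" for t
    using that by (intro coef_limit k) auto
qed

lemma lim_coef_bounded:
  assumes k: "k \<in> xi_index"
  obtains K where "K \<ge> 0" "\<And>t. t \<in> {0..T} \<Longrightarrow> \<bar>lim_coef k t\<bar> \<le> K" "\<forall>\<^sub>F j in sequentially. \<forall>t\<in>{0..T}. \<bar>coef j k t\<bar> \<le> K"
proof -
  obtain K where K: "\<forall>\<^sub>F j in sequentially. \<forall>t\<in>{0..T}. \<bar>coef j k t\<bar> \<le> K" using coef_bounded[OF k] by blast
  have l: "\<bar>lim_coef k t\<bar> \<le> K" if t: "t \<in> {0..T}" for t
  proof (rule tendsto_upperbound[OF tendsto_rabs[OF coef_limit[OF k t]]])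
    show "\<forall>\<^sub>F j in sequentially. \<bar>coef j k t\<bar> \<le> K" using K by eventually_elim (use t in blast)
  qed simp
  have "0 \<le> K" using l[of 0] T by auto
  then show ?thesis using that l K by blast
qed

text \<open>
  The coefficients converge pointwise to one side and weakly in time to the other.
\<close>

lemma lim_coef_eq:
  assumes k: "k \<in> xi_index" shows "AE t in time_measure T. ip (\<theta> t) (sine_mode k) = lim_coef k t"
proof -
  interpret finite_measure "time_measure T" by (rule finite_time)
  obtain K where K: "K \<ge> 0" "\<And>t. t \<in> {0..T} \<Longrightarrow> \<bar>lim_coef k t\<bar> \<le> K" "\<forall>\<^sub>F j in sequentially. \<forall>t\<in>{0..T}. \<bar>coef j k t\<bar> \<le> K"
    using lim_coef_bounded[OF k] by blast
  obtain J where J: "\<And>j t. j \<ge> J \<Longrightarrow> t \<in> {0..T} \<Longrightarrow> \<bar>coef j k t\<bar> \<le> K" using K(3) unfolding eventually_sequentially by blast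
  note d = dual_W12(1)[OF ip_W12_dual[OF mode_L2(1)[of k]]]
  note lm = lim_coef_measurable[OF k]
  have li: "integrable (time_measure T) (lim_coef k)"
    by (rule integrable_const_bound[where B = K]) (use K(2) lm in \<open>auto intro!: AE_I2\<close>)
  have ti: "integrable (time_measure T) (\<lambda>t. ip (\<theta> t) (sine_mode k))"
    by (rule dual_time_integrable(1)[OF hat_W12.seminormed_axioms d limits(1)])
  have "AE t in time_measure T. ip (\<theta> t) (sine_mode k) - lim_coef k t = 0"
  proof (rule AE_zero_test)
    show "integrable (time_measure T) (\<lambda>t. ip (\<theta> t) (sine_mode k) - lim_coef k t)" using li ti by simp
    fix \<psi> :: "real \<Rightarrow> real" assume p: "\<psi> \<in> borel_measurable (time_measure T)" "\<And>t. \<bar>\<psi> t\<bar> \<le> 1"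
    have 1: "(\<lambda>j. LINT t|time_measure T. \<psi> t * coef j k t) \<longlonglongrightarrow> (LINT t|time_measure T. \<psi> t * ip (\<theta> t) (sine_mode k))"
      unfolding coef_def by (rule dual_time(2)[OF hat_W12.seminormed_axioms d p conv_\<theta>])
    have "(\<lambda>j. LINT t|time_measure T. \<psi> t * coef (j + J) k t) \<longlonglongrightarrow> (LINT t|time_measure T. \<psi> t * lim_coef k t)"
    proof (rule integral_dominated_convergence[where w = "\<lambda>_. K"])
      show "(\<lambda>t. \<psi> t * lim_coef k t) \<in> borel_measurable (time_measure T)" using p lm by measurable
      show "(\<lambda>t. \<psi> t * coef (j + J) k t) \<in> borel_measurable (time_measure T)" for j
        using p coef_integrable[OF k] by measurable
      show "AE t in time_measure T. (\<lambda>j. \<psi> t * coef (j + J) k t) \<longlonglongrightarrow> \<psi> t * lim_coef k t"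
        using coef_limit[OF k] by (intro AE_I2 tendsto_intros LIMSEQ_ignore_initial_segment) auto
      show "AE t in time_measure T. norm (\<psi> t * coef (j + J) k t) \<le> K" for j
      proof (intro AE_I2)
        fix t assume "t \<in> space (time_measure T)"
        then have "\<bar>coef (j + J) k t\<bar> \<le> K" by (intro J) auto
        then have "\<bar>\<psi> t\<bar> * \<bar>coef (j + J) k t\<bar> \<le> 1 * K" using p(2) by (intro mult_mono) auto
        then show "norm (\<psi> t * coef (j + J) k t) \<le> K" by (simp add: abs_mult)
      qed
    qed simp
    then have "(\<lambda>j. LINT t|time_measure T. \<psi> t * coef j k t) \<longlonglongrightarrow> (LINT t|time_measure T. \<psi> t * lim_coef k t)"
      by (rule LIMSEQ_offset)
    then have "(LINT t|time_measure T. \<psi> t * ip (\<theta> t) (sine_mode k)) = (LINT t|time_measure T. \<psi> t * lim_coef k t)"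
      using LIMSEQ_unique[OF 1] by blast
    moreover have "integrable (time_measure T) (\<lambda>t. \<psi> t * ip (\<theta> t) (sine_mode k))"
      by (rule dual_time(1)[OF hat_W12.seminormed_axioms d p limits(1)])
    moreover have "integrable (time_measure T) (\<lambda>t. \<psi> t * lim_coef k t)"
    proof (rule Bochner_Integration.integrable_bound[OF li])
      show "(\<lambda>t. \<psi> t * lim_coef k t) \<in> borel_measurable (time_measure T)" using p lm by measurable
      show "AE t in time_measure T. norm (\<psi> t * lim_coef k t) \<le> norm (lim_coef k t)"
        using mult_right_mono[OF p(2) abs_ge_zero] by (intro AE_I2) (simp add: abs_mult)
    qed
    ultimately show "(LINT t|time_measure T. \<psi> t * (ip (\<theta> t) (sine_mode k) - lim_coef k t)) = 0"
      by (simp add: right_diff_distrib)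
  qed
  then show ?thesis by simp
qed

text \<open>
  Dominated convergence, with the bound from \<open>lim_coef_bounded\<close>.
\<close>

lemma coef_converges:
  assumes k: "k \<in> xi_index"
  shows "(\<lambda>j. LINT t|time_measure T. (ip (\<theta>N (r j) t - \<theta> t) (sine_mode k))\<^sup>2) \<longlonglongrightarrow> 0"
    "integrable (time_measure T) (\<lambda>t. (ip (\<theta>N (r j) t - \<theta> t) (sine_mode k))\<^sup>2)"
proof -
  interpret finite_measure "time_measure T" by (rule finite_time)
  note d = dual_W12(1)[OF ip_W12_dual[OF mode_L2(1)[of k]]]
  note i = dual_time_integrable(2)[OF hat_W12.seminormed_axioms d hat_W12.L2_time_diff(1)[OF limits(5) limits(1)]]
  show "integrable (time_measure T) (\<lambda>t. (ip (\<theta>N (r j) t - \<theta> t) (sine_mode k))\<^sup>2)" by (rule i)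
  obtain K where K: "K \<ge> 0" "\<And>t. t \<in> {0..T} \<Longrightarrow> \<bar>lim_coef k t\<bar> \<le> K" "\<forall>\<^sub>F j in sequentially. \<forall>t\<in>{0..T}. \<bar>coef j k t\<bar> \<le> K"
    using lim_coef_bounded[OF k] by blast
  obtain J where J: "\<And>j t. j \<ge> J \<Longrightarrow> t \<in> {0..T} \<Longrightarrow> \<bar>coef j k t\<bar> \<le> K" using K(3) unfolding eventually_sequentially by blast
  note lm = lim_coef_measurable[OF k]
  have eq: "(LINT t|time_measure T. (ip (\<theta>N (r j) t - \<theta> t) (sine_mode k))\<^sup>2) = (LINT t|time_measure T. (coef j k t - lim_coef k t)\<^sup>2)" for j
  proof (rule integral_cong_AE)
    show "AE t in time_measure T. (ip (\<theta>N (r j) t - \<theta> t) (sine_mode k))\<^sup>2 = (coef j k t - lim_coef k t)\<^sup>2"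
      using lim_coef_eq[OF k] hat_W12.L2_timeD(1)[OF limits(1)] hat_W12.L2_timeD(1)[OF limits(5)[of j]]
      by eventually_elim (simp add: coef_def L2.diff_left hat_L2 mode_L2)
    show "(\<lambda>t. (ip (\<theta>N (r j) t - \<theta> t) (sine_mode k))\<^sup>2) \<in> borel_measurable (time_measure T)" using i by measurable
    show "(\<lambda>t. (coef j k t - lim_coef k t)\<^sup>2) \<in> borel_measurable (time_measure T)"
      using coef_integrable[OF k, of j] lm by measurable
  qed
  have "(\<lambda>j. LINT t|time_measure T. (coef (j + J) k t - lim_coef k t)\<^sup>2) \<longlonglongrightarrow> (LINT t|time_measure T. 0)"
  proof (rule integral_dominated_convergence[where w = "\<lambda>_. (2 * K)\<^sup>2"])
    show "(\<lambda>t. (coef (j + J) k t - lim_coef k t)\<^sup>2) \<in> borel_measurable (time_measure T)" for j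
      using coef_integrable[OF k, of "j + J"] lm by measurable
    show "AE t in time_measure T. (\<lambda>j. (coef (j + J) k t - lim_coef k t)\<^sup>2) \<longlonglongrightarrow> 0"
    proof (intro AE_I2)
      fix t assume "t \<in> space (time_measure T)"
      then have "(\<lambda>j. coef (j + J) k t) \<longlonglongrightarrow> lim_coef k t"
        by (intro LIMSEQ_ignore_initial_segment coef_limit k) auto
      then have "(\<lambda>j. (coef (j + J) k t - lim_coef k t)\<^sup>2) \<longlonglongrightarrow> (lim_coef k t - lim_coef k t)\<^sup>2" by (intro tendsto_intros)
      then show "(\<lambda>j. (coef (j + J) k t - lim_coef k t)\<^sup>2) \<longlonglongrightarrow> 0" by simp
    qed
    show "AE t in time_measure T. norm ((coef (j + J) k t - lim_coef k t)\<^sup>2) \<le> (2 * K)\<^sup>2" for j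
    proof (intro AE_I2)
      fix t assume "t \<in> space (time_measure T)"
      then have t: "t \<in> {0..T}" by auto
      have "\<bar>coef (j + J) k t - lim_coef k t\<bar> \<le> 2 * K" using J[of "j + J", OF _ t] K(2)[OF t] by simp
      then have "\<bar>coef (j + J) k t - lim_coef k t\<bar>\<^sup>2 \<le> (2 * K)\<^sup>2" by (intro power_mono) auto
      then show "norm ((coef (j + J) k t - lim_coef k t)\<^sup>2) \<le> (2 * K)\<^sup>2" by simp
    qed
  qed simp_all
  then have "(\<lambda>j. LINT t|time_measure T. (coef (j + J) k t - lim_coef k t)\<^sup>2) \<longlonglongrightarrow> 0" by simp
  then show "(\<lambda>j. LINT t|time_measure T. (ip (\<theta>N (r j) t - \<theta> t) (sine_mode k))\<^sup>2) \<longlonglongrightarrow> 0"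
    unfolding eq by (rule LIMSEQ_offset)
qed

lemma diff_time: "(\<lambda>t. \<theta>N (r j) t - \<theta> t) \<in> L2_time T hat_W12 W12_norm"
  by (rule hat_W12.L2_time_diff(1)[OF limits(5) limits(1)])

text \<open>
  Split into the frequencies up to \<open>M\<close>, of which finitely many coefficients converge,
  and the rest, which is of order \<open>1 / M\<^sup>2\<close> uniformly in \<open>j\<close>.
\<close>

lemma strong_convergence: "(\<lambda>j. L2_time_norm T L2_norm (\<lambda>t. \<theta>N (r j) t - \<theta> t)) \<longlonglongrightarrow> 0"
proof -
  let ?d = "\<lambda>j t. \<theta>N (r j) t - \<theta> t" and ?J = "truncated xi_index"
  obtain C where C: "C \<ge> 0" "\<And>j. L2_time_norm T W12_norm (\<theta>N (r j)) \<le> C" using temperature_bound by blast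
  define D where "D = 2 * C\<^sup>2 + 2 * (L2_time_norm T W12_norm \<theta>)\<^sup>2"
  have D0: "D \<ge> 0" by (simp add: D_def)
  have D: "(L2_time_norm T W12_norm (?d j))\<^sup>2 \<le> D" for j
  proof -
    have "(L2_time_norm T W12_norm (\<theta>N (r j)))\<^sup>2 \<le> C\<^sup>2" by (intro power_mono C hat_W12.L2_time_norm_nonneg)
    then show ?thesis using hat_W12.L2_time_diff(2)[OF limits(5) limits(1), of j] unfolding D_def by linarith
  qed
  define S where "S M j = (\<Sum>k\<in>?J M. (LINT t|time_measure T. (ip (?d j t) (sine_mode k))\<^sup>2) / ip (sine_mode k) (sine_mode k))" for M j
  have S: "S M \<longlonglongrightarrow> (\<Sum>k\<in>?J M. 0 / ip (sine_mode k) (sine_mode k))" for M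
    unfolding S_def divide_inverse
    by (intro tendsto_sum tendsto_mult tendsto_const coef_converges(1)) (rule truncated_index)
  have bound: "(L2_time_norm T L2_norm (?d j))\<^sup>2 \<le> S M j + D / (pi * real (Suc M))\<^sup>2" for M j
  proof -
    let ?c = "\<lambda>k t. (ip (?d j t) (sine_mode k))\<^sup>2 / ip (sine_mode k) (sine_mode k)"
    have i1: "integrable (time_measure T) (?c k)" if "k \<in> ?J M" for k
      using coef_converges(2)[OF truncated_index[OF that], of j] by simp
    have i2: "integrable (time_measure T) (\<lambda>t. (W12_norm (?d j t))\<^sup>2 / (pi * real (Suc M))\<^sup>2)"
      using hat_W12.L2_timeD(2)[OF diff_time[of j]] by simp
    have "(L2_time_norm T L2_norm (?d j))\<^sup>2 = (LINT t|time_measure T. (L2_norm (?d j t))\<^sup>2)"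
      by (simp add: L2_time_norm_def)
    also have "\<dots> \<le> (LINT t|time_measure T. (\<Sum>k\<in>?J M. ?c k t) + (W12_norm (?d j t))\<^sup>2 / (pi * real (Suc M))\<^sup>2)"
    proof (rule integral_mono_AE)
      show "integrable (time_measure T) (\<lambda>t. (L2_norm (?d j t))\<^sup>2)"
        by (rule seminormed.L2_timeD(2)[OF hat_L2_seminormed hat_time_L2[OF diff_time]])
      show "integrable (time_measure T) (\<lambda>t. (\<Sum>k\<in>?J M. ?c k t) + (W12_norm (?d j t))\<^sup>2 / (pi * real (Suc M))\<^sup>2)"
        using i1 i2 by (intro Bochner_Integration.integrable_add Bochner_Integration.integrable_sum)
      show "AE t in time_measure T. (L2_norm (?d j t))\<^sup>2 \<le> (\<Sum>k\<in>?J M. ?c k t) + (W12_norm (?d j t))\<^sup>2 / (pi * real (Suc M))\<^sup>2"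
        using hat_W12.L2_timeD(1)[OF diff_time[of j]]
      proof eventually_elim
        case (elim t)
        have "(L2_norm (wgrad (?d j t)))\<^sup>2 \<le> (W12_norm (?d j t))\<^sup>2"
          using elim hat_W12_subset by (intro power_mono W12_norm_ge L2.nrm_nonneg hat_L2) blast+
        then have "(L2_norm (wgrad (?d j t)))\<^sup>2 / (pi * real (Suc M))\<^sup>2 \<le> (W12_norm (?d j t))\<^sup>2 / (pi * real (Suc M))\<^sup>2"
          by (rule divide_right_mono) simp
        then show ?case using poincare_tail[OF elim, of M] by (simp add: sine_mode_def case_prod_unfold)
      qed
    qed
    also have "\<dots> = S M j + (LINT t|time_measure T. (W12_norm (?d j t))\<^sup>2) / (pi * real (Suc M))\<^sup>2"
      unfolding S_def using i1 i2 by (subst Bochner_Integration.integral_add) (auto simp: Bochner_Integration.integral_sum)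
    also have "(LINT t|time_measure T. (W12_norm (?d j t))\<^sup>2) = (L2_time_norm T W12_norm (?d j))\<^sup>2"
      by (simp add: hat_W12.L2_time_norm_square)
    finally show ?thesis using divide_right_mono[OF D[of j] zero_le_power2[of "pi * real (Suc M)"]] by linarith
  qed
  have "(\<lambda>j. (L2_time_norm T L2_norm (?d j))\<^sup>2) \<longlonglongrightarrow> 0"
  proof (rule LIMSEQ_I)
    fix e :: real assume e: "e > 0"
    have "(\<lambda>M. D * inverse (real (Suc M))) \<longlonglongrightarrow> D * 0" by (intro tendsto_intros LIMSEQ_inverse_real_of_nat)
    then have "\<forall>\<^sub>F M in sequentially. D * inverse (real (Suc M)) < e/2" by (rule order_tendstoD) (use e in simp)
    then obtain M where M: "D * inverse (real (Suc M)) < e/2" unfolding eventually_sequentially by blast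
    have "D / (pi * real (Suc M))\<^sup>2 \<le> D / real (Suc M)"
    proof (rule divide_left_mono[OF _ D0])
      have a: "real (Suc M) \<le> pi * real (Suc M)" using mult_right_mono[of 1 pi "real (Suc M)"] pi_gt3 by simp
      have b: "1 \<le> pi * real (Suc M)" by (rule order_trans[OF _ a]) simp
      have "real (Suc M) * 1 \<le> (pi * real (Suc M)) * (pi * real (Suc M))" using a b by (intro mult_mono) auto
      then show "real (Suc M) \<le> (pi * real (Suc M))\<^sup>2" by (simp add: power2_eq_square)
    qed simp
    then have M': "D / (pi * real (Suc M))\<^sup>2 < e/2"
      using M divide_inverse[of D "real (Suc M)"] by linarith
    have "\<forall>\<^sub>F j in sequentially. S M j < e/2" using order_tendstoD(2)[OF S[of M], of "e/2"] e by simp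
    then obtain J where J: "\<And>j. j \<ge> J \<Longrightarrow> S M j < e/2" unfolding eventually_sequentially by blast
    have "norm ((L2_time_norm T L2_norm (?d j))\<^sup>2 - 0) < e" if "j \<ge> J" for j
    proof -
      have "(L2_time_norm T L2_norm (?d j))\<^sup>2 < e" using bound[of j M] J[OF that] M' by linarith
      then show ?thesis by simp
    qed
    then show "\<exists>J. \<forall>j\<ge>J. norm ((L2_time_norm T L2_norm (?d j))\<^sup>2 - 0) < e" by blast
  qed
  then have "(\<lambda>j. sqrt ((L2_time_norm T L2_norm (?d j))\<^sup>2)) \<longlonglongrightarrow> sqrt 0" by (rule tendsto_real_sqrt)
  then show ?thesis by (simp add: L2_time_norm_def)
qed

section \<open>Passing to the limit in the heat equation\<close>

text \<open>
  The difference to the term with the limiting temperature tends to zero by strong convergence and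
  boundedness of the velocities; what remains is linear in the velocity and passes to the weak
  limit.
\<close>

lemma convection_limit:
  assumes k: "k \<in> xi_index" and p: "\<psi> \<in> borel_measurable (time_measure T)" "\<And>t. \<bar>\<psi> t\<bar> \<le> 1"
  shows "(\<lambda>j. LINT t|time_measure T. \<psi> t * convection k (\<theta>N (r j) t) (perp_grad (\<Phi>N (r j) t)))
      \<longlonglongrightarrow> (LINT t|time_measure T. \<psi> t * convection k (\<theta> t) (u t))"
    "integrable (time_measure T) (\<lambda>t. \<psi> t * convection k (\<theta> t) (u t))"
    "integrable (time_measure T) (\<lambda>t. \<psi> t * convection k (\<theta>N (r j) t) (perp_grad (\<Phi>N (r j) t)))"
proof -
  obtain K where K: "K \<ge> 0" "bounded_form hat_W12 L2_norm hat_L2_vec L2_norm (convection k) K"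
    using convection_form[OF k] by blast
  interpret B: bounded_form hat_W12 L2_norm hat_L2_vec L2_norm "convection k" K by (rule K(2))
  let ?v = "\<lambda>j t. perp_grad (\<Phi>N (r j) t)"
  obtain C where C: "C \<ge> 0" "\<And>j. L2_time_norm T L2_norm (?v j) \<le> C" using velocity_bound by blast
  have tL: "\<theta> \<in> L2_time T hat_W12 L2_norm" "\<theta>N (r j) \<in> L2_time T hat_W12 L2_norm" for j
    by (intro hat_time_L2 limits)+
  have sc: "(\<lambda>t. \<psi> t *\<^sub>R f t) \<in> L2_time T hat_W12 L2_norm" if "f \<in> L2_time T hat_W12 L2_norm" for f
    by (rule L2_time_scale[OF hat_L2_seminormed p that])
  have pull: "integrable (time_measure T) (\<lambda>t. \<psi> t * convection k (f t) (g t))"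
    if f: "f \<in> L2_time T hat_W12 L2_norm" and g: "g \<in> L2_time T hat_L2_vec L2_norm" for f g
  proof (rule Bochner_Integration.integrable_bound[OF B.form_time(1)[OF f g]])
    show "(\<lambda>t. \<psi> t * convection k (f t) (g t)) \<in> borel_measurable (time_measure T)"
      using B.form_time(1)[OF f g] p(1) by measurable
    show "AE t in time_measure T. norm (\<psi> t * convection k (f t) (g t)) \<le> norm (convection k (f t) (g t))"
      using mult_right_mono[OF p(2) abs_ge_zero] by (intro AE_I2) (simp add: abs_mult)
  qed
  show i: "integrable (time_measure T) (\<lambda>t. \<psi> t * convection k (\<theta> t) (u t))"
    "integrable (time_measure T) (\<lambda>t. \<psi> t * convection k (\<theta>N (r j) t) (?v j t))" for j
    by (intro pull tL limits)+
  have swap: "bounded_form hat_L2_vec L2_norm hat_W12 L2_norm (\<lambda>v f. convection k f v) K"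
  proof (intro bounded_form.intro hat_L2_seminormed hat_vec.seminormed_axioms bounded_form_axioms.intro)
    fix c f v assume v: "v \<in> hat_L2_vec" and f: "f \<in> hat_W12"
    have "(\<lambda>p. f p *\<^sub>R grad (sine_mode k) p) \<in> L2"
    proof -
      have "(\<lambda>p. (dx (sine_mode k) p *\<^sub>R f p, dz (sine_mode k) p *\<^sub>R f p)) \<in> L2"
        by (intro L2_Pair continuous_mult_L2 hat_L2(1) f C1D mode_C1(1) k)
      then show ?thesis by (simp add: grad_def mult.commute)
    qed
    then show "convection k f (c *\<^sub>R v) = c * convection k f v"
      unfolding convection_def using v hat_W12_subset by (intro L2.scale_left) auto
  qed (use B.form_add_left B.form_add_right B.form_bound in \<open>auto simp: mult.commute\<close>)
  have conv: "(\<lambda>j. LINT t|time_measure T. \<psi> t * convection k (\<theta> t) (?v j t)) \<longlonglongrightarrow> (LINT t|time_measure T. \<psi> t * convection k (\<theta> t) (u t))"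
  proof -
    have eq: "(LINT t|time_measure T. convection k (\<psi> t *\<^sub>R \<theta> t) (w t)) = (LINT t|time_measure T. \<psi> t * convection k (\<theta> t) (w t))"
      if w: "w \<in> L2_time T hat_L2_vec L2_norm" for w
    proof (rule integral_cong_AE)
      show "(\<lambda>t. convection k (\<psi> t *\<^sub>R \<theta> t) (w t)) \<in> borel_measurable (time_measure T)"
        using B.form_time(1)[OF sc[OF tL(1)] w] by measurable
      show "(\<lambda>t. \<psi> t * convection k (\<theta> t) (w t)) \<in> borel_measurable (time_measure T)"
        using pull[OF tL(1) w] by measurable
      show "AE t in time_measure T. convection k (\<psi> t *\<^sub>R \<theta> t) (w t) = \<psi> t * convection k (\<theta> t) (w t)"
        using hat_W12.L2_timeD(1)[OF limits(1)] hat_vec.L2_timeD(1)[OF w] by eventually_elim (rule B.form_scale_left)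
    qed
    show ?thesis using bounded_form.form_weak_limit[OF swap conv_u sc[OF tL(1)]]
      unfolding eq[OF limits(7)] eq[OF limits(3)] .
  qed
  have small: "(\<lambda>j. (LINT t|time_measure T. \<psi> t * convection k (\<theta>N (r j) t) (?v j t)) - (LINT t|time_measure T. \<psi> t * convection k (\<theta> t) (?v j t))) \<longlonglongrightarrow> 0"
  proof (rule Lim_null_comparison[OF always_eventually], rule allI)
    fix j
    let ?d = "\<lambda>t. \<theta>N (r j) t - \<theta> t"
    have dt: "?d \<in> L2_time T hat_W12 L2_norm" by (rule hat_time_L2[OF diff_time])
    have "(LINT t|time_measure T. \<psi> t * convection k (\<theta>N (r j) t) (?v j t)) - (LINT t|time_measure T. \<psi> t * convection k (\<theta> t) (?v j t))
      = (LINT t|time_measure T. \<psi> t * convection k (\<theta>N (r j) t) (?v j t) - \<psi> t * convection k (\<theta> t) (?v j t))"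
      using i(2)[of j] pull[OF tL(1) limits(7)[of j]] by simp
    also have "\<dots> = (LINT t|time_measure T. \<psi> t * convection k (?d t) (?v j t))"
    proof (rule integral_cong_AE)
      show "(\<lambda>t. \<psi> t * convection k (\<theta>N (r j) t) (?v j t) - \<psi> t * convection k (\<theta> t) (?v j t)) \<in> borel_measurable (time_measure T)"
        using i(2)[of j] pull[OF tL(1) limits(7)[of j]] by measurable
      show "(\<lambda>t. \<psi> t * convection k (?d t) (?v j t)) \<in> borel_measurable (time_measure T)"
        using pull[OF dt limits(7)[of j]] by measurable
      show "AE t in time_measure T. \<psi> t * convection k (\<theta>N (r j) t) (?v j t) - \<psi> t * convection k (\<theta> t) (?v j t) = \<psi> t * convection k (?d t) (?v j t)"
        using hat_W12.L2_timeD(1)[OF limits(1)] hat_W12.L2_timeD(1)[OF limits(5)[of j]] hat_vec.L2_timeD(1)[OF limits(7)[of j]]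
      proof eventually_elim
        case (elim t)
        have "convection k (?d t + \<theta> t) (?v j t) = convection k (?d t) (?v j t) + convection k (\<theta> t) (?v j t)"
          by (intro B.form_add_left hat_W12.clos elim)
        then show ?case by (simp flip: right_diff_distrib)
      qed
    qed
    also have "\<bar>\<dots>\<bar> \<le> (LINT t|time_measure T. \<bar>\<psi> t * convection k (?d t) (?v j t)\<bar>)" by (rule integral_abs_bound)
    also have "\<dots> \<le> (LINT t|time_measure T. \<bar>convection k (?d t) (?v j t)\<bar>)"
      using mult_right_mono[OF p(2) abs_ge_zero]
      by (intro integral_mono integrable_abs pull[OF dt limits(7)[of j]] B.form_time(1)[OF dt limits(7)[of j]]) (simp add: abs_mult)
    also have "\<dots> \<le> \<bar>K\<bar> * (L2_time_norm T L2_norm ?d * L2_time_norm T L2_norm (?v j))"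
      by (rule B.form_time(2)[OF dt limits(7)])
    also have "\<dots> \<le> \<bar>K\<bar> * (L2_time_norm T L2_norm ?d * C)"
      by (intro mult_left_mono C) (auto simp: L2_time_norm_def)
    finally show "norm ((LINT t|time_measure T. \<psi> t * convection k (\<theta>N (r j) t) (?v j t)) - (LINT t|time_measure T. \<psi> t * convection k (\<theta> t) (?v j t)))
      \<le> \<bar>K\<bar> * (L2_time_norm T L2_norm ?d * C)" by simp
  next
    have "(\<lambda>j. \<bar>K\<bar> * (L2_time_norm T L2_norm (\<lambda>t. \<theta>N (r j) t - \<theta> t) * C)) \<longlonglongrightarrow> \<bar>K\<bar> * (0 * C)"
      by (intro tendsto_intros strong_convergence)
    then show "(\<lambda>j. \<bar>K\<bar> * (L2_time_norm T L2_norm (\<lambda>t. \<theta>N (r j) t - \<theta> t) * C)) \<longlonglongrightarrow> 0" by simp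
  qed
  show "(\<lambda>j. LINT t|time_measure T. \<psi> t * convection k (\<theta>N (r j) t) (?v j t))
      \<longlonglongrightarrow> (LINT t|time_measure T. \<psi> t * convection k (\<theta> t) (u t))"
    using tendsto_add[OF small conv] by simp
qed

lemma limit_heat_mode:
  assumes k: "k \<in> xi_index"
  shows "AE t in time_measure T. d\<theta> t (sine_mode k) + ip (\<lambda>p. u t p \<bullet> wgrad (\<theta> t) p) (sine_mode k) =
    ip (\<lambda>p. snd (u t p)) (sine_mode k) - ip (wgrad (\<theta> t)) (grad (sine_mode k))"
proof -
  note s1 = seminormed_hat_dual and e1 = evaluation_dual[OF sine_mode_hat[OF k]]
  note s2 = hat_vec.seminormed_axioms and e2 = snd_dual[OF mode_L2(1)[of k]]
  note s3 = hat_W12.seminormed_axioms and e3 = dual_W12(1)[OF wgrad_W12_dual[OF C1_L2(4)[OF mode_C1(1)[OF k]]]]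
  let ?E = "\<lambda>t. d\<theta> t (sine_mode k) - convection k (\<theta> t) (u t) - ip (\<lambda>p. snd (u t p)) (sine_mode k) + ip (wgrad (\<theta> t)) (grad (sine_mode k))"
  obtain i m n where km: "k = (i, m, n)" by (cases k)
  have i: "i = 1 \<or> i = -1" using k by (simp add: km xi_index_iff)
  have "AE t in time_measure T. ?E t = 0"
  proof (rule AE_zero_test)
    show "integrable (time_measure T) ?E"
      using convection_limit(2)[OF k, of "\<lambda>_. 1"] dual_time_integrable(1)[OF s1 e1 limits(2)]
        dual_time_integrable(1)[OF s2 e2 limits(3)] dual_time_integrable(1)[OF s3 e3 limits(1)] by simp
    fix \<psi> :: "real \<Rightarrow> real" assume p: "\<psi> \<in> borel_measurable (time_measure T)" "\<And>t. \<bar>\<psi> t\<bar> \<le> 1"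
    note i1 = dual_time(1)[OF s1 e1 p] and i2 = dual_time(1)[OF s2 e2 p] and i3 = dual_time(1)[OF s3 e3 p]
    have split: "(LINT t|time_measure T. \<psi> t * (a t - b t - c t + d t)) =
        (LINT t|time_measure T. \<psi> t * a t) - (LINT t|time_measure T. \<psi> t * b t) - (LINT t|time_measure T. \<psi> t * c t) + (LINT t|time_measure T. \<psi> t * d t)"
      if "integrable (time_measure T) (\<lambda>t. \<psi> t * a t)" "integrable (time_measure T) (\<lambda>t. \<psi> t * b t)"
        "integrable (time_measure T) (\<lambda>t. \<psi> t * c t)" "integrable (time_measure T) (\<lambda>t. \<psi> t * d t)" for a b c d :: "real \<Rightarrow> real"
      using that by (simp add: distrib_left right_diff_distrib)
    let ?v = "\<lambda>j t. perp_grad (\<Phi>N (r j) t)" and ?f = "\<lambda>j. \<theta>N (r j)"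
    have lim: "(\<lambda>j. (LINT t|time_measure T. \<psi> t * pivot (d\<theta>N (r j) t) (sine_mode k)) - (LINT t|time_measure T. \<psi> t * convection k (?f j t) (?v j t))
        - (LINT t|time_measure T. \<psi> t * ip (\<lambda>p. snd (?v j t p)) (sine_mode k)) + (LINT t|time_measure T. \<psi> t * ip (wgrad (?f j t)) (grad (sine_mode k))))
      \<longlonglongrightarrow> (LINT t|time_measure T. \<psi> t * d\<theta> t (sine_mode k)) - (LINT t|time_measure T. \<psi> t * convection k (\<theta> t) (u t))
        - (LINT t|time_measure T. \<psi> t * ip (\<lambda>p. snd (u t p)) (sine_mode k)) + (LINT t|time_measure T. \<psi> t * ip (wgrad (\<theta> t)) (grad (sine_mode k)))"
      by (intro tendsto_add tendsto_diff dual_time(2)[OF s1 e1 p conv_d\<theta>] dual_time(2)[OF s2 e2 p conv_u]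
          dual_time(2)[OF s3 e3 p conv_\<theta>] convection_limit(1)[OF k p])
    have "\<forall>\<^sub>F j in sequentially. (LINT t|time_measure T. \<psi> t * pivot (d\<theta>N (r j) t) (sine_mode k)) - (LINT t|time_measure T. \<psi> t * convection k (?f j t) (?v j t))
        - (LINT t|time_measure T. \<psi> t * ip (\<lambda>p. snd (?v j t p)) (sine_mode k)) + (LINT t|time_measure T. \<psi> t * ip (wgrad (?f j t)) (grad (sine_mode k))) = 0"
      using eventually_mode[of i m n xi_index]
    proof eventually_elim
      case (elim j)
      then have kj: "k \<in> truncated xi_index (r j)" using k km by blast
      have "(LINT t|time_measure T. \<psi> t * (pivot (d\<theta>N (r j) t) (sine_mode k) - convection k (?f j t) (?v j t)
          - ip (\<lambda>p. snd (?v j t p)) (sine_mode k) + ip (wgrad (?f j t)) (grad (sine_mode k)))) = (LINT t|time_measure T. 0)"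
        using heat_mode[OF kj] by (intro Bochner_Integration.integral_cong refl) (simp add: pivot_def)
      then show ?case
        by (subst split[symmetric, OF i1[OF limits(6)] convection_limit(3)[OF k p] i2[OF limits(7)] i3[OF limits(5)]]) simp
    qed
    from LIMSEQ_unique[OF lim tendsto_eventually[OF this]]
    show "(LINT t|time_measure T. \<psi> t * ?E t) = 0"
      by (subst split[OF i1[OF limits(2)] convection_limit(2)[OF k p] i2[OF limits(3)] i3[OF limits(1)]])
  qed
  then show ?thesis using hat_W12.L2_timeD(1)[OF limits(1)] hat_vec.L2_timeD(1)[OF limits(3)]
  proof eventually_elim
    case (elim t)
    then show ?case using convective_by_parts[OF elim(3,2) i, of m n] by (simp add: convection_def km sine_mode_def)
  qed
qed

lemma limit_heat:
  "AE t in time_measure T. \<forall>k. k \<in> xi_index \<longrightarrow>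
    d\<theta> t (sine_mode k) + ip (\<lambda>p. u t p \<bullet> wgrad (\<theta> t) p) (sine_mode k) =
    ip (\<lambda>p. snd (u t p)) (sine_mode k) - ip (wgrad (\<theta> t)) (grad (sine_mode k))"
  unfolding AE_all_countable
proof
  fix k show "AE t in time_measure T. k \<in> xi_index \<longrightarrow>
    d\<theta> t (sine_mode k) + ip (\<lambda>p. u t p \<bullet> wgrad (\<theta> t) p) (sine_mode k) =
    ip (\<lambda>p. snd (u t p)) (sine_mode k) - ip (wgrad (\<theta> t)) (grad (sine_mode k))"
    using limit_heat_mode[of k] by (cases "k \<in> xi_index") auto
qed

end

section \<open>From basis functions to all test functions\<close>

lemma hat_density:
  assumes F: "F \<in> dual hat_W12 W12_norm" and z: "\<And>k. k \<in> xi_index \<Longrightarrow> F (sine_mode k) = 0" and g: "g \<in> hat_W12"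
  shows "F g = 0"
proof (rule closure_span_dual_zero[OF hat_W12.seminormed_axioms _ F])
  show "xi_set \<subseteq> hat_W12" using span_superset span_subsets(1) by (rule order_trans)
  show "F b = 0" if "b \<in> xi_set" for b using that z by (force simp: sine_mode_def)
  show "g \<in> closure_span hat_W12 W12_norm xi_set"
    using g unfolding closure_span_def hat_W12_def by blast
qed

lemma pressure_all_tests:
  assumes P: "P \<in> tilde_W12" and \<theta>: "\<theta> \<in> hat_W12" and h: "h \<in> tilde_W12"
    and eq: "\<And>i m n. (i, m, n) \<in> phi_index \<Longrightarrow>
      - ip (wgrad P) (grad (phi i m n)) - \<beta> * ip (\<lambda>p. snd (wgrad P p)) (phi i m n)
        = R * ip (\<lambda>p. exp (\<beta> * snd p) * snd (wgrad \<theta> p)) (phi i m n)"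
  shows "- ip (wgrad P) (wgrad h) - \<beta> * ip (\<lambda>p. snd (wgrad P p)) h = R * ip (\<lambda>p. exp (\<beta> * snd p) * snd (wgrad \<theta> p)) h"
proof -
  have PL: "wgrad P \<in> L2" using P hat_W12_subset W12_wgrad by blast
  have L: "(\<lambda>p. snd (wgrad P p)) \<in> L2" by (rule L2_components(2)[OF PL])
  have wL: "(\<lambda>p. exp (\<beta> * snd p) * snd (wgrad \<theta> p)) \<in> L2"
    using weight_mult_L2[OF L2_components(2)[OF hat_L2(2)[OF \<theta>]], of \<beta>] unfolding weight_def .
  let ?F = "\<lambda>h. - ip (wgrad h) (wgrad P) - \<beta> * ip h (\<lambda>p. snd (wgrad P p)) - R * ip h (\<lambda>p. exp (\<beta> * snd p) * snd (wgrad \<theta> p))"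
  have "?F h = 0"
  proof (rule closure_span_dual_zero[OF W12.seminormed_axioms basis_sets(2) _ _ h[unfolded tilde_W12_def]])
    show "?F \<in> dual W12 W12_norm"
      by (intro dual_diff dual_minus dual_scale wgrad_W12_dual ip_W12_dual PL L wL)
    fix b assume "b \<in> phi_set"
    then obtain i m n where b: "b = phi i m n" and k: "(i, m, n) \<in> phi_index" by blast
    have i: "i = 1 \<or> i = -1" using k by (auto simp: phi_index_def)
    note B = phi_C1(1)[OF i, of m n]
    show "?F b = 0" unfolding b C1_ip_wgrad[OF B PL] L2.sym[OF C1_L2(4)[OF B] PL] L2.sym[OF phi_L2 L] L2.sym[OF phi_L2 wL]
      using eq[OF k] by simp
  qed
  moreover have "h \<in> L2" "wgrad h \<in> L2" using h hat_W12_subset W12_wgrad by blast+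
  ultimately show ?thesis using L2.sym[of h] L2.sym[of "wgrad h" "wgrad P"] PL L wL by simp
qed

text \<open>
  By the multiplier property of \<open>u\<close> every term is a bounded functional of
  \<open>g\<close>, so the equation extends from basis functions by density. The same bound makes
  the convective term integrable.
\<close>

lemma heat_all_tests:
  assumes P: "P \<in> tilde_W12" and \<theta>: "\<theta> \<in> hat_W12" and u: "u \<in> hat_L2_vec" and F: "F \<in> hat_W12_dual"
    and stream: "\<And>i m n. i = 1 \<or> i = -1 \<Longrightarrow> ip u (perp_grad (xi i m n)) =
      \<beta> * ip (\<lambda>p. exp (- \<beta> * snd p) * fst (wgrad P p)) (xi i m n) - R * ip (\<lambda>p. fst (wgrad \<theta> p)) (xi i m n)"
    and heat: "\<And>k. k \<in> xi_index \<Longrightarrow> F (sine_mode k) + ip (\<lambda>p. u p \<bullet> wgrad \<theta> p) (sine_mode k) =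
      ip (\<lambda>p. snd (u p)) (sine_mode k) - ip (wgrad \<theta>) (grad (sine_mode k))"
    and g: "g \<in> hat_W12"
  shows "integrable \<mu> (\<lambda>p. (u p \<bullet> wgrad \<theta> p) * g p)"
    "F g + ip (\<lambda>p. u p \<bullet> wgrad \<theta> p) g = ip (\<lambda>p. snd (u p)) g - ip (wgrad \<theta>) (wgrad g)"
proof -
  have PL: "wgrad P \<in> L2" using P hat_W12_subset W12_wgrad by blast
  have TL: "wgrad \<theta> \<in> L2" by (rule hat_L2(2)[OF \<theta>])
  have uL: "u \<in> L2" using u hat_W12_subset by auto
  have vL: "(\<lambda>p. snd (u p)) \<in> L2" by (rule L2_components(2)[OF uL])
  have a: "(\<lambda>p. weight (-\<beta>) p * fst (wgrad P p)) \<in> L2" by (intro weight_mult_L2 L2_components PL)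
  have b: "(\<lambda>p. fst (wgrad \<theta> p)) \<in> L2" by (intro L2_components TL)
  let ?S = "(-\<beta>) *\<^sub>R (\<lambda>p. weight (-\<beta>) p * fst (wgrad P p)) + R *\<^sub>R (\<lambda>p. fst (wgrad \<theta> p))"
  have SL: "?S \<in> L2" by (intro L2.clos a b)
  have st: "ip u (perp_grad (xi i m n)) = - ip ?S (xi i m n)" if i: "i = 1 \<or> i = -1" for i m n
    unfolding L2.add_left[OF L2.clos(4)[OF a] L2.clos(4)[OF b] xi_L2] L2.scale_left[OF a xi_L2] L2.scale_left[OF b xi_L2]
    using stream[OF i, of m n] unfolding weight_def by simp
  obtain K where K: "K \<ge> 0" "\<And>g. g \<in> hat_W12 \<Longrightarrow> (\<lambda>p. g p *\<^sub>R u p) \<in> L2"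
    "\<And>g. g \<in> hat_W12 \<Longrightarrow> L2_norm (\<lambda>p. g p *\<^sub>R u p) \<le> K * W12_norm g"
    by (rule velocity_multiplier[OF u SL st]) (assumption | rule that)+
  have comm: "(u p \<bullet> wgrad \<theta> p) * g p = wgrad \<theta> p \<bullet> (g p *\<^sub>R u p)" for p g by (simp add: inner_commute)
  show "integrable \<mu> (\<lambda>p. (u p \<bullet> wgrad \<theta> p) * g p)" unfolding comm by (rule L2_integrable_inner[OF TL K(2)[OF g]])
  have conv: "ip (\<lambda>p. u p \<bullet> wgrad \<theta> p) g = ip (wgrad \<theta>) (\<lambda>p. g p *\<^sub>R u p)" for g
    unfolding ip_def inner_real_def comm ..
  have cd: "(\<lambda>g. ip (\<lambda>p. u p \<bullet> wgrad \<theta> p) g) \<in> dual hat_W12 W12_norm"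
    unfolding conv
  proof (rule dualI[where C = "L2_norm (wgrad \<theta>) * K"])
    fix f g assume fg: "f \<in> hat_W12" "g \<in> hat_W12"
    have "(\<lambda>p. (f + g) p *\<^sub>R u p) = (\<lambda>p. f p *\<^sub>R u p) + (\<lambda>p. g p *\<^sub>R u p)" by (auto simp: fsimps scaleR_add_left)
    then show "ip (wgrad \<theta>) (\<lambda>p. (f + g) p *\<^sub>R u p) = ip (wgrad \<theta>) (\<lambda>p. f p *\<^sub>R u p) + ip (wgrad \<theta>) (\<lambda>p. g p *\<^sub>R u p)"
      using K(2) fg TL by (simp only: L2.add_right)
  next
    fix c f assume f: "f \<in> hat_W12"
    have "(\<lambda>p. (c *\<^sub>R f) p *\<^sub>R u p) = c *\<^sub>R (\<lambda>p. f p *\<^sub>R u p)" by (auto simp: fsimps)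
    then show "ip (wgrad \<theta>) (\<lambda>p. (c *\<^sub>R f) p *\<^sub>R u p) = c * ip (wgrad \<theta>) (\<lambda>p. f p *\<^sub>R u p)"
      using K(2) f TL by (simp only: L2.scale_right)
  next
    fix f assume f: "f \<in> hat_W12"
    have "\<bar>ip (wgrad \<theta>) (\<lambda>p. f p *\<^sub>R u p)\<bar> \<le> L2_norm (wgrad \<theta>) * L2_norm (\<lambda>p. f p *\<^sub>R u p)"
      by (rule L2.cauchy_schwarz[OF TL K(2)[OF f]])
    also have "\<dots> \<le> L2_norm (wgrad \<theta>) * (K * W12_norm f)"
      by (intro mult_left_mono K(3) f L2.nrm_nonneg TL)
    finally show "\<bar>ip (wgrad \<theta>) (\<lambda>p. f p *\<^sub>R u p)\<bar> \<le> L2_norm (wgrad \<theta>) * K * W12_norm f" by (simp add: mult.assoc)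
  qed
  have W: "l \<in> dual W12 W12_norm \<Longrightarrow> l \<in> dual hat_W12 W12_norm" for l
    using dual_subset hat_W12_subset by blast
  have "F g + ip (\<lambda>p. u p \<bullet> wgrad \<theta> p) g - ip g (\<lambda>p. snd (u p)) + ip (wgrad g) (wgrad \<theta>) = 0"
  proof (rule hat_density[OF _ _ g])
    have "F \<in> dual hat_W12 W12_norm" using F unfolding hat_W12_dual_def .
    from dual_add[OF dual_diff[OF dual_add[OF this cd] W[OF ip_W12_dual[OF vL]]] W[OF wgrad_W12_dual[OF TL]]]
    show "(\<lambda>g. F g + ip (\<lambda>p. u p \<bullet> wgrad \<theta> p) g - ip g (\<lambda>p. snd (u p)) + ip (wgrad g) (wgrad \<theta>)) \<in> dual hat_W12 W12_norm" .
    fix k assume k: "k \<in> xi_index"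
    note X = mode_C1(1)[OF k]
    show "F (sine_mode k) + ip (\<lambda>p. u p \<bullet> wgrad \<theta> p) (sine_mode k) - ip (sine_mode k) (\<lambda>p. snd (u p)) + ip (wgrad (sine_mode k)) (wgrad \<theta>) = 0"
      unfolding C1_ip_wgrad[OF X TL] L2.sym[OF C1_L2(4)[OF X] TL] L2.sym[OF mode_L2(1) vL] using heat[OF k] by simp
  qed
  then show "F g + ip (\<lambda>p. u p \<bullet> wgrad \<theta> p) g = ip (\<lambda>p. snd (u p)) g - ip (wgrad \<theta>) (wgrad g)"
    using L2.sym[OF hat_L2(1)[OF g] vL] L2.sym[OF hat_L2(2)[OF g] TL] by simp
qed

section \<open>The initial value\<close>

text \<open>
  A majorant of the squares of the terms gives convergence with an error bound that depends on the
  majorant alone. Applied to coefficients depending on time it yields uniform convergence.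
\<close>

lemma sine_series:
  assumes W: "\<And>k. k \<in> xi_index \<Longrightarrow> (c k)\<^sup>2 * ip (sine_mode k) (sine_mode k) \<le> W k"
    and lim: "(\<lambda>N. \<Sum>k\<in>truncated xi_index N. W k) \<longlonglongrightarrow> L"
  obtains g where "g \<in> hat_L2" "\<And>N. (L2_norm ((\<Sum>k\<in>truncated xi_index N. c k *\<^sub>R sine_mode k) - g))\<^sup>2 \<le> L - (\<Sum>k\<in>truncated xi_index N. W k)"
    "\<And>k. k \<in> xi_index \<Longrightarrow> ip g (sine_mode k) = c k * ip (sine_mode k) (sine_mode k)"
proof -
  let ?J = "truncated xi_index" and ?S = "\<lambda>N. \<Sum>k\<in>truncated xi_index N. c k *\<^sub>R sine_mode k"
  define V where "V N = (\<Sum>k\<in>?J N. W k)" for N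
  have SL: "?S N \<in> L2" for N by (intro L2.sum_closed mode_L2)
  have W0: "W k \<ge> 0" if "k \<in> xi_index" for k
    using W[OF that] L2.nonneg[OF mode_L2(1)[of k]] by (meson mult_nonneg_nonneg order_trans zero_le_power2)
  have mono: "V M \<le> V N" if "M \<le> N" for M N
    unfolding V_def using truncated_mono[OF that] finite_truncated W0 truncated_index by (intro sum_mono2) blast+
  have VL: "V N \<le> L" for N
    using lim[folded V_def] mono by (intro incseq_le) (auto intro: monoI)
  have diff: "(L2_norm (?S N - ?S M))\<^sup>2 \<le> V N - V M" if MN: "M \<le> N" for M N
  proof -
    have sub: "?J M \<subseteq> ?J N" using truncated_mono[OF MN] .
    have fin: "finite (?J N - ?J M)" using finite_truncated(1) by blast
    have "?S N - ?S M = (\<Sum>k\<in>?J N - ?J M. c k *\<^sub>R sine_mode k)"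
      using sum.subset_diff[OF sub finite_truncated(1), of "\<lambda>k. c k *\<^sub>R sine_mode k"] by (simp add: algebra_simps)
    then have "(L2_norm (?S N - ?S M))\<^sup>2 = (\<Sum>k\<in>?J N - ?J M. (c k)\<^sup>2 * ip (sine_mode k) (sine_mode k))"
      using L2.orthogonal_sum_square[of "?J N - ?J M" sine_mode c] fin mode_L2(1) sine_mode_orthogonal truncated_index
      by (metis (no_types, lifting) DiffD1)
    also have "\<dots> \<le> (\<Sum>k\<in>?J N - ?J M. W k)" using W truncated_index by (intro sum_mono) blast
    also have "\<dots> = V N - V M" unfolding V_def
      using sum.subset_diff[OF sub finite_truncated(1), of W] by simp
    finally show ?thesis .
  qed
  have cauchy: "\<exists>K. \<forall>m\<ge>K. \<forall>n\<ge>K. L2_norm (?S m - ?S n) < e" if e: "e > 0" for e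
  proof -
    have "\<forall>\<^sub>F N in sequentially. V N > L - e\<^sup>2" using lim[folded V_def] e by (intro order_tendstoD(1)) auto
    then obtain K where K: "V K > L - e\<^sup>2" unfolding eventually_sequentially by blast
    have le: "L2_norm (?S m - ?S n) < e" if "n \<ge> K" "n \<le> m" for m n
    proof -
      have "(L2_norm (?S m - ?S n))\<^sup>2 < e\<^sup>2" using diff[OF that(2)] VL[of m] mono[OF that(1)] K by linarith
      then show ?thesis using e by (simp add: power2_less_imp_less)
    qed
    have "L2_norm (?S m - ?S n) < e" if "m \<ge> K" "n \<ge> K" for m n
      using le[of n m] le[of m n] that L2.nrm_sym[OF SL SL, of m n] by (cases "n \<le> m") auto
    then show ?thesis by blast
  qed
  obtain g where g: "g \<in> L2" "(\<lambda>N. L2_norm (?S N - g)) \<longlonglongrightarrow> 0" using L2_complete[OF SL cauchy] by blast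
  have near: "(L2_norm (?S N - g))\<^sup>2 \<le> L - V N" for N
  proof -
    have "L2_norm (?S N - g) \<le> sqrt (L - V N) + L2_norm (?S M - g)" if "M \<ge> N" for M
    proof -
      have "L2_norm (?S N - ?S M) \<le> sqrt (L - V N)"
        using diff[OF that] VL[of M] L2.nrm_sym[OF SL SL, of M N] by (intro real_le_rsqrt) simp
      then show ?thesis using L2.triangle3[OF SL SL g(1), of N M] by linarith
    qed
    then have "\<forall>\<^sub>F M in sequentially. L2_norm (?S N - g) \<le> sqrt (L - V N) + L2_norm (?S M - g)"
      unfolding eventually_sequentially by blast
    moreover have "(\<lambda>M. sqrt (L - V N) + L2_norm (?S M - g)) \<longlonglongrightarrow> sqrt (L - V N) + 0" by (intro tendsto_intros g)
    ultimately have "L2_norm (?S N - g) \<le> sqrt (L - V N) + 0" by (intro tendsto_lowerbound) auto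
    then have "(L2_norm (?S N - g))\<^sup>2 \<le> (sqrt (L - V N))\<^sup>2"
      using L2.nrm_nonneg[OF L2.clos(3)[OF SL g(1)], of N] by (intro power_mono) auto
    then show ?thesis using VL[of N] by simp
  qed
  have coef: "ip g (sine_mode k) = c k * ip (sine_mode k) (sine_mode k)" if k: "k \<in> xi_index" for k
  proof -
    have lim1: "(\<lambda>N. ip (sine_mode k) (?S N)) \<longlonglongrightarrow> ip (sine_mode k) g"
      by (rule L2_ip_limit[OF mode_L2(1) g(1) SL]) (use g(2) L2.nrm_sym[OF SL g(1)] in simp)
    obtain i m n where km: "k = (i, m, n)" by (cases k)
    have "ip (sine_mode k) (?S N) = c k * ip (sine_mode k) (sine_mode k)" if N: "N \<ge> max m n" for N
    proof -
      have kN: "k \<in> ?J N" using k N unfolding km by (intro mode_truncated) auto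
      have "ip (sine_mode k) (?S N) = (\<Sum>l\<in>?J N. c l * ip (sine_mode k) (sine_mode l))" by (intro L2.sum_right mode_L2)
      also have "\<dots> = (\<Sum>l\<in>?J N. if k = l then c k * ip (sine_mode k) (sine_mode k) else 0)"
        using sine_mode_orthogonal[OF k truncated_index] by (intro sum.cong) auto
      finally show ?thesis using kN finite_truncated(1) by simp
    qed
    then have "\<forall>\<^sub>F N in sequentially. ip (sine_mode k) (?S N) = c k * ip (sine_mode k) (sine_mode k)"
      unfolding eventually_sequentially by blast
    from LIMSEQ_unique[OF lim1 tendsto_eventually[OF this]] show ?thesis
      using L2.sym[OF g(1) mode_L2(1)] by simp
  qed
  have "g \<in> hat_L2" unfolding hat_L2_def closure_span_def
  proof (intro CollectI conjI allI impI g(1))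
    fix e :: real assume "e > 0"
    then have "\<forall>\<^sub>F N in sequentially. L2_norm (?S N - g) < e" by (rule order_tendstoD(2)[OF g(2)])
    then obtain N where N: "L2_norm (?S N - g) < e" unfolding eventually_sequentially by blast
    have "?S N \<in> span xi_set"
    proof (intro span_sum span_scale span_base)
      fix k assume "k \<in> ?J N"
      then show "sine_mode k \<in> xi_set" using truncated_index[of k N] by (cases k) (auto simp: sine_mode_def)
    qed
    then show "\<exists>p\<in>span xi_set. L2_norm (g - p) < e" using N L2.nrm_sym[OF SL g(1), of N] by auto
  qed
  then show ?thesis using that near coef unfolding V_def by blast
qed

text \<open>
  A nonvanishing sine function has \<open>n \<ge> 1\<close>, and \<open>\<pi> \<ge> 1\<close>.
\<close>

lemma eigenvalue_ge_1:
  assumes k: "(i, m, n) \<in> xi_index" and nz: "ip (sine_mode (i, m, n)) (sine_mode (i, m, n)) \<noteq> 0"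
  shows "eigenvalue m n \<ge> 1"
proof -
  have i: "i = 1 \<or> i = -1" using k by (simp add: xi_index_iff)
  have "n \<ge> 1" using nz unfolding sine_mode_def prod.case ip_xi[OF i i] by (auto simp: sin_sq_def split: if_splits)
  then have "1 * 1 \<le> pi * real n" using pi_gt3 by (intro mult_mono) auto
  then have "1 \<le> (pi * real n)\<^sup>2" by (simp add: one_le_power)
  then show ?thesis unfolding eigenvalue_def by (simp add: add_increasing)
qed

text \<open>
  The dual counterpart of \<open>gradient_bessel\<close>: apply \<open>F\<close> to the
  combination \<open>f\<close> of basis functions with coefficients \<open>F (sine_mode k) / (lam
  k * nu k)\<close>. Then \<open>F f\<close> is the sum \<open>S\<close> on the left, while the
  norm of \<open>f\<close> is at most the root of \<open>2 S\<close>. The factor 2 compares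
  \<open>1 + lam k\<close> with \<open>2 * lam k\<close>.
\<close>

lemma dual_bessel:
  assumes F: "F \<in> hat_W12_dual" and I: "finite I" "I \<subseteq> xi_index"
  shows "(\<Sum>(i, m, n)\<in>I. (F (xi i m n))\<^sup>2 / (eigenvalue m n * ip (xi i m n) (xi i m n))) \<le> 2 * (hat_W12_dual_norm F)\<^sup>2"
proof -
  have F': "F \<in> dual hat_W12 W12_norm" using F unfolding hat_W12_dual_def .
  define lam where "lam k = eigenvalue (fst (snd k)) (snd (snd k))" for k :: "int \<times> nat \<times> nat"
  define nu where "nu k = ip (sine_mode k) (sine_mode k)" for k
  define c where "c k = F (sine_mode k) / (lam k * nu k)" for k
  define S where "S = (\<Sum>k\<in>I. (F (sine_mode k))\<^sup>2 / (lam k * nu k))"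
  define f where "f = (\<Sum>k\<in>I. c k *\<^sub>R sine_mode k)"
  have nu0: "nu k \<ge> 0" for k unfolding nu_def by (rule L2.nonneg[OF mode_L2(1)])
  have lam0: "lam k \<ge> 0" for k by (simp add: lam_def eigenvalue_def)
  have lam1: "lam k \<ge> 1" if "k \<in> I" "nu k \<noteq> 0" for k
    using eigenvalue_ge_1[of "fst k" "fst (snd k)" "snd (snd k)"] that I(2)
    by (auto simp: lam_def nu_def sine_mode_def xi_index_def)
  have sm: "sine_mode k \<in> hat_W12" if "k \<in> I" for k using that I(2) sine_mode_hat by blast
  have fh: "f \<in> hat_W12" unfolding f_def by (rule hat_W12.sum_closed[OF sm])
  have S0: "S \<ge> 0" unfolding S_def using nu0 lam0 by (intro sum_nonneg) simp
  have Fsum: "F (\<Sum>k\<in>A. c k *\<^sub>R sine_mode k) = (\<Sum>k\<in>A. c k * F (sine_mode k))" if "finite A" "A \<subseteq> I" for A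
    using that
  proof (induction A rule: finite_induct)
    case empty
    then show ?case using dualD(2)[OF F' hat_W12.clos(1), of 0] by (simp add: zero_fun_def)
  next
    case (insert k A)
    have "(\<Sum>k\<in>A. c k *\<^sub>R sine_mode k) \<in> hat_W12" using insert sm by (intro hat_W12.sum_closed) blast
    moreover have "sine_mode k \<in> hat_W12" using insert sm by blast
    ultimately have step: "F (c k *\<^sub>R sine_mode k + (\<Sum>k\<in>A. c k *\<^sub>R sine_mode k)) = c k * F (sine_mode k) + F (\<Sum>k\<in>A. c k *\<^sub>R sine_mode k)"
      using dualD(1)[OF F' hat_W12.clos(4)] dualD(2)[OF F'] by simp
    have IH: "F (\<Sum>k\<in>A. c k *\<^sub>R sine_mode k) = (\<Sum>k\<in>A. c k * F (sine_mode k))" using insert by blast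
    show ?case unfolding sum.insert[OF insert(1,2)] step IH ..
  qed
  have "F f = (\<Sum>k\<in>I. c k * F (sine_mode k))" unfolding f_def by (rule Fsum[OF I(1) order_refl])
  then have Ff: "F f = S" unfolding S_def c_def by (simp add: power2_eq_square)
  have orth: "W12_ip (sine_mode k) (sine_mode l) = 0" if "k \<in> I" "l \<in> I" "k \<noteq> l" for k l
  proof -
    obtain i m n j m' n' where kl: "k = (i, m, n)" "l = (j, m', n')" by (cases k; cases l)
    have ij: "i = 1 \<or> i = -1" "j = 1 \<or> j = -1" using that I(2) by (auto simp: kl xi_index_iff)
    have Y: "C1 (sine_mode l)" using mode_C1(1) that I(2) by blast
    have "ip (wgrad (sine_mode k)) (wgrad (sine_mode l)) = ip (wgrad (sine_mode k)) (grad (sine_mode l))"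
      by (intro ip_cong_AE AE_I2 refl C1_wgrad(2) Y hat_L2(2) sm that C1_L2(4))
    then show ?thesis using that(3) hat_grad_xi[OF sm[OF that(1)] ij(2), of m' n']
      sine_mode_orthogonal[of k l] that I(2) unfolding W12_ip_def by (auto simp: kl sine_mode_def subset_iff)
  qed
  have diag: "W12_ip (sine_mode k) (sine_mode k) = (1 + lam k) * nu k" if k: "k \<in> I" for k
  proof -
    obtain i m n where km: "k = (i, m, n)" by (cases k)
    have i: "i = 1 \<or> i = -1" using k I(2) by (auto simp: km xi_index_iff)
    have Y: "C1 (sine_mode k)" using mode_C1(1) k I(2) by blast
    have "ip (wgrad (sine_mode k)) (wgrad (sine_mode k)) = ip (wgrad (sine_mode k)) (grad (sine_mode k))"
      by (intro ip_cong_AE AE_I2 refl C1_wgrad(2) Y hat_L2(2) sm k C1_L2(4))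
    then show ?thesis using hat_grad_xi[OF sm[OF k] i, of m n]
      unfolding W12_ip_def nu_def lam_def by (simp add: km sine_mode_def algebra_simps)
  qed
  have "(W12_norm f)\<^sup>2 = (\<Sum>k\<in>I. (c k)\<^sup>2 * ((1 + lam k) * nu k))"
    unfolding f_def by (subst hat_W12.orthogonal_sum_square[OF I(1) sm orth]) (auto simp: diag)
  also have "\<dots> \<le> (\<Sum>k\<in>I. 2 * ((F (sine_mode k))\<^sup>2 / (lam k * nu k)))"
  proof (intro sum_mono)
    fix k assume k: "k \<in> I"
    show "(c k)\<^sup>2 * ((1 + lam k) * nu k) \<le> 2 * ((F (sine_mode k))\<^sup>2 / (lam k * nu k))"
    proof (cases "nu k = 0")
      case False
      then have p: "nu k > 0" "lam k \<ge> 1" using nu0[of k] lam1[OF k] by auto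
      have "(c k)\<^sup>2 * ((1 + lam k) * nu k) \<le> (c k)\<^sup>2 * ((2 * lam k) * nu k)" using p by (intro mult_left_mono mult_right_mono) auto
      also have "\<dots> = 2 * ((F (sine_mode k))\<^sup>2 / (lam k * nu k))" using p unfolding c_def by (simp add: field_simps power2_eq_square)
      finally show ?thesis .
    qed simp
  qed
  also have "\<dots> = 2 * S" unfolding S_def by (simp add: sum_distrib_left)
  finally have nf: "W12_norm f \<le> sqrt (2 * S)" by (rule real_le_rsqrt)
  define q where "q = hat_W12_dual_norm F"
  have q0: "q \<ge> 0" "\<bar>F f\<bar> \<le> q * W12_norm f"
    using dual_norm_bound[OF hat_W12.seminormed_axioms F' fh] unfolding q_def hat_W12_dual_norm_def by auto
  have "S \<le> q * W12_norm f" using q0(2) Ff S0 by simp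
  also have "\<dots> \<le> q * sqrt (2 * S)" by (intro mult_left_mono nf q0(1))
  finally have "S\<^sup>2 \<le> (q * sqrt (2 * S))\<^sup>2" using S0 by (intro power_mono)
  also have "\<dots> = q\<^sup>2 * (2 * S)" using S0 by (simp add: power_mult_distrib)
  finally have "S * S \<le> (2 * q\<^sup>2) * S" by (simp add: power2_eq_square mult_ac)
  then have "S \<le> 2 * q\<^sup>2" using S0 by (cases "S = 0") auto
  moreover have "S = (\<Sum>(i, m, n)\<in>I. (F (xi i m n))\<^sup>2 / (eigenvalue m n * ip (xi i m n) (xi i m n)))"
    unfolding S_def by (intro sum.cong refl) (auto simp: lam_def nu_def sine_mode_def)
  ultimately show ?thesis unfolding q_def by simp
qed

context galerkin_limit
begin

lemma rate_limit_integrable: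
  assumes k: "k \<in> xi_index"
  shows "integrable (time_measure T) (\<lambda>s. d\<theta> s (sine_mode k))" "integrable (time_measure T) (\<lambda>s. (d\<theta> s (sine_mode k))\<^sup>2)"
  using dual_time_integrable[OF seminormed_hat_dual evaluation_dual[OF sine_mode_hat[OF k]] limits(2)] by auto

lemma lim_coef_increment:
  assumes k: "k \<in> xi_index" and st: "0 \<le> s" "s \<le> t" "t \<le> T"
  shows "(lim_coef k t - lim_coef k s)\<^sup>2 \<le> (t - s) * (LINT \<tau>|time_measure T. (d\<theta> \<tau> (sine_mode k))\<^sup>2)"
proof -
  interpret finite_measure "time_measure T" by (rule finite_time)
  let ?g = "\<lambda>\<tau>. d\<theta> \<tau> (sine_mode k)" and ?a = "\<lambda>\<tau>. indicator {..<t} \<tau> - indicator {..<s} \<tau> :: real"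
  note gi = rate_limit_integrable[OF k]
  have gt: "integrable (time_measure T) (\<lambda>\<tau>. indicator {..<t} \<tau> * ?g \<tau>)" for t
    by (rule dual_time(1)[OF seminormed_hat_dual evaluation_dual[OF sine_mode_hat[OF k]] indicator_lessThan limits(2)])
  have am: "?a \<in> borel_measurable (time_measure T)" using indicator_lessThan(1) by (intro borel_measurable_diff)
  have a2: "(?a \<tau>)\<^sup>2 = indicator {s..<t} \<tau>" for \<tau> using st by (auto simp: indicator_def)
  have ai: "integrable (time_measure T) (\<lambda>\<tau>. (?a \<tau>)\<^sup>2)"
    by (rule integrable_const_bound[where B = 1]) (use am in \<open>auto simp: a2 indicator_def intro!: AE_I2 borel_measurable_power[of ?a _ 2, simplified a2]\<close>)
  have a_int: "(LINT \<tau>|time_measure T. (?a \<tau>)\<^sup>2) \<le> t - s"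
  proof -
    have "(LINT \<tau>|time_measure T. indicator {s..<t} \<tau>) = measure (time_measure T) ({s..<t} \<inter> {0<..<T})"
      by (simp add: Int_commute)
    also have "\<dots> = measure lebesgue ({s..<t} \<inter> {0<..<T})"
      by (simp add: measure_restrict_space)
    also have "\<dots> \<le> measure lebesgue {s..t}" by (intro measure_mono_fmeasurable) auto
    also have "\<dots> = t - s" using st by simp
    finally show ?thesis unfolding a2 .
  qed
  have "lim_coef k t - lim_coef k s = (LINT \<tau>|time_measure T. ?a \<tau> * ?g \<tau>)"
    unfolding lim_coef_def using gt by (simp add: left_diff_distrib)
  then have "\<bar>lim_coef k t - lim_coef k s\<bar> \<le> (LINT \<tau>|time_measure T. \<bar>?a \<tau> * ?g \<tau>\<bar>)"
    using integral_abs_bound by metis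
  also have "\<dots> \<le> sqrt (LINT \<tau>|time_measure T. (?a \<tau>)\<^sup>2) * sqrt (LINT \<tau>|time_measure T. (?g \<tau>)\<^sup>2)"
    using gi by (intro integral_cauchy_schwarz am ai) auto
  finally have "\<bar>lim_coef k t - lim_coef k s\<bar>\<^sup>2 \<le> (sqrt (LINT \<tau>|time_measure T. (?a \<tau>)\<^sup>2) * sqrt (LINT \<tau>|time_measure T. (?g \<tau>)\<^sup>2))\<^sup>2"
    by (intro power_mono) auto
  also have "\<dots> = (LINT \<tau>|time_measure T. (?a \<tau>)\<^sup>2) * (LINT \<tau>|time_measure T. (?g \<tau>)\<^sup>2)"
    by (simp add: power_mult_distrib)
  finally show ?thesis
    using mult_right_mono[OF a_int, of "LINT \<tau>|time_measure T. (?g \<tau>)\<^sup>2"] by simp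
qed

lemma lim_coef_square_integrable:
  assumes k: "k \<in> xi_index" shows "integrable (time_measure T) (\<lambda>t. (lim_coef k t)\<^sup>2)"
proof -
  interpret finite_measure "time_measure T" by (rule finite_time)
  obtain K where K: "K \<ge> 0" "\<And>t. t \<in> {0..T} \<Longrightarrow> \<bar>lim_coef k t\<bar> \<le> K" "\<forall>\<^sub>F j in sequentially. \<forall>t\<in>{0..T}. \<bar>coef j k t\<bar> \<le> K"
    using lim_coef_bounded[OF k] by blast
  show ?thesis
  proof (rule integrable_const_bound)
    show "AE t in time_measure T. norm ((lim_coef k t)\<^sup>2) \<le> K\<^sup>2"
    proof (rule AE_I2)
      fix t assume "t \<in> space (time_measure T)"
      then have "\<bar>lim_coef k t\<bar> \<le> K" by (intro K) auto
      then have "\<bar>lim_coef k t\<bar>\<^sup>2 \<le> K\<^sup>2" by (intro power_mono) auto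
      then show "norm ((lim_coef k t)\<^sup>2) \<le> K\<^sup>2" by simp
    qed
    show "(\<lambda>t. (lim_coef k t)\<^sup>2) \<in> borel_measurable (time_measure T)" using lim_coef_measurable[OF k] by measurable
  qed
qed

text \<open>
  Hoelder continuity with exponent one half, by the Cauchy-Schwarz inequality.
\<close>

lemma lim_coef_holder:
  assumes k: "k \<in> xi_index" and st: "s \<in> {0..T}" "t \<in> {0..T}"
  shows "(lim_coef k t - lim_coef k s)\<^sup>2 \<le> \<bar>t - s\<bar> * (LINT \<tau>|time_measure T. (d\<theta> \<tau> (sine_mode k))\<^sup>2)"
  using lim_coef_increment[OF k, of s t] lim_coef_increment[OF k, of t s] st
  by (cases "s \<le> t") (auto simp: power2_commute)

text \<open>
  Average \<open>c(t)\<^sup>2 \<le> 2 c(s)\<^sup>2 + 2 (c(t) - c(s))\<^sup>2\<close> over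
  \<open>s\<close> in an interval of length \<open>h\<close> whose closure contains
  \<open>t\<close>.
\<close>

lemma lim_coef_sup:
  assumes k: "k \<in> xi_index" and t: "t \<in> {0..T}" and h: "0 < h" "h \<le> T"
  shows "h * (lim_coef k t)\<^sup>2 \<le> 2 * (LINT s|time_measure T. (lim_coef k s)\<^sup>2) + 2 * h\<^sup>2 * (LINT \<tau>|time_measure T. (d\<theta> \<tau> (sine_mode k))\<^sup>2)"
proof -
  interpret finite_measure "time_measure T" by (rule finite_time)
  \<comment> \<open>The interval starts at \<open>t\<close> unless it would leave the domain on the
    right.\<close>
  define a where "a = min t (T - h)"
  define G where "G = (LINT \<tau>|time_measure T. (d\<theta> \<tau> (sine_mode k))\<^sup>2)"
  have G: "G \<ge> 0" by (simp add: G_def)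
  have a: "0 \<le> a" "a + h \<le> T" "a \<le> t" "t \<le> a + h" using t h by (auto simp: a_def)
  let ?I = "{a<..<a+h}"
  have sub: "?I \<inter> {0<..<T} = ?I" using a by auto
  have im: "(indicator ?I :: real \<Rightarrow> real) \<in> borel_measurable (time_measure T)"
    by (rule measurable_restrict_space1) (intro borel_measurable_indicator, simp)
  have ii: "integrable (time_measure T) (indicator ?I :: real \<Rightarrow> real)"
    by (rule integrable_const_bound[where B = 1]) (use im in \<open>auto simp: indicator_def\<close>)
  have iI: "(LINT s|time_measure T. indicator ?I s) = h"
  proof -
    have "(LINT s|time_measure T. indicator ?I s) = measure (time_measure T) (?I \<inter> {0<..<T})"
      by (simp add: Int_commute)
    also have "\<dots> = measure lebesgue (?I \<inter> {0<..<T})" by (rule measure_restrict_space) auto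
    also have "\<dots> = measure lebesgue ?I" unfolding sub ..
    also have "\<dots> = measure lborel ?I" by (rule measure_completion) simp
    finally show ?thesis using h by (simp only: measure_lborel_Ioo)
  qed
  have "(LINT s|time_measure T. indicator ?I s * (lim_coef k t)\<^sup>2) \<le> (LINT s|time_measure T. 2 * (lim_coef k s)\<^sup>2 + indicator ?I s * (2 * h * G))"
  proof (rule integral_mono)
    show "integrable (time_measure T) (\<lambda>s. indicator ?I s * (lim_coef k t)\<^sup>2)" using ii by simp
    show "integrable (time_measure T) (\<lambda>s. 2 * (lim_coef k s)\<^sup>2 + indicator ?I s * (2 * h * G))"
      using ii lim_coef_square_integrable[OF k] by simp
    fix s assume "s \<in> space (time_measure T)"
    show "indicator ?I s * (lim_coef k t)\<^sup>2 \<le> 2 * (lim_coef k s)\<^sup>2 + indicator ?I s * (2 * h * G)"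
    proof (cases "s \<in> ?I")
      case True
      have s: "s \<in> {0..T}" using True a by auto
      have "(lim_coef k t - lim_coef k s)\<^sup>2 \<le> \<bar>t - s\<bar> * G" unfolding G_def by (rule lim_coef_holder[OF k s t])
      also have "\<dots> \<le> h * G" using True a G by (intro mult_right_mono) auto
      finally have 1: "(lim_coef k t - lim_coef k s)\<^sup>2 \<le> h * G" .
      have "(x + y)\<^sup>2 \<le> 2 * x\<^sup>2 + 2 * y\<^sup>2" for x y :: real using sum_squares_bound[of x y] by (simp add: power2_sum)
      from this[of "lim_coef k s" "lim_coef k t - lim_coef k s"] show ?thesis using 1 True by simp
    qed simp
  qed
  also have "(LINT s|time_measure T. 2 * (lim_coef k s)\<^sup>2 + indicator ?I s * (2 * h * G)) = 2 * (LINT s|time_measure T. (lim_coef k s)\<^sup>2) + h * (2 * h * G)"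
    using ii lim_coef_square_integrable[OF k] iI by simp
  finally show ?thesis using iI unfolding G_def by (simp add: power2_eq_square mult_ac)
qed

text \<open>
  The bound of \<open>lim_coef_sup\<close> with \<open>h = T / l\<close>, where \<open>l\<close>
  is the eigenvalue. This choice balances the two terms: the eigenvalue in front of the first one
  is matched by the gradient, its inverse in the second one by the dual norm.
\<close>

definition majorant :: "int \<times> nat \<times> nat \<Rightarrow> real" where
  "majorant k = (let l = eigenvalue (fst (snd k)) (snd (snd k)) in
     (2 / T * (l * (LINT s|time_measure T. (lim_coef k s)\<^sup>2)) + 2 * T * ((LINT s|time_measure T. (d\<theta> s (sine_mode k))\<^sup>2) / l))
       / ip (sine_mode k) (sine_mode k))"

lemma majorant_bound:
  assumes k: "k \<in> xi_index" and t: "t \<in> {0..T}"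
  shows "(lim_coef k t / ip (sine_mode k) (sine_mode k))\<^sup>2 * ip (sine_mode k) (sine_mode k) \<le> majorant k"
proof (cases "ip (sine_mode k) (sine_mode k) = 0")
  case True
  then show ?thesis by (simp add: majorant_def)
next
  case False
  define l where "l = eigenvalue (fst (snd k)) (snd (snd k))"
  define A where "A = (LINT s|time_measure T. (lim_coef k s)\<^sup>2)"
  define G where "G = (LINT s|time_measure T. (d\<theta> s (sine_mode k))\<^sup>2)"
  define nu where "nu = ip (sine_mode k) (sine_mode k)"
  have nu: "nu > 0" using False L2.nonneg[OF mode_L2(1)[of k]] by (simp add: nu_def)
  have l: "l \<ge> 1" using eigenvalue_ge_1[of "fst k" "fst (snd k)" "snd (snd k)"] k False by (simp add: l_def)
  have "T / l \<le> T / 1" using l T by (intro divide_left_mono) auto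
  then have "(T / l) * (lim_coef k t)\<^sup>2 \<le> 2 * A + 2 * (T / l)\<^sup>2 * G"
    using lim_coef_sup[OF k t, of "T / l"] l T unfolding A_def G_def by simp
  then have "(l / T) * ((T / l) * (lim_coef k t)\<^sup>2) \<le> (l / T) * (2 * A + 2 * (T / l)\<^sup>2 * G)"
    using l T by (intro mult_left_mono) auto
  moreover have "(l / T) * ((T / l) * (lim_coef k t)\<^sup>2) = (lim_coef k t)\<^sup>2" using l T by simp
  moreover have "(l / T) * (2 * A + 2 * (T / l)\<^sup>2 * G) = 2 / T * (l * A) + 2 * T * (G / l)"
    using l T by (simp add: field_simps power2_eq_square)
  ultimately have "(lim_coef k t)\<^sup>2 \<le> 2 / T * (l * A) + 2 * T * (G / l)" by simp
  then have "(lim_coef k t)\<^sup>2 / nu \<le> (2 / T * (l * A) + 2 * T * (G / l)) / nu" using nu by (intro divide_right_mono) auto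
  then show ?thesis using nu unfolding majorant_def Let_def A_def[symmetric] G_def[symmetric] l_def[symmetric] nu_def[symmetric]
    by (simp add: power2_eq_square)
qed

text \<open>
  Integrate \<open>gradient_bessel\<close> for \<open>\<theta>\<close> and
  \<open>dual_bessel\<close> for its derivative in time.
\<close>

lemma majorant_summable: "\<exists>L. (\<lambda>N. \<Sum>k\<in>truncated xi_index N. majorant k) \<longlonglongrightarrow> L"
proof -
  let ?J = "truncated xi_index"
  define l where "l k = eigenvalue (fst (snd k)) (snd (snd k))" for k :: "int \<times> nat \<times> nat"
  define nu where "nu k = ip (sine_mode k) (sine_mode k)" for k
  have nn: "0 \<le> majorant k" if "k \<in> xi_index" for k
    using majorant_bound[OF that, of 0] T L2.nonneg[OF mode_L2(1)[of k]] by (auto intro: order_trans[rotated] mult_nonneg_nonneg)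
  have "(\<Sum>k\<in>?J N. majorant k) \<le> 2 / T * (LINT t|time_measure T. (W12_norm (\<theta> t))\<^sup>2) + 2 * T * (LINT t|time_measure T. 2 * (hat_W12_dual_norm (d\<theta> t))\<^sup>2)" for N
  proof -
    have iA: "integrable (time_measure T) (\<lambda>t. l k * (lim_coef k t)\<^sup>2 / nu k)" if "k \<in> ?J N" for k
      using lim_coef_square_integrable[OF truncated_index[OF that]] by simp
    have iG: "integrable (time_measure T) (\<lambda>t. (d\<theta> t (sine_mode k))\<^sup>2 / (l k * nu k))" if "k \<in> ?J N" for k
      using rate_limit_integrable(2)[OF truncated_index[OF that]] by simp
    have "(\<Sum>k\<in>?J N. majorant k) = 2 / T * (\<Sum>k\<in>?J N. (LINT t|time_measure T. l k * (lim_coef k t)\<^sup>2 / nu k))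
        + 2 * T * (\<Sum>k\<in>?J N. (LINT t|time_measure T. (d\<theta> t (sine_mode k))\<^sup>2 / (l k * nu k)))"
      unfolding majorant_def Let_def l_def[symmetric] nu_def[symmetric] sum_distrib_left sum.distrib[symmetric]
      by (intro sum.cong refl) (simp add: add_divide_distrib)
    also have "\<dots> = 2 / T * (LINT t|time_measure T. (\<Sum>k\<in>?J N. l k * (lim_coef k t)\<^sup>2 / nu k))
        + 2 * T * (LINT t|time_measure T. (\<Sum>k\<in>?J N. (d\<theta> t (sine_mode k))\<^sup>2 / (l k * nu k)))"
      using Bochner_Integration.integral_sum[of "?J N" "time_measure T" "\<lambda>k t. l k * (lim_coef k t)\<^sup>2 / nu k", OF iA]
        Bochner_Integration.integral_sum[of "?J N" "time_measure T" "\<lambda>k t. (d\<theta> t (sine_mode k))\<^sup>2 / (l k * nu k)", OF iG] by simp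
    also have "\<dots> \<le> 2 / T * (LINT t|time_measure T. (W12_norm (\<theta> t))\<^sup>2) + 2 * T * (LINT t|time_measure T. 2 * (hat_W12_dual_norm (d\<theta> t))\<^sup>2)"
    proof (intro add_mono mult_left_mono integral_mono_AE)
      show "integrable (time_measure T) (\<lambda>t. \<Sum>k\<in>?J N. l k * (lim_coef k t)\<^sup>2 / nu k)" using iA by (rule Bochner_Integration.integrable_sum)
      show "integrable (time_measure T) (\<lambda>t. \<Sum>k\<in>?J N. (d\<theta> t (sine_mode k))\<^sup>2 / (l k * nu k))" using iG by (rule Bochner_Integration.integrable_sum)
      show "integrable (time_measure T) (\<lambda>t. (W12_norm (\<theta> t))\<^sup>2)" by (rule hat_W12.L2_timeD(2)[OF limits(1)])
      show "integrable (time_measure T) (\<lambda>t. 2 * (hat_W12_dual_norm (d\<theta> t))\<^sup>2)"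
        using seminormed.L2_timeD(2)[OF seminormed_hat_dual limits(2)] by simp
      have all: "AE t in time_measure T. \<forall>k. k \<in> xi_index \<longrightarrow> ip (\<theta> t) (sine_mode k) = lim_coef k t"
        unfolding AE_all_countable
      proof
        fix k show "AE t in time_measure T. k \<in> xi_index \<longrightarrow> ip (\<theta> t) (sine_mode k) = lim_coef k t"
          using lim_coef_eq[of k] by (cases "k \<in> xi_index") auto
      qed
      show "AE t in time_measure T. (\<Sum>k\<in>?J N. l k * (lim_coef k t)\<^sup>2 / nu k) \<le> (W12_norm (\<theta> t))\<^sup>2"
        using all hat_W12.L2_timeD(1)[OF limits(1)]
      proof eventually_elim
        case (elim t)
        have "(\<Sum>k\<in>?J N. l k * (lim_coef k t)\<^sup>2 / nu k) = (\<Sum>(i, m, n)\<in>?J N. eigenvalue m n * ((ip (\<theta> t) (xi i m n))\<^sup>2 / ip (xi i m n) (xi i m n)))"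
        proof (intro sum.cong refl)
          fix k assume k: "k \<in> ?J N"
          have e: "lim_coef k t = ip (\<theta> t) (sine_mode k)" using elim(1)[rule_format, OF truncated_index[OF k]] ..
          show "l k * (lim_coef k t)\<^sup>2 / nu k = (case k of (i, m, n) \<Rightarrow> eigenvalue m n * ((ip (\<theta> t) (xi i m n))\<^sup>2 / ip (xi i m n) (xi i m n)))"
            unfolding e l_def nu_def by (cases k) (simp add: sine_mode_def)
        qed
        also have "\<dots> \<le> (L2_norm (wgrad (\<theta> t)))\<^sup>2" by (rule gradient_bessel[OF elim(2) finite_truncated(1) truncated_subset])
        also have "\<dots> \<le> (W12_norm (\<theta> t))\<^sup>2"
          using elim(2) hat_W12_subset by (intro power_mono W12_norm_ge(2) L2.nrm_nonneg hat_L2(2)) blast+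
        finally show ?case .
      qed
      show "AE t in time_measure T. (\<Sum>k\<in>?J N. (d\<theta> t (sine_mode k))\<^sup>2 / (l k * nu k)) \<le> 2 * (hat_W12_dual_norm (d\<theta> t))\<^sup>2"
        using seminormed.L2_timeD(1)[OF seminormed_hat_dual limits(2)]
      proof eventually_elim
        case (elim t)
        have "(\<Sum>k\<in>?J N. (d\<theta> t (sine_mode k))\<^sup>2 / (l k * nu k)) = (\<Sum>(i, m, n)\<in>?J N. (d\<theta> t (xi i m n))\<^sup>2 / (eigenvalue m n * ip (xi i m n) (xi i m n)))"
          by (intro sum.cong refl) (auto simp: l_def nu_def sine_mode_def)
        also have "\<dots> \<le> 2 * (hat_W12_dual_norm (d\<theta> t))\<^sup>2" by (rule dual_bessel[OF elim finite_truncated(1) truncated_subset])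
        finally show ?case .
      qed
    qed (use T in auto)
    finally show ?thesis .
  qed
  moreover have "incseq (\<lambda>N. \<Sum>k\<in>?J N. majorant k)"
    using truncated_mono finite_truncated nn truncated_index by (intro monoI sum_mono2) blast+
  ultimately show ?thesis using incseq_convergent by blast
qed

lemma lim_coef_continuous:
  assumes k: "k \<in> xi_index" and t: "t \<in> {0..T}"
  shows "((\<lambda>s. lim_coef k s - lim_coef k t) \<longlongrightarrow> 0) (at t within {0..T})"
proof -
  define G where "G = (LINT \<tau>|time_measure T. (d\<theta> \<tau> (sine_mode k))\<^sup>2)"
  have ev: "\<forall>\<^sub>F s in at t within {0..T}. norm (lim_coef k s - lim_coef k t) \<le> sqrt (\<bar>s - t\<bar> * G)"
    unfolding eventually_at_filter
  proof (intro always_eventually allI impI)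
    fix s assume "s \<in> {0..T}"
    from lim_coef_holder[OF k t this] show "norm (lim_coef k s - lim_coef k t) \<le> sqrt (\<bar>s - t\<bar> * G)"
      unfolding G_def by (intro real_le_rsqrt) simp
  qed
  have "((\<lambda>s. sqrt (\<bar>s - t\<bar> * G)) \<longlongrightarrow> sqrt (\<bar>t - t\<bar> * G)) (at t within {0..T})" by (intro tendsto_intros)
  then show ?thesis by (intro Lim_null_comparison[OF ev]) simp
qed

text \<open>
  The sum of the Fourier series with the coefficients \<open>lim_coef k t\<close> is the
  continuous representative. Its partial sums are continuous and converge uniformly; it agrees
  with \<open>\<theta>\<close> and at time 0 with \<open>\<theta>0\<close> because the
  coefficients agree and the sine system is complete.
\<close>

lemma initial_value: "has_initial_value T \<theta> \<theta>0"
proof -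
  let ?J = "truncated xi_index"
  define nu where "nu k = ip (sine_mode k) (sine_mode k)" for k
  define S where "S N t = (\<Sum>k\<in>?J N. (lim_coef k t / nu k) *\<^sub>R sine_mode k)" for N t
  define V where "V N = (\<Sum>k\<in>?J N. majorant k)" for N
  obtain L where L: "V \<longlonglongrightarrow> L" using majorant_summable unfolding V_def[abs_def] by blast
  have SL: "S N t \<in> L2" for N t unfolding S_def by (intro L2.sum_closed mode_L2)
  have ex: "\<exists>g. g \<in> hat_L2 \<and> (\<forall>N. (L2_norm (S N t - g))\<^sup>2 \<le> L - V N) \<and> (\<forall>k\<in>xi_index. ip g (sine_mode k) = lim_coef k t / nu k * nu k)"
    if t: "t \<in> {0..T}" for t
  proof -
    have b: "(lim_coef k t / nu k)\<^sup>2 * ip (sine_mode k) (sine_mode k) \<le> majorant k" if "k \<in> xi_index" for k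
      unfolding nu_def by (rule majorant_bound[OF that t])
    obtain g where "g \<in> hat_L2" "\<And>N. (L2_norm ((\<Sum>k\<in>?J N. (lim_coef k t / nu k) *\<^sub>R sine_mode k) - g))\<^sup>2 \<le> L - (\<Sum>k\<in>?J N. majorant k)"
      "\<And>k. k \<in> xi_index \<Longrightarrow> ip g (sine_mode k) = lim_coef k t / nu k * ip (sine_mode k) (sine_mode k)"
      by (rule sine_series[OF b L[unfolded V_def[abs_def]]]) (assumption | rule that)+
    then show ?thesis unfolding S_def V_def nu_def by blast
  qed
  then obtain \<eta> where \<eta>: "\<And>t. t \<in> {0..T} \<Longrightarrow> \<eta> t \<in> hat_L2"
    "\<And>t N. t \<in> {0..T} \<Longrightarrow> (L2_norm (S N t - \<eta> t))\<^sup>2 \<le> L - V N"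
    "\<And>t k. t \<in> {0..T} \<Longrightarrow> k \<in> xi_index \<Longrightarrow> ip (\<eta> t) (sine_mode k) = lim_coef k t / nu k * nu k"
    by metis
  have \<eta>L: "\<eta> t \<in> L2" if "t \<in> {0..T}" for t using \<eta>(1)[OF that] hat_W12_subset by blast
  have identify: "AE p in \<mu>. \<eta> t p = f p"
    if t: "t \<in> {0..T}" and f: "f \<in> L2" and c: "\<And>k. k \<in> xi_index \<Longrightarrow> ip f (sine_mode k) = lim_coef k t" for t f
  proof -
    have "AE p in \<mu>. (\<eta> t - f) p = 0"
    proof (rule sine_modes_total)
      show "\<eta> t - f \<in> L2" by (intro L2.clos \<eta>L t f)
      fix i :: int and m n :: nat assume "i = 1 \<or> i = -1"
      then have k: "(i, m, n) \<in> xi_index" by (simp add: xi_index_iff)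
      have "ip (\<eta> t) (sine_mode (i, m, n)) = ip f (sine_mode (i, m, n))"
      proof (cases "nu (i, m, n) = 0")
        case True
        then show ?thesis using L2.null_orthogonal[OF \<eta>L[OF t] mode_L2(1)] L2.null_orthogonal[OF f mode_L2(1)]
          unfolding nu_def by metis
      next
        case False
        then show ?thesis using \<eta>(3)[OF t k] c[OF k] by simp
      qed
      then show "ip (\<eta> t - f) (xi i m n) = 0"
        using L2.diff_left[OF \<eta>L[OF t] f xi_L2] by (simp add: sine_mode_def)
    qed
    then show ?thesis by eventually_elim (simp add: fsimps)
  qed
  have cont: "((\<lambda>s. L2_norm (\<eta> s - \<eta> t)) \<longlongrightarrow> 0) (at t within {0..T})" if t: "t \<in> {0..T}" for t
  proof (rule tendstoI)
    fix e :: real assume e: "e > 0"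
    have "\<forall>\<^sub>F N in sequentially. V N > L - (e/3)\<^sup>2" using L e by (intro order_tendstoD(1)) auto
    then obtain N where N: "V N > L - (e/3)\<^sup>2" unfolding eventually_sequentially by blast
    have near: "L2_norm (S N s - \<eta> s) < e/3" if s: "s \<in> {0..T}" for s
    proof -
      have "(L2_norm (S N s - \<eta> s))\<^sup>2 < (e/3)\<^sup>2" using \<eta>(2)[OF s, of N] N by linarith
      then show ?thesis using e by (intro power2_less_imp_less[of _ "e/3"]) auto
    qed
    have Sdiff: "(L2_norm (S N s - S N t))\<^sup>2 = (\<Sum>k\<in>?J N. ((lim_coef k s - lim_coef k t) / nu k)\<^sup>2 * nu k)" for s
    proof -
      have "S N s - S N t = (\<Sum>k\<in>?J N. ((lim_coef k s - lim_coef k t) / nu k) *\<^sub>R sine_mode k)"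
        unfolding S_def by (simp add: sum_subtractf[symmetric] diff_divide_distrib scaleR_diff_left)
      then show ?thesis using mode_sum_square(1)[of "\<lambda>k. (lim_coef k s - lim_coef k t) / nu k" N] by (simp add: nu_def)
    qed
    have "((\<lambda>s. \<Sum>k\<in>?J N. ((lim_coef k s - lim_coef k t) / nu k)\<^sup>2 * nu k) \<longlongrightarrow> (\<Sum>k\<in>?J N. (0 * inverse (nu k))\<^sup>2 * nu k)) (at t within {0..T})"
      unfolding divide_inverse by (intro tendsto_intros lim_coef_continuous t truncated_index)
    then have lim0: "((\<lambda>s. (L2_norm (S N s - S N t))\<^sup>2) \<longlongrightarrow> 0) (at t within {0..T})" unfolding Sdiff by simp
    have "\<forall>\<^sub>F s in at t within {0..T}. (L2_norm (S N s - S N t))\<^sup>2 < (e/3)\<^sup>2" by (rule order_tendstoD(2)[OF lim0]) (use e in simp)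
    moreover have "\<forall>\<^sub>F s in at t within {0..T}. s \<in> {0..T}" by (simp add: eventually_at_filter)
    ultimately show "\<forall>\<^sub>F s in at t within {0..T}. dist (L2_norm (\<eta> s - \<eta> t)) 0 < e"
    proof eventually_elim
      case (elim s)
      have 1: "L2_norm (S N s - S N t) < e/3" using elim(1) e by (intro power2_less_imp_less[of _ "e/3"]) auto
      have "L2_norm (\<eta> s - \<eta> t) \<le> L2_norm (\<eta> s - S N s) + L2_norm (S N s - \<eta> t)"
        by (rule L2.triangle3[OF \<eta>L[OF elim(2)] SL \<eta>L[OF t]])
      moreover have "L2_norm (S N s - \<eta> t) \<le> L2_norm (S N s - S N t) + L2_norm (S N t - \<eta> t)"
        by (rule L2.triangle3[OF SL SL \<eta>L[OF t]])
      moreover have "L2_norm (\<eta> s - S N s) = L2_norm (S N s - \<eta> s)" by (rule L2.nrm_sym[OF \<eta>L[OF elim(2)] SL])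
      ultimately have "L2_norm (\<eta> s - \<eta> t) < e" using 1 near[OF elim(2)] near[OF t] by linarith
      then show ?case using L2.nrm_nonneg[OF L2.clos(3)[OF \<eta>L[OF elim(2)] \<eta>L[OF t]]] by (simp add: dist_real_def)
    qed
  qed
  have all: "AE t in time_measure T. \<forall>k. k \<in> xi_index \<longrightarrow> ip (\<theta> t) (sine_mode k) = lim_coef k t"
    unfolding AE_all_countable
  proof
    fix k show "AE t in time_measure T. k \<in> xi_index \<longrightarrow> ip (\<theta> t) (sine_mode k) = lim_coef k t"
      using lim_coef_eq[of k] by (cases "k \<in> xi_index") auto
  qed
  have ae: "AE t in time_measure T. AE p in \<mu>. \<eta> t p = \<theta> t p"
    using all hat_W12.L2_timeD(1)[OF limits(1)] AE_space
  proof eventually_elim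
    case (elim t)
    then show ?case by (intro identify hat_L2(1)) auto
  qed
  have z: "lim_coef k 0 = ip \<theta>0 (sine_mode k)" for k
  proof -
    have "(LINT s|time_measure T. indicator {..<0} s * d\<theta> s (sine_mode k)) = (LINT s|time_measure T. 0)"
      by (intro Bochner_Integration.integral_cong refl) (auto simp: indicator_def)
    then show ?thesis unfolding lim_coef_def by simp
  qed
  have "AE p in \<mu>. \<eta> 0 p = \<theta>0 p" using T by (intro identify theta0_L2) (auto simp: z)
  then show ?thesis unfolding has_initial_value_def using \<eta>(1) cont ae by (intro exI[of _ \<eta>]) blast
qed

lemma limit_equations:
  "AE t in time_measure T.
        (\<forall>g \<in> hat_W12.
           integrable (lebesgue_on \<Omega>0) (\<lambda>p. (u t p \<bullet> wgrad (\<theta> t) p) * g p) \<and>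
           d\<theta> t g + ip (\<lambda>p. u t p \<bullet> wgrad (\<theta> t) p) g
             = ip (\<lambda>p. snd (u t p)) g - ip (wgrad (\<theta> t)) (wgrad g)) \<and>
        (\<forall>h \<in> tilde_W12.
           - ip (wgrad (P t)) (wgrad h) - \<beta> * ip (\<lambda>p. snd (wgrad (P t) p)) h
             = R * ip (\<lambda>p. exp (\<beta> * snd p) * snd (wgrad (\<theta> t) p)) h) \<and>
        (AE p in lebesgue_on \<Omega>0.
           u t p = - (exp (- \<beta> * snd p) *\<^sub>R wgrad (P t) p) + (R * \<theta> t p) *\<^sub>R (0, 1))"
  using limit_pressure limit_stream limit_heat hat_W12.L2_timeD(1)[OF limits(1)]
    tilde_W12.L2_timeD(1)[OF limits(4)] hat_vec.L2_timeD(1)[OF limits(3)]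
    seminormed.L2_timeD(1)[OF seminormed_hat_dual limits(2)]
proof eventually_elim
  case (elim t)
  have pr: "- ip (wgrad (P t)) (grad (phi i m n)) - \<beta> * ip (\<lambda>p. snd (wgrad (P t) p)) (phi i m n)
      = R * ip (\<lambda>p. exp (\<beta> * snd p) * snd (wgrad (\<theta> t) p)) (phi i m n)" if "(i, m, n) \<in> phi_index" for i m n
    using elim(1)[rule_format, OF that] by simp
  have st: "ip (u t) (perp_grad (xi i m n)) =
      \<beta> * ip (\<lambda>p. exp (- \<beta> * snd p) * fst (wgrad (P t) p)) (xi i m n) - R * ip (\<lambda>p. fst (wgrad (\<theta> t) p)) (xi i m n)"
    if "i = 1 \<or> i = -1" for i m n
    using elim(2)[rule_format, of "(i, m, n)"] that by (simp add: xi_index_iff)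
  have he: "d\<theta> t (sine_mode k) + ip (\<lambda>p. u t p \<bullet> wgrad (\<theta> t) p) (sine_mode k) =
      ip (\<lambda>p. snd (u t p)) (sine_mode k) - ip (wgrad (\<theta> t)) (grad (sine_mode k))" if "k \<in> xi_index" for k
    using elim(3) that by blast
  show ?case
    using heat_all_tests[OF elim(5,4,6,7) st he] pressure_all_tests[OF elim(5,4) _ pr] darcy_law[OF elim(5,4,6) pr st] by blast
qed

end

theorem theorem3p2:
  fixes T R \<beta> :: real
    and \<theta>0 :: "real \<times> real \<Rightarrow> real"
    and \<theta>N d\<theta>N PN \<Phi>N :: "nat \<Rightarrow> real \<Rightarrow> real \<times> real \<Rightarrow> real"
    and r :: "nat \<Rightarrow> nat"
    and \<theta> P :: "real \<Rightarrow> real \<times> real \<Rightarrow> real"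
    and u :: "real \<Rightarrow> real \<times> real \<Rightarrow> real \<times> real"
    and d\<theta> :: "real \<Rightarrow> (real \<times> real \<Rightarrow> real) \<Rightarrow> real"
  assumes "T > 0" and "R > 0" and "0 \<le> \<beta>" and "\<beta> < 2 * pi"
    and "\<theta>0 \<in> hat_L2"
    and "\<And>N. galerkin T R \<beta> \<theta>0 N (\<theta>N N) (d\<theta>N N) (PN N) (\<Phi>N N)"
    and "strict_mono r"
    and "weakly_converges_L2_time T hat_W12 W12_norm (\<lambda>j. \<theta>N (r j)) \<theta>"
    and "has_time_derivative T \<theta> d\<theta>"
    and "weakly_converges_L2_time T hat_W12_dual hat_W12_dual_norm
           (\<lambda>j t. pivot (d\<theta>N (r j) t)) d\<theta>"
    and "weakly_converges_L2_time T hat_L2_vec L2_norm (\<lambda>j t. perp_grad (\<Phi>N (r j) t)) u"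
    and "weakly_converges_L2_time T tilde_W12 W12_norm (\<lambda>j. PN (r j)) P"
  shows "weak_solution T R \<beta> \<theta>0 \<theta> u P"
proof -
  interpret galerkin_limit T R \<beta> \<theta>0 \<theta>N d\<theta>N PN \<Phi>N r \<theta> P u d\<theta>
    by (rule galerkin_limit.intro) (fact assms)+
  show ?thesis unfolding weak_solution_def
    using limits(1-4) assms(9) limit_equations initial_value by (intro exI[of _ d\<theta>] conjI)
qed

end
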